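(* Let $(F,\theta)$ be an ID-field of positive characteristic $p$ with $\theta$ non-degenerate and with perfect field of constants $K=C_F$. Let $E/F$ be a PPV-extension with Galois group scheme $\mathcal{G}=\underline{\mathrm{Gal}}(E/F)$. Then $E/F$ is a purely inseparable extension if and only if $\mathcal{G}$ is an infinitesimal group scheme. In this case, the exponent $\mathrm{e}(E/F)$ and the height $\mathrm{h}(\mathcal{G})$ are equal.
   Context: All rings are commutative with unit. Fix $m\ge 1$; $\mathbf{T}=(T_1,\dots,T_m)$ and multiindex notation is used, with $\binom{\mathbf{i}+\mathbf{j}}{\mathbf{i}}=\prod_{\mu}\binom{i_\mu+j_\mu}{i_\mu}$. ID-rings. An ($m$-variate) iterative derivation on a ring $R$ is a ring homomorphism $\theta:R\to R[[\mathbf{T}]]$, $\theta(r)=\sum_{\mathbf{i}\in\mathbb{N}^m}\theta^{(\mathbf{i})}(r)\mathbf{T}^{\mathbf{i}}$, with $\theta^{(\mathbf{0})}=\mathrm{id}_R$ and $\theta^{(\mathbf{i})}\circ\theta^{(\mathbf{j})}=\binom{\mathbf{i}+\mathbf{j}}{\mathbf{i}}\theta^{(\mathbf{i}+\mathbf{j})}$ for all $\mathbf{i},\mathbf{j}$. Then $(R,\theta)$ is an ID-ring (ID-field if $R$ is a field), with ring of constants $C_R=\{r\in R\mid\theta(r)=r\}$. An ideal $I$ is an ID-ideal if $\theta(I)\subseteq I[[\mathbf{T}]]$; $R$ is ID-simple if it has no nontrivial ID-ideals. Iterative derivations extend to localisations by $\theta(r/s)=\theta(r)\theta(s)^{-1}$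 and to tensor products by $\theta^{(\mathbf{k})}(r\otimes s)=\sum_{\mathbf{i}+\mathbf{j}=\mathbf{k}}\theta^{(\mathbf{i})}(r)\otimes\theta^{(\mathbf{j})}(s)$. ID-homomorphisms are ring homomorphisms compatible with the iterative derivations. $\theta$ is non-degenerate if the $m$ derivations $\theta^{(1,0,\dots,0)},\dots,\theta^{(0,\dots,0,1)}$ are $R$-linearly independent. PPV-extensions. An iterative differential equation (IDE) over an ID-field $(F,\theta)$ is an equation $\theta(\mathbf{y})=A\mathbf{y}$ with $A=\sum_{\mathbf{k}}A_{\mathbf{k}}\mathbf{T}^{\mathbf{k}}\in\mathrm{GL}_n(F[[\mathbf{T}]])$, $A_{\mathbf{0}}=1_n$ and $\binom{\mathbf{k}+\mathbf{l}}{\mathbf{l}}A_{\mathbf{k}+\mathbf{l}}=\sum_{\mathbf{i}+\mathbf{j}=\mathbf{l}}\theta^{(\mathbf{i})}(A_{\mathbf{k}})A_{\mathbf{j}}$ for all $\mathbf{k},\mathbf{l}$. A PPV-ring (pseudo Picard–Vessiot ring) for it is an ID-ring extension $R$ of $F$ such that $R$ is ID-simple, there is $Y\in\mathrm{GL}_n(R)$ with $\theta(Y)=AY$ (componentwise), $R$ is generated as $F$-algebra by the entries of $Y$ and $\det(Y)^{-1}$, and $C_R=C_F$. Such $R$ is an integral domain; $E=\operatorname{Quot}(R)$ is the PPV-field, and $E/F$ is called a PPV-extension ($R$ is determined by $E$ and $F$). Galois group scheme. With $K=C_F$, the functor $L\mapsto\mathrm{Aut}^{\mathrm{ID}}(R\otimes_K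 L/F\otimes_K L)$ on $K$-algebras $L$ (with trivial iterative derivation on $L$) is (known to be) an affine group scheme $\mathcal{G}$ of finite type over $K$, the Galois group scheme $\underline{\mathrm{Gal}}(R/F)=\underline{\mathrm{Gal}}(E/F)$. It is known that $\operatorname{Spec}(R)$ is a $(\mathcal{G}\times_K F)$-torsor, and the corresponding ring isomorphism $\gamma:R\otimes_F R\to R\otimes_K K[\mathcal{G}]$ is an $R$-linear ID-isomorphism; it identifies $K[\mathcal{G}]$ with $C_{R\otimes_F R}$, and the counit $K[\mathcal{G}]\to K$ is induced by the multiplication $R\otimes_F R\to R$. For a purely inseparable extension $E/F$, the exponent $\mathrm{e}(E/F)$ is the minimal $e\in\mathbb{N}$ such that $E^{p^e}\subseteq F$. An affine group scheme $\mathcal{G}$ of finite type over $K$ is infinitesimal if the augmentation ideal $K[\mathcal{G}]^+$ (kernel of the counit) is nilpotent; its height $\mathrm{h}(\mathcal{G})$ is the minimal $h\in\mathbb{N}$ with $x^{p^h}=0$ for all $x\in K[\mathcal{G}]^+$. *)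

theory Defs
  imports
    "HOL-Algebra.Algebra"
    "HOL-Library.Function_Algebras"
    "HOL-Library.Poly_Mapping"
    "HOL-Combinatorics.Permutations"
begin

text \<open>The variables \<open>T\<^sub>\<mu>\<close> are indexed by a finite type \<open>'i\<close> (so \<open>m = CARD('i) \<ge> 1\<close>), and a
  multiindex is a function \<open>'i \<Rightarrow> nat\<close> with pointwise addition.  A subring \<open>S\<close> of a ring \<open>E\<close> is
  treated as the ring \<open>E\<lparr>carrier := S\<rparr>\<close>.\<close>

type_synonym 'i multiindex = "'i \<Rightarrow> nat"

definition mbinom :: "'i::finite multiindex \<Rightarrow> 'i multiindex \<Rightarrow> nat" where
  "mbinom i j = (\<Prod>\<mu>\<in>UNIV. (i \<mu> + j \<mu>) choose i \<mu>)"

definition unit_index :: "'i \<Rightarrow> 'i multiindex" where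
  "unit_index \<mu> = (\<lambda>\<nu>. if \<nu> = \<mu> then 1 else 0)"

definition splittings :: "'i::finite multiindex \<Rightarrow> ('i multiindex \<times> 'i multiindex) set" where
  "splittings k = {(i, j). i + j = k}"


section \<open>Power series and iterative derivations\<close>

text \<open>The ring \<open>R[[T]]\<close>; a power series is its family of coefficients.\<close>

definition mps :: "('a, 'b) ring_scheme \<Rightarrow> ('i::finite multiindex \<Rightarrow> 'a) ring" where
  "mps R = \<lparr>carrier = UNIV \<rightarrow> carrier R,
     monoid.mult = (\<lambda>f g k. \<Oplus>\<^bsub>R\<^esub>z\<in>splittings k. f (fst z) \<otimes>\<^bsub>R\<^esub> g (snd z)),
     monoid.one = (\<lambda>k. if k = 0 then \<one>\<^bsub>R\<^esub> else \<zero>\<^bsub>R\<^esub>),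
     ring.zero = (\<lambda>k. \<zero>\<^bsub>R\<^esub>),
     ring.add = (\<lambda>f g k. f k \<oplus>\<^bsub>R\<^esub> g k)\<rparr>"

definition mps_const :: "('a, 'b) ring_scheme \<Rightarrow> 'a \<Rightarrow> 'i::finite multiindex \<Rightarrow> 'a" where
  "mps_const R r = (\<lambda>k. if k = 0 then r else \<zero>\<^bsub>R\<^esub>)"

text \<open>\<open>\<theta> r i\<close> is \<open>\<theta>\<^bsup>(i)\<^esup>(r)\<close>.\<close>

definition iterative_derivation ::
    "('a, 'b) ring_scheme \<Rightarrow> ('a \<Rightarrow> 'i::finite multiindex \<Rightarrow> 'a) \<Rightarrow> bool" where
  "iterative_derivation R \<theta> \<longleftrightarrow>
     \<theta> \<in> ring_hom R (mps R) \<and>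
     (\<forall>r\<in>carrier R. \<theta> r 0 = r) \<and>
     (\<forall>r\<in>carrier R. \<forall>i j. \<theta> (\<theta> r j) i = [mbinom i j] \<cdot>\<^bsub>R\<^esub> \<theta> r (i + j))"

definition ID_ring :: "('a, 'b) ring_scheme \<Rightarrow> ('a \<Rightarrow> 'i::finite multiindex \<Rightarrow> 'a) \<Rightarrow> bool" where
  "ID_ring R \<theta> \<longleftrightarrow> cring R \<and> iterative_derivation R \<theta>"

definition ID_field :: "('a, 'b) ring_scheme \<Rightarrow> ('a \<Rightarrow> 'i::finite multiindex \<Rightarrow> 'a) \<Rightarrow> bool" where
  "ID_field R \<theta> \<longleftrightarrow> field R \<and> iterative_derivation R \<theta>"

definition ID_constants ::
    "('a, 'b) ring_scheme \<Rightarrow> ('a \<Rightarrow> 'i::finite multiindex \<Rightarrow> 'a) \<Rightarrow> 'a set" where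
  "ID_constants R \<theta> = {r \<in> carrier R. \<theta> r = mps_const R r}"

definition ID_ideal ::
    "('a, 'b) ring_scheme \<Rightarrow> ('a \<Rightarrow> 'i::finite multiindex \<Rightarrow> 'a) \<Rightarrow> 'a set \<Rightarrow> bool" where
  "ID_ideal R \<theta> I \<longleftrightarrow> ideal I R \<and> (\<forall>r\<in>I. \<forall>k. \<theta> r k \<in> I)"

definition ID_simple :: "('a, 'b) ring_scheme \<Rightarrow> ('a \<Rightarrow> 'i::finite multiindex \<Rightarrow> 'a) \<Rightarrow> bool" where
  "ID_simple R \<theta> \<longleftrightarrow> (\<forall>I. ID_ideal R \<theta> I \<longrightarrow> I = {\<zero>\<^bsub>R\<^esub>} \<or> I = carrier R)"

definition ID_hom :: "('a, 'b) ring_scheme \<Rightarrow> ('a \<Rightarrow> 'i::finite multiindex \<Rightarrow> 'a) \<Rightarrow>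
    ('c, 'd) ring_scheme \<Rightarrow> ('c \<Rightarrow> 'i multiindex \<Rightarrow> 'c) \<Rightarrow> ('a \<Rightarrow> 'c) set" where
  "ID_hom R \<theta> S \<eta> = {f \<in> ring_hom R S. \<forall>r\<in>carrier R. \<forall>k. f (\<theta> r k) = \<eta> (f r) k}"

definition nondegenerate ::
    "('a, 'b) ring_scheme \<Rightarrow> ('a \<Rightarrow> 'i::finite multiindex \<Rightarrow> 'a) \<Rightarrow> bool" where
  "nondegenerate R \<theta> \<longleftrightarrow>
     (\<forall>c \<in> UNIV \<rightarrow> carrier R.
        (\<forall>r\<in>carrier R. (\<Oplus>\<^bsub>R\<^esub>\<mu>\<in>UNIV. c \<mu> \<otimes>\<^bsub>R\<^esub> \<theta> r (unit_index \<mu>)) = \<zero>\<^bsub>R\<^esub>) \<longrightarrow>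
        (\<forall>\<mu>. c \<mu> = \<zero>\<^bsub>R\<^esub>))"


section \<open>Matrices\<close>

text \<open>An \<open>n \<times> n\<close> matrix is a function \<open>nat \<Rightarrow> nat \<Rightarrow> 'a\<close>; only its entries at indices below \<open>n\<close>
  are relevant.\<close>

definition mat_mul :: "('a, 'b) ring_scheme \<Rightarrow> nat \<Rightarrow>
    (nat \<Rightarrow> nat \<Rightarrow> 'a) \<Rightarrow> (nat \<Rightarrow> nat \<Rightarrow> 'a) \<Rightarrow> nat \<Rightarrow> nat \<Rightarrow> 'a" where
  "mat_mul R n M N = (\<lambda>r s. \<Oplus>\<^bsub>R\<^esub>t\<in>{..<n}. M r t \<otimes>\<^bsub>R\<^esub> N t s)"

definition mat_one :: "('a, 'b) ring_scheme \<Rightarrow> nat \<Rightarrow> nat \<Rightarrow> 'a" where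
  "mat_one R = (\<lambda>r s. if r = s then \<one>\<^bsub>R\<^esub> else \<zero>\<^bsub>R\<^esub>)"

definition mat_eq :: "nat \<Rightarrow> (nat \<Rightarrow> nat \<Rightarrow> 'a) \<Rightarrow> (nat \<Rightarrow> nat \<Rightarrow> 'a) \<Rightarrow> bool" where
  "mat_eq n M N \<longleftrightarrow> (\<forall>r<n. \<forall>s<n. M r s = N r s)"

definition mat_carrier :: "('a, 'b) ring_scheme \<Rightarrow> nat \<Rightarrow> (nat \<Rightarrow> nat \<Rightarrow> 'a) set" where
  "mat_carrier R n = {M. \<forall>r<n. \<forall>s<n. M r s \<in> carrier R}"

definition general_linear :: "('a, 'b) ring_scheme \<Rightarrow> nat \<Rightarrow> (nat \<Rightarrow> nat \<Rightarrow> 'a) set" where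
  "general_linear R n = {M \<in> mat_carrier R n. \<exists>N \<in> mat_carrier R n.
     mat_eq n (mat_mul R n M N) (mat_one R) \<and> mat_eq n (mat_mul R n N M) (mat_one R)}"

definition mat_det :: "('a, 'b) ring_scheme \<Rightarrow> nat \<Rightarrow> (nat \<Rightarrow> nat \<Rightarrow> 'a) \<Rightarrow> 'a" where
  "mat_det R n M = (\<Oplus>\<^bsub>R\<^esub>\<sigma>\<in>{\<sigma>. \<sigma> permutes {..<n}}.
     [(sign \<sigma> :: int)] \<cdot>\<^bsub>R\<^esub> (\<Otimes>\<^bsub>R\<^esub>r\<in>{..<n}. M r (\<sigma> r)))"


section \<open>Pseudo Picard--Vessiot extensions\<close>

text \<open>\<open>A r s k\<close> is the entry at \<open>(r, s)\<close> of the coefficient matrix \<open>A\<^sub>k\<close>.\<close>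

definition IDE :: "('a, 'b) ring_scheme \<Rightarrow> ('a \<Rightarrow> 'i::finite multiindex \<Rightarrow> 'a) \<Rightarrow> nat \<Rightarrow>
    (nat \<Rightarrow> nat \<Rightarrow> 'i multiindex \<Rightarrow> 'a) \<Rightarrow> bool" where
  "IDE F \<theta> n A \<longleftrightarrow>
     A \<in> general_linear (mps F) n \<and>
     mat_eq n (\<lambda>r s. A r s 0) (mat_one F) \<and>
     (\<forall>k l. mat_eq n
        (\<lambda>r s. [mbinom l k] \<cdot>\<^bsub>F\<^esub> A r s (k + l))
        (\<lambda>r s. \<Oplus>\<^bsub>F\<^esub>z\<in>splittings l.
           mat_mul F n (\<lambda>r s. \<theta> (A r s k) (fst z)) (\<lambda>r s. A r s (snd z)) r s))"

definition PPV_ring :: "('a, 'b) ring_scheme \<Rightarrow> 'a set \<Rightarrow> ('a \<Rightarrow> 'i::finite multiindex \<Rightarrow> 'a) \<Rightarrow>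
    nat \<Rightarrow> (nat \<Rightarrow> nat \<Rightarrow> 'i multiindex \<Rightarrow> 'a) \<Rightarrow> bool" where
  "PPV_ring R F \<theta> n A \<longleftrightarrow>
     ID_ring R \<theta> \<and> subfield F R \<and> ID_field (R\<lparr>carrier := F\<rparr>) \<theta> \<and> ID_simple R \<theta> \<and>
     (\<exists>Y \<in> general_linear R n.
        mat_eq n (\<lambda>r s. \<theta> (Y r s)) (mat_mul (mps R) n A (\<lambda>r s. mps_const R (Y r s))) \<and>
        carrier R = generate_ring R
          (F \<union> {Y r s | r s. r < n \<and> s < n} \<union> {inv\<^bsub>R\<^esub> (mat_det R n Y)})) \<and>
     ID_constants R \<theta> = ID_constants (R\<lparr>carrier := F\<rparr>) \<theta>"

text \<open>\<open>E\<close> is the field of fractions of its subring \<open>R\<close>, which is a PPV-ring over \<open>F\<close>.  The iterative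
  derivation of \<open>E\<close> is then the unique extension of that of \<open>R\<close>.\<close>

definition PPV_extension :: "('a, 'b) ring_scheme \<Rightarrow> 'a set \<Rightarrow> 'a set \<Rightarrow>
    ('a \<Rightarrow> 'i::finite multiindex \<Rightarrow> 'a) \<Rightarrow> bool" where
  "PPV_extension E F R \<theta> \<longleftrightarrow>
     ID_field E \<theta> \<and> subring R E \<and>
     (\<exists>n A. IDE (E\<lparr>carrier := F\<rparr>) \<theta> n A \<and> PPV_ring (E\<lparr>carrier := R\<rparr>) F \<theta> n A) \<and>
     (\<forall>x\<in>carrier E. \<exists>a\<in>R. \<exists>b\<in>R - {\<zero>\<^bsub>E\<^esub>}. x = a \<otimes>\<^bsub>E\<^esub> inv\<^bsub>E\<^esub> b)"


section \<open>Tensor products of algebras\<close>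

text \<open>A subring \<open>S\<close> of \<open>E\<close> as an algebra over any smaller subring.\<close>

definition sub_alg :: "('a, 'b) ring_scheme \<Rightarrow> 'a set \<Rightarrow> ('a, 'a) module" where
  "sub_alg E S = \<lparr>carrier = S, monoid.mult = monoid.mult E, monoid.one = monoid.one E, ring.zero = ring.zero E, ring.add = ring.add E,
     smult = monoid.mult E\<rparr>"

definition alg_hom :: "('k, 'x) ring_scheme \<Rightarrow> ('k, 'a, 'y) module_scheme \<Rightarrow>
    ('k, 'b, 'z) module_scheme \<Rightarrow> ('a \<Rightarrow> 'b) set" where
  "alg_hom K A B = {f \<in> extensional (carrier A) \<inter> ring_hom A B.
     \<forall>c\<in>carrier K. \<forall>a\<in>carrier A. f (c \<odot>\<^bsub>A\<^esub> a) = c \<odot>\<^bsub>B\<^esub> f a}"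

text \<open>\<open>A \<otimes>\<^sub>K B\<close> is the free abelian group on \<open>A \<times> B\<close>, with the multiplication extending the
  componentwise one biadditively (the integral monoid ring of \<open>A \<times> B\<close>), modulo the ideal generated
  by the bilinearity relations.\<close>

definition pair_ring :: "('k, 'a, 'y) module_scheme \<Rightarrow> ('k, 'b, 'z) module_scheme \<Rightarrow>
    (('a \<times> 'b) \<Rightarrow>\<^sub>0 int) ring" where
  "pair_ring A B = \<lparr>carrier = {x. Poly_Mapping.keys x \<subseteq> carrier A \<times> carrier B},
     monoid.mult = (\<lambda>x y. frag_extend (\<lambda>(a, b). frag_extend (\<lambda>(a', b').
               frag_of (a \<otimes>\<^bsub>A\<^esub> a', b \<otimes>\<^bsub>B\<^esub> b')) y) x),
     monoid.one = frag_of (\<one>\<^bsub>A\<^esub>, \<one>\<^bsub>B\<^esub>),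
     ring.zero = 0,
     ring.add = (+)\<rparr>"

definition tensor_relations :: "('k, 'x) ring_scheme \<Rightarrow> ('k, 'a, 'y) module_scheme \<Rightarrow>
    ('k, 'b, 'z) module_scheme \<Rightarrow> (('a \<times> 'b) \<Rightarrow>\<^sub>0 int) set" where
  "tensor_relations K A B =
     {frag_of (a \<oplus>\<^bsub>A\<^esub> a', b) - frag_of (a, b) - frag_of (a', b) | a a' b.
        a \<in> carrier A \<and> a' \<in> carrier A \<and> b \<in> carrier B} \<union>
     {frag_of (a, b \<oplus>\<^bsub>B\<^esub> b') - frag_of (a, b) - frag_of (a, b') | a b b'.
        a \<in> carrier A \<and> b \<in> carrier B \<and> b' \<in> carrier B} \<union>
     {frag_of (c \<odot>\<^bsub>A\<^esub> a, b) - frag_of (a, c \<odot>\<^bsub>B\<^esub> b) | c a b.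
        c \<in> carrier K \<and> a \<in> carrier A \<and> b \<in> carrier B}"

definition tensor_ideal :: "('k, 'x) ring_scheme \<Rightarrow> ('k, 'a, 'y) module_scheme \<Rightarrow>
    ('k, 'b, 'z) module_scheme \<Rightarrow> (('a \<times> 'b) \<Rightarrow>\<^sub>0 int) set" where
  "tensor_ideal K A B = genideal (pair_ring A B) (tensor_relations K A B)"

definition tensor :: "('k, 'x) ring_scheme \<Rightarrow> ('k, 'a, 'y) module_scheme \<Rightarrow>
    ('k, 'b, 'z) module_scheme \<Rightarrow> (('a \<times> 'b) \<Rightarrow>\<^sub>0 int) set ring" where
  "tensor K A B = pair_ring A B Quot tensor_ideal K A B"

text \<open>The additive map \<open>A \<otimes>\<^sub>K B \<rightarrow> A' \<otimes>\<^sub>K B'\<close> sending \<open>a \<otimes> b\<close> to the class of \<open>h a b\<close>, meaningful if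
  this class is bilinear in \<open>(a, b)\<close>.\<close>

definition tensor_lift :: "('k, 'x) ring_scheme \<Rightarrow> ('k, 'c, 'y) module_scheme \<Rightarrow>
    ('k, 'd, 'z) module_scheme \<Rightarrow> ('a \<Rightarrow> 'b \<Rightarrow> (('c \<times> 'd) \<Rightarrow>\<^sub>0 int)) \<Rightarrow>
    (('a \<times> 'b) \<Rightarrow>\<^sub>0 int) set \<Rightarrow> (('c \<times> 'd) \<Rightarrow>\<^sub>0 int) set" where
  "tensor_lift K A' B' h Z = the_elem
     ((\<lambda>x. tensor_ideal K A' B' +>\<^bsub>pair_ring A' B'\<^esub> frag_extend (\<lambda>(a, b). h a b) x) ` Z)"

definition tensor_map :: "('k, 'x) ring_scheme \<Rightarrow> ('k, 'c, 'y) module_scheme \<Rightarrow>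
    ('k, 'd, 'z) module_scheme \<Rightarrow> ('a \<Rightarrow> 'c) \<Rightarrow> ('b \<Rightarrow> 'd) \<Rightarrow>
    (('a \<times> 'b) \<Rightarrow>\<^sub>0 int) set \<Rightarrow> (('c \<times> 'd) \<Rightarrow>\<^sub>0 int) set" where
  "tensor_map K A' B' f g = tensor_lift K A' B' (\<lambda>a b. frag_of (f a, g b))"

definition tensor_ID :: "('k, 'x) ring_scheme \<Rightarrow>
    ('k, 'a, 'y) module_scheme \<Rightarrow> ('a \<Rightarrow> 'i::finite multiindex \<Rightarrow> 'a) \<Rightarrow>
    ('k, 'b, 'z) module_scheme \<Rightarrow> ('b \<Rightarrow> 'i multiindex \<Rightarrow> 'b) \<Rightarrow>
    (('a \<times> 'b) \<Rightarrow>\<^sub>0 int) set \<Rightarrow> 'i multiindex \<Rightarrow> (('a \<times> 'b) \<Rightarrow>\<^sub>0 int) set" where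
  "tensor_ID K A \<theta> B \<eta> Z k =
     tensor_lift K A B (\<lambda>a b. \<Sum>(i, j)\<in>splittings k. frag_of (\<theta> a i, \<eta> b j)) Z"


section \<open>The Galois group scheme\<close>

definition const_ring :: "('a, 'b) ring_scheme \<Rightarrow> 'a set \<Rightarrow>
    ('a \<Rightarrow> 'i::finite multiindex \<Rightarrow> 'a) \<Rightarrow> ('a, 'a) module" where
  "const_ring E F \<theta> = sub_alg E (ID_constants (E\<lparr>carrier := F\<rparr>) \<theta>)"

text \<open>The value at a \<open>K\<close>-algebra \<open>L\<close> of the functor \<open>L \<mapsto> Aut\<^bsup>ID\<^esup>(R \<otimes>\<^sub>K L / F \<otimes>\<^sub>K L)\<close>, where \<open>L\<close> carries
  the trivial iterative derivation \<open>mps_const L\<close>.\<close>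

definition Gal :: "('a, 'b) ring_scheme \<Rightarrow> 'a set \<Rightarrow> 'a set \<Rightarrow>
    ('a \<Rightarrow> 'i::finite multiindex \<Rightarrow> 'a) \<Rightarrow> ('a, 'l) module \<Rightarrow>
    ((('a \<times> 'l) \<Rightarrow>\<^sub>0 int) set \<Rightarrow> (('a \<times> 'l) \<Rightarrow>\<^sub>0 int) set) monoid" where
  "Gal E F R \<theta> L =
    (let K = const_ring E F \<theta>;
         RL = tensor K (sub_alg E R) L;
         FL = tensor K (sub_alg E F) L;
         \<Theta> = tensor_ID K (sub_alg E R) \<theta> L (mps_const L);
         \<iota> = tensor_map K (sub_alg E R) L (\<lambda>x. x) (\<lambda>x. x)
     in (BijGroup (carrier RL))
          \<lparr>carrier := {\<sigma> \<in> Bij (carrier RL). \<sigma> \<in> ID_hom RL \<Theta> RL \<Theta> \<and>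
                         (\<forall>x\<in>carrier FL. \<sigma> (\<iota> x) = \<iota> x)}\<rparr>)"

text \<open>The functor on a homomorphism \<open>f : L \<rightarrow> L'\<close>: base change of \<open>\<sigma>\<close> along \<open>f\<close>, i.e. the
  automorphism over \<open>F \<otimes>\<^sub>K L'\<close> whose restriction along \<open>id \<otimes> f : R \<otimes>\<^sub>K L \<rightarrow> R \<otimes>\<^sub>K L'\<close> is
  \<open>(id \<otimes> f) \<circ> \<sigma>\<close>.  It is unique because \<open>R \<otimes>\<^sub>K L'\<close> is spanned over \<open>L'\<close> by the image of \<open>R\<close>.\<close>

definition Gal_map :: "('a, 'b) ring_scheme \<Rightarrow> 'a set \<Rightarrow> 'a set \<Rightarrow>
    ('a \<Rightarrow> 'i::finite multiindex \<Rightarrow> 'a) \<Rightarrow> ('a, 'l) module \<Rightarrow> ('a, 'm) module \<Rightarrow> ('l \<Rightarrow> 'm) \<Rightarrow>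
    ((('a \<times> 'l) \<Rightarrow>\<^sub>0 int) set \<Rightarrow> (('a \<times> 'l) \<Rightarrow>\<^sub>0 int) set) \<Rightarrow>
    ((('a \<times> 'm) \<Rightarrow>\<^sub>0 int) set \<Rightarrow> (('a \<times> 'm) \<Rightarrow>\<^sub>0 int) set)" where
  "Gal_map E F R \<theta> L L' f \<sigma> =
    (let K = const_ring E F \<theta>;
         f\<^sub>R = tensor_map K (sub_alg E R) L' (\<lambda>x. x) f
     in THE \<tau>. \<tau> \<in> carrier (Gal E F R \<theta> L') \<and>
               (\<forall>x\<in>carrier (tensor K (sub_alg E R) L). \<tau> (f\<^sub>R x) = f\<^sub>R (\<sigma> x)))"

text \<open>The affine group scheme \<open>Gal(E/F)\<close> is given by its coordinate ring \<open>A = K[\<G>]\<close> with the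
  universal automorphism \<open>u\<close>: the \<open>K\<close>-algebra \<open>A\<close> represents the functor via \<open>f \<mapsto> Gal(f)(u)\<close>.  The
  test algebras \<open>L\<close> range over all \<open>K\<close>-algebras with elements in the type \<open>'u\<close>, which thus plays
  the role of a universe.\<close>

definition represents_Gal :: "('a, 'b) ring_scheme \<Rightarrow> 'a set \<Rightarrow> 'a set \<Rightarrow>
    ('a \<Rightarrow> 'i::finite multiindex \<Rightarrow> 'a) \<Rightarrow> ('a, 'u) module \<Rightarrow>
    ((('a \<times> 'u) \<Rightarrow>\<^sub>0 int) set \<Rightarrow> (('a \<times> 'u) \<Rightarrow>\<^sub>0 int) set) \<Rightarrow> bool" where
  "represents_Gal E F R \<theta> A u \<longleftrightarrow>
     algebra (const_ring E F \<theta>) A \<and> u \<in> carrier (Gal E F R \<theta> A) \<and>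
     (\<forall>L :: ('a, 'u) module. algebra (const_ring E F \<theta>) L \<longrightarrow>
        bij_betw (\<lambda>f. Gal_map E F R \<theta> A L f u)
          (alg_hom (const_ring E F \<theta>) A L) (carrier (Gal E F R \<theta> L)))"

text \<open>The counit \<open>K[\<G>] \<rightarrow> K\<close> is the homomorphism corresponding to the neutral element of \<open>\<G>(K)\<close>.\<close>

definition is_counit :: "('a, 'b) ring_scheme \<Rightarrow> 'a set \<Rightarrow> 'a set \<Rightarrow>
    ('a \<Rightarrow> 'i::finite multiindex \<Rightarrow> 'a) \<Rightarrow> ('a, 'u) module \<Rightarrow>
    ((('a \<times> 'u) \<Rightarrow>\<^sub>0 int) set \<Rightarrow> (('a \<times> 'u) \<Rightarrow>\<^sub>0 int) set) \<Rightarrow> ('u \<Rightarrow> 'a) \<Rightarrow> bool" where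
  "is_counit E F R \<theta> A u \<epsilon> \<longleftrightarrow>
     \<epsilon> \<in> alg_hom (const_ring E F \<theta>) A (const_ring E F \<theta>) \<and>
     Gal_map E F R \<theta> A (const_ring E F \<theta>) \<epsilon> u = \<one>\<^bsub>Gal E F R \<theta> (const_ring E F \<theta>)\<^esub>"

text \<open>Infinitesimality and height in terms of the coordinate ring \<open>A\<close> and its augmentation ideal
  \<open>I\<close>; \<open>(ideal_prod A I ^^ n) (carrier A)\<close> is \<open>I\<^sup>n\<close>.\<close>

definition infinitesimal :: "('u, 'b) ring_scheme \<Rightarrow> 'u set \<Rightarrow> bool" where
  "infinitesimal A I \<longleftrightarrow> (\<exists>n. (ideal_prod A I ^^ n) (carrier A) = {\<zero>\<^bsub>A\<^esub>})"

definition has_height :: "nat \<Rightarrow> ('u, 'b) ring_scheme \<Rightarrow> 'u set \<Rightarrow> nat \<Rightarrow> bool" where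
  "has_height p A I h \<longleftrightarrow>
     (\<forall>x\<in>I. x [^]\<^bsub>A\<^esub> (p ^ h) = \<zero>\<^bsub>A\<^esub>) \<and>
     (\<forall>h'. (\<forall>x\<in>I. x [^]\<^bsub>A\<^esub> (p ^ h') = \<zero>\<^bsub>A\<^esub>) \<longrightarrow> h \<le> h')"


section \<open>Fields of positive characteristic\<close>

definition ring_char :: "('a, 'b) ring_scheme \<Rightarrow> nat" where
  "ring_char R = group.ord (add_monoid R) \<one>\<^bsub>R\<^esub>"

definition perfect_field :: "nat \<Rightarrow> ('a, 'b) ring_scheme \<Rightarrow> bool" where
  "perfect_field p K \<longleftrightarrow> field K \<and> (\<lambda>x. x [^]\<^bsub>K\<^esub> p) ` carrier K = carrier K"

definition purely_inseparable :: "nat \<Rightarrow> ('a, 'b) ring_scheme \<Rightarrow> 'a set \<Rightarrow> bool" where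
  "purely_inseparable p E F \<longleftrightarrow> (\<forall>x\<in>carrier E. \<exists>e::nat. x [^]\<^bsub>E\<^esub> (p ^ e) \<in> F)"

definition has_exponent :: "nat \<Rightarrow> ('a, 'b) ring_scheme \<Rightarrow> 'a set \<Rightarrow> nat \<Rightarrow> bool" where
  "has_exponent p E F e \<longleftrightarrow>
     (\<forall>x\<in>carrier E. x [^]\<^bsub>E\<^esub> (p ^ e) \<in> F) \<and>
     (\<forall>e'. (\<forall>x\<in>carrier E. x [^]\<^bsub>E\<^esub> (p ^ e') \<in> F) \<longrightarrow> e \<le> e')"

end

theory Submission
  imports Defs
begin

text \<open>
  Let \<open>q = p\<^sup>e\<close>.  Both directions rest on the equivalence of \<open>R\<^sup>q \<subseteq> F\<close> with the vanishing of all
  \<open>x\<^sup>q\<close>, \<open>x\<close> in the augmentation ideal.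

  Write \<open>u (g \<otimes> 1) - g \<otimes> 1 = \<Sum> r\<^sub>i \<otimes> a\<^sub>i\<close> with \<open>r\<^sub>i\<close> linearly independent over \<open>K\<close>, where \<open>u\<close> is the
  universal automorphism and \<open>g\<close> an entry of \<open>Y\<close> or of its inverse.  Together with the coefficients for
  the inverse of \<open>u\<close>, the \<open>a\<^sub>i\<close> lie in the augmentation ideal and generate \<open>A\<close>, since \<open>u\<close> is already
  defined over the subalgebra they generate.  If \<open>g\<^sup>q \<in> F\<close>, then \<open>\<Sum> r\<^sub>i\<^sup>q \<otimes> a\<^sub>i\<^sup>q = 0\<close>, and the \<open>r\<^sub>i\<^sup>q\<close> are
  still independent because \<open>K\<close> is perfect; so \<open>a\<^sub>i\<^sup>q = 0\<close>.

  Conversely, if \<open>x\<^sup>q = 0\<close> on the augmentation ideal, then \<open>u\<close>, and hence every automorphism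
  in \<open>Gal(L)\<close>, fixes \<open>r\<^sup>q \<otimes> 1\<close> for all \<open>r \<in> R\<close>.  The matrix \<open>Y\<^sup>-\<^sup>1 \<otimes> Y\<close> over \<open>R \<otimes>\<^sub>F R\<close> is constant, and
  for the algebra \<open>L\<close> of constants generated by its entries and those of its inverse,
  \<open>R \<otimes>\<^sub>K L\<close> is isomorphic to \<open>R \<otimes>\<^sub>F R\<close>.  The embedding of \<open>R\<close> as second factor
  thus becomes an element of \<open>Gal(L)\<close>.  As it fixes \<open>r\<^sup>q\<close>, we have \<open>r\<^sup>q \<otimes> 1 = 1 \<otimes> r\<^sup>q\<close> in \<open>R \<otimes>\<^sub>F R\<close>,
  so \<open>r\<^sup>q \<in> F\<close>.
\<close>

section \<open>Tensor products of algebras\<close>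

text \<open>The coordinate ring \<open>A\<close> is accessible only through its functor of points,
  and only on test algebras whose elements lie in the type \<open>'u\<close>. This shapes both
  directions. That given elements generate \<open>A\<close> is shown by producing a point over the
  subalgebra they generate and comparing classifying maps, which are unique. That enough
  automorphisms exist requires a concrete test algebra inside \<open>R \<otimes>\<^sub>F R\<close>;
  it has to be copied into \<open>'u\<close> first, which is a cardinality argument, as it is
  generated over \<open>K\<close> by finitely many elements.

  The comparison of \<open>R \<otimes>\<^sub>K L\<close> with \<open>R \<otimes>\<^sub>F R\<close>
  rests on ID-simplicity: constants that are independent over \<open>K\<close> stay independent over
  \<open>R\<close>, because the leading coefficients of the relations among them form an ID-ideal.

  Finite generation of \<open>R\<close> enters twice. It replaces the exponents of single elements
  by a common one, and it gives finitely many generators of the augmentation ideal, without which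
  bounded height would yield a nil ideal but not a nilpotent one.\<close>

lemma add_monoid_hom_finsum:
  assumes "abelian_group G" "abelian_group H" "h \<in> hom (add_monoid G) (add_monoid H)"
    and "f \<in> W \<rightarrow> carrier G"
  shows "h (finsum G f W) = finsum H (\<lambda>x. h (f x)) W"
proof -
  interpret G: abelian_group G by fact
  interpret H: abelian_group H by fact
  interpret h: abelian_group_hom G H h
    by (rule abelian_group_homI) (use assms in \<open>auto intro!: group_hom.intro simp: group_hom_axioms_def G.a_group H.a_group\<close>)
  show ?thesis
    using assms(4)
  proof (induct W rule: infinite_finite_induct)
    case (infinite W)
    then show ?case by (simp add: G.add.finprod_infinite H.add.finprod_infinite)
  next
    case empty
    then show ?case by simp
  next
    case (insert x W)
    then show ?case by (auto simp: G.finsum_insert H.finsum_insert Pi_iff)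
  qed
qed

text \<open>Maps that are merely additive are the right generality: the components of an iterative
  derivation are not multiplicative, and maps out of a tensor product are first constructed as
  additive ones.\<close>

lemma add_monoid_hom_simps:
  assumes "abelian_group G" "abelian_group H" "h \<in> hom (add_monoid G) (add_monoid H)"
  shows "h \<zero>\<^bsub>G\<^esub> = \<zero>\<^bsub>H\<^esub>" "x \<in> carrier G \<Longrightarrow> h (\<ominus>\<^bsub>G\<^esub> x) = \<ominus>\<^bsub>H\<^esub> h x"
    "x \<in> carrier G \<Longrightarrow> h x \<in> carrier H"
    "x \<in> carrier G \<Longrightarrow> y \<in> carrier G \<Longrightarrow> h (x \<oplus>\<^bsub>G\<^esub> y) = h x \<oplus>\<^bsub>H\<^esub> h y"
    "x \<in> carrier G \<Longrightarrow> y \<in> carrier G \<Longrightarrow> h (x \<ominus>\<^bsub>G\<^esub> y) = h x \<ominus>\<^bsub>H\<^esub> h y"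
proof -
  interpret G: abelian_group G by fact
  interpret H: abelian_group H by fact
  interpret h: abelian_group_hom G H h
    by (rule abelian_group_homI) (use assms in \<open>auto intro!: group_hom.intro simp: group_hom_axioms_def G.a_group H.a_group\<close>)
  show "h \<zero>\<^bsub>G\<^esub> = \<zero>\<^bsub>H\<^esub>" "x \<in> carrier G \<Longrightarrow> h (\<ominus>\<^bsub>G\<^esub> x) = \<ominus>\<^bsub>H\<^esub> h x"
    "x \<in> carrier G \<Longrightarrow> h x \<in> carrier H"
    "x \<in> carrier G \<Longrightarrow> y \<in> carrier G \<Longrightarrow> h (x \<oplus>\<^bsub>G\<^esub> y) = h x \<oplus>\<^bsub>H\<^esub> h y"
    "x \<in> carrier G \<Longrightarrow> y \<in> carrier G \<Longrightarrow> h (x \<ominus>\<^bsub>G\<^esub> y) = h x \<ominus>\<^bsub>H\<^esub> h y"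
    by (auto simp: a_minus_def)
qed

lemma (in abelian_group) minus_zero_imp_eq:
  assumes "x \<in> carrier G" "y \<in> carrier G" "x \<ominus> y = \<zero>"
  shows "x = y"
  using assms minus_equality[of x "\<ominus> y"] by (simp add: a_minus_def)

text \<open>The base \<open>K\<close> is left general, because tensor products are taken over the
  field of constants as well as over \<open>F\<close>.\<close>

locale tensor_product = A: algebra K A + B: algebra K B
  for K :: "('k, 'x) ring_scheme" and A :: "('k, 'a, 'y) module_scheme"
    and B :: "('k, 'b, 'z) module_scheme"
begin

section \<open>The integral monoid ring of pairs\<close>

abbreviation "P \<equiv> pair_ring A B"

lemma pair_ring_simps [simp]:
  "carrier P = {x. Poly_Mapping.keys x \<subseteq> carrier A \<times> carrier B}"
  "\<one>\<^bsub>P\<^esub> = frag_of (\<one>\<^bsub>A\<^esub>, \<one>\<^bsub>B\<^esub>)" "\<zero>\<^bsub>P\<^esub> = 0" "x \<oplus>\<^bsub>P\<^esub> y = x + y"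
  by (simp_all add: pair_ring_def)

lemma pair_mult_frag_of [simp]:
  "frag_of (a, b) \<otimes>\<^bsub>P\<^esub> frag_of (a', b') = frag_of (a \<otimes>\<^bsub>A\<^esub> a', b \<otimes>\<^bsub>B\<^esub> b')"
  by (simp add: pair_ring_def)

lemma pair_mult_add_left: "(x + x') \<otimes>\<^bsub>P\<^esub> y = x \<otimes>\<^bsub>P\<^esub> y + x' \<otimes>\<^bsub>P\<^esub> y"
  by (simp add: pair_ring_def frag_extend_add)

lemma pair_mult_diff_left: "(x - x') \<otimes>\<^bsub>P\<^esub> y = x \<otimes>\<^bsub>P\<^esub> y - x' \<otimes>\<^bsub>P\<^esub> y"
  by (simp add: pair_ring_def frag_extend_diff)

lemma pair_mult_zero_left [simp]: "0 \<otimes>\<^bsub>P\<^esub> y = 0"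
  by (simp add: pair_ring_def)

text \<open>The product is a nested \<open>frag_extend\<close> with the left factor outside.
  Linearity on the left is therefore immediate, while linearity on the right needs an induction over
  the left factor.\<close>

lemma pair_mult_diff_right: "x \<otimes>\<^bsub>P\<^esub> (y - y') = x \<otimes>\<^bsub>P\<^esub> y - x \<otimes>\<^bsub>P\<^esub> y'"
proof (induction x rule: frag_induction[OF subset_UNIV])
  case (2 z)
  then show ?case by (cases z) (simp add: pair_ring_def frag_extend_diff)
next
  case (3 a b)
  then show ?case by (simp add: pair_mult_diff_left)
qed simp

lemma pair_mult_zero_right [simp]: "x \<otimes>\<^bsub>P\<^esub> 0 = 0"
  using pair_mult_diff_right[of x 0 0] by simp

text \<open>The difference step of \<open>frag_induction\<close> carries no information on supports.
  Proving membership in the carrier along with \<open>Q\<close> makes it available for both terms of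
  a difference.\<close>

lemma pair_ring_induct [consumes 1, case_names zero one diff]:
  assumes "x \<in> carrier P" and "Q 0"
    and "\<And>a b. a \<in> carrier A \<Longrightarrow> b \<in> carrier B \<Longrightarrow> Q (frag_of (a, b))"
    and "\<And>x y. x \<in> carrier P \<Longrightarrow> y \<in> carrier P \<Longrightarrow> Q x \<Longrightarrow> Q y \<Longrightarrow> Q (x - y)"
  shows "Q x"
proof -
  have "x \<in> carrier P \<and> Q x"
    by (rule frag_induction[of x "carrier A \<times> carrier B"])
       (use assms in \<open>auto dest: subsetD[OF keys_diff]\<close>)
  thus ?thesis by simp
qed

lemma pair_mult_closed:
  assumes "x \<in> carrier P" "y \<in> carrier P"
  shows "x \<otimes>\<^bsub>P\<^esub> y \<in> carrier P"
  using assms(1)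
proof (induction rule: pair_ring_induct)
  case (one a b)
  show ?case using assms(2)
    by (induction rule: pair_ring_induct)
       (use one in \<open>auto simp: pair_mult_diff_right dest: subsetD[OF keys_diff]\<close>)
qed (auto simp: pair_mult_diff_left dest: subsetD[OF keys_diff])

lemma pair_mult_comm:
  assumes "x \<in> carrier P" "y \<in> carrier P"
  shows "x \<otimes>\<^bsub>P\<^esub> y = y \<otimes>\<^bsub>P\<^esub> x"
  using assms(1)
proof (induction rule: pair_ring_induct)
  case (one a b)
  show ?case using assms(2)
    by (induction rule: pair_ring_induct)
       (use one in \<open>auto simp: pair_mult_diff_right pair_mult_diff_left A.m_comm B.m_comm\<close>)
qed (auto simp: pair_mult_diff_left pair_mult_diff_right)

lemma pair_mult_assoc:
  assumes "x \<in> carrier P" "y \<in> carrier P" "z \<in> carrier P"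
  shows "(x \<otimes>\<^bsub>P\<^esub> y) \<otimes>\<^bsub>P\<^esub> z = x \<otimes>\<^bsub>P\<^esub> (y \<otimes>\<^bsub>P\<^esub> z)"
  using assms(1)
proof (induction rule: pair_ring_induct)
  case (one a b)
  show ?case using assms(2)
  proof (induction rule: pair_ring_induct)
    case (one a' b')
    show ?case using assms(3)
    by (induction rule: pair_ring_induct)
       (use one \<open>a \<in> _\<close> \<open>b \<in> _\<close> in \<open>auto simp: pair_mult_diff_right pair_mult_diff_left A.m_assoc B.m_assoc\<close>)
  qed (auto simp: pair_mult_diff_left pair_mult_diff_right)
qed (auto simp: pair_mult_diff_left pair_mult_diff_right)

lemma pair_mult_one:
  assumes "x \<in> carrier P"
  shows "\<one>\<^bsub>P\<^esub> \<otimes>\<^bsub>P\<^esub> x = x"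
  using assms
  by (induction rule: pair_ring_induct) (auto simp: pair_mult_diff_right)

sublocale P: cring P
proof (rule cringI)
  show "abelian_group P"
  proof (rule abelian_groupI)
    fix x assume "x \<in> carrier P"
    then show "\<exists>y\<in>carrier P. y \<oplus>\<^bsub>P\<^esub> x = \<zero>\<^bsub>P\<^esub>"
      by (intro bexI[of _ "- x"]) auto
  qed (auto dest: subsetD[OF keys_add])
  show "comm_monoid P"
    by (rule comm_monoidI)
       (use pair_mult_closed pair_mult_assoc pair_mult_one pair_mult_comm in auto)
qed (use pair_mult_add_left in auto)

lemma pair_uminus [simp]: "x \<in> carrier P \<Longrightarrow> \<ominus>\<^bsub>P\<^esub> x = - x"
  by (rule P.minus_equality) auto

lemma pair_minus [simp]: "x \<in> carrier P \<Longrightarrow> y \<in> carrier P \<Longrightarrow> x \<ominus>\<^bsub>P\<^esub> y = x - y"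
  by (simp add: a_minus_def)

section \<open>The quotient and its pure tensors\<close>

abbreviation "I \<equiv> tensor_ideal K A B"
abbreviation "T \<equiv> tensor K A B"

lemma tensor_relationsI:
  "\<lbrakk>a \<in> carrier A; a' \<in> carrier A; b \<in> carrier B\<rbrakk> \<Longrightarrow>
    frag_of (a \<oplus>\<^bsub>A\<^esub> a', b) - frag_of (a, b) - frag_of (a', b) \<in> tensor_relations K A B"
  "\<lbrakk>a \<in> carrier A; b \<in> carrier B; b' \<in> carrier B\<rbrakk> \<Longrightarrow>
    frag_of (a, b \<oplus>\<^bsub>B\<^esub> b') - frag_of (a, b) - frag_of (a, b') \<in> tensor_relations K A B"
  "\<lbrakk>c \<in> carrier K; a \<in> carrier A; b \<in> carrier B\<rbrakk> \<Longrightarrow>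
    frag_of (c \<odot>\<^bsub>A\<^esub> a, b) - frag_of (a, c \<odot>\<^bsub>B\<^esub> b) \<in> tensor_relations K A B"
  unfolding tensor_relations_def by blast+

lemma tensor_relations_cases:
  assumes "r \<in> tensor_relations K A B"
  obtains a a' b where "a \<in> carrier A" "a' \<in> carrier A" "b \<in> carrier B"
      "r = frag_of (a \<oplus>\<^bsub>A\<^esub> a', b) - frag_of (a, b) - frag_of (a', b)"
    | a b b' where "a \<in> carrier A" "b \<in> carrier B" "b' \<in> carrier B"
      "r = frag_of (a, b \<oplus>\<^bsub>B\<^esub> b') - frag_of (a, b) - frag_of (a, b')"
    | c a b where "c \<in> carrier K" "a \<in> carrier A" "b \<in> carrier B"
      "r = frag_of (c \<odot>\<^bsub>A\<^esub> a, b) - frag_of (a, c \<odot>\<^bsub>B\<^esub> b)"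
  using assms unfolding tensor_relations_def
  by (elim UnE CollectE exE conjE) (rule that; assumption)+

lemma tensor_relations_closed: "tensor_relations K A B \<subseteq> carrier P"
  by (auto simp: tensor_relations_def dest!: subsetD[OF keys_diff])

sublocale I: ideal I P
  unfolding tensor_ideal_def by (rule P.genideal_ideal[OF tensor_relations_closed])

sublocale T: cring T
  unfolding tensor_def by (rule I.quotient_is_cring) unfold_locales

text \<open>The pure tensor \<open>a \<otimes> b\<close>.\<close>

definition t :: "'a \<Rightarrow> 'b \<Rightarrow> (('a \<times> 'b) \<Rightarrow>\<^sub>0 int) set" where
  "t a b = I +>\<^bsub>P\<^esub> frag_of (a, b)"

abbreviation cls :: "(('a \<times> 'b) \<Rightarrow>\<^sub>0 int) \<Rightarrow> (('a \<times> 'b) \<Rightarrow>\<^sub>0 int) set" where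
  "cls x \<equiv> I +>\<^bsub>P\<^esub> x"

lemma cls_ring_hom: "cls \<in> ring_hom P T"
  unfolding tensor_def by (rule I.rcos_ring_hom)

lemma carrier_T: "carrier T = cls ` carrier P"
  by (auto simp: tensor_def FactRing_def A_RCOSETS_def')

lemma cls_closed: "x \<in> carrier P \<Longrightarrow> cls x \<in> carrier T"
  using ring_hom_closed[OF cls_ring_hom] by blast

lemma cls_add: "x \<in> carrier P \<Longrightarrow> y \<in> carrier P \<Longrightarrow> cls (x + y) = cls x \<oplus>\<^bsub>T\<^esub> cls y"
  using ring_hom_add[OF cls_ring_hom] by force

lemma cls_zero_iff: "x \<in> carrier P \<Longrightarrow> cls x = \<zero>\<^bsub>T\<^esub> \<longleftrightarrow> x \<in> I"
  by (metis FactRing_def I.a_rcos_const I.a_rcos_self I.ideal_axioms P.quotient_eq_iff_same_a_r_cos P.zero_closed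
      partial_object.simps(1) ring_record_simps(11) tensor_def)

lemma cls_diff: "x \<in> carrier P \<Longrightarrow> y \<in> carrier P \<Longrightarrow> cls (x - y) = cls x \<ominus>\<^bsub>T\<^esub> cls y"
proof -
  assume xy: "x \<in> carrier P" "y \<in> carrier P"
  interpret c: ring_hom_cring P T cls
    by (intro ring_hom_cring.intro ring_hom_cring_axioms.intro cls_ring_hom) unfold_locales
  show ?thesis using c.hom_sub[OF xy] xy by simp
qed

lemma cls_eqI: "x - y \<in> I \<Longrightarrow> x \<in> carrier P \<Longrightarrow> y \<in> carrier P \<Longrightarrow> cls x = cls y"
  using cls_diff[of x y] cls_zero_iff[of "x - y"] cls_closed T.r_right_minus_eq[of "cls x" "cls y"]
  by (metis P.minus_closed pair_minus)

lemma t_closed [simp]: "a \<in> carrier A \<Longrightarrow> b \<in> carrier B \<Longrightarrow> t a b \<in> carrier T"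
  unfolding t_def by (rule cls_closed) simp

lemma relations_I: "tensor_relations K A B \<subseteq> I"
  unfolding tensor_ideal_def by (rule P.genideal_self[OF tensor_relations_closed])

lemma t_add_left:
  assumes "a \<in> carrier A" "a' \<in> carrier A" "b \<in> carrier B"
  shows "t (a \<oplus>\<^bsub>A\<^esub> a') b = t a b \<oplus>\<^bsub>T\<^esub> t a' b"
proof -
  have "frag_of (a \<oplus>\<^bsub>A\<^esub> a', b) - frag_of (a, b) - frag_of (a', b) \<in> I"
    by (intro subsetD[OF relations_I] tensor_relationsI assms)
  then have "t (a \<oplus>\<^bsub>A\<^esub> a') b = cls (frag_of (a, b) + frag_of (a', b))"
    unfolding t_def by (intro cls_eqI) (use assms in \<open>auto simp: algebra_simps dest!: subsetD[OF keys_add]\<close>)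
  then show ?thesis using assms by (simp add: t_def cls_add)
qed

lemma t_add_right:
  assumes "a \<in> carrier A" "b \<in> carrier B" "b' \<in> carrier B"
  shows "t a (b \<oplus>\<^bsub>B\<^esub> b') = t a b \<oplus>\<^bsub>T\<^esub> t a b'"
proof -
  have "frag_of (a, b \<oplus>\<^bsub>B\<^esub> b') - frag_of (a, b) - frag_of (a, b') \<in> I"
    by (intro subsetD[OF relations_I] tensor_relationsI assms)
  then have "t a (b \<oplus>\<^bsub>B\<^esub> b') = cls (frag_of (a, b) + frag_of (a, b'))"
    unfolding t_def by (intro cls_eqI) (use assms in \<open>auto simp: algebra_simps dest!: subsetD[OF keys_add]\<close>)
  then show ?thesis using assms by (simp add: t_def cls_add)
qed

lemma t_balanced:
  assumes "c \<in> carrier K" "a \<in> carrier A" "b \<in> carrier B"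
  shows "t (c \<odot>\<^bsub>A\<^esub> a) b = t a (c \<odot>\<^bsub>B\<^esub> b)"
proof -
  have "frag_of (c \<odot>\<^bsub>A\<^esub> a, b) - frag_of (a, c \<odot>\<^bsub>B\<^esub> b) \<in> I"
    by (intro subsetD[OF relations_I] tensor_relationsI assms)
  then show ?thesis
    unfolding t_def by (intro cls_eqI) (use assms in \<open>auto\<close>)
qed

lemma t_mult:
  assumes "a \<in> carrier A" "b \<in> carrier B" "a' \<in> carrier A" "b' \<in> carrier B"
  shows "t a b \<otimes>\<^bsub>T\<^esub> t a' b' = t (a \<otimes>\<^bsub>A\<^esub> a') (b \<otimes>\<^bsub>B\<^esub> b')"
  unfolding t_def
  using ring_hom_mult[OF cls_ring_hom, of "frag_of (a, b)" "frag_of (a', b')"] assms by simp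

lemma t_one: "\<one>\<^bsub>T\<^esub> = t \<one>\<^bsub>A\<^esub> \<one>\<^bsub>B\<^esub>"
  unfolding t_def using ring_hom_one[OF cls_ring_hom] by simp

lemma t_zero_left [simp]: "b \<in> carrier B \<Longrightarrow> t \<zero>\<^bsub>A\<^esub> b = \<zero>\<^bsub>T\<^esub>"
  using t_add_left[of "\<zero>\<^bsub>A\<^esub>" "\<zero>\<^bsub>A\<^esub>" b] T.add.l_cancel_one[of "t \<zero>\<^bsub>A\<^esub> b" "t \<zero>\<^bsub>A\<^esub> b"] by auto

lemma t_zero_right [simp]: "a \<in> carrier A \<Longrightarrow> t a \<zero>\<^bsub>B\<^esub> = \<zero>\<^bsub>T\<^esub>"
  using t_add_right[of a "\<zero>\<^bsub>B\<^esub>" "\<zero>\<^bsub>B\<^esub>"] T.add.l_cancel_one[of "t a \<zero>\<^bsub>B\<^esub>" "t a \<zero>\<^bsub>B\<^esub>"] by auto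

lemma t_uminus_left: "a \<in> carrier A \<Longrightarrow> b \<in> carrier B \<Longrightarrow> t (\<ominus>\<^bsub>A\<^esub> a) b = \<ominus>\<^bsub>T\<^esub> t a b"
  using t_add_left[of "\<ominus>\<^bsub>A\<^esub> a" a b] by (simp add: A.l_neg T.minus_equality)

lemma tensor_induct [consumes 1, case_names pure add]:
  assumes "x \<in> carrier T"
    and pure: "\<And>a b. a \<in> carrier A \<Longrightarrow> b \<in> carrier B \<Longrightarrow> Q (t a b)"
    and add: "\<And>x y. x \<in> carrier T \<Longrightarrow> y \<in> carrier T \<Longrightarrow> Q x \<Longrightarrow> Q y \<Longrightarrow> Q (x \<oplus>\<^bsub>T\<^esub> y)"
  shows "Q x"
proof -
  obtain y where y: "y \<in> carrier P" "x = cls y" using assms(1) carrier_T by auto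
  \<comment> \<open>The free abelian group is generated under differences, whereas \<open>Q\<close>
    is only known to be stable under sums. So a class and its negative are controlled together; the
    negative of a pure tensor is again pure.\<close>
  have "Q (cls y) \<and> Q (\<ominus>\<^bsub>T\<^esub> cls y)" using y(1)
  proof (induction rule: pair_ring_induct)
    case zero
    have "cls 0 = \<zero>\<^bsub>T\<^esub>" by (subst cls_zero_iff) (use I.zero_closed in auto)
    then show ?case using pure[of "\<zero>\<^bsub>A\<^esub>" "\<zero>\<^bsub>B\<^esub>"] by simp
  next
    case (one a b)
    then show ?case using pure[of a b] pure[of "\<ominus>\<^bsub>A\<^esub> a" b] by (simp add: t_uminus_left) (simp add: t_def)
  next
    case (diff x y)
    have "cls (x - y) = cls x \<oplus>\<^bsub>T\<^esub> \<ominus>\<^bsub>T\<^esub> cls y" using diff by (simp add: cls_diff a_minus_def)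
    moreover have "\<ominus>\<^bsub>T\<^esub> cls (x - y) = \<ominus>\<^bsub>T\<^esub> cls x \<oplus>\<^bsub>T\<^esub> cls y"
      using diff cls_closed by (simp add: cls_diff a_minus_def T.minus_add)
    ultimately show ?case
      using diff add cls_closed T.a_inv_closed by metis
  qed
  with y show ?thesis by simp
qed

text \<open>The tensor product is a quotient by a ring ideal, while its universal property is also
  wanted for maps that are only additive. This lemma bridges the two.\<close>

lemma pair_hom_vanishes_on_I:
  assumes G: "abelian_group G" and h: "h \<in> hom (add_monoid P) (add_monoid G)"
    and van: "\<And>x. x \<in> tensor_relations K A B \<Longrightarrow> h x = \<zero>\<^bsub>G\<^esub>" and x: "x \<in> I"
  shows "h x = \<zero>\<^bsub>G\<^esub>"
proof -
  interpret G: abelian_group G by fact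
  note hs = add_monoid_hom_simps[OF P.abelian_group_axioms G h]
  \<comment> \<open>The relations are stable under multiplication by pairs, so \<open>h\<close> kills the whole ideal.\<close>
  let ?N = "{x \<in> carrier P. \<forall>y\<in>carrier P. h (y \<otimes>\<^bsub>P\<^esub> x) = \<zero>\<^bsub>G\<^esub>}"
  have N: "ideal ?N P"
  proof (rule idealI)
    show "ring P" ..
    show "subgroup ?N (add_monoid P)"
    proof (rule P.add.subgroupI)
      show "?N \<noteq> {}" using hs(1) by (force intro!: exI[of _ 0])
    next
      fix a assume a: "a \<in> ?N"
      then show "\<ominus>\<^bsub>P\<^esub> a \<in> ?N"
        using hs(2)
        by (auto simp: P.r_minus simp del: pair_ring_simps pair_uminus)
    next
      fix a b assume "a \<in> ?N" "b \<in> ?N"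
      then show "a \<oplus>\<^bsub>P\<^esub> b \<in> ?N"
        using hs(4) by (auto simp: P.r_distr simp del: pair_ring_simps)
    qed auto
    fix a x assume ax: "a \<in> ?N" "x \<in> carrier P"
    have *: "y \<otimes>\<^bsub>P\<^esub> (x \<otimes>\<^bsub>P\<^esub> a) = (y \<otimes>\<^bsub>P\<^esub> x) \<otimes>\<^bsub>P\<^esub> a" if "y \<in> carrier P" for y
      using that ax by (intro P.m_assoc[symmetric]) auto
    show 1: "x \<otimes>\<^bsub>P\<^esub> a \<in> ?N" using ax by (auto simp: * simp del: pair_ring_simps)
    have "a \<otimes>\<^bsub>P\<^esub> x = x \<otimes>\<^bsub>P\<^esub> a" using ax by (intro P.m_comm) auto
    with 1 show "a \<otimes>\<^bsub>P\<^esub> x \<in> ?N" by simp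
  qed
  have rel: "frag_of (a', b') \<otimes>\<^bsub>P\<^esub> r \<in> tensor_relations K A B"
    if "a' \<in> carrier A" "b' \<in> carrier B" "r \<in> tensor_relations K A B" for a' b' r
    using that(3)
  proof (cases r rule: tensor_relations_cases)
    case (1 a a1 b)
    then show ?thesis
      using tensor_relationsI(1)[of "a' \<otimes>\<^bsub>A\<^esub> a" "a' \<otimes>\<^bsub>A\<^esub> a1" "b' \<otimes>\<^bsub>B\<^esub> b"] that(1,2)
      by (simp add: pair_mult_diff_right A.r_distr)
  next
    case (2 a b b1)
    then show ?thesis
      using tensor_relationsI(2)[of "a' \<otimes>\<^bsub>A\<^esub> a" "b' \<otimes>\<^bsub>B\<^esub> b" "b' \<otimes>\<^bsub>B\<^esub> b1"] that(1,2)
      by (simp add: pair_mult_diff_right B.r_distr)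
  next
    case (3 c a b)
    have "a' \<otimes>\<^bsub>A\<^esub> (c \<odot>\<^bsub>A\<^esub> a) = c \<odot>\<^bsub>A\<^esub> (a' \<otimes>\<^bsub>A\<^esub> a)"
      using 3 that(1) A.smult_assoc2[of c a a'] by (simp add: A.m_comm)
    moreover have "b' \<otimes>\<^bsub>B\<^esub> (c \<odot>\<^bsub>B\<^esub> b) = c \<odot>\<^bsub>B\<^esub> (b' \<otimes>\<^bsub>B\<^esub> b)"
      using 3 that(2) B.smult_assoc2[of c b b'] by (simp add: B.m_comm)
    ultimately show ?thesis
      using tensor_relationsI(3)[of c "a' \<otimes>\<^bsub>A\<^esub> a" "b' \<otimes>\<^bsub>B\<^esub> b"] that(1,2) 3
      by (simp add: pair_mult_diff_right)
  qed
  have "tensor_relations K A B \<subseteq> ?N"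
  proof
    fix r assume r: "r \<in> tensor_relations K A B"
    have "h (y \<otimes>\<^bsub>P\<^esub> r) = \<zero>\<^bsub>G\<^esub>" if "y \<in> carrier P" for y
      using that
    proof (induction rule: pair_ring_induct)
      case zero then show ?case using hs(1) by simp
    next
      case (one a b) then show ?case using rel[OF _ _ r] van by simp
    next
      case (diff x y)
      have "r \<in> carrier P" using r tensor_relations_closed by blast
      then have "h (x \<otimes>\<^bsub>P\<^esub> r - y \<otimes>\<^bsub>P\<^esub> r) = h (x \<otimes>\<^bsub>P\<^esub> r) \<ominus>\<^bsub>G\<^esub> h (y \<otimes>\<^bsub>P\<^esub> r)"
        using hs(5)[of "x \<otimes>\<^bsub>P\<^esub> r" "y \<otimes>\<^bsub>P\<^esub> r"] diff pair_mult_closed pair_minus by metis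
      then show ?case using diff by (simp add: pair_mult_diff_left a_minus_def)
    qed
    then show "r \<in> ?N" using r tensor_relations_closed by auto
  qed
  then have "I \<subseteq> ?N" unfolding tensor_ideal_def by (rule P.genideal_minimal[OF N])
  \<comment> \<open>Membership in \<open>?N\<close> says that all multiples of an element are
    killed; the multiple by one is the element itself.\<close>
  with x have "h (\<one>\<^bsub>P\<^esub> \<otimes>\<^bsub>P\<^esub> x) = \<zero>\<^bsub>G\<^esub>" using P.one_closed by blast
  moreover have "x \<in> carrier P" using x I.a_subset by blast
  ultimately show ?thesis by (simp add: P.l_one del: pair_ring_simps)
qed

section \<open>Universal properties\<close>

lemma hom_eq_on_tensor:
  assumes G: "abelian_group G" and "h \<in> hom (add_monoid T) (add_monoid G)"
    "h' \<in> hom (add_monoid T) (add_monoid G)"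
    and "\<And>a b. a \<in> carrier A \<Longrightarrow> b \<in> carrier B \<Longrightarrow> h (t a b) = h' (t a b)"
    and x: "x \<in> carrier T"
  shows "h x = h' x"
  using x
  by (induction rule: tensor_induct)
     (simp_all add: assms(4) add_monoid_hom_simps(4)[OF T.abelian_group_axioms G assms(2)]
       add_monoid_hom_simps(4)[OF T.abelian_group_axioms G assms(3)])

text \<open>The map \<open>h0\<close> on the free group is exported together with \<open>h\<close>,
  because \<open>tensor_lift\<close> is evaluated on representatives and has to be compared with a
  map defined there.\<close>

lemma tensor_additive_universal:
  assumes G: "abelian_group G"
    and cl: "\<And>a b. a \<in> carrier A \<Longrightarrow> b \<in> carrier B \<Longrightarrow> f a b \<in> carrier G"
    and l: "\<And>a a' b. a \<in> carrier A \<Longrightarrow> a' \<in> carrier A \<Longrightarrow> b \<in> carrier B \<Longrightarrow> f (a \<oplus>\<^bsub>A\<^esub> a') b = f a b \<oplus>\<^bsub>G\<^esub> f a' b"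
    and r: "\<And>a b b'. a \<in> carrier A \<Longrightarrow> b \<in> carrier B \<Longrightarrow> b' \<in> carrier B \<Longrightarrow> f a (b \<oplus>\<^bsub>B\<^esub> b') = f a b \<oplus>\<^bsub>G\<^esub> f a b'"
    and bal: "\<And>c a b. c \<in> carrier K \<Longrightarrow> a \<in> carrier A \<Longrightarrow> b \<in> carrier B \<Longrightarrow> f (c \<odot>\<^bsub>A\<^esub> a) b = f a (c \<odot>\<^bsub>B\<^esub> b)"
  obtains h h0 where "h \<in> hom (add_monoid T) (add_monoid G)"
    "h0 \<in> hom (add_monoid P) (add_monoid G)"
    "\<And>a b. a \<in> carrier A \<Longrightarrow> b \<in> carrier B \<Longrightarrow> h (t a b) = f a b"
    "\<And>a b. a \<in> carrier A \<Longrightarrow> b \<in> carrier B \<Longrightarrow> h0 (frag_of (a, b)) = f a b"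
    "\<And>x. x \<in> carrier P \<Longrightarrow> h (cls x) = h0 x"
proof -
  interpret G: abelian_group G by fact
  let ?S = "carrier A \<times> carrier B"
  obtain h0 where h0: "h0 \<in> hom (free_Abelian_group ?S) (add_monoid G)"
      "\<And>z. z \<in> ?S \<Longrightarrow> h0 (frag_of z) = f (fst z) (snd z)"
    by (rule comm_group.free_Abelian_group_universal[OF G.a_comm_group, of "\<lambda>z. f (fst z) (snd z)" ?S])
       (use cl in auto)
  have hP: "h0 \<in> hom (add_monoid P) (add_monoid G)"
    using h0(1) by (auto simp: hom_def Pi_iff)
  note hs = add_monoid_hom_simps[OF P.abelian_group_axioms G hP]
  have hd: "h0 (x - y) = h0 x \<ominus>\<^bsub>G\<^esub> h0 y" if "x \<in> carrier P" "y \<in> carrier P" for x y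
    using hs(5)[OF that] pair_minus[OF that] by simp
  have kd: "x - y \<in> carrier P" if "x \<in> carrier P" "y \<in> carrier P" for x y
    using P.minus_closed[OF that] pair_minus[OF that] by simp
  have sub0: "(x \<oplus>\<^bsub>G\<^esub> y) \<ominus>\<^bsub>G\<^esub> x \<ominus>\<^bsub>G\<^esub> y = \<zero>\<^bsub>G\<^esub>" if "x \<in> carrier G" "y \<in> carrier G" for x y
    using that G.a_assoc[of "x \<oplus>\<^bsub>G\<^esub> y" "\<ominus>\<^bsub>G\<^esub> x" "\<ominus>\<^bsub>G\<^esub> y"] G.minus_add[of x y] G.r_neg[of "x \<oplus>\<^bsub>G\<^esub> y"]
    by (simp add: a_minus_def)
  have fo: "frag_of (a, b) \<in> carrier P" if "a \<in> carrier A" "b \<in> carrier B" for a b using that by simp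
  have "h0 x = \<zero>\<^bsub>G\<^esub>" if "x \<in> tensor_relations K A B" for x
    using that
  proof (cases x rule: tensor_relations_cases)
    case (1 a a' b)
    then show ?thesis using fo
      by (simp add: hd kd h0 l cl sub0 del: pair_ring_simps)
  next
    case (2 a b b')
    then show ?thesis using fo
      by (simp add: hd kd h0 r cl sub0 del: pair_ring_simps)
  next
    case (3 c a b)
    then show ?thesis using fo
      by (simp add: hd h0 bal cl a_minus_def G.r_neg del: pair_ring_simps)
  qed
  then have van: "h0 x = \<zero>\<^bsub>G\<^esub>" if "x \<in> I" for x
    using pair_hom_vanishes_on_I[OF G hP] that by blast
  \<comment> \<open>Any representative may be chosen: two of them differ by an element of the tensor
    ideal, and \<open>h0\<close> kills that.\<close>
  define h where "h Z = h0 (SOME x. x \<in> carrier P \<and> Z = cls x)" for Z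
  have hc: "h (cls x) = h0 x" if x: "x \<in> carrier P" for x
  proof -
    let ?y = "SOME y. y \<in> carrier P \<and> cls x = cls y"
    have ex: "\<exists>y. y \<in> carrier P \<and> cls x = cls y" using x by (intro exI[of _ x] conjI refl)
    have y: "?y \<in> carrier P \<and> cls x = cls ?y" using someI_ex[OF ex] .
    then have "cls (x - ?y) = \<zero>\<^bsub>T\<^esub>" using x cls_closed by (simp add: cls_diff T.r_right_minus_eq)
    then have "h0 (x - ?y) = \<zero>\<^bsub>G\<^esub>" using van cls_zero_iff kd x y by blast
    then show ?thesis unfolding h_def using hd[of x ?y] x y hs(3)
      G.minus_zero_imp_eq[ of "h0 x" "h0 ?y"] by simp
  qed
  have "h \<in> hom (add_monoid T) (add_monoid G)"
  proof (rule homI)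
    fix x assume "x \<in> carrier (add_monoid T)"
    then obtain x' where "x' \<in> carrier P" "x = cls x'" using carrier_T by auto
    then show "h x \<in> carrier (add_monoid G)" using hc hs(3) by auto
    fix y assume "y \<in> carrier (add_monoid T)"
    then obtain y' where y: "y' \<in> carrier P" "y = cls y'" using carrier_T by auto
    have "h (cls x' \<oplus>\<^bsub>T\<^esub> cls y') = h (cls (x' + y'))"
      using \<open>x' \<in> carrier P\<close> y by (simp add: cls_add del: pair_ring_simps)
    also have "\<dots> = h0 (x' \<oplus>\<^bsub>P\<^esub> y')" using hc[of "x' \<oplus>\<^bsub>P\<^esub> y'"] P.a_closed \<open>x' \<in> carrier P\<close> y by simp
    also have "\<dots> = h0 x' \<oplus>\<^bsub>G\<^esub> h0 y'" using hs(4) \<open>x' \<in> carrier P\<close> y by blast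
    finally show "h (x \<otimes>\<^bsub>add_monoid T\<^esub> y) = h x \<otimes>\<^bsub>add_monoid G\<^esub> h y"
      using hc \<open>x' \<in> carrier P\<close> \<open>x = cls x'\<close> y by simp
  qed
  then show thesis
    by (rule that[of h h0]) (use hP hc h0 fo in \<open>auto simp: t_def\<close>)
qed

text \<open>The additive map is available already; multiplicativity is reduced to pure tensors by
  \<open>tensor_induct\<close> in both factors, and there it holds because the target is
  commutative.\<close>

lemma tensor_ring_universal:
  assumes S: "cring S" and f: "f \<in> ring_hom A S" and g: "g \<in> ring_hom B S"
    and bal: "\<And>c a b. c \<in> carrier K \<Longrightarrow> a \<in> carrier A \<Longrightarrow> b \<in> carrier B \<Longrightarrow>
        f (c \<odot>\<^bsub>A\<^esub> a) \<otimes>\<^bsub>S\<^esub> g b = f a \<otimes>\<^bsub>S\<^esub> g (c \<odot>\<^bsub>B\<^esub> b)"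
  obtains h where "h \<in> ring_hom T S"
    "\<And>a b. a \<in> carrier A \<Longrightarrow> b \<in> carrier B \<Longrightarrow> h (t a b) = f a \<otimes>\<^bsub>S\<^esub> g b"
proof -
  interpret S: cring S by fact
  note fs = ring_hom_closed[OF f] ring_hom_add[OF f] ring_hom_mult[OF f] ring_hom_one[OF f]
  note gs = ring_hom_closed[OF g] ring_hom_add[OF g] ring_hom_mult[OF g] ring_hom_one[OF g]
  obtain h h0 where h: "h \<in> hom (add_monoid T) (add_monoid S)"
    and "h0 \<in> hom (add_monoid P) (add_monoid S)"
    and ht: "\<And>a b. a \<in> carrier A \<Longrightarrow> b \<in> carrier B \<Longrightarrow> h (t a b) = f a \<otimes>\<^bsub>S\<^esub> g b"
    by (rule tensor_additive_universal[OF S.abelian_group_axioms, of "\<lambda>a b. f a \<otimes>\<^bsub>S\<^esub> g b"])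
       (use bal in \<open>auto simp: fs gs S.l_distr S.r_distr\<close>)
  note hs = add_monoid_hom_simps[OF T.abelian_group_axioms S.abelian_group_axioms h]
  have "h (x \<otimes>\<^bsub>T\<^esub> y) = h x \<otimes>\<^bsub>S\<^esub> h y" if x: "x \<in> carrier T" and y: "y \<in> carrier T" for x y
    using x
  proof (induction rule: tensor_induct)
    case (pure a b)
    show ?case using y
    proof (induction rule: tensor_induct)
      case (pure a' b')
      then show ?case using \<open>a \<in> _\<close> \<open>b \<in> _\<close>
        by (simp add: t_mult ht fs gs S.m_ac)
    next
      case (add u v)
      then show ?case using pure by (simp add: T.r_distr hs S.r_distr)
    qed
  next
    case (add u v)
    then show ?case using y by (simp add: T.l_distr hs S.l_distr)
  qed
  then have "h \<in> ring_hom T S"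
    by (intro ring_hom_memI) (use hs in \<open>auto simp: t_one ht fs gs\<close>)
  then show thesis using that ht by blast
qed

end

section \<open>Functoriality, and derivations on a tensor product\<close>

context tensor_product
begin

text \<open>\<open>tensor_lift\<close> takes \<open>the_elem\<close> of the image of a whole coset,
  so the point is that this image is a singleton. On every representative the extension of
  \<open>h\<close> has the class given by \<open>H0\<close>, which depends on the coset
  alone.\<close>

lemma tensor_lift_hom:
  assumes CD: "tensor_product K C D"
    and cl: "\<And>a b. a \<in> carrier A \<Longrightarrow> b \<in> carrier B \<Longrightarrow> h a b \<in> carrier (pair_ring C D)"
    and l: "\<And>a a' b. a \<in> carrier A \<Longrightarrow> a' \<in> carrier A \<Longrightarrow> b \<in> carrier B \<Longrightarrow>
      tensor_ideal K C D +>\<^bsub>pair_ring C D\<^esub> h (a \<oplus>\<^bsub>A\<^esub> a') b =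
      (tensor_ideal K C D +>\<^bsub>pair_ring C D\<^esub> h a b) \<oplus>\<^bsub>tensor K C D\<^esub> (tensor_ideal K C D +>\<^bsub>pair_ring C D\<^esub> h a' b)"
    and r: "\<And>a b b'. a \<in> carrier A \<Longrightarrow> b \<in> carrier B \<Longrightarrow> b' \<in> carrier B \<Longrightarrow>
      tensor_ideal K C D +>\<^bsub>pair_ring C D\<^esub> h a (b \<oplus>\<^bsub>B\<^esub> b') =
      (tensor_ideal K C D +>\<^bsub>pair_ring C D\<^esub> h a b) \<oplus>\<^bsub>tensor K C D\<^esub> (tensor_ideal K C D +>\<^bsub>pair_ring C D\<^esub> h a b')"
    and bal: "\<And>c a b. c \<in> carrier K \<Longrightarrow> a \<in> carrier A \<Longrightarrow> b \<in> carrier B \<Longrightarrow>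
      tensor_ideal K C D +>\<^bsub>pair_ring C D\<^esub> h (c \<odot>\<^bsub>A\<^esub> a) b = tensor_ideal K C D +>\<^bsub>pair_ring C D\<^esub> h a (c \<odot>\<^bsub>B\<^esub> b)"
  shows "tensor_lift K C D h \<in> hom (add_monoid T) (add_monoid (tensor K C D))"
    and "a \<in> carrier A \<Longrightarrow> b \<in> carrier B \<Longrightarrow>
      tensor_lift K C D h (t a b) = tensor_ideal K C D +>\<^bsub>pair_ring C D\<^esub> h a b"
proof -
  interpret CD: tensor_product K C D by fact
  obtain H H0 where H: "H \<in> hom (add_monoid T) (add_monoid CD.T)"
      "H0 \<in> hom (add_monoid P) (add_monoid CD.T)"
      "\<And>a b. a \<in> carrier A \<Longrightarrow> b \<in> carrier B \<Longrightarrow> H (t a b) = CD.cls (h a b)"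
      "\<And>a b. a \<in> carrier A \<Longrightarrow> b \<in> carrier B \<Longrightarrow> H0 (frag_of (a, b)) = CD.cls (h a b)"
      "\<And>x. x \<in> carrier P \<Longrightarrow> H (cls x) = H0 x"
    by (rule tensor_additive_universal[OF CD.T.abelian_group_axioms, of "\<lambda>a b. CD.cls (h a b)"])
       (use cl l r bal CD.cls_closed in \<open>auto simp del: pair_ring_simps CD.pair_ring_simps\<close>)
  note H0s = add_monoid_hom_simps[OF P.abelian_group_axioms CD.T.abelian_group_axioms H(2)]
  let ?fe = "frag_extend (\<lambda>(a, b). h a b)"
  have fe: "?fe x \<in> carrier CD.P \<and> CD.cls (?fe x) = H0 x" if "x \<in> carrier P" for x
    using that
  proof (induction rule: pair_ring_induct)
    case zero
    have "CD.cls 0 = \<zero>\<^bsub>CD.T\<^esub>" by (subst CD.cls_zero_iff) (use CD.I.zero_closed in auto)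
    then show ?case using H0s(1) by simp
  next
    case (one a b)
    then show ?case using cl[of a b] H(4)[of a b] by simp
  next
    case (diff x y)
    have "?fe (x - y) = ?fe x \<ominus>\<^bsub>CD.P\<^esub> ?fe y"
      using diff CD.pair_minus[of "?fe x" "?fe y"] by (simp add: frag_extend_diff)
    moreover have "CD.cls (?fe x - ?fe y) = CD.cls (?fe x) \<ominus>\<^bsub>CD.T\<^esub> CD.cls (?fe y)"
      using diff by (intro CD.cls_diff) auto
    moreover have "H0 (x - y) = H0 x \<ominus>\<^bsub>CD.T\<^esub> H0 y" using H0s(5)[of x y] diff by simp
    ultimately show ?case using diff CD.P.minus_closed[of "?fe x" "?fe y"]
      by (simp add: frag_extend_diff del: CD.pair_ring_simps)
  qed
  have lift: "tensor_lift K C D h Z = H Z" if Z: "Z \<in> carrier T" for Z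
  proof -
    obtain x where x: "x \<in> carrier P" "Z = cls x" using Z carrier_T by auto
    have "CD.cls (?fe y) = H Z" if "y \<in> Z" for y
    proof -
      have y: "y \<in> carrier P" using that x I.a_elemrcos_carrier by blast
      have "cls y = cls x" using I.a_repr_independence'[of y x] that x by simp
      then show ?thesis using fe[OF y] H(5)[OF y] x by simp
    qed
    moreover have "x \<in> Z" using x I.a_rcos_self by simp
    ultimately have "(\<lambda>y. CD.cls (?fe y)) ` Z = {H Z}" by auto
    then show ?thesis by (simp add: tensor_lift_def)
  qed
  note Hs = add_monoid_hom_simps[OF T.abelian_group_axioms CD.T.abelian_group_axioms H(1)]
  show "tensor_lift K C D h \<in> hom (add_monoid T) (add_monoid CD.T)"
    by (rule homI) (simp_all add: lift Hs)
  show "a \<in> carrier A \<Longrightarrow> b \<in> carrier B \<Longrightarrow> tensor_lift K C D h (t a b) = CD.cls (h a b)"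
    by (simp add: lift H(3))
qed

lemma tensor_map_hom:
  assumes CD: "tensor_product K C D"
    and f: "f \<in> hom (add_monoid A) (add_monoid C)"
      "\<And>c a. c \<in> carrier K \<Longrightarrow> a \<in> carrier A \<Longrightarrow> f (c \<odot>\<^bsub>A\<^esub> a) = c \<odot>\<^bsub>C\<^esub> f a"
    and g: "g \<in> hom (add_monoid B) (add_monoid D)"
      "\<And>c a. c \<in> carrier K \<Longrightarrow> a \<in> carrier B \<Longrightarrow> g (c \<odot>\<^bsub>B\<^esub> a) = c \<odot>\<^bsub>D\<^esub> g a"
  shows "tensor_map K C D f g \<in> hom (add_monoid T) (add_monoid (tensor K C D))"
    and "a \<in> carrier A \<Longrightarrow> b \<in> carrier B \<Longrightarrow> tensor_map K C D f g (t a b) = tensor_product.t K C D (f a) (g b)"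
proof -
  interpret CD: tensor_product K C D by fact
  note fs = add_monoid_hom_simps[OF A.abelian_group_axioms CD.A.abelian_group_axioms f(1)]
  note gs = add_monoid_hom_simps[OF B.abelian_group_axioms CD.B.abelian_group_axioms g(1)]
  note * = tensor_lift_hom[OF CD, of "\<lambda>a b. frag_of (f a, g b)", folded CD.t_def tensor_map_def]
  show "tensor_map K C D f g \<in> hom (add_monoid T) (add_monoid (tensor K C D))"
    by (rule *) (simp_all add: fs gs CD.t_add_left CD.t_add_right f(2) g(2) CD.t_balanced)
  show "a \<in> carrier A \<Longrightarrow> b \<in> carrier B \<Longrightarrow> tensor_map K C D f g (t a b) = CD.t (f a) (g b)"
    by (rule *) (simp_all add: fs gs CD.t_add_left CD.t_add_right f(2) g(2) CD.t_balanced)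
qed

lemma ring_hom_on_tensor:
  assumes S: "cring S" and h: "h \<in> hom (add_monoid T) (add_monoid S)"
    and one: "h \<one>\<^bsub>T\<^esub> = \<one>\<^bsub>S\<^esub>"
    and mult: "\<And>a b a' b'. a \<in> carrier A \<Longrightarrow> b \<in> carrier B \<Longrightarrow> a' \<in> carrier A \<Longrightarrow> b' \<in> carrier B \<Longrightarrow>
      h (t (a \<otimes>\<^bsub>A\<^esub> a') (b \<otimes>\<^bsub>B\<^esub> b')) = h (t a b) \<otimes>\<^bsub>S\<^esub> h (t a' b')"
  shows "h \<in> ring_hom T S"
proof -
  interpret S: cring S by fact
  note hs = add_monoid_hom_simps[OF T.abelian_group_axioms S.abelian_group_axioms h]
  have "h (x \<otimes>\<^bsub>T\<^esub> y) = h x \<otimes>\<^bsub>S\<^esub> h y" if x: "x \<in> carrier T" and y: "y \<in> carrier T" for x y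
    using x
  proof (induction rule: tensor_induct)
    case (pure a b)
    show ?case using y
    proof (induction rule: tensor_induct)
      case (pure a' b')
      then show ?case using \<open>a \<in> _\<close> \<open>b \<in> _\<close> by (simp add: t_mult mult)
    next
      case (add u v)
      then show ?case using pure by (simp add: T.r_distr hs S.r_distr)
    qed
  next
    case (add u v)
    then show ?case using y by (simp add: T.l_distr hs S.l_distr)
  qed
  then show ?thesis
    by (intro ring_hom_memI) (use hs one in auto)
qed

lemma tensor_map_ring_hom:
  assumes CD: "tensor_product K C D"
    and f: "f \<in> ring_hom A C"
      "\<And>c a. c \<in> carrier K \<Longrightarrow> a \<in> carrier A \<Longrightarrow> f (c \<odot>\<^bsub>A\<^esub> a) = c \<odot>\<^bsub>C\<^esub> f a"
    and g: "g \<in> ring_hom B D"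
      "\<And>c a. c \<in> carrier K \<Longrightarrow> a \<in> carrier B \<Longrightarrow> g (c \<odot>\<^bsub>B\<^esub> a) = c \<odot>\<^bsub>D\<^esub> g a"
  shows "tensor_map K C D f g \<in> ring_hom T (tensor K C D)"
    and "a \<in> carrier A \<Longrightarrow> b \<in> carrier B \<Longrightarrow> tensor_map K C D f g (t a b) = tensor_product.t K C D (f a) (g b)"
proof -
  interpret CD: tensor_product K C D by fact
  have f': "f \<in> hom (add_monoid A) (add_monoid C)" and g': "g \<in> hom (add_monoid B) (add_monoid D)"
    using f(1) g(1) by (auto simp: ring_hom_def hom_def)
  note * = tensor_map_hom[OF CD f' f(2) g' g(2)]
  show tm: "a \<in> carrier A \<Longrightarrow> b \<in> carrier B \<Longrightarrow> tensor_map K C D f g (t a b) = CD.t (f a) (g b)" for a b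
    by (rule *)
  show "tensor_map K C D f g \<in> ring_hom T (tensor K C D)"
    by (rule ring_hom_on_tensor[OF CD.T.is_cring *(1)])
       (use ring_hom_closed[OF f(1)] ring_hom_closed[OF g(1)] ring_hom_mult[OF f(1)] ring_hom_mult[OF g(1)]
          ring_hom_one[OF f(1)] ring_hom_one[OF g(1)]
        in \<open>auto simp: t_one CD.t_one tm CD.t_mult\<close>)
qed

end

lemma finite_splittings [simp]: "finite (splittings (k :: 'i::finite multiindex))"
proof -
  have "finite (PiE UNIV (\<lambda>\<mu>. {..k \<mu>}))" by (intro finite_PiE) auto
  then have fin: "finite {i. \<forall>\<mu>. i \<mu> \<le> k \<mu>}" by (rule rev_finite_subset) auto
  have "splittings k \<subseteq> {i. \<forall>\<mu>. i \<mu> \<le> k \<mu>} \<times> {i. \<forall>\<mu>. i \<mu> \<le> k \<mu>}"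
    by (auto simp: splittings_def)
  then show ?thesis using fin by (meson finite_SigmaI finite_subset)
qed

lemma (in tensor_product) sum_in_I:
  assumes "finite U" "\<And>z. z \<in> U \<Longrightarrow> f z \<in> I"
  shows "sum f U \<in> I"
  using assms
proof (induction rule: finite_induct)
  case empty then show ?case using I.zero_closed by simp
next
  case (insert z U)
  then have "f z \<oplus>\<^bsub>P\<^esub> sum f U \<in> I" by (intro I.a_closed) auto
  then show ?case using insert by simp
qed

text \<open>With the trivial derivation on \<open>B\<close> only the splitting \<open>(k, 0)\<close>
  contributes. Every other summand has a zero in its second slot and so lies in the tensor
  ideal.\<close>

lemma (in tensor_product) tensor_ID_const:
  fixes \<theta> :: "'a \<Rightarrow> 'i::finite multiindex \<Rightarrow> 'a"
  assumes cl: "\<And>a k. a \<in> carrier A \<Longrightarrow> \<theta> a k \<in> carrier A"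
    and add: "\<And>a a' k. a \<in> carrier A \<Longrightarrow> a' \<in> carrier A \<Longrightarrow> \<theta> (a \<oplus>\<^bsub>A\<^esub> a') k = \<theta> a k \<oplus>\<^bsub>A\<^esub> \<theta> a' k"
    and smult: "\<And>c a k. c \<in> carrier K \<Longrightarrow> a \<in> carrier A \<Longrightarrow> \<theta> (c \<odot>\<^bsub>A\<^esub> a) k = c \<odot>\<^bsub>A\<^esub> \<theta> a k"
  shows "(\<lambda>x. tensor_ID K A \<theta> B (mps_const B) x k) \<in> hom (add_monoid T) (add_monoid T)"
    and "a \<in> carrier A \<Longrightarrow> b \<in> carrier B \<Longrightarrow> tensor_ID K A \<theta> B (mps_const B) (t a b) k = t (\<theta> a k) b"
proof -
  define h where "h = (\<lambda>a b. \<Sum>(i, j)\<in>splittings k. frag_of (\<theta> a i, mps_const B b j))"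
  have h: "h a b \<in> carrier P \<and> cls (h a b) = t (\<theta> a k) b" if ab: "a \<in> carrier A" "b \<in> carrier B" for a b
  proof -
    have mem: "(k, 0) \<in> splittings k" by (auto simp: splittings_def)
    let ?rest = "\<Sum>(i, j)\<in>splittings k - {(k, 0)}. frag_of (\<theta> a i, mps_const B b j)"
    have eq: "h a b = frag_of (\<theta> a k, b) + ?rest"
      using sum.remove[OF finite_splittings mem, of "\<lambda>(i, j). frag_of (\<theta> a i, mps_const B b j)"]
      by (simp add: mps_const_def h_def)
    have I0: "frag_of (\<theta> a i, \<zero>\<^bsub>B\<^esub>) \<in> I" for i
      using cls_zero_iff[of "frag_of (\<theta> a i, \<zero>\<^bsub>B\<^esub>)"] t_zero_right[OF cl[OF ab(1), of i]] cl[OF ab(1)]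
      by (simp add: t_def)
    have nz: "snd z \<noteq> 0" if "z \<in> splittings k - {(k, 0)}" for z
      using that by (cases z) (auto simp: splittings_def)
    have rI: "?rest \<in> I"
      by (rule sum_in_I) (use nz I0 in \<open>auto simp: case_prod_unfold mps_const_def\<close>)
    then have rP: "?rest \<in> carrier P" using I.a_subset by blast
    have fP: "frag_of (\<theta> a k, b) \<in> carrier P" using cl ab by simp
    show ?thesis unfolding eq using P.a_closed[OF fP rP] cls_zero_iff[OF rP] rI cls_add[OF fP rP] cls_closed[OF fP]
      by (simp add: t_def)
  qed
  note * = tensor_lift_hom[OF tensor_product_axioms, of h]
  have eq: "tensor_ID K A \<theta> B (mps_const B) x k = tensor_lift K A B h x" for x
    by (simp add: tensor_ID_def h_def)
  show "(\<lambda>x. tensor_ID K A \<theta> B (mps_const B) x k) \<in> hom (add_monoid T) (add_monoid T)"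
    unfolding eq eta_contract_eq
    by (rule *) (use h in \<open>simp_all add: add t_add_left t_add_right cl smult t_balanced del: pair_ring_simps\<close>)
  show "a \<in> carrier A \<Longrightarrow> b \<in> carrier B \<Longrightarrow> tensor_ID K A \<theta> B (mps_const B) (t a b) k = t (\<theta> a k) b"
    unfolding eq
    by (subst *(2)) (use h in \<open>simp_all add: add t_add_left t_add_right cl smult t_balanced del: pair_ring_simps\<close>)
qed

section \<open>Vector spaces\<close>

locale vspace = K: field K + M: module K M
  for K :: "('k, 'x) ring_scheme" and M :: "('k, 'm, 'y) module_scheme"

text \<open>Meant for finite \<open>V\<close>; over an infinite set \<open>finsum\<close> is zero by
  convention.\<close>

definition lin_indep :: "('k, 'x) ring_scheme \<Rightarrow> ('k, 'm, 'y) module_scheme \<Rightarrow> 'm set \<Rightarrow> bool" where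
  "lin_indep K M V \<longleftrightarrow> (\<forall>c \<in> V \<rightarrow> carrier K.
     (\<Oplus>\<^bsub>M\<^esub>v\<in>V. c v \<odot>\<^bsub>M\<^esub> v) = \<zero>\<^bsub>M\<^esub> \<longrightarrow> (\<forall>v\<in>V. c v = \<zero>\<^bsub>K\<^esub>))"

context vspace
begin

lemma smult_inverse_cancel:
  "k \<in> carrier K \<Longrightarrow> k \<noteq> \<zero>\<^bsub>K\<^esub> \<Longrightarrow> x \<in> carrier M \<Longrightarrow> inv\<^bsub>K\<^esub> k \<odot>\<^bsub>M\<^esub> (k \<odot>\<^bsub>M\<^esub> x) = x"
  by (simp add: M.smult_assoc1[symmetric] K.field_Units)

lemma finsum_remove:
  assumes "finite V" "w \<in> V" "f \<in> V \<rightarrow> carrier M"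
  shows "finsum M f V = f w \<oplus>\<^bsub>M\<^esub> finsum M f (V - {w})"
  using assms M.finsum_insert[of "V - {w}" w f] by (auto simp: insert_absorb)

text \<open>A dependence expresses some vector \<open>w\<close> through the others, balancedness
  moves the scalars into the other slot, and the summand at \<open>w\<close> is absorbed by the
  rest. Leaving \<open>b\<close> abstract makes the statement usable for the left and for the right
  factor of a tensor product.\<close>

lemma balanced_sum_indep:
  assumes N: "module K N" and G: "abelian_group G"
    and cl: "\<And>n m. n \<in> carrier N \<Longrightarrow> m \<in> carrier M \<Longrightarrow> b n m \<in> carrier G"
    and l: "\<And>n n' m. n \<in> carrier N \<Longrightarrow> n' \<in> carrier N \<Longrightarrow> m \<in> carrier M \<Longrightarrow> b (n \<oplus>\<^bsub>N\<^esub> n') m = b n m \<oplus>\<^bsub>G\<^esub> b n' m"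
    and r: "\<And>n m m'. n \<in> carrier N \<Longrightarrow> m \<in> carrier M \<Longrightarrow> m' \<in> carrier M \<Longrightarrow> b n (m \<oplus>\<^bsub>M\<^esub> m') = b n m \<oplus>\<^bsub>G\<^esub> b n m'"
    and bal: "\<And>c n m. c \<in> carrier K \<Longrightarrow> n \<in> carrier N \<Longrightarrow> m \<in> carrier M \<Longrightarrow> b (c \<odot>\<^bsub>N\<^esub> n) m = b n (c \<odot>\<^bsub>M\<^esub> m)"
    and V: "finite V" "V \<subseteq> carrier M" "a \<in> V \<rightarrow> carrier N"
  shows "\<exists>W a'. W \<subseteq> V \<and> lin_indep K M W \<and> a' \<in> W \<rightarrow> carrier N \<and>
    (\<Oplus>\<^bsub>G\<^esub>v\<in>V. b (a v) v) = (\<Oplus>\<^bsub>G\<^esub>v\<in>W. b (a' v) v)"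
  using V
proof (induction "card V" arbitrary: V a rule: less_induct)
  case less
  interpret N: module K N by fact
  interpret G: abelian_group G by fact
  show ?case
  proof (cases "lin_indep K M V")
    case True
    then show ?thesis using less.prems by blast
  next
    case False
    then obtain c w where c: "c \<in> V \<rightarrow> carrier K" "(\<Oplus>\<^bsub>M\<^esub>v\<in>V. c v \<odot>\<^bsub>M\<^esub> v) = \<zero>\<^bsub>M\<^esub>" and w: "w \<in> V" "c w \<noteq> \<zero>\<^bsub>K\<^esub>"
      by (auto simp: lin_indep_def)
    let ?U = "V - {w}"
    have VM: "\<And>v. v \<in> V \<Longrightarrow> v \<in> carrier M" and cK: "\<And>v. v \<in> V \<Longrightarrow> c v \<in> carrier K"
      and aN: "\<And>v. v \<in> V \<Longrightarrow> a v \<in> carrier N"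
      using less.prems c by auto
    have finU: "finite ?U" using less.prems by simp
    have iK: "inv\<^bsub>K\<^esub> (c w) \<in> carrier K" using w cK by (simp add: K.field_Units)
    \<comment> \<open>The coefficients of \<open>w\<close> in terms of the other vectors: the given
      relation divided by \<open>-c w\<close>.\<close>
    define d where "d v = \<ominus>\<^bsub>K\<^esub> (inv\<^bsub>K\<^esub> (c w) \<otimes>\<^bsub>K\<^esub> c v)" for v
    have dK: "\<And>v. v \<in> V \<Longrightarrow> d v \<in> carrier K" using iK cK by (simp add: d_def)
    let ?S = "\<Oplus>\<^bsub>M\<^esub>v\<in>?U. d v \<odot>\<^bsub>M\<^esub> v"
    have SM: "?S \<in> carrier M" using VM dK by (intro M.finsum_closed) auto
    have "\<zero>\<^bsub>M\<^esub> = inv\<^bsub>K\<^esub> (c w) \<odot>\<^bsub>M\<^esub> (c w \<odot>\<^bsub>M\<^esub> w \<oplus>\<^bsub>M\<^esub> (\<Oplus>\<^bsub>M\<^esub>v\<in>?U. c v \<odot>\<^bsub>M\<^esub> v))"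
      using finsum_remove[of V w "\<lambda>v. c v \<odot>\<^bsub>M\<^esub> v", symmetric] less.prems w VM cK c(2) iK by (simp add: Pi_iff)
    also have "\<dots> = w \<oplus>\<^bsub>M\<^esub> (\<Oplus>\<^bsub>M\<^esub>v\<in>?U. inv\<^bsub>K\<^esub> (c w) \<odot>\<^bsub>M\<^esub> (c v \<odot>\<^bsub>M\<^esub> v))"
      using iK w VM cK finU
      by (simp add: M.smult_r_distr smult_inverse_cancel M.finsum_smult_ldistr)
    also have "(\<Oplus>\<^bsub>M\<^esub>v\<in>?U. inv\<^bsub>K\<^esub> (c w) \<odot>\<^bsub>M\<^esub> (c v \<odot>\<^bsub>M\<^esub> v)) = (\<Oplus>\<^bsub>M\<^esub>v\<in>?U. (\<ominus>\<^bsub>K\<^esub> \<one>\<^bsub>K\<^esub>) \<odot>\<^bsub>M\<^esub> (d v \<odot>\<^bsub>M\<^esub> v))"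
      using VM cK iK
      by (intro M.finsum_cong') (auto simp: d_def M.smult_l_minus M.smult_assoc1 K.l_minus)
    also have "\<dots> = \<ominus>\<^bsub>M\<^esub> ?S"
      using VM dK finU SM by (simp add: M.finsum_smult_ldistr[symmetric] M.smult_l_minus)
    finally have "w \<ominus>\<^bsub>M\<^esub> ?S = \<zero>\<^bsub>M\<^esub>" by (simp add: a_minus_def)
    then have weq: "w = ?S" using M.minus_zero_imp_eq[OF VM[OF w(1)] SM] by simp
    have bh: "b n \<in> hom (add_monoid M) (add_monoid G)" if "n \<in> carrier N" for n
      by (rule homI) (use that cl r in auto)
    have "b (a w) w = b (a w) (\<Oplus>\<^bsub>M\<^esub>v\<in>?U. d v \<odot>\<^bsub>M\<^esub> v)" using weq by simp
    also have "\<dots> = (\<Oplus>\<^bsub>G\<^esub>v\<in>?U. b (a w) (d v \<odot>\<^bsub>M\<^esub> v))"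
      using VM dK aN w by (intro add_monoid_hom_finsum[OF M.abelian_group_axioms G bh]) auto
    also have "\<dots> = (\<Oplus>\<^bsub>G\<^esub>v\<in>?U. b (d v \<odot>\<^bsub>N\<^esub> a w) v)"
      using VM dK aN w by (intro G.finsum_cong') (auto simp: bal cl)
    finally have bw: "b (a w) w = (\<Oplus>\<^bsub>G\<^esub>v\<in>?U. b (d v \<odot>\<^bsub>N\<^esub> a w) v)" .
    have "(\<Oplus>\<^bsub>G\<^esub>v\<in>V. b (a v) v) = b (a w) w \<oplus>\<^bsub>G\<^esub> (\<Oplus>\<^bsub>G\<^esub>v\<in>?U. b (a v) v)"
      using G.finsum_insert[of ?U w "\<lambda>v. b (a v) v"] finU w VM aN cl by (auto simp: insert_absorb)
    also have "\<dots> = (\<Oplus>\<^bsub>G\<^esub>v\<in>?U. b (d v \<odot>\<^bsub>N\<^esub> a w) v \<oplus>\<^bsub>G\<^esub> b (a v) v)"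
      unfolding bw using VM aN cl dK w by (intro G.finsum_addf[symmetric]) auto
    also have "\<dots> = (\<Oplus>\<^bsub>G\<^esub>v\<in>?U. b (d v \<odot>\<^bsub>N\<^esub> a w \<oplus>\<^bsub>N\<^esub> a v) v)"
      using VM aN cl dK w by (intro G.finsum_cong') (auto simp: l)
    finally have tot: "(\<Oplus>\<^bsub>G\<^esub>v\<in>V. b (a v) v) = (\<Oplus>\<^bsub>G\<^esub>v\<in>?U. b (d v \<odot>\<^bsub>N\<^esub> a w \<oplus>\<^bsub>N\<^esub> a v) v)" .
    have "card ?U < card V" using w less.prems by (intro psubset_card_mono) auto
    from less.hyps[OF this finU, of "\<lambda>v. d v \<odot>\<^bsub>N\<^esub> a w \<oplus>\<^bsub>N\<^esub> a v"] tot show ?thesis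
      using VM aN dK w by (auto simp: Pi_iff) blast
  qed
qed

text \<open>The space may be infinite-dimensional, so the functional comes from Zorn's lemma: a
  subspace maximal among those that contain the other vectors of \<open>V\<close> and avoid
  \<open>w\<close> is a complement of the line through \<open>w\<close>, and \<open>\<phi>\<close>
  is the projection onto that line.\<close>

lemma exists_coordinate:
  assumes V: "finite V" "V \<subseteq> carrier M" "lin_indep K M V" and w: "w \<in> V"
  obtains \<phi> where "\<phi> \<in> carrier M \<rightarrow> carrier K"
    "\<And>x y. x \<in> carrier M \<Longrightarrow> y \<in> carrier M \<Longrightarrow> \<phi> (x \<oplus>\<^bsub>M\<^esub> y) = \<phi> x \<oplus>\<^bsub>K\<^esub> \<phi> y"
    "\<And>c x. c \<in> carrier K \<Longrightarrow> x \<in> carrier M \<Longrightarrow> \<phi> (c \<odot>\<^bsub>M\<^esub> x) = c \<otimes>\<^bsub>K\<^esub> \<phi> x"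
    "\<phi> w = \<one>\<^bsub>K\<^esub>" "\<And>v. v \<in> V \<Longrightarrow> v \<noteq> w \<Longrightarrow> \<phi> v = \<zero>\<^bsub>K\<^esub>"
proof -
  let ?U = "V - {w}"
  have VM: "\<And>v. v \<in> V \<Longrightarrow> v \<in> carrier M" using V by auto
  have wM: "w \<in> carrier M" using w VM by simp
  define sub where "sub W \<longleftrightarrow> W \<subseteq> carrier M \<and> \<zero>\<^bsub>M\<^esub> \<in> W \<and> (\<forall>x\<in>W. \<forall>y\<in>W. x \<oplus>\<^bsub>M\<^esub> y \<in> W) \<and>
    (\<forall>c\<in>carrier K. \<forall>x\<in>W. c \<odot>\<^bsub>M\<^esub> x \<in> W)" for W
  let ?A = "{W. sub W \<and> ?U \<subseteq> W \<and> w \<notin> W}"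
  define S where "S = {(\<Oplus>\<^bsub>M\<^esub>v\<in>?U. c v \<odot>\<^bsub>M\<^esub> v) | c. c \<in> ?U \<rightarrow> carrier K}"
  have subS: "sub S" unfolding sub_def
  proof (intro conjI ballI)
    show "S \<subseteq> carrier M" unfolding S_def using VM by (auto intro!: M.finsum_closed)
    have "(\<Oplus>\<^bsub>M\<^esub>v\<in>?U. \<zero>\<^bsub>K\<^esub> \<odot>\<^bsub>M\<^esub> v) = \<zero>\<^bsub>M\<^esub>"
      by (rule M.add.finprod_one_eqI) (use VM in simp)
    then show "\<zero>\<^bsub>M\<^esub> \<in> S" unfolding S_def by (force intro!: exI[of _ "\<lambda>_. \<zero>\<^bsub>K\<^esub>"])
  next
    fix x y assume "x \<in> S" "y \<in> S"
    then obtain c d where cd: "c \<in> ?U \<rightarrow> carrier K" "d \<in> ?U \<rightarrow> carrier K"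
      "x = (\<Oplus>\<^bsub>M\<^esub>v\<in>?U. c v \<odot>\<^bsub>M\<^esub> v)" "y = (\<Oplus>\<^bsub>M\<^esub>v\<in>?U. d v \<odot>\<^bsub>M\<^esub> v)" by (auto simp: S_def)
    have "x \<oplus>\<^bsub>M\<^esub> y = (\<Oplus>\<^bsub>M\<^esub>v\<in>?U. c v \<odot>\<^bsub>M\<^esub> v \<oplus>\<^bsub>M\<^esub> d v \<odot>\<^bsub>M\<^esub> v)"
      unfolding cd(3,4) by (rule M.finsum_addf[symmetric]) (use cd VM in auto)
    also have "\<dots> = (\<Oplus>\<^bsub>M\<^esub>v\<in>?U. (c v \<oplus>\<^bsub>K\<^esub> d v) \<odot>\<^bsub>M\<^esub> v)"
      by (rule M.finsum_cong') (use cd VM in \<open>auto simp: M.smult_l_distr Pi_iff\<close>)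
    finally show "x \<oplus>\<^bsub>M\<^esub> y \<in> S" using cd unfolding S_def
      by (auto intro!: exI[of _ "\<lambda>v. c v \<oplus>\<^bsub>K\<^esub> d v"])
  next
    fix k x assume k: "k \<in> carrier K" and "x \<in> S"
    then obtain c where c: "c \<in> ?U \<rightarrow> carrier K" "x = (\<Oplus>\<^bsub>M\<^esub>v\<in>?U. c v \<odot>\<^bsub>M\<^esub> v)" by (auto simp: S_def)
    have "k \<odot>\<^bsub>M\<^esub> x = (\<Oplus>\<^bsub>M\<^esub>v\<in>?U. k \<odot>\<^bsub>M\<^esub> (c v \<odot>\<^bsub>M\<^esub> v))"
      unfolding c(2) by (rule M.finsum_smult_ldistr) (use c k VM V in auto)
    also have "\<dots> = (\<Oplus>\<^bsub>M\<^esub>v\<in>?U. (k \<otimes>\<^bsub>K\<^esub> c v) \<odot>\<^bsub>M\<^esub> v)"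
      by (rule M.finsum_cong') (use c k VM in \<open>auto simp: M.smult_assoc1 Pi_iff\<close>)
    finally show "k \<odot>\<^bsub>M\<^esub> x \<in> S" using c k unfolding S_def
      by (auto intro!: exI[of _ "\<lambda>v. k \<otimes>\<^bsub>K\<^esub> c v"])
  qed
  have US: "?U \<subseteq> S"
  proof
    fix u assume u: "u \<in> ?U"
    have "(\<Oplus>\<^bsub>M\<^esub>v\<in>?U. (if v = u then \<one>\<^bsub>K\<^esub> else \<zero>\<^bsub>K\<^esub>) \<odot>\<^bsub>M\<^esub> v) = (\<Oplus>\<^bsub>M\<^esub>v\<in>?U. if u = v then v else \<zero>\<^bsub>M\<^esub>)"
      by (rule M.finsum_cong') (use VM in auto)
    also have "\<dots> = u" using M.finsum_singleton[OF u, of "\<lambda>v. v"] V VM by auto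
    finally show "u \<in> S" unfolding S_def
      by (intro CollectI exI[of _ "\<lambda>v. if v = u then \<one>\<^bsub>K\<^esub> else \<zero>\<^bsub>K\<^esub>"]) auto
  qed
  have wS: "w \<notin> S"
  proof
    assume "w \<in> S"
    then obtain c where c: "c \<in> ?U \<rightarrow> carrier K" "w = (\<Oplus>\<^bsub>M\<^esub>v\<in>?U. c v \<odot>\<^bsub>M\<^esub> v)" by (auto simp: S_def)
    let ?c = "\<lambda>v. if v = w then \<ominus>\<^bsub>K\<^esub> \<one>\<^bsub>K\<^esub> else c v"
    have "(\<Oplus>\<^bsub>M\<^esub>v\<in>V. ?c v \<odot>\<^bsub>M\<^esub> v) = ?c w \<odot>\<^bsub>M\<^esub> w \<oplus>\<^bsub>M\<^esub> (\<Oplus>\<^bsub>M\<^esub>v\<in>?U. ?c v \<odot>\<^bsub>M\<^esub> v)"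
      using V w VM c by (intro finsum_remove) (auto simp: Pi_iff)
    also have "(\<Oplus>\<^bsub>M\<^esub>v\<in>?U. ?c v \<odot>\<^bsub>M\<^esub> v) = (\<Oplus>\<^bsub>M\<^esub>v\<in>?U. c v \<odot>\<^bsub>M\<^esub> v)"
      by (rule M.finsum_cong') (use VM c in auto)
    also have "\<dots> = w" using c by simp
    also have "?c w \<odot>\<^bsub>M\<^esub> w \<oplus>\<^bsub>M\<^esub> w = \<zero>\<^bsub>M\<^esub>" using wM by (simp add: M.smult_l_minus M.l_neg)
    finally have "(\<Oplus>\<^bsub>M\<^esub>v\<in>V. ?c v \<odot>\<^bsub>M\<^esub> v) = \<zero>\<^bsub>M\<^esub>" .
    moreover have "?c \<in> V \<rightarrow> carrier K" using c by (auto simp: Pi_iff)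
    ultimately have "\<forall>v\<in>V. ?c v = \<zero>\<^bsub>K\<^esub>" using V(3) unfolding lin_indep_def by (elim ballE[of _ _ ?c]) auto
    then have "?c w = \<zero>\<^bsub>K\<^esub>" using w by (rule bspec)
    then show False using K.one_not_zero K.add.inv_eq_1_iff[of "\<one>\<^bsub>K\<^esub>"] by simp
  qed
  have "\<exists>W\<in>?A. \<forall>X'\<in>?A. W \<subseteq> X' \<longrightarrow> X' = W"
  proof (rule subset_Zorn_nonempty)
    show "?A \<noteq> {}" using subS US wS by blast
  next
    fix \<C> assume C: "\<C> \<noteq> {}" "subset.chain ?A \<C>"
    have ch: "\<And>W1 W2. W1 \<in> \<C> \<Longrightarrow> W2 \<in> \<C> \<Longrightarrow> W1 \<subseteq> W2 \<or> W2 \<subseteq> W1" and CA: "\<C> \<subseteq> ?A"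
      using C(2) by (auto simp: subset_chain_def)
    have "sub (\<Union>\<C>)" unfolding sub_def
    proof (intro conjI ballI)
      show "\<Union>\<C> \<subseteq> carrier M" "\<zero>\<^bsub>M\<^esub> \<in> \<Union>\<C>" using CA C(1) by (auto simp: sub_def)
      fix x y assume "x \<in> \<Union>\<C>" "y \<in> \<Union>\<C>"
      then obtain W1 W2 where "W1 \<in> \<C>" "W2 \<in> \<C>" "x \<in> W1" "y \<in> W2" by auto
      then obtain W3 where "W3 \<in> \<C>" "x \<in> W3" "y \<in> W3" using ch by blast
      moreover from this have "sub W3" using CA by auto
      ultimately show "x \<oplus>\<^bsub>M\<^esub> y \<in> \<Union>\<C>" unfolding sub_def by (intro UnionI[of W3]) simp_all
    next
      fix c x assume "c \<in> carrier K" "x \<in> \<Union>\<C>"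
      then obtain W1 where "c \<in> carrier K" "W1 \<in> \<C>" "x \<in> W1" by auto
      moreover from this have "sub W1" using CA by auto
      ultimately show "c \<odot>\<^bsub>M\<^esub> x \<in> \<Union>\<C>" unfolding sub_def by (intro UnionI[of W1]) simp_all
    qed
    moreover have "?U \<subseteq> \<Union>\<C>" "w \<notin> \<Union>\<C>" using CA C(1) by auto
    ultimately show "\<Union>\<C> \<in> ?A" by simp
  qed
  then obtain W where "W \<in> ?A" and max: "\<forall>X'\<in>?A. W \<subseteq> X' \<longrightarrow> X' = W" by (elim bexE)
  then have W: "sub W" "?U \<subseteq> W" "w \<notin> W" by simp_all
  have Wc: "\<And>x. x \<in> W \<Longrightarrow> x \<in> carrier M" "\<zero>\<^bsub>M\<^esub> \<in> W" "\<And>x y. x \<in> W \<Longrightarrow> y \<in> W \<Longrightarrow> x \<oplus>\<^bsub>M\<^esub> y \<in> W"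
    "\<And>c x. c \<in> carrier K \<Longrightarrow> x \<in> W \<Longrightarrow> c \<odot>\<^bsub>M\<^esub> x \<in> W"
    using W(1) by (auto simp: sub_def)
  have Wm: "\<ominus>\<^bsub>M\<^esub> x \<in> W" if "x \<in> W" for x
    using Wc(4)[of "\<ominus>\<^bsub>K\<^esub> \<one>\<^bsub>K\<^esub>" x] Wc(1)[OF that] that by (simp add: M.smult_l_minus)
  \<comment> \<open>Otherwise adjoining \<open>x\<close> to \<open>W\<close> still keeps
    \<open>w\<close> out, since \<open>w = y + k x\<close> has \<open>k\<close> nonzero and could be
    solved for \<open>x\<close>. Maximality then puts \<open>x\<close> into \<open>W\<close>, where
    it has the required form with coefficient zero.\<close>
  have ex: "\<exists>k\<in>carrier K. \<exists>y\<in>W. x = y \<oplus>\<^bsub>M\<^esub> k \<odot>\<^bsub>M\<^esub> w" if x: "x \<in> carrier M" for x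
  proof (rule ccontr)
    assume no: "\<not> ?thesis"
    let ?W = "{y \<oplus>\<^bsub>M\<^esub> k \<odot>\<^bsub>M\<^esub> x | y k. y \<in> W \<and> k \<in> carrier K}"
    have "sub ?W" unfolding sub_def
    proof (intro conjI ballI)
      show "?W \<subseteq> carrier M" using Wc x by auto
      show "\<zero>\<^bsub>M\<^esub> \<in> ?W" using Wc(2) x by (intro CollectI exI[of _ "\<zero>\<^bsub>M\<^esub>"] exI[of _ "\<zero>\<^bsub>K\<^esub>"]) simp
    next
      fix u v assume "u \<in> ?W" "v \<in> ?W"
      then obtain y k y' k' where *: "y \<in> W" "y' \<in> W" "k \<in> carrier K" "k' \<in> carrier K"
        "u = y \<oplus>\<^bsub>M\<^esub> k \<odot>\<^bsub>M\<^esub> x" "v = y' \<oplus>\<^bsub>M\<^esub> k' \<odot>\<^bsub>M\<^esub> x" by auto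
      then have "u \<oplus>\<^bsub>M\<^esub> v = (y \<oplus>\<^bsub>M\<^esub> y') \<oplus>\<^bsub>M\<^esub> (k \<oplus>\<^bsub>K\<^esub> k') \<odot>\<^bsub>M\<^esub> x"
        using Wc(1) x by (simp add: M.smult_l_distr M.a_ac)
      then show "u \<oplus>\<^bsub>M\<^esub> v \<in> ?W" using * Wc(3)[of y y'] by (intro CollectI exI[of _ "y \<oplus>\<^bsub>M\<^esub> y'"] exI[of _ "k \<oplus>\<^bsub>K\<^esub> k'"]) simp
    next
      fix c u assume "c \<in> carrier K" "u \<in> ?W"
      then obtain y k where *: "c \<in> carrier K" "y \<in> W" "k \<in> carrier K" "u = y \<oplus>\<^bsub>M\<^esub> k \<odot>\<^bsub>M\<^esub> x" by auto
      then have "c \<odot>\<^bsub>M\<^esub> u = c \<odot>\<^bsub>M\<^esub> y \<oplus>\<^bsub>M\<^esub> (c \<otimes>\<^bsub>K\<^esub> k) \<odot>\<^bsub>M\<^esub> x"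
        using Wc(1) x by (simp add: M.smult_r_distr M.smult_assoc1)
      then show "c \<odot>\<^bsub>M\<^esub> u \<in> ?W" using * Wc(4)[of c y] by (intro CollectI exI[of _ "c \<odot>\<^bsub>M\<^esub> y"] exI[of _ "c \<otimes>\<^bsub>K\<^esub> k"]) simp
    qed
    moreover have WW: "W \<subseteq> ?W"
    proof
      fix y assume "y \<in> W"
      then show "y \<in> ?W" using Wc(1) x by (intro CollectI exI[of _ y] exI[of _ "\<zero>\<^bsub>K\<^esub>"]) simp
    qed
    moreover have "w \<notin> ?W"
    proof
      assume "w \<in> ?W"
      then obtain y k where *: "y \<in> W" "k \<in> carrier K" "w = y \<oplus>\<^bsub>M\<^esub> k \<odot>\<^bsub>M\<^esub> x" by auto
      have k0: "k \<noteq> \<zero>\<^bsub>K\<^esub>" using * W(3) Wc(1) x by auto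
      let ?i = "inv\<^bsub>K\<^esub> k"
      have i: "?i \<in> carrier K" using * k0 by (simp add: K.field_Units)
      have "?i \<odot>\<^bsub>M\<^esub> w = ?i \<odot>\<^bsub>M\<^esub> (y \<oplus>\<^bsub>M\<^esub> k \<odot>\<^bsub>M\<^esub> x)" using *(3) by simp
      also have "\<dots> = ?i \<odot>\<^bsub>M\<^esub> y \<oplus>\<^bsub>M\<^esub> x"
        using * i k0 Wc(1) x by (simp add: M.smult_r_distr smult_inverse_cancel)
      finally have "x = \<ominus>\<^bsub>M\<^esub> (?i \<odot>\<^bsub>M\<^esub> y) \<oplus>\<^bsub>M\<^esub> ?i \<odot>\<^bsub>M\<^esub> w"
        using i Wc(1)[OF *(1)] x by (simp add: M.a_assoc[symmetric] M.l_neg)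
      then show False using no i Wm[OF Wc(4)[OF i *(1)]] by blast
    qed
    moreover have "?U \<subseteq> ?W" using WW W(2) by blast
    ultimately have "?W = W" using max by (elim ballE[of _ _ ?W]) simp_all
    moreover have "x \<in> ?W" using Wc(2) x by (intro CollectI exI[of _ "\<zero>\<^bsub>M\<^esub>"] exI[of _ "\<one>\<^bsub>K\<^esub>"]) simp
    ultimately have "x \<in> W" by simp
    then have "x = x \<oplus>\<^bsub>M\<^esub> \<zero>\<^bsub>K\<^esub> \<odot>\<^bsub>M\<^esub> w" using wM x by simp
    then show False using no \<open>x \<in> W\<close> K.zero_closed by blast
  qed
  have uniq: "k = k'" if "k \<in> carrier K" "k' \<in> carrier K" "y \<in> W" "y' \<in> W"
      "y \<oplus>\<^bsub>M\<^esub> k \<odot>\<^bsub>M\<^esub> w = y' \<oplus>\<^bsub>M\<^esub> k' \<odot>\<^bsub>M\<^esub> w" for k k' y y'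
  proof (rule ccontr)
    assume ne: "k \<noteq> k'"
    let ?d = "k \<ominus>\<^bsub>K\<^esub> k'"
    have d: "?d \<in> carrier K" "?d \<noteq> \<zero>\<^bsub>K\<^esub>" using that ne by auto
    note yM = Wc(1)[OF that(3)] Wc(1)[OF that(4)]
    have "?d \<odot>\<^bsub>M\<^esub> w = k \<odot>\<^bsub>M\<^esub> w \<oplus>\<^bsub>M\<^esub> \<ominus>\<^bsub>M\<^esub> (k' \<odot>\<^bsub>M\<^esub> w)"
      using that wM by (simp add: a_minus_def M.smult_l_distr M.smult_l_minus)
    also have "k \<odot>\<^bsub>M\<^esub> w = \<ominus>\<^bsub>M\<^esub> y \<oplus>\<^bsub>M\<^esub> (y' \<oplus>\<^bsub>M\<^esub> k' \<odot>\<^bsub>M\<^esub> w)"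
      unfolding that(5)[symmetric] using yM that(1) wM by (simp add: M.a_assoc[symmetric] M.l_neg)
    also have "\<dots> \<oplus>\<^bsub>M\<^esub> \<ominus>\<^bsub>M\<^esub> (k' \<odot>\<^bsub>M\<^esub> w) = \<ominus>\<^bsub>M\<^esub> y \<oplus>\<^bsub>M\<^esub> y'"
      using yM that wM by (simp add: M.a_assoc M.r_neg)
    finally have "?d \<odot>\<^bsub>M\<^esub> w \<in> W" using Wc(3)[OF Wm[OF that(3)] that(4)] by simp
    then have "inv\<^bsub>K\<^esub> ?d \<odot>\<^bsub>M\<^esub> (?d \<odot>\<^bsub>M\<^esub> w) \<in> W" using d by (intro Wc(4)[of "inv\<^bsub>K\<^esub> ?d" "?d \<odot>\<^bsub>M\<^esub> w"]) (simp_all add: K.field_Units)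
    then show False using W(3) smult_inverse_cancel[OF d wM] by simp
  qed
  define \<phi> where "\<phi> x = (THE k. k \<in> carrier K \<and> (\<exists>y\<in>W. x = y \<oplus>\<^bsub>M\<^esub> k \<odot>\<^bsub>M\<^esub> w))" for x
  have \<phi>I: "\<phi> x = k" if "k \<in> carrier K" "y \<in> W" "x = y \<oplus>\<^bsub>M\<^esub> k \<odot>\<^bsub>M\<^esub> w" for x k y
    unfolding \<phi>_def
  proof (rule the_equality)
    show "k \<in> carrier K \<and> (\<exists>y\<in>W. x = y \<oplus>\<^bsub>M\<^esub> k \<odot>\<^bsub>M\<^esub> w)" using that by (intro conjI bexI[of _ y])
    fix k' assume "k' \<in> carrier K \<and> (\<exists>y\<in>W. x = y \<oplus>\<^bsub>M\<^esub> k' \<odot>\<^bsub>M\<^esub> w)"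
    then obtain y' where "k' \<in> carrier K" "y' \<in> W" "x = y' \<oplus>\<^bsub>M\<^esub> k' \<odot>\<^bsub>M\<^esub> w" by (elim conjE bexE)
    then show "k' = k" using that by (intro uniq[of k' k y' y]) simp_all
  qed
  show thesis
  proof (rule that[of \<phi>])
    show "\<phi> \<in> carrier M \<rightarrow> carrier K"
    proof
      fix x assume "x \<in> carrier M"
      from ex[OF this] obtain k y where "k \<in> carrier K" "y \<in> W" "x = y \<oplus>\<^bsub>M\<^esub> k \<odot>\<^bsub>M\<^esub> w" by (elim bexE)
      then show "\<phi> x \<in> carrier K" using \<phi>I[of k y x] by simp
    qed
    show "\<phi> w = \<one>\<^bsub>K\<^esub>" using Wc(2) wM by (intro \<phi>I[of _ "\<zero>\<^bsub>M\<^esub>"]) auto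
    show "\<phi> v = \<zero>\<^bsub>K\<^esub>" if "v \<in> V" "v \<noteq> w" for v
      using that W(2) VM wM by (intro \<phi>I[of _ v]) auto
  next
    fix x y assume xy: "x \<in> carrier M" "y \<in> carrier M"
    obtain k y1 where 1: "k \<in> carrier K" "y1 \<in> W" "x = y1 \<oplus>\<^bsub>M\<^esub> k \<odot>\<^bsub>M\<^esub> w" using ex[OF xy(1)] by blast
    obtain k' y2 where 2: "k' \<in> carrier K" "y2 \<in> W" "y = y2 \<oplus>\<^bsub>M\<^esub> k' \<odot>\<^bsub>M\<^esub> w" using ex[OF xy(2)] by blast
    have "x \<oplus>\<^bsub>M\<^esub> y = (y1 \<oplus>\<^bsub>M\<^esub> y2) \<oplus>\<^bsub>M\<^esub> (k \<oplus>\<^bsub>K\<^esub> k') \<odot>\<^bsub>M\<^esub> w"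
      using 1 2 Wc(1) wM by (simp add: M.smult_l_distr M.a_ac)
    then have "\<phi> (x \<oplus>\<^bsub>M\<^esub> y) = k \<oplus>\<^bsub>K\<^esub> k'" using 1 2 Wc(3) by (intro \<phi>I) auto
    then show "\<phi> (x \<oplus>\<^bsub>M\<^esub> y) = \<phi> x \<oplus>\<^bsub>K\<^esub> \<phi> y" using \<phi>I[OF 1] \<phi>I[OF 2] by simp
  next
    fix c x assume cx: "c \<in> carrier K" "x \<in> carrier M"
    obtain k y1 where 1: "k \<in> carrier K" "y1 \<in> W" "x = y1 \<oplus>\<^bsub>M\<^esub> k \<odot>\<^bsub>M\<^esub> w" using ex[OF cx(2)] by blast
    have "c \<odot>\<^bsub>M\<^esub> x = c \<odot>\<^bsub>M\<^esub> y1 \<oplus>\<^bsub>M\<^esub> (c \<otimes>\<^bsub>K\<^esub> k) \<odot>\<^bsub>M\<^esub> w"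
      using 1 cx Wc(1) wM by (simp add: M.smult_r_distr M.smult_assoc1)
    then have "\<phi> (c \<odot>\<^bsub>M\<^esub> x) = c \<otimes>\<^bsub>K\<^esub> k" using 1 cx Wc(4) by (intro \<phi>I) auto
    then show "\<phi> (c \<odot>\<^bsub>M\<^esub> x) = c \<otimes>\<^bsub>K\<^esub> \<phi> x" using \<phi>I[OF 1] by simp
  qed
qed

end

text \<open>Letting the coordinate functional of \<open>w\<close> act on the left factor gives a
  well-defined additive map from the tensor product to \<open>B\<close>, and this map isolates
  \<open>b w\<close>.\<close>

lemma (in tensor_product) tensor_left_indep_zero:
  assumes "field K" and V: "finite V" "V \<subseteq> carrier A" "lin_indep K A V" and b: "b \<in> V \<rightarrow> carrier B"
    and z: "(\<Oplus>\<^bsub>T\<^esub>v\<in>V. t v (b v)) = \<zero>\<^bsub>T\<^esub>" and w: "w \<in> V"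
  shows "b w = \<zero>\<^bsub>B\<^esub>"
proof -
  interpret vspace K A by (intro vspace.intro assms A.module)
  obtain \<phi> where \<phi>: "\<phi> \<in> carrier A \<rightarrow> carrier K"
    "\<And>x y. x \<in> carrier A \<Longrightarrow> y \<in> carrier A \<Longrightarrow> \<phi> (x \<oplus>\<^bsub>A\<^esub> y) = \<phi> x \<oplus>\<^bsub>K\<^esub> \<phi> y"
    "\<And>c x. c \<in> carrier K \<Longrightarrow> x \<in> carrier A \<Longrightarrow> \<phi> (c \<odot>\<^bsub>A\<^esub> x) = c \<otimes>\<^bsub>K\<^esub> \<phi> x"
    "\<phi> w = \<one>\<^bsub>K\<^esub>" "\<And>v. v \<in> V \<Longrightarrow> v \<noteq> w \<Longrightarrow> \<phi> v = \<zero>\<^bsub>K\<^esub>"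
    using exists_coordinate[OF V w] by blast
  have \<phi>K: "\<And>x. x \<in> carrier A \<Longrightarrow> \<phi> x \<in> carrier K" using \<phi>(1) by auto
  obtain h h0 where h: "h \<in> hom (add_monoid T) (add_monoid B)" "h0 \<in> hom (add_monoid P) (add_monoid B)"
      "\<And>x y. x \<in> carrier A \<Longrightarrow> y \<in> carrier B \<Longrightarrow> h (t x y) = \<phi> x \<odot>\<^bsub>B\<^esub> y"
    by (rule tensor_additive_universal[OF B.abelian_group_axioms, of "\<lambda>x y. \<phi> x \<odot>\<^bsub>B\<^esub> y"])
       (use \<phi> \<phi>K in \<open>auto simp: B.smult_l_distr B.smult_r_distr B.smult_assoc1[symmetric] A.R.m_comm\<close>)
  have bB: "\<And>v. v \<in> V \<Longrightarrow> b v \<in> carrier B" using b by auto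
  have "\<zero>\<^bsub>B\<^esub> = h (\<Oplus>\<^bsub>T\<^esub>v\<in>V. t v (b v))"
    using add_monoid_hom_simps(1)[OF T.abelian_group_axioms B.abelian_group_axioms h(1)] z by simp
  also have "\<dots> = (\<Oplus>\<^bsub>B\<^esub>v\<in>V. h (t v (b v)))"
    by (rule add_monoid_hom_finsum[OF T.abelian_group_axioms B.abelian_group_axioms h(1)]) (use V bB in auto)
  also have "\<dots> = (\<Oplus>\<^bsub>B\<^esub>v\<in>V. if w = v then b v else \<zero>\<^bsub>B\<^esub>)"
    by (rule B.finsum_cong') (use V bB h(3) \<phi>(4,5) in \<open>auto simp: subset_iff\<close>)
  also have "\<dots> = b w" using B.finsum_singleton[OF w V(1) b] by simp
  finally show ?thesis ..
qed

text \<open>Any presentation by pure tensors is thinned out by \<open>balanced_sum_indep\<close>.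
  Independent left factors are what later permits conclusions about the individual coefficients on
  the right.\<close>

lemma (in tensor_product) tensor_left_expansion:
  assumes "field K" and x: "x \<in> carrier T"
  obtains V b where "finite V" "V \<subseteq> carrier A" "lin_indep K A V" "b \<in> V \<rightarrow> carrier B"
    "x = (\<Oplus>\<^bsub>T\<^esub>v\<in>V. t v (b v))"
proof -
  interpret vspace K A by (intro vspace.intro assms A.module)
  have "\<exists>V b. finite V \<and> V \<subseteq> carrier A \<and> b \<in> V \<rightarrow> carrier B \<and> x = (\<Oplus>\<^bsub>T\<^esub>v\<in>V. t v (b v))"
    using x
  proof (induction rule: tensor_induct)
    case (pure a b)
    then show ?case by (intro exI[of _ "{a}"] exI[of _ "\<lambda>_. b"]) (auto simp: T.finsum_insert)
  next
    case (add x y)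
    then obtain V b W c where *: "finite V" "V \<subseteq> carrier A" "b \<in> V \<rightarrow> carrier B" "x = (\<Oplus>\<^bsub>T\<^esub>v\<in>V. t v (b v))"
      "finite W" "W \<subseteq> carrier A" "c \<in> W \<rightarrow> carrier B" "y = (\<Oplus>\<^bsub>T\<^esub>v\<in>W. t v (c v))" by blast
    \<comment> \<open>Sums are indexed by the left factors themselves. Two presentations are
      extended by zero to the union of their index sets and then merge by additivity on the
      right.\<close>
    let ?b = "\<lambda>v. if v \<in> V then b v else \<zero>\<^bsub>B\<^esub>" and ?c = "\<lambda>v. if v \<in> W then c v else \<zero>\<^bsub>B\<^esub>"
    have A: "\<And>v. v \<in> V \<union> W \<Longrightarrow> v \<in> carrier A" "\<And>v. ?b v \<in> carrier B" "\<And>v. ?c v \<in> carrier B"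
      "\<And>v. v \<in> V \<Longrightarrow> b v \<in> carrier B" "\<And>v. v \<in> W \<Longrightarrow> c v \<in> carrier B" using * by auto
    have "x = (\<Oplus>\<^bsub>T\<^esub>v\<in>V \<union> W. t v (?b v))"
      unfolding *(4) by (rule T.add.finprod_mono_neutral_cong_left) (use * A in auto)
    moreover have "y = (\<Oplus>\<^bsub>T\<^esub>v\<in>V \<union> W. t v (?c v))"
      unfolding *(8) by (rule T.add.finprod_mono_neutral_cong_left) (use * A in auto)
    ultimately have "x \<oplus>\<^bsub>T\<^esub> y = (\<Oplus>\<^bsub>T\<^esub>v\<in>V \<union> W. t v (?b v) \<oplus>\<^bsub>T\<^esub> t v (?c v))"
      by (simp only:) (rule T.finsum_addf[symmetric]; use A in auto)
    also have "\<dots> = (\<Oplus>\<^bsub>T\<^esub>v\<in>V \<union> W. t v (?b v \<oplus>\<^bsub>B\<^esub> ?c v))"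
      by (rule T.finsum_cong') (use A in \<open>auto simp: t_add_right\<close>)
    finally show ?case using * A
      by (intro exI[of _ "V \<union> W"] exI[of _ "\<lambda>v. ?b v \<oplus>\<^bsub>B\<^esub> ?c v"]) auto
  qed
  then obtain V b where Vb: "finite V" "V \<subseteq> carrier A" "b \<in> V \<rightarrow> carrier B" "x = (\<Oplus>\<^bsub>T\<^esub>v\<in>V. t v (b v))" by blast
  obtain W c where "W \<subseteq> V" "lin_indep K A W" "c \<in> W \<rightarrow> carrier B"
    "(\<Oplus>\<^bsub>T\<^esub>v\<in>V. t v (b v)) = (\<Oplus>\<^bsub>T\<^esub>v\<in>W. t v (c v))"
    using balanced_sum_indep[OF B.module T.abelian_group_axioms, of "\<lambda>b a. t a b", OF _ _ _ _ Vb(1-3)]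
    by (auto simp: t_add_left t_add_right t_balanced)
  then show thesis using that[of W c] Vb finite_subset by blast
qed

section \<open>The Galois functor\<close>

lemma sub_alg_simps [simp]:
  "carrier (sub_alg E S) = S" "x \<otimes>\<^bsub>sub_alg E S\<^esub> y = x \<otimes>\<^bsub>E\<^esub> y" "x \<oplus>\<^bsub>sub_alg E S\<^esub> y = x \<oplus>\<^bsub>E\<^esub> y"
  "\<one>\<^bsub>sub_alg E S\<^esub> = \<one>\<^bsub>E\<^esub>" "\<zero>\<^bsub>sub_alg E S\<^esub> = \<zero>\<^bsub>E\<^esub>" "c \<odot>\<^bsub>sub_alg E S\<^esub> x = c \<otimes>\<^bsub>E\<^esub> x"
  by (simp_all add: sub_alg_def)

lemma sub_alg_cring:
  assumes "cring E" "subring S E"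
  shows "cring (sub_alg E S)"
proof -
  interpret E: cring E by fact
  note S = subringE[OF assms(2)]
  have SE: "\<And>x. x \<in> S \<Longrightarrow> x \<in> carrier E" using S(1) by auto
  show ?thesis
  proof (rule cringI)
    show "abelian_group (sub_alg E S)"
    proof (rule abelian_groupI)
      fix x assume "x \<in> carrier (sub_alg E S)"
      then show "\<exists>y\<in>carrier (sub_alg E S). y \<oplus>\<^bsub>sub_alg E S\<^esub> x = \<zero>\<^bsub>sub_alg E S\<^esub>"
        using S(5) SE by (intro bexI[of _ "\<ominus>\<^bsub>E\<^esub> x"]) (auto simp: E.l_neg)
    qed (use S SE in \<open>auto simp: E.a_ac\<close>)
    show "comm_monoid (sub_alg E S)"
      by (rule comm_monoidI) (use S SE in \<open>auto simp: E.m_ac\<close>)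
  qed (use SE in \<open>auto simp: E.l_distr\<close>)
qed

lemma sub_alg_algebra:
  assumes "cring E" "subring S E" "subring S' E" "S \<subseteq> S'"
  shows "algebra (sub_alg E S) (sub_alg E S')"
proof -
  interpret E: cring E by fact
  note S = subringE[OF assms(2)] and S' = subringE[OF assms(3)]
  have SE: "\<And>x. x \<in> S \<Longrightarrow> x \<in> carrier E" "\<And>x. x \<in> S' \<Longrightarrow> x \<in> carrier E" using S(1) S'(1) by auto
  show ?thesis
    by (rule algebraI)
       (use sub_alg_cring[OF assms(1,2)] sub_alg_cring[OF assms(1,3)] S S' SE assms(4)
        in \<open>auto simp: E.l_distr E.r_distr E.m_assoc subset_iff\<close>)
qed

lemma ring_hom_inv_into:
  assumes "ring A" and h: "h \<in> ring_hom A B" and bij: "bij_betw h (carrier A) (carrier B)"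
  shows "inv_into (carrier A) h \<in> ring_hom B A"
proof -
  interpret A: ring A by fact
  let ?g = "inv_into (carrier A) h"
  have g: "\<And>y. y \<in> carrier B \<Longrightarrow> ?g y \<in> carrier A" "\<And>y. y \<in> carrier B \<Longrightarrow> h (?g y) = y"
    using bij by (auto simp: bij_betw_def inv_into_into f_inv_into_f)
  have inj: "\<And>x. x \<in> carrier A \<Longrightarrow> ?g (h x) = x" using bij by (simp add: bij_betw_def)
  show ?thesis
  proof (rule ring_hom_memI)
    fix x y assume xy: "x \<in> carrier B" "y \<in> carrier B"
    show "?g x \<in> carrier A" using g xy by simp
    show "?g (x \<otimes>\<^bsub>B\<^esub> y) = ?g x \<otimes>\<^bsub>A\<^esub> ?g y"
      using inj[of "?g x \<otimes>\<^bsub>A\<^esub> ?g y"] g xy by (simp add: ring_hom_mult[OF h])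
    show "?g (x \<oplus>\<^bsub>B\<^esub> y) = ?g x \<oplus>\<^bsub>A\<^esub> ?g y"
      using inj[of "?g x \<oplus>\<^bsub>A\<^esub> ?g y"] g xy by (simp add: ring_hom_add[OF h])
  next
    show "?g \<one>\<^bsub>B\<^esub> = \<one>\<^bsub>A\<^esub>" using inj[of "\<one>\<^bsub>A\<^esub>"] by (simp add: ring_hom_one[OF h])
  qed
qed

lemma alg_hom_simps:
  assumes "f \<in> alg_hom K A B"
  shows "f \<in> ring_hom A B" "c \<in> carrier K \<Longrightarrow> a \<in> carrier A \<Longrightarrow> f (c \<odot>\<^bsub>A\<^esub> a) = c \<odot>\<^bsub>B\<^esub> f a"
    "f \<in> extensional (carrier A)"
  using assms by (auto simp: alg_hom_def)

lemma (in tensor_product) ring_hom_eq_on_tensor: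
  assumes S: "cring S" and "h \<in> ring_hom T S" "h' \<in> ring_hom T S"
    and A: "\<And>a. a \<in> carrier A \<Longrightarrow> h (t a \<one>\<^bsub>B\<^esub>) = h' (t a \<one>\<^bsub>B\<^esub>)"
    and B: "\<And>b. b \<in> carrier B \<Longrightarrow> h (t \<one>\<^bsub>A\<^esub> b) = h' (t \<one>\<^bsub>A\<^esub> b)"
    and x: "x \<in> carrier T"
  shows "h x = h' x"
proof -
  interpret S: cring S by fact
  have "h (t a b) = h' (t a b)" if "a \<in> carrier A" "b \<in> carrier B" for a b
  proof -
    have "h (t a \<one>\<^bsub>B\<^esub> \<otimes>\<^bsub>T\<^esub> t \<one>\<^bsub>A\<^esub> b) = h' (t a \<one>\<^bsub>B\<^esub> \<otimes>\<^bsub>T\<^esub> t \<one>\<^bsub>A\<^esub> b)"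
      using that by (simp add: ring_hom_mult[OF assms(2)] ring_hom_mult[OF assms(3)] A B)
    then show ?thesis using that by (simp add: t_mult)
  qed
  moreover have "h \<in> hom (add_monoid T) (add_monoid S)" "h' \<in> hom (add_monoid T) (add_monoid S)"
    using assms(2,3) by (simp_all add: ring_hom_def hom_def)
  ultimately show ?thesis
    using hom_eq_on_tensor[OF S.abelian_group_axioms _ _ _ x, of h h'] by simp
qed

text \<open>The differential-algebraic core of a PPV-ring: constants of \<open>R\<close> lie in
  \<open>F\<close>, and \<open>R\<close> is ID-simple. Subrings appear as \<open>sub_alg\<close>,
  because the tensor product expects module records. The differential equation joins later, in
  \<open>ppv_torsor\<close>.\<close>

locale ppv = E: field E
  for E :: "('e, 'b) ring_scheme" and F R :: "'e set" and \<theta> :: "'e \<Rightarrow> 'i::finite multiindex \<Rightarrow> 'e" +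
  assumes subring_R: "subring R E" and subfield_F: "subfield F E" and F_subset_R: "F \<subseteq> R"
    and theta_hom: "\<theta> \<in> ring_hom (sub_alg E R) (mps (sub_alg E R))"
    and theta_F: "\<And>f k. f \<in> F \<Longrightarrow> \<theta> f k \<in> F"
    and theta_0: "\<And>r. r \<in> R \<Longrightarrow> \<theta> r 0 = r"
    and field_K: "field (const_ring E F \<theta>)"
    and constants_R: "\<And>r. r \<in> R \<Longrightarrow> \<theta> r = mps_const E r \<Longrightarrow> r \<in> F"
    and ID_simple_R: "\<And>I. ideal I (sub_alg E R) \<Longrightarrow> (\<And>r k. r \<in> I \<Longrightarrow> \<theta> r k \<in> I) \<Longrightarrow> I = {\<zero>\<^bsub>E\<^esub>} \<or> I = R"
begin

abbreviation "K \<equiv> const_ring E F \<theta>"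
abbreviation "KC \<equiv> carrier K"
abbreviation "RR \<equiv> sub_alg E R"
abbreviation "FF \<equiv> sub_alg E F"

lemma K_simps [simp]:
  "x \<otimes>\<^bsub>K\<^esub> y = x \<otimes>\<^bsub>E\<^esub> y" "x \<oplus>\<^bsub>K\<^esub> y = x \<oplus>\<^bsub>E\<^esub> y" "\<one>\<^bsub>K\<^esub> = \<one>\<^bsub>E\<^esub>" "\<zero>\<^bsub>K\<^esub> = \<zero>\<^bsub>E\<^esub>" "c \<odot>\<^bsub>K\<^esub> x = c \<otimes>\<^bsub>E\<^esub> x"
  by (simp_all add: const_ring_def)

lemma KC_iff: "c \<in> KC \<longleftrightarrow> c \<in> F \<and> \<theta> c = mps_const E c"
proof -
  have "\<zero>\<^bsub>E\<lparr>carrier := F\<rparr>\<^esub> = \<zero>\<^bsub>E\<^esub>" by simp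
  then show ?thesis by (simp only: const_ring_def ID_constants_def mps_const_def sub_alg_simps) simp
qed

sublocale K: field K by (rule field_K)

lemma K_eq: "K = sub_alg E KC"
  by (simp add: const_ring_def)

lemma subring_F: "subring F E"
  by (rule subfieldE(1)[OF subfield_F])

lemma KC_subset_F: "KC \<subseteq> F" by (auto simp: KC_iff)
lemma KC_subset_R: "KC \<subseteq> R" using KC_subset_F F_subset_R by auto
lemma R_subset_E: "R \<subseteq> carrier E" by (rule subringE(1)[OF subring_R])

lemma in_E [simp, intro]: "r \<in> R \<Longrightarrow> r \<in> carrier E" "f \<in> F \<Longrightarrow> f \<in> carrier E" "c \<in> KC \<Longrightarrow> c \<in> carrier E"
  "f \<in> F \<Longrightarrow> f \<in> R" "c \<in> KC \<Longrightarrow> c \<in> R" "c \<in> KC \<Longrightarrow> c \<in> F"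
  using R_subset_E F_subset_R KC_subset_F by auto

lemma subring_KC: "subring KC E"
proof (rule E.subringI)
  show "KC \<subseteq> carrier E" by auto
  show "\<one>\<^bsub>E\<^esub> \<in> KC" using K.one_closed by simp
  show "\<And>h. h \<in> KC \<Longrightarrow> \<ominus>\<^bsub>E\<^esub> h \<in> KC"
  proof -
    fix h assume h: "h \<in> KC"
    have "\<ominus>\<^bsub>K\<^esub> h \<oplus>\<^bsub>K\<^esub> h = \<zero>\<^bsub>K\<^esub>" "\<ominus>\<^bsub>K\<^esub> h \<in> KC" using h by (auto simp only: K.l_neg K.a_inv_closed)
    then show "\<ominus>\<^bsub>E\<^esub> h \<in> KC" using h E.minus_equality[of "\<ominus>\<^bsub>K\<^esub> h" h] by (simp add: in_E)
  qed
qed (use K.a_closed K.m_closed in simp_all)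

sublocale RR: cring RR by (rule sub_alg_cring[OF E.is_cring subring_R])
sublocale FF: cring FF by (rule sub_alg_cring[OF E.is_cring subring_F])

lemma algebra_K_R: "algebra K RR"
  using sub_alg_algebra[OF E.is_cring subring_KC subring_R KC_subset_R] K_eq by simp

lemma algebra_K_F: "algebra K FF"
  using sub_alg_algebra[OF E.is_cring subring_KC subring_F KC_subset_F] K_eq by simp

lemma algebra_K_K: "algebra K K"
  using sub_alg_algebra[OF E.is_cring subring_KC subring_KC] K_eq by simp

lemma algebra_F_R: "algebra FF RR"
  by (rule sub_alg_algebra[OF E.is_cring subring_F subring_R F_subset_R])

lemma theta_closed [simp]: "r \<in> R \<Longrightarrow> \<theta> r k \<in> R"
  using ring_hom_closed[OF theta_hom, of r] by (auto simp: mps_def)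

lemma theta_add: "r \<in> R \<Longrightarrow> s \<in> R \<Longrightarrow> \<theta> (r \<oplus>\<^bsub>E\<^esub> s) k = \<theta> r k \<oplus>\<^bsub>E\<^esub> \<theta> s k"
  using ring_hom_add[OF theta_hom, of r s] by (simp add: mps_def)

lemma theta_mult: "r \<in> R \<Longrightarrow> s \<in> R \<Longrightarrow>
    \<theta> (r \<otimes>\<^bsub>E\<^esub> s) k = (\<Oplus>\<^bsub>RR\<^esub>z\<in>splittings k. \<theta> r (fst z) \<otimes>\<^bsub>E\<^esub> \<theta> s (snd z))"
  using ring_hom_mult[OF theta_hom, of r s] by (simp add: mps_def)

text \<open>The expansion of a constant has only its zeroth term, so a single splitting survives in
  the product formula. This linearity over the constants is what lets the components of
  \<open>\<theta>\<close> act on \<open>R \<otimes> L\<close>.\<close>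

lemma theta_smult:
  assumes "c \<in> KC" "r \<in> R"
  shows "\<theta> (c \<otimes>\<^bsub>E\<^esub> r) k = c \<otimes>\<^bsub>E\<^esub> \<theta> r k"
proof -
  have mem: "(0, k) \<in> splittings k" by (auto simp: splittings_def)
  have c: "\<theta> c i = (if i = 0 then c else \<zero>\<^bsub>E\<^esub>)" for i
    using assms(1) by (simp add: KC_iff mps_const_def)
  have "\<theta> (c \<otimes>\<^bsub>E\<^esub> r) k = (\<Oplus>\<^bsub>RR\<^esub>z\<in>splittings k. if (0, k) = z then c \<otimes>\<^bsub>E\<^esub> \<theta> r (snd z) else \<zero>\<^bsub>RR\<^esub>)"
    unfolding theta_mult[OF in_E(5)[OF assms(1)] assms(2)]
  proof (rule RR.finsum_cong')
    fix z assume "z \<in> splittings k"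
    then have "fst z + snd z = k" by (auto simp: splittings_def)
    then have "(0, k) = z \<longleftrightarrow> fst z = 0" by (cases z) auto
    then show "\<theta> c (fst z) \<otimes>\<^bsub>E\<^esub> \<theta> r (snd z) = (if (0, k) = z then c \<otimes>\<^bsub>E\<^esub> \<theta> r (snd z) else \<zero>\<^bsub>RR\<^esub>)"
      using assms by (simp add: c)
  qed (use assms RR.m_closed RR.zero_closed in \<open>auto simp: in_E(5)\<close>)
  also have "\<dots> = c \<otimes>\<^bsub>E\<^esub> \<theta> r (snd (0, k))"
    using RR.finsum_singleton[OF mem, of "\<lambda>z. c \<otimes>\<^bsub>E\<^esub> \<theta> r (snd z)"] assms RR.m_closed by auto
  finally show ?thesis by simp
qed

section \<open>The rings \<open>R \<otimes> L\<close> and their derivations\<close>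

lemma tp: "algebra K L \<Longrightarrow> tensor_product K RR L"
  by (intro tensor_product.intro algebra_K_R)

abbreviation "TT L \<equiv> tensor K RR L"
abbreviation "pt L \<equiv> tensor_product.t K RR L"
abbreviation "\<Theta> L \<equiv> tensor_ID K RR \<theta> L (mps_const L)"
abbreviation "id\<^sub>R L' f \<equiv> tensor_map K RR L' (\<lambda>x. x) f"

lemma Theta_hom:
  assumes "algebra K L"
  shows "(\<lambda>x. \<Theta> L x k) \<in> hom (add_monoid (TT L)) (add_monoid (TT L))"
    and "r \<in> R \<Longrightarrow> l \<in> carrier L \<Longrightarrow> \<Theta> L (pt L r l) k = pt L (\<theta> r k) l"
proof -
  interpret L: tensor_product K RR L by (rule tp[OF assms])
  note * = L.tensor_ID_const[of \<theta>]
  show "(\<lambda>x. \<Theta> L x k) \<in> hom (add_monoid (TT L)) (add_monoid (TT L))"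
    by (rule *) (simp_all add: theta_add theta_smult)
  show "r \<in> R \<Longrightarrow> l \<in> carrier L \<Longrightarrow> \<Theta> L (pt L r l) k = pt L (\<theta> r k) l"
    by (rule *) (simp_all add: theta_add theta_smult)
qed

text \<open>The elements \<open>1 \<otimes> l\<close> are constants, so multiplication by them
  commutes with the derivation. This is what reduces compatibility of an automorphism to the
  elements \<open>r \<otimes> 1\<close>.\<close>

lemma Theta_const_mult:
  assumes L: "algebra K L" and x: "x \<in> carrier (TT L)" and l: "l \<in> carrier L"
  shows "\<Theta> L (x \<otimes>\<^bsub>TT L\<^esub> pt L \<one>\<^bsub>E\<^esub> l) k = \<Theta> L x k \<otimes>\<^bsub>TT L\<^esub> pt L \<one>\<^bsub>E\<^esub> l"
proof -
  interpret L: tensor_product K RR L by (rule tp[OF L])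
  have one: "\<one>\<^bsub>E\<^esub> \<in> R" using subringE(3)[OF subring_R] .
  note Ts = add_monoid_hom_simps[OF L.T.abelian_group_axioms L.T.abelian_group_axioms Theta_hom(1)[OF L]]
  have ol: "pt L \<one>\<^bsub>E\<^esub> l \<in> carrier (TT L)" using L.t_closed[of "\<one>\<^bsub>E\<^esub>" l] one l by simp
  show ?thesis using x
  proof (induction rule: L.tensor_induct)
    case (pure a b)
    then have "a \<in> R" by simp
    then show ?case using pure l one
      by (simp add: L.t_mult Theta_hom(2)[OF L])
  next
    case (add x y)
    then show ?case using ol by (simp add: L.T.l_distr Ts)
  qed
qed

lemma idR_hom:
  assumes "algebra K L" "algebra K L'" "f \<in> alg_hom K L L'"
  shows "id\<^sub>R L' f \<in> ring_hom (TT L) (TT L')"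
    and "r \<in> R \<Longrightarrow> l \<in> carrier L \<Longrightarrow> id\<^sub>R L' f (pt L r l) = pt L' r (f l)"
proof -
  interpret L: tensor_product K RR L by (rule tp[OF assms(1)])
  note f = alg_hom_simps[OF assms(3)]
  note * = L.tensor_map_ring_hom[OF tp[OF assms(2)], of "\<lambda>x. x" f]
  show "id\<^sub>R L' f \<in> ring_hom (TT L) (TT L')"
    by (rule *) (use f in \<open>auto intro!: ring_hom_memI\<close>)
  show "r \<in> R \<Longrightarrow> l \<in> carrier L \<Longrightarrow> id\<^sub>R L' f (pt L r l) = pt L' r (f l)"
    by (rule *) (use f in \<open>auto intro!: ring_hom_memI\<close>)
qed

lemma idR_Theta:
  assumes L: "algebra K L" and L': "algebra K L'" and f: "f \<in> alg_hom K L L'" and x: "x \<in> carrier (TT L)"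
  shows "id\<^sub>R L' f (\<Theta> L x k) = \<Theta> L' (id\<^sub>R L' f x) k"
proof -
  interpret L: tensor_product K RR L by (rule tp[OF L])
  interpret L': tensor_product K RR L' by (rule tp[OF L'])
  note h = idR_hom[OF L L' f]
  note Ts = add_monoid_hom_simps[OF L.T.abelian_group_axioms L.T.abelian_group_axioms Theta_hom(1)[OF L]]
  note Ts' = add_monoid_hom_simps[OF L'.T.abelian_group_axioms L'.T.abelian_group_axioms Theta_hom(1)[OF L']]
  show ?thesis using x
  proof (induction rule: L.tensor_induct)
    case (pure a b)
    then have "a \<in> R" by simp
    then show ?case using pure ring_hom_closed[OF alg_hom_simps(1)[OF f]]
      by (simp add: Theta_hom(2)[OF L] Theta_hom(2)[OF L'] h(2))
  next
    case (add x y)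
    then show ?case by (simp add: Ts Ts' ring_hom_add[OF h(1)] ring_hom_closed[OF h(1)])
  qed
qed

text \<open>An automorphism in question fixes the constants \<open>1 \<otimes> l\<close>. Hence
  commutation with the derivation needs testing on \<open>r \<otimes> 1\<close> alone, and
  triviality on the image of \<open>F \<otimes> L\<close> can be tested on pure tensors.\<close>

lemma Gal_iff:
  assumes L: "algebra K L"
  shows "\<sigma> \<in> carrier (Gal E F R \<theta> L) \<longleftrightarrow>
    \<sigma> \<in> extensional (carrier (TT L)) \<and> bij_betw \<sigma> (carrier (TT L)) (carrier (TT L)) \<and>
    \<sigma> \<in> ring_hom (TT L) (TT L) \<and>
    (\<forall>r\<in>R. \<forall>k. \<sigma> (pt L (\<theta> r k) \<one>\<^bsub>L\<^esub>) = \<Theta> L (\<sigma> (pt L r \<one>\<^bsub>L\<^esub>)) k) \<and>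
    (\<forall>f\<in>F. \<forall>l\<in>carrier L. \<sigma> (pt L f l) = pt L f l)" (is "_ \<longleftrightarrow> ?rhs")
proof -
  interpret L: tensor_product K RR L by (rule tp[OF L])
  interpret FL: tensor_product K FF L by (intro tensor_product.intro algebra_K_F L)
  have one: "\<one>\<^bsub>E\<^esub> \<in> R" "\<one>\<^bsub>E\<^esub> \<in> F" using subringE(3)[OF subring_R] subringE(3)[OF subring_F] .
  let ?\<iota> = "tensor_map K RR L (\<lambda>x. x) (\<lambda>x. x)"
  have \<iota>: "?\<iota> \<in> ring_hom FL.T L.T" "\<And>f l. f \<in> F \<Longrightarrow> l \<in> carrier L \<Longrightarrow> ?\<iota> (FL.t f l) = L.t f l"
  proof -
    have 1: "(\<lambda>x. x) \<in> ring_hom FF RR" "(\<lambda>x. x) \<in> ring_hom L L"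
      by (auto intro!: ring_hom_memI)
    note * = FL.tensor_map_ring_hom[OF L.tensor_product_axioms 1(1) _ 1(2)]
    show "?\<iota> \<in> ring_hom FL.T L.T" by (rule *) simp_all
    show "\<And>f l. f \<in> F \<Longrightarrow> l \<in> carrier L \<Longrightarrow> ?\<iota> (FL.t f l) = L.t f l" by (rule *) simp_all
  qed
  note Ts = add_monoid_hom_simps[OF L.T.abelian_group_axioms L.T.abelian_group_axioms Theta_hom(1)[OF L]]
  have "\<sigma> \<in> carrier (Gal E F R \<theta> L) \<longleftrightarrow> \<sigma> \<in> Bij (carrier (TT L)) \<and> \<sigma> \<in> ring_hom (TT L) (TT L) \<and>
      (\<forall>x\<in>carrier (TT L). \<forall>k. \<sigma> (\<Theta> L x k) = \<Theta> L (\<sigma> x) k) \<and> (\<forall>x\<in>carrier FL.T. \<sigma> (?\<iota> x) = ?\<iota> x)"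
    by (auto simp: Gal_def Let_def ID_hom_def)
  also have "\<dots> \<longleftrightarrow> ?rhs"
  proof (intro iffI; elim conjE)
    assume \<sigma>: "\<sigma> \<in> Bij (carrier (TT L))" "\<sigma> \<in> ring_hom (TT L) (TT L)"
      and ID: "\<forall>x\<in>carrier (TT L). \<forall>k. \<sigma> (\<Theta> L x k) = \<Theta> L (\<sigma> x) k" and fx: "\<forall>x\<in>carrier FL.T. \<sigma> (?\<iota> x) = ?\<iota> x"
    have "\<sigma> (pt L (\<theta> r k) \<one>\<^bsub>L\<^esub>) = \<Theta> L (\<sigma> (pt L r \<one>\<^bsub>L\<^esub>)) k" if "r \<in> R" for r k
    proof -
      have "pt L r \<one>\<^bsub>L\<^esub> \<in> carrier (TT L)" using that L.t_closed[of r "\<one>\<^bsub>L\<^esub>"] by simp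
      from bspec[OF ID this] show ?thesis using that by (simp add: Theta_hom(2)[OF L])
    qed
    moreover have "\<sigma> (pt L f l) = pt L f l" if "f \<in> F" "l \<in> carrier L" for f l
    proof -
      have "FL.t f l \<in> carrier FL.T" using that FL.t_closed[of f l] by simp
      from bspec[OF fx this] show ?thesis using that by (simp add: \<iota>(2))
    qed
    ultimately show ?rhs using \<sigma> by (simp add: Bij_def)
  next
    assume \<sigma>: "\<sigma> \<in> extensional (carrier (TT L))" "bij_betw \<sigma> (carrier (TT L)) (carrier (TT L))"
      "\<sigma> \<in> ring_hom (TT L) (TT L)"
      and ID: "\<forall>r\<in>R. \<forall>k. \<sigma> (pt L (\<theta> r k) \<one>\<^bsub>L\<^esub>) = \<Theta> L (\<sigma> (pt L r \<one>\<^bsub>L\<^esub>)) k"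
      and fx: "\<forall>f\<in>F. \<forall>l\<in>carrier L. \<sigma> (pt L f l) = pt L f l"
    note s = ring_hom_closed[OF \<sigma>(3)] ring_hom_mult[OF \<sigma>(3)] ring_hom_add[OF \<sigma>(3)]
    have "\<sigma> (\<Theta> L x k) = \<Theta> L (\<sigma> x) k" if "x \<in> carrier (TT L)" for x k
      using that
    proof (induction rule: L.tensor_induct)
      case (pure a b)
      then have a: "a \<in> R" by simp
      have sp: "L.t r b = L.t r \<one>\<^bsub>L\<^esub> \<otimes>\<^bsub>TT L\<^esub> L.t \<one>\<^bsub>E\<^esub> b" if "r \<in> R" for r
        using L.t_mult[of r "\<one>\<^bsub>L\<^esub>" "\<one>\<^bsub>E\<^esub>" b] that one pure by simp
      have c: "L.t \<one>\<^bsub>E\<^esub> b \<in> carrier (TT L)" "\<And>r. r \<in> R \<Longrightarrow> L.t r \<one>\<^bsub>L\<^esub> \<in> carrier (TT L)"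
        using L.t_closed one pure by simp_all
      have fb: "\<sigma> (L.t \<one>\<^bsub>E\<^esub> b) = L.t \<one>\<^bsub>E\<^esub> b" using fx one pure by simp
      have "\<sigma> (\<Theta> L (L.t a b) k) = \<sigma> (L.t (\<theta> a k) \<one>\<^bsub>L\<^esub>) \<otimes>\<^bsub>TT L\<^esub> L.t \<one>\<^bsub>E\<^esub> b"
        using a pure sp[of "\<theta> a k"] c by (simp add: Theta_hom(2)[OF L] s fb)
      also have "\<dots> = \<Theta> L (\<sigma> (L.t a \<one>\<^bsub>L\<^esub>) \<otimes>\<^bsub>TT L\<^esub> L.t \<one>\<^bsub>E\<^esub> b) k"
        using ID a pure Theta_const_mult[OF L s(1)[OF c(2)[OF a]] pure(2)] by simp
      also have "\<sigma> (L.t a \<one>\<^bsub>L\<^esub>) \<otimes>\<^bsub>TT L\<^esub> L.t \<one>\<^bsub>E\<^esub> b = \<sigma> (L.t a b)"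
        using sp[OF a] c a by (simp add: s fb)
      finally show ?case .
    next
      case (add x y)
      then show ?case by (simp add: Ts s)
    qed
    moreover have "\<sigma> (?\<iota> x) = ?\<iota> x" if "x \<in> carrier FL.T" for x
      using that
    proof (induction rule: FL.tensor_induct)
      case (pure a b)
      then show ?case using fx by (simp add: \<iota>(2))
    next
      case (add x y)
      then show ?case by (simp add: ring_hom_add[OF \<iota>(1)] s ring_hom_closed[OF \<iota>(1)])
    qed
    ultimately show "\<sigma> \<in> Bij (carrier (TT L)) \<and> \<sigma> \<in> ring_hom (TT L) (TT L) \<and>
      (\<forall>x\<in>carrier (TT L). \<forall>k. \<sigma> (\<Theta> L x k) = \<Theta> L (\<sigma> x) k) \<and> (\<forall>x\<in>carrier FL.T. \<sigma> (?\<iota> x) = ?\<iota> x)"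
      using \<sigma> by (simp add: Bij_def)
  qed
  finally show ?thesis .
qed

text \<open>In this order: extensional, bijective, ring homomorphism, compatible with the derivation
  on \<open>r \<otimes> 1\<close>, identity on \<open>f \<otimes> l\<close>.\<close>

lemmas GalD = iffD1[OF Gal_iff, THEN conjunct1] iffD1[OF Gal_iff, THEN conjunct2, THEN conjunct1]
  iffD1[OF Gal_iff, THEN conjunct2, THEN conjunct2, THEN conjunct1]
  iffD1[OF Gal_iff, THEN conjunct2, THEN conjunct2, THEN conjunct2, THEN conjunct1, THEN bspec, THEN spec]
  iffD1[OF Gal_iff, THEN conjunct2, THEN conjunct2, THEN conjunct2, THEN conjunct2, THEN bspec, THEN bspec]

lemma one_R [simp]: "\<one>\<^bsub>E\<^esub> \<in> R" and one_F [simp]: "\<one>\<^bsub>E\<^esub> \<in> F"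
  using subringE(3)[OF subring_R] subringE(3)[OF subring_F] .

section \<open>Automorphisms over a test algebra and their base change\<close>

lemma Gal_eqI:
  assumes L: "algebra K L" and \<sigma>: "\<sigma> \<in> carrier (Gal E F R \<theta> L)" and \<tau>: "\<tau> \<in> carrier (Gal E F R \<theta> L)"
    and eq: "\<And>r. r \<in> R \<Longrightarrow> \<sigma> (pt L r \<one>\<^bsub>L\<^esub>) = \<tau> (pt L r \<one>\<^bsub>L\<^esub>)"
  shows "\<sigma> = \<tau>"
proof (rule extensionalityI[OF GalD(1)[OF L \<sigma>] GalD(1)[OF L \<tau>]])
  interpret L: tensor_product K RR L by (rule tp[OF L])
  fix x assume x: "x \<in> carrier (TT L)"
  show "\<sigma> x = \<tau> x"
    by (rule L.ring_hom_eq_on_tensor[OF L.T.is_cring GalD(3)[OF L \<sigma>] GalD(3)[OF L \<tau>] _ _ x])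
       (use eq GalD(5)[OF L \<sigma> one_F] GalD(5)[OF L \<tau> one_F] in simp_all)
qed

text \<open>Formulated for endomorphisms fixing \<open>F \<otimes> L\<close>, so that it applies to
  an automorphism and to its inverse alike; bijectivity of the base change is then read off from the
  two results.\<close>

lemma base_change_endo:
  assumes L: "algebra K L" and L': "algebra K L'" and f: "f \<in> alg_hom K L L'"
    and s: "\<sigma> \<in> ring_hom (TT L) (TT L)" and fx: "\<And>f l. f \<in> F \<Longrightarrow> l \<in> carrier L \<Longrightarrow> \<sigma> (pt L f l) = pt L f l"
  obtains \<tau> where "\<tau> \<in> ring_hom (TT L') (TT L')"
    "\<And>r l. r \<in> R \<Longrightarrow> l \<in> carrier L' \<Longrightarrow> \<tau> (pt L' r l) = id\<^sub>R L' f (\<sigma> (pt L r \<one>\<^bsub>L\<^esub>)) \<otimes>\<^bsub>TT L'\<^esub> pt L' \<one>\<^bsub>E\<^esub> l"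
    "\<And>f l. f \<in> F \<Longrightarrow> l \<in> carrier L' \<Longrightarrow> \<tau> (pt L' f l) = pt L' f l"
    "\<And>x. x \<in> carrier (TT L) \<Longrightarrow> \<tau> (id\<^sub>R L' f x) = id\<^sub>R L' f (\<sigma> x)"
proof -
  interpret L: tensor_product K RR L by (rule tp[OF L])
  interpret L': tensor_product K RR L' by (rule tp[OF L'])
  note h = idR_hom[OF L L' f]
  note ss = ring_hom_closed[OF s] ring_hom_mult[OF s] ring_hom_add[OF s] ring_hom_one[OF s]
  note hs = ring_hom_closed[OF h(1)] ring_hom_mult[OF h(1)] ring_hom_add[OF h(1)] ring_hom_one[OF h(1)]
  note fs = alg_hom_simps[OF f]
  note fc = ring_hom_closed[OF fs(1)] ring_hom_one[OF fs(1)]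
  have tL: "\<And>r l. r \<in> R \<Longrightarrow> l \<in> carrier L \<Longrightarrow> L.t r l \<in> carrier L.T" using L.t_closed by simp
  have tL': "\<And>r l. r \<in> R \<Longrightarrow> l \<in> carrier L' \<Longrightarrow> L'.t r l \<in> carrier L'.T" using L'.t_closed by simp
  let ?g = "\<lambda>r. id\<^sub>R L' f (\<sigma> (L.t r \<one>\<^bsub>L\<^esub>))"
  have gr: "?g \<in> ring_hom RR L'.T"
  proof (rule ring_hom_memI)
    fix x y assume xy: "x \<in> carrier RR" "y \<in> carrier RR"
    show "?g x \<in> carrier L'.T" using xy by (simp add: hs ss tL)
    show "?g (x \<otimes>\<^bsub>RR\<^esub> y) = ?g x \<otimes>\<^bsub>L'.T\<^esub> ?g y"
      using xy L.t_mult[of x "\<one>\<^bsub>L\<^esub>" y "\<one>\<^bsub>L\<^esub>", symmetric] by (simp add: hs ss tL)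
    show "?g (x \<oplus>\<^bsub>RR\<^esub> y) = ?g x \<oplus>\<^bsub>L'.T\<^esub> ?g y"
      using xy L.t_add_left[of x y "\<one>\<^bsub>L\<^esub>"] by (simp add: hs ss tL)
  next
    have "L.t \<one>\<^bsub>E\<^esub> \<one>\<^bsub>L\<^esub> = \<one>\<^bsub>L.T\<^esub>" using L.t_one by simp
    then show "?g \<one>\<^bsub>RR\<^esub> = \<one>\<^bsub>L'.T\<^esub>" by (simp only: sub_alg_simps ss hs)
  qed
  have br: "L'.t \<one>\<^bsub>E\<^esub> \<in> ring_hom L' L'.T"
    by (rule ring_hom_memI)
       (use tL' L'.t_mult[of "\<one>\<^bsub>E\<^esub>" _ "\<one>\<^bsub>E\<^esub>"] L'.t_add_right[of "\<one>\<^bsub>E\<^esub>"] L'.t_one in auto)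
  have gF: "?g c = L'.t c \<one>\<^bsub>L'\<^esub>" if "c \<in> F" for c
    using that by (simp add: fx h(2) fc)
  have bal: "?g (c \<odot>\<^bsub>RR\<^esub> a) \<otimes>\<^bsub>L'.T\<^esub> L'.t \<one>\<^bsub>E\<^esub> b = ?g a \<otimes>\<^bsub>L'.T\<^esub> L'.t \<one>\<^bsub>E\<^esub> (c \<odot>\<^bsub>L'\<^esub> b)"
    if cab: "c \<in> KC" "a \<in> carrier RR" "b \<in> carrier L'" for c a b
  proof -
    have "?g (c \<odot>\<^bsub>RR\<^esub> a) = ?g a \<otimes>\<^bsub>L'.T\<^esub> ?g c"
      using cab ring_hom_mult[OF gr, of a c] by (simp add: E.m_comm in_E)
    also have "\<dots> = ?g a \<otimes>\<^bsub>L'.T\<^esub> L'.t c \<one>\<^bsub>L'\<^esub>" using gF[of c] cab by (simp add: in_E)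
    finally have "?g (c \<odot>\<^bsub>RR\<^esub> a) \<otimes>\<^bsub>L'.T\<^esub> L'.t \<one>\<^bsub>E\<^esub> b = ?g a \<otimes>\<^bsub>L'.T\<^esub> (L'.t c \<one>\<^bsub>L'\<^esub> \<otimes>\<^bsub>L'.T\<^esub> L'.t \<one>\<^bsub>E\<^esub> b)"
      using cab by (simp add: L'.T.m_assoc hs ss tL tL' in_E(5))
    also have "L'.t c \<one>\<^bsub>L'\<^esub> \<otimes>\<^bsub>L'.T\<^esub> L'.t \<one>\<^bsub>E\<^esub> b = L'.t \<one>\<^bsub>E\<^esub> (c \<odot>\<^bsub>L'\<^esub> b)"
      using cab L'.t_mult[of c "\<one>\<^bsub>L'\<^esub>" "\<one>\<^bsub>E\<^esub>" b] L'.t_balanced[of c "\<one>\<^bsub>E\<^esub>" b] by (simp add: in_E)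
    finally show ?thesis .
  qed
  obtain \<tau> where \<tau>: "\<tau> \<in> ring_hom L'.T L'.T"
    "\<And>a b. a \<in> carrier RR \<Longrightarrow> b \<in> carrier L' \<Longrightarrow> \<tau> (L'.t a b) = ?g a \<otimes>\<^bsub>L'.T\<^esub> L'.t \<one>\<^bsub>E\<^esub> b"
    by (rule L'.tensor_ring_universal[OF L'.T.is_cring gr br bal]) (auto intro: that)
  show thesis
  proof (rule that[OF \<tau>(1)])
    show 1: "\<tau> (pt L' r l) = ?g r \<otimes>\<^bsub>TT L'\<^esub> pt L' \<one>\<^bsub>E\<^esub> l" if "r \<in> R" "l \<in> carrier L'" for r l
      using \<tau>(2)[of r l] that by simp
    show "\<tau> (pt L' c l) = pt L' c l" if "c \<in> F" "l \<in> carrier L'" for c l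
      using 1[of c l] that gF[of c] L'.t_mult[of c "\<one>\<^bsub>L'\<^esub>" "\<one>\<^bsub>E\<^esub>" l] by (simp add: in_E)
    show "\<tau> (id\<^sub>R L' f x) = id\<^sub>R L' f (\<sigma> x)" if "x \<in> carrier (TT L)" for x
      using that
    proof (induction rule: L.tensor_induct)
      case (pure r l)
      then have r: "r \<in> R" by simp
      have "\<tau> (id\<^sub>R L' f (L.t r l)) = ?g r \<otimes>\<^bsub>TT L'\<^esub> id\<^sub>R L' f (\<sigma> (L.t \<one>\<^bsub>E\<^esub> l))"
        using r pure by (simp add: h(2) 1 fc fx)
      also have "\<dots> = id\<^sub>R L' f (\<sigma> (L.t r \<one>\<^bsub>L\<^esub> \<otimes>\<^bsub>L.T\<^esub> L.t \<one>\<^bsub>E\<^esub> l))"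
        using r pure by (simp add: ss hs tL)
      also have "L.t r \<one>\<^bsub>L\<^esub> \<otimes>\<^bsub>L.T\<^esub> L.t \<one>\<^bsub>E\<^esub> l = L.t r l"
        using L.t_mult[of r "\<one>\<^bsub>L\<^esub>" "\<one>\<^bsub>E\<^esub>" l] r pure by simp
      finally show ?case .
    next
      case (add x y)
      then show ?case by (simp add: hs ss ring_hom_add[OF \<tau>(1)])
    qed
  qed
qed

lemma Gal_inverse:
  assumes L: "algebra K L" and \<sigma>: "\<sigma> \<in> carrier (Gal E F R \<theta> L)"
  obtains \<tau> where "\<tau> \<in> ring_hom (TT L) (TT L)" "\<And>f l. f \<in> F \<Longrightarrow> l \<in> carrier L \<Longrightarrow> \<tau> (pt L f l) = pt L f l"
    "\<And>x. x \<in> carrier (TT L) \<Longrightarrow> \<tau> (\<sigma> x) = x" "\<And>x. x \<in> carrier (TT L) \<Longrightarrow> \<sigma> (\<tau> x) = x"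
proof -
  interpret L: tensor_product K RR L by (rule tp[OF L])
  note s = GalD[OF L \<sigma>]
  let ?\<tau> = "inv_into (carrier (TT L)) \<sigma>"
  have 1: "\<And>x. x \<in> carrier (TT L) \<Longrightarrow> ?\<tau> (\<sigma> x) = x" "\<And>x. x \<in> carrier (TT L) \<Longrightarrow> \<sigma> (?\<tau> x) = x"
    using s(2) by (auto simp: bij_betw_def f_inv_into_f)
  have 2: "?\<tau> \<in> ring_hom (TT L) (TT L)"
    by (rule ring_hom_inv_into[OF L.T.ring_axioms s(3,2)])
  have 3: "?\<tau> (pt L f l) = pt L f l" if "f \<in> F" "l \<in> carrier L" for f l
    using 1(1)[of "pt L f l"] s(5)[OF that] L.t_closed[of f l] that by (simp add: in_E)
  show thesis by (rule that[OF 2 3 1])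
qed

text \<open>This makes the definite description in \<open>Gal_map\<close> usable. Existence comes
  from base changing \<open>\<sigma>\<close> and its inverse, uniqueness from
  \<open>Gal_eqI\<close>, as an automorphism is determined by its values on
  \<open>r \<otimes> 1\<close>.\<close>

lemma base_change:
  assumes L: "algebra K L" and L': "algebra K L'" and f: "f \<in> alg_hom K L L'" and \<sigma>: "\<sigma> \<in> carrier (Gal E F R \<theta> L)"
  shows "Gal_map E F R \<theta> L L' f \<sigma> \<in> carrier (Gal E F R \<theta> L')"
    and "x \<in> carrier (TT L) \<Longrightarrow> Gal_map E F R \<theta> L L' f \<sigma> (id\<^sub>R L' f x) = id\<^sub>R L' f (\<sigma> x)"
    and "\<tau> \<in> carrier (Gal E F R \<theta> L') \<Longrightarrow> (\<And>r. r \<in> R \<Longrightarrow> \<tau> (pt L' r \<one>\<^bsub>L'\<^esub>) = id\<^sub>R L' f (\<sigma> (pt L r \<one>\<^bsub>L\<^esub>))) \<Longrightarrow>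
      Gal_map E F R \<theta> L L' f \<sigma> = \<tau>"
proof -
  interpret L: tensor_product K RR L by (rule tp[OF L])
  interpret L': tensor_product K RR L' by (rule tp[OF L'])
  note h = idR_hom[OF L L' f]
  note hs = ring_hom_closed[OF h(1)] ring_hom_mult[OF h(1)] ring_hom_add[OF h(1)] ring_hom_one[OF h(1)]
  note s = GalD[OF L \<sigma>]
  have fone: "f \<one>\<^bsub>L\<^esub> = \<one>\<^bsub>L'\<^esub>" using ring_hom_one[OF alg_hom_simps(1)[OF f]] .
  have tL: "\<And>r l. r \<in> R \<Longrightarrow> l \<in> carrier L \<Longrightarrow> L.t r l \<in> carrier L.T" using L.t_closed by simp
  have tL': "\<And>r l. r \<in> R \<Longrightarrow> l \<in> carrier L' \<Longrightarrow> L'.t r l \<in> carrier L'.T" using L'.t_closed by simp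
  obtain \<rho> where \<rho>: "\<rho> \<in> ring_hom (TT L) (TT L)" "\<And>f l. f \<in> F \<Longrightarrow> l \<in> carrier L \<Longrightarrow> \<rho> (pt L f l) = pt L f l"
    "\<And>x. x \<in> carrier (TT L) \<Longrightarrow> \<rho> (\<sigma> x) = x" "\<And>x. x \<in> carrier (TT L) \<Longrightarrow> \<sigma> (\<rho> x) = x"
    using Gal_inverse[OF L \<sigma>] by blast
  obtain \<sigma>' where \<sigma>': "\<sigma>' \<in> ring_hom (TT L') (TT L')"
    "\<And>r l. r \<in> R \<Longrightarrow> l \<in> carrier L' \<Longrightarrow> \<sigma>' (pt L' r l) = id\<^sub>R L' f (\<sigma> (pt L r \<one>\<^bsub>L\<^esub>)) \<otimes>\<^bsub>TT L'\<^esub> pt L' \<one>\<^bsub>E\<^esub> l"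
    "\<And>f l. f \<in> F \<Longrightarrow> l \<in> carrier L' \<Longrightarrow> \<sigma>' (pt L' f l) = pt L' f l"
    "\<And>x. x \<in> carrier (TT L) \<Longrightarrow> \<sigma>' (id\<^sub>R L' f x) = id\<^sub>R L' f (\<sigma> x)"
    using base_change_endo[OF L L' f s(3) s(5)] by blast
  obtain \<rho>' where \<rho>': "\<rho>' \<in> ring_hom (TT L') (TT L')"
    "\<And>r l. r \<in> R \<Longrightarrow> l \<in> carrier L' \<Longrightarrow> \<rho>' (pt L' r l) = id\<^sub>R L' f (\<rho> (pt L r \<one>\<^bsub>L\<^esub>)) \<otimes>\<^bsub>TT L'\<^esub> pt L' \<one>\<^bsub>E\<^esub> l"
    "\<And>f l. f \<in> F \<Longrightarrow> l \<in> carrier L' \<Longrightarrow> \<rho>' (pt L' f l) = pt L' f l"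
    "\<And>x. x \<in> carrier (TT L) \<Longrightarrow> \<rho>' (id\<^sub>R L' f x) = id\<^sub>R L' f (\<rho> x)"
    using base_change_endo[OF L L' f \<rho>(1,2)] by blast
  have pt1: "pt L' r \<one>\<^bsub>L'\<^esub> = id\<^sub>R L' f (pt L r \<one>\<^bsub>L\<^esub>)" if "r \<in> R" for r
    using h(2)[OF that, of "\<one>\<^bsub>L\<^esub>"] fone by simp
  have idh: "(\<lambda>x. x) \<in> ring_hom (TT L') (TT L')" by (auto intro!: ring_hom_memI)
  have inv1: "\<rho>' (\<sigma>' x) = x" if x: "x \<in> carrier (TT L')" for x
    using L'.ring_hom_eq_on_tensor[OF L'.T.is_cring ring_hom_trans[OF \<sigma>'(1) \<rho>'(1)] idh _ _ x]
      tL ring_hom_closed[OF s(3)] by (simp add: pt1 \<sigma>'(3,4) \<rho>'(3,4) \<rho>(3))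
  have inv2: "\<sigma>' (\<rho>' x) = x" if x: "x \<in> carrier (TT L')" for x
    using L'.ring_hom_eq_on_tensor[OF L'.T.is_cring ring_hom_trans[OF \<rho>'(1) \<sigma>'(1)] idh _ _ x]
      tL ring_hom_closed[OF \<rho>(1)] by (simp add: pt1 \<sigma>'(3,4) \<rho>'(3,4) \<rho>(4))
  define \<tau>0 where "\<tau>0 = restrict \<sigma>' (carrier (TT L'))"
  have bij: "bij_betw \<tau>0 (carrier (TT L')) (carrier (TT L'))"
    by (rule bij_betwI[where g = \<rho>'])
       (use inv1 inv2 ring_hom_closed[OF \<sigma>'(1)] ring_hom_closed[OF \<rho>'(1)] in \<open>auto simp: \<tau>0_def\<close>)
  have rh: "\<tau>0 \<in> ring_hom (TT L') (TT L')"
    unfolding \<tau>0_def by (rule L'.T.ring_hom_restrict[OF \<sigma>'(1)]) simp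
  have \<tau>0: "\<tau>0 \<in> carrier (Gal E F R \<theta> L')"
    unfolding Gal_iff[OF L']
  proof (intro conjI ballI allI)
    show "\<tau>0 \<in> extensional (carrier (TT L'))" by (simp add: \<tau>0_def)
    show "bij_betw \<tau>0 (carrier (TT L')) (carrier (TT L'))" by (rule bij)
    show "\<tau>0 \<in> ring_hom (TT L') (TT L')" by (rule rh)
  next
    fix r k assume r: "r \<in> R"
    have "\<tau>0 (pt L' (\<theta> r k) \<one>\<^bsub>L'\<^esub>) = id\<^sub>R L' f (\<sigma> (pt L (\<theta> r k) \<one>\<^bsub>L\<^esub>))"
      using r tL tL'[of "\<theta> r k" "\<one>\<^bsub>L'\<^esub>"] by (simp add: \<tau>0_def pt1 \<sigma>'(4))
    also have "\<dots> = \<Theta> L' (id\<^sub>R L' f (\<sigma> (pt L r \<one>\<^bsub>L\<^esub>))) k"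
      using r tL ring_hom_closed[OF s(3)] by (simp add: s(4) idR_Theta[OF L L' f])
    also have "id\<^sub>R L' f (\<sigma> (pt L r \<one>\<^bsub>L\<^esub>)) = \<tau>0 (pt L' r \<one>\<^bsub>L'\<^esub>)"
      using r tL tL'[of r "\<one>\<^bsub>L'\<^esub>"] by (simp add: \<tau>0_def pt1 \<sigma>'(4))
    finally show "\<tau>0 (pt L' (\<theta> r k) \<one>\<^bsub>L'\<^esub>) = \<Theta> L' (\<tau>0 (pt L' r \<one>\<^bsub>L'\<^esub>)) k" .
  next
    fix c l assume "c \<in> F" "l \<in> carrier L'"
    then show "\<tau>0 (pt L' c l) = pt L' c l" using tL'[of c l] by (simp add: \<tau>0_def \<sigma>'(3) in_E)
  qed
  have \<tau>0c: "\<tau>0 (id\<^sub>R L' f x) = id\<^sub>R L' f (\<sigma> x)" if "x \<in> carrier (TT L)" for x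
    using that hs by (simp add: \<tau>0_def \<sigma>'(4))
  have uniq: "\<tau> = \<tau>0" if "\<tau> \<in> carrier (Gal E F R \<theta> L')" "\<And>r. r \<in> R \<Longrightarrow> \<tau> (pt L' r \<one>\<^bsub>L'\<^esub>) = id\<^sub>R L' f (\<sigma> (pt L r \<one>\<^bsub>L\<^esub>))" for \<tau>
    by (rule Gal_eqI[OF L' that(1) \<tau>0]) (use that(2) \<tau>0c tL pt1 in simp)
  have "Gal_map E F R \<theta> L L' f \<sigma> = \<tau>0"
    unfolding Gal_map_def Let_def
  proof (rule the_equality)
    show "\<tau>0 \<in> carrier (Gal E F R \<theta> L') \<and> (\<forall>x\<in>carrier (TT L). \<tau>0 (id\<^sub>R L' f x) = id\<^sub>R L' f (\<sigma> x))"
      using \<tau>0 \<tau>0c by simp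
    fix \<tau> assume *: "\<tau> \<in> carrier (Gal E F R \<theta> L') \<and> (\<forall>x\<in>carrier (TT L). \<tau> (id\<^sub>R L' f x) = id\<^sub>R L' f (\<sigma> x))"
    show "\<tau> = \<tau>0" by (rule uniq) (use * pt1 tL in simp_all)
  qed
  then show "Gal_map E F R \<theta> L L' f \<sigma> \<in> carrier (Gal E F R \<theta> L')"
    "x \<in> carrier (TT L) \<Longrightarrow> Gal_map E F R \<theta> L L' f \<sigma> (id\<^sub>R L' f x) = id\<^sub>R L' f (\<sigma> x)"
    "\<tau> \<in> carrier (Gal E F R \<theta> L') \<Longrightarrow> (\<And>r. r \<in> R \<Longrightarrow> \<tau> (pt L' r \<one>\<^bsub>L'\<^esub>) = id\<^sub>R L' f (\<sigma> (pt L r \<one>\<^bsub>L\<^esub>))) \<Longrightarrow>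
      Gal_map E F R \<theta> L L' f \<sigma> = \<tau>"
    using \<tau>0 \<tau>0c uniq by simp_all
qed

end

section \<open>The Frobenius endomorphism\<close>

context cring
begin

lemma binomial_expansion:
  assumes x: "x \<in> carrier R" and y: "y \<in> carrier R"
  shows "(x \<oplus> y) [^] (n::nat) = (\<Oplus>k\<in>{..n}. [(n choose k)] \<cdot> (x [^] k \<otimes> y [^] (n - k)))"
proof (induction n)
  case 0
  then show ?case using x y by simp
next
  case (Suc n)
  let ?B = "\<lambda>n k. [(n choose k)] \<cdot> (x [^] k \<otimes> y [^] (n - k))"
  have B: "?B n k \<in> carrier R" for n k using x y by simp
  \<comment> \<open>Pascal's rule. At \<open>k = n\<close> the second summand is zero, because its
    binomial coefficient is.\<close>
  have step: "?B (Suc n) (Suc k) = x \<otimes> ?B n k \<oplus> y \<otimes> ?B n (Suc k)" if "k \<le> n" for k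
  proof (cases "k = n")
    case True
    then show ?thesis using x y by (simp add: add_pow_rdistr m_ac binomial_eq_0)
  next
    case False
    then have "n - k = Suc (n - Suc k)" using that by simp
    then show ?thesis using x y by (simp add: add_pow_rdistr add.nat_pow_mult[symmetric] m_ac)
  qed
  have "(\<Oplus>k\<in>{..Suc n}. ?B (Suc n) k) = (\<Oplus>k\<in>{..n}. ?B (Suc n) (Suc k)) \<oplus> ?B (Suc n) 0"
    using B by (intro finsum_Suc2) auto
  also have "(\<Oplus>k\<in>{..n}. ?B (Suc n) (Suc k)) = (\<Oplus>k\<in>{..n}. x \<otimes> ?B n k \<oplus> y \<otimes> ?B n (Suc k))"
    using B x y by (intro finsum_cong' step) auto
  also have "\<dots> = (\<Oplus>k\<in>{..n}. x \<otimes> ?B n k) \<oplus> (\<Oplus>k\<in>{..n}. y \<otimes> ?B n (Suc k))"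
    using B x y by (intro finsum_addf) auto
  also have "\<dots> \<oplus> ?B (Suc n) 0 = (\<Oplus>k\<in>{..n}. x \<otimes> ?B n k) \<oplus> ((\<Oplus>k\<in>{..n}. y \<otimes> ?B n (Suc k)) \<oplus> y \<otimes> ?B n 0)"
    using B x y by (simp add: a_assoc finsum_closed m_comm)
  also have "(\<Oplus>k\<in>{..n}. y \<otimes> ?B n (Suc k)) \<oplus> y \<otimes> ?B n 0 = (\<Oplus>k\<in>{..Suc n}. y \<otimes> ?B n k)"
    using B y by (intro finsum_Suc2[symmetric]) auto
  also have "\<dots> = y \<otimes> ?B n (Suc n) \<oplus> (\<Oplus>k\<in>{..n}. y \<otimes> ?B n k)"
    using B y by (intro finsum_Suc) auto
  also have "\<dots> = (\<Oplus>k\<in>{..n}. y \<otimes> ?B n k)"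
    using B x y by (simp add: finsum_closed binomial_eq_0)
  also have "(\<Oplus>k\<in>{..n}. x \<otimes> ?B n k) = x \<otimes> (\<Oplus>k\<in>{..n}. ?B n k)"
    using B x by (intro finsum_rdistr[symmetric]) auto
  also have "(\<Oplus>k\<in>{..n}. y \<otimes> ?B n k) = y \<otimes> (\<Oplus>k\<in>{..n}. ?B n k)"
    using B y by (intro finsum_rdistr[symmetric]) auto
  finally show ?case
    using Suc B x y by (simp add: l_distr m_comm finsum_closed)
qed

lemma add_pow_eq_mult: "x \<in> carrier R \<Longrightarrow> [(n::nat)] \<cdot> x = ([n] \<cdot> \<one>) \<otimes> x"
  by (simp add: add_pow_ldistr)

lemma add_pow_char_dvd:
  assumes "[(p::nat)] \<cdot> \<one> = \<zero>" "p dvd n" "x \<in> carrier R"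
  shows "[n] \<cdot> x = \<zero>"
proof -
  obtain m where "n = p * m" using assms(2) by auto
  then have "[n] \<cdot> x = [m] \<cdot> ([p] \<cdot> x)" using assms(3) add.nat_pow_pow[of x m p] by simp
  also have "[p] \<cdot> x = \<zero>" using assms add_pow_eq_mult[of x p] by simp
  finally show ?thesis by simp
qed

text \<open>Asking only for \<open>p \<cdot> 1 = 0\<close> in a commutative ring matters: the
  coordinate ring \<open>A\<close> and the tensor product \<open>R \<otimes> A\<close> will contain
  nilpotents, and there \<open>p\<close>-th powers must still be additive.\<close>

lemma frobenius_add_prime:
  assumes p: "Factorial_Ring.prime (p::nat)" and ch: "[p] \<cdot> \<one> = \<zero>" and x: "x \<in> carrier R" and y: "y \<in> carrier R"
  shows "(x \<oplus> y) [^] p = x [^] p \<oplus> y [^] p"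
proof -
  have p0: "p > 0" using p by (simp add: prime_gt_0_nat)
  let ?B = "\<lambda>k. [(p choose k)] \<cdot> (x [^] k \<otimes> y [^] (p - k))"
  have B: "?B k \<in> carrier R" for k using x y by simp
  have "(x \<oplus> y) [^] p = (\<Oplus>k\<in>{..p}. ?B k)" by (rule binomial_expansion[OF x y])
  also have "\<dots> = (\<Oplus>k\<in>{0, p}. ?B k)"
  proof (rule add.finprod_mono_neutral_cong_right)
    show "?B k = \<zero>" if "k \<in> {..p} - {0, p}" for k
      using that x y by (intro add_pow_char_dvd[OF ch] dvd_choose_prime p) auto
  qed (use B in auto)
  also have "\<dots> = ?B 0 \<oplus> (\<Oplus>k\<in>{p}. ?B k)" using x y p0 by (intro finsum_insert) auto
  also have "(\<Oplus>k\<in>{p}. ?B k) = ?B p \<oplus> (\<Oplus>k\<in>{}. ?B k)" using x y by (intro finsum_insert) auto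
  also have "\<dots> = x [^] p" using x y by simp
  also have "?B 0 = y [^] p" using x y by simp
  finally show ?thesis using x y by (simp add: a_comm)
qed

lemma frobenius_add:
  assumes p: "Factorial_Ring.prime (p::nat)" and ch: "[p] \<cdot> \<one> = \<zero>" and x: "x \<in> carrier R" and y: "y \<in> carrier R"
  shows "(x \<oplus> y) [^] (p ^ e) = x [^] (p ^ e) \<oplus> y [^] (p ^ e)"
proof (induction e)
  case 0
  then show ?case using x y by simp
next
  case (Suc e)
  have *: "z [^] (p ^ Suc e) = (z [^] (p ^ e)) [^] p" if "z \<in> carrier R" for z
    using that by (simp add: nat_pow_pow mult.commute)
  show ?case using x y Suc by (simp add: * frobenius_add_prime[OF p ch] del: power_Suc)
qed

text \<open>Additivity applied to \<open>(x - y) + y\<close> avoids any discussion of the sign of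
  \<open>(-1)^q\<close>.\<close>

lemma frobenius_minus:
  assumes p: "Factorial_Ring.prime (p::nat)" and ch: "[p] \<cdot> \<one> = \<zero>" and x: "x \<in> carrier R" and y: "y \<in> carrier R"
  shows "(x \<ominus> y) [^] (p ^ e) = x [^] (p ^ e) \<ominus> y [^] (p ^ e)"
proof -
  have "x \<ominus> y \<oplus> y = x" using x y by (simp add: a_minus_def a_assoc l_neg)
  then have "x [^] (p ^ e) = (x \<ominus> y) [^] (p ^ e) \<oplus> y [^] (p ^ e)"
    using frobenius_add[OF p ch, of "x \<ominus> y" y e] x y by simp
  then show ?thesis using x y by (simp add: a_minus_def a_assoc r_neg)
qed

lemma frobenius_finsum:
  assumes p: "Factorial_Ring.prime (p::nat)" and ch: "[p] \<cdot> \<one> = \<zero>" and f: "finite V" "f \<in> V \<rightarrow> carrier R"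
  shows "(finsum R f V) [^] (p ^ e) = (\<Oplus>v\<in>V. f v [^] (p ^ e))"
  using f
proof (induction rule: finite_induct)
  case empty
  then show ?case using prime_gt_0_nat[OF p] by (simp add: nat_pow_zero)
next
  case (insert v V)
  then show ?case by (simp add: finsum_insert frobenius_add[OF p ch] Pi_iff)
qed

end

lemma ring_hom_add_pow:
  assumes "ring A" "ring B" "h \<in> ring_hom A B" "x \<in> carrier A"
  shows "h ([(n::nat)] \<cdot>\<^bsub>A\<^esub> x) = [n] \<cdot>\<^bsub>B\<^esub> h x"
proof -
  interpret A: ring A by fact
  interpret B: ring B by fact
  interpret h: ring_hom_ring A B h by (intro ring_hom_ringI2 assms)
  show ?thesis by (induction n) (use assms(4) in auto)
qed

lemma ring_hom_nat_pow:
  assumes "ring A" "ring B" "h \<in> ring_hom A B" "x \<in> carrier A"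
  shows "h (x [^]\<^bsub>A\<^esub> (n::nat)) = h x [^]\<^bsub>B\<^esub> n"
proof -
  interpret A: ring A by fact
  interpret B: ring B by fact
  interpret h: ring_hom_ring A B h by (intro ring_hom_ringI2 assms)
  show ?thesis by (induction n) (use assms(4) in auto)
qed

lemma ring_hom_char:
  assumes "ring A" "ring B" "h \<in> ring_hom A B" "[(n::nat)] \<cdot>\<^bsub>A\<^esub> \<one>\<^bsub>A\<^esub> = \<zero>\<^bsub>A\<^esub>"
  shows "[n] \<cdot>\<^bsub>B\<^esub> \<one>\<^bsub>B\<^esub> = \<zero>\<^bsub>B\<^esub>"
proof -
  interpret A: ring A by fact
  interpret B: ring B by fact
  interpret h: ring_hom_ring A B h by (intro ring_hom_ringI2 assms)
  show ?thesis using ring_hom_add_pow[OF assms(1-3), of "\<one>\<^bsub>A\<^esub>" n] assms(4) by simp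
qed

lemma sub_alg_pow: "x [^]\<^bsub>sub_alg E S\<^esub> (n::nat) = x [^]\<^bsub>E\<^esub> n"
  by (induction n) (simp_all add: nat_pow_def)

lemma sub_alg_add_pow: "[(n::nat)] \<cdot>\<^bsub>sub_alg E S\<^esub> x = [n] \<cdot>\<^bsub>E\<^esub> x"
  by (induction n) (simp_all add: add_pow_def nat_pow_def)

lemma (in tensor_product) t_pow:
  assumes "a \<in> carrier A" "b \<in> carrier B"
  shows "t a b [^]\<^bsub>T\<^esub> (n::nat) = t (a [^]\<^bsub>A\<^esub> n) (b [^]\<^bsub>B\<^esub> n)"
  by (induction n) (use assms in \<open>simp_all add: t_one t_mult\<close>)

lemma (in tensor_product) t_left_ring_hom: "(\<lambda>a. t a \<one>\<^bsub>B\<^esub>) \<in> ring_hom A T"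
  by (rule ring_hom_memI) (simp_all add: t_mult t_add_left t_one)

lemma (in tensor_product) t_right_ring_hom: "(\<lambda>b. t \<one>\<^bsub>A\<^esub> b) \<in> ring_hom B T"
  by (rule ring_hom_memI) (simp_all add: t_mult t_add_right t_one)

lemma (in algebra) scalar_ring_hom: "(\<lambda>c. c \<odot>\<^bsub>M\<^esub> \<one>\<^bsub>M\<^esub>) \<in> ring_hom R M"
proof (rule ring_hom_memI)
  fix x y assume xy: "x \<in> carrier R" "y \<in> carrier R"
  show "x \<odot>\<^bsub>M\<^esub> \<one>\<^bsub>M\<^esub> \<in> carrier M" using xy by simp
  show "(x \<otimes> y) \<odot>\<^bsub>M\<^esub> \<one>\<^bsub>M\<^esub> = (x \<odot>\<^bsub>M\<^esub> \<one>\<^bsub>M\<^esub>) \<otimes>\<^bsub>M\<^esub> (y \<odot>\<^bsub>M\<^esub> \<one>\<^bsub>M\<^esub>)"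
    using xy by (simp add: smult_assoc2 smult_assoc1)
  show "(x \<oplus> y) \<odot>\<^bsub>M\<^esub> \<one>\<^bsub>M\<^esub> = x \<odot>\<^bsub>M\<^esub> \<one>\<^bsub>M\<^esub> \<oplus>\<^bsub>M\<^esub> y \<odot>\<^bsub>M\<^esub> \<one>\<^bsub>M\<^esub>"
    using xy by (simp add: smult_l_distr)
qed simp

text \<open>The characteristic is the additive order of one. Primality comes from integrality: if
  \<open>p\<close> divides \<open>m * n\<close>, then the images of \<open>m\<close> and
  \<open>n\<close> have product zero.\<close>

lemma ring_char_field:
  assumes "field F" "ring_char F = p" "p > 0"
  shows "Factorial_Ring.prime p" "[p] \<cdot>\<^bsub>F\<^esub> \<one>\<^bsub>F\<^esub> = \<zero>\<^bsub>F\<^esub>"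
proof -
  interpret F: field F by fact
  have ord: "[n] \<cdot>\<^bsub>F\<^esub> \<one>\<^bsub>F\<^esub> = \<zero>\<^bsub>F\<^esub> \<longleftrightarrow> p dvd n" for n :: nat
    using F.add.pow_eq_id[of "\<one>\<^bsub>F\<^esub>" n] assms(2) by (simp add: ring_char_def add_pow_def)
  then show "[p] \<cdot>\<^bsub>F\<^esub> \<one>\<^bsub>F\<^esub> = \<zero>\<^bsub>F\<^esub>" by simp
  show "Factorial_Ring.prime p"
  proof (rule prime_natI)
    have "\<not> p dvd 1" using ord[of 1] F.one_not_zero by simp
    then show "p \<ge> 2" using assms(3) by (cases p; cases "p - 1") auto
    fix m n assume "p dvd m * n"
    then have "[(m * n)] \<cdot>\<^bsub>F\<^esub> \<one>\<^bsub>F\<^esub> = \<zero>\<^bsub>F\<^esub>" using ord by blast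
    moreover have "[(m * n)] \<cdot>\<^bsub>F\<^esub> \<one>\<^bsub>F\<^esub> = ([m] \<cdot>\<^bsub>F\<^esub> \<one>\<^bsub>F\<^esub>) \<otimes>\<^bsub>F\<^esub> ([n] \<cdot>\<^bsub>F\<^esub> \<one>\<^bsub>F\<^esub>)"
      using F.add_pow_eq_mult[of "[n] \<cdot>\<^bsub>F\<^esub> \<one>\<^bsub>F\<^esub>" m] F.add.nat_pow_pow[of "\<one>\<^bsub>F\<^esub>" m n] by (simp add: mult.commute)
    ultimately show "p dvd m \<or> p dvd n" using ord F.integral by (metis F.add.nat_pow_closed F.one_closed)
  qed
qed

section \<open>Nilpotent ideals\<close>

context cring
begin

abbreviation ipow :: "'a set \<Rightarrow> nat \<Rightarrow> 'a set" where
  "ipow I n \<equiv> (ideal_prod R I ^^ n) (carrier R)"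

lemma ipow_ideal: "ideal I R \<Longrightarrow> ideal (ipow I n) R"
  by (induction n) (simp_all add: oneideal ideal_prod_is_ideal)

lemma pow_in_ipow:
  assumes "ideal I R" "x \<in> I"
  shows "x [^] n \<in> ipow I n"
proof (induction n)
  case (Suc n)
  have x: "x \<in> carrier R" using assms ideal.Icarr by metis
  have "x [^] Suc n = x \<otimes> x [^] n" using x by (simp add: m_comm)
  then show ?case using Suc assms(2) by (simp add: ideal_prod.prod)
qed simp

lemma ideal_prod_subset:
  assumes "ideal S R" "\<And>i j. i \<in> I \<Longrightarrow> j \<in> J \<Longrightarrow> i \<otimes> j \<in> S"
  shows "ideal_prod R I J \<subseteq> S"
proof
  interpret S: ideal S R by fact
  fix x assume "x \<in> ideal_prod R I J"
  then show "x \<in> S" by induction (simp_all add: assms(2))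
qed

lemma colon_ideal:
  assumes "ideal S R" "i \<in> carrier R"
  shows "ideal {z \<in> carrier R. i \<otimes> z \<in> S} R"
proof -
  interpret S: ideal S R by fact
  show ?thesis
  proof (rule idealI)
    show "subgroup {z \<in> carrier R. i \<otimes> z \<in> S} (add_monoid R)"
      by (rule add.subgroupI) (use assms(2) in \<open>auto simp: r_minus r_distr intro!: exI[of _ \<zero>]\<close>)
    fix a x assume ax: "a \<in> {z \<in> carrier R. i \<otimes> z \<in> S}" "x \<in> carrier R"
    have "i \<otimes> (x \<otimes> a) = x \<otimes> (i \<otimes> a)" using ax assms(2) by (simp add: m_lcomm)
    then show 1: "x \<otimes> a \<in> {z \<in> carrier R. i \<otimes> z \<in> S}" using ax S.I_l_closed by simp
    then show "a \<otimes> x \<in> {z \<in> carrier R. i \<otimes> z \<in> S}" using ax m_comm[of a x] by simp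
  qed (rule ring_axioms)
qed

text \<open>Iterated ideal products are nested to the right, so the left-hand side is not literally
  a product of \<open>ipow I m\<close> with \<open>N\<close>. Replacing \<open>S\<close> by its
  colon ideal with respect to an element of \<open>I\<close> strips off one factor at a time and
  avoids associativity of ideal products.\<close>

lemma ipow_add_subset:
  assumes I: "ideal I R" and N: "N \<subseteq> carrier R" and "ideal S R" "\<And>x y. x \<in> ipow I m \<Longrightarrow> y \<in> N \<Longrightarrow> x \<otimes> y \<in> S"
  shows "(ideal_prod R I ^^ m) N \<subseteq> S"
  using assms(3-)
proof (induction m arbitrary: S)
  case 0
  show ?case
  proof
    fix y assume y: "y \<in> (ideal_prod R I ^^ 0) N"
    then have "\<one> \<otimes> y \<in> S" using 0(2)[of \<one> y] by simp
    then show "y \<in> S" using y N by auto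
  qed
next
  case (Suc m)
  interpret I: ideal I R by fact
  interpret M: ideal "ipow I m" R by (rule ipow_ideal[OF I])
  interpret S: ideal S R by fact
  have "ideal_prod R I ((ideal_prod R I ^^ m) N) \<subseteq> S"
  proof (rule ideal_prod_subset[OF Suc.prems(1)])
    fix i z assume i: "i \<in> I" and z: "z \<in> (ideal_prod R I ^^ m) N"
    have ic: "i \<in> carrier R" using i by simp
    have "(ideal_prod R I ^^ m) N \<subseteq> {z \<in> carrier R. i \<otimes> z \<in> S}"
    proof (rule Suc.IH[OF colon_ideal[OF Suc.prems(1) ic]])
      fix x y assume xy: "x \<in> ipow I m" "y \<in> N"
      then have "i \<otimes> x \<in> ipow I (Suc m)" using i by (simp add: ideal_prod.prod)
      then have "(i \<otimes> x) \<otimes> y \<in> S" using Suc.prems(2) xy by blast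
      moreover have "x \<in> carrier R" "y \<in> carrier R" using xy N by auto
      ultimately show "x \<otimes> y \<in> {z \<in> carrier R. i \<otimes> z \<in> S}" using ic by (simp add: m_assoc)
    qed
    then show "i \<otimes> z \<in> S" using z by auto
  qed
  then show ?case by simp
qed

definition add_principal :: "'a set \<Rightarrow> 'a \<Rightarrow> 'a set" where
  "add_principal J c = {j \<oplus> r \<otimes> c | j r. j \<in> J \<and> r \<in> carrier R}"

lemma add_principal_ideal:
  assumes "ideal J R" "c \<in> carrier R"
  shows "ideal (add_principal J c) R"
proof -
  interpret J: ideal J R by fact
  have I: "j \<oplus> r \<otimes> c \<in> add_principal J c" if "j \<in> J" "r \<in> carrier R" for j r
    using that by (auto simp: add_principal_def)
  have E: "\<exists>j r. x = j \<oplus> r \<otimes> c \<and> j \<in> J \<and> r \<in> carrier R" if "x \<in> add_principal J c" for x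
    using that by (auto simp: add_principal_def)
  show ?thesis
  proof (rule idealI)
    show "subgroup (add_principal J c) (add_monoid R)"
    proof (rule add.subgroupI)
      show "add_principal J c \<subseteq> carrier R" using assms(2) by (auto simp: add_principal_def)
      show "add_principal J c \<noteq> {}" using I[of \<zero> \<zero>] by auto
    next
      fix x assume "x \<in> add_principal J c"
      then obtain j r where *: "x = j \<oplus> r \<otimes> c" "j \<in> J" "r \<in> carrier R" using E by blast
      then have "\<ominus> x = \<ominus> j \<oplus> (\<ominus> r) \<otimes> c" using assms(2) by (simp add: minus_add l_minus)
      then show "\<ominus> x \<in> add_principal J c" using I[of "\<ominus> j" "\<ominus> r"] * by simp
    next
      fix x y assume "x \<in> add_principal J c" "y \<in> add_principal J c"
      then obtain j r j' r' where *: "x = j \<oplus> r \<otimes> c" "j \<in> J" "r \<in> carrier R"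
        "y = j' \<oplus> r' \<otimes> c" "j' \<in> J" "r' \<in> carrier R" using E by blast
      then have "x \<oplus> y = (j \<oplus> j') \<oplus> (r \<oplus> r') \<otimes> c" using assms(2) by (simp add: l_distr a_ac)
      then show "x \<oplus> y \<in> add_principal J c" using I[of "j \<oplus> j'" "r \<oplus> r'"] * by simp
    qed
    fix a x assume "a \<in> add_principal J c" and x: "x \<in> carrier R"
    then obtain j r where *: "a = j \<oplus> r \<otimes> c" "j \<in> J" "r \<in> carrier R" using E by blast
    then have "x \<otimes> a = x \<otimes> j \<oplus> (x \<otimes> r) \<otimes> c" using assms(2) x by (simp add: r_distr m_assoc)
    then show 1: "x \<otimes> a \<in> add_principal J c" using I[of "x \<otimes> j" "x \<otimes> r"] * x by (simp add: J.I_l_closed)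
    have "a \<in> carrier R" using * assms(2) by simp
    then show "a \<otimes> x \<in> add_principal J c" using 1 m_comm[of a x] x by simp
  qed (rule ring_axioms)
qed

text \<open>Modulo \<open>J\<close>, a multiple of \<open>c\<close> times a multiple of
  \<open>c^k\<close> is a multiple of \<open>c^(k+1)\<close>. So each further block of
  \<open>n\<close> factors gains one power of \<open>c\<close>.\<close>

lemma ipow_add_principal:
  assumes I: "ideal I R" and J: "ideal J R" and c: "c \<in> carrier R" and sub: "ipow I n \<subseteq> add_principal J c"
  shows "ipow I (n * k) \<subseteq> add_principal J (c [^] k)"
proof (induction k)
  case 0
  interpret J: ideal J R by fact
  show ?case
  proof
    fix x assume "x \<in> ipow I (n * 0)"
    then have "x \<in> carrier R" by simp
    then show "x \<in> add_principal J (c [^] (0::nat))" unfolding add_principal_def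
      by (intro CollectI exI[of _ \<zero>] exI[of _ x]) simp
  qed
next
  case (Suc k)
  interpret J: ideal J R by fact
  interpret IK: ideal "ipow I (n * k)" R by (rule ipow_ideal[OF I])
  have ck: "c [^] k \<in> carrier R" "c [^] Suc k \<in> carrier R" using c by simp_all
  have "(ideal_prod R I ^^ n) (ipow I (n * k)) \<subseteq> add_principal J (c [^] Suc k)"
  proof (rule ipow_add_subset[OF I _ add_principal_ideal[OF J ck(2)]])
    show "ipow I (n * k) \<subseteq> carrier R" using IK.a_subset .
    fix x y assume "x \<in> ipow I n" "y \<in> ipow I (n * k)"
    then have "x \<in> add_principal J c" "y \<in> add_principal J (c [^] k)" using sub Suc by auto
    then obtain j r j' r' where *: "x = j \<oplus> r \<otimes> c" "j \<in> J" "r \<in> carrier R"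
      "y = j' \<oplus> r' \<otimes> c [^] k" "j' \<in> J" "r' \<in> carrier R" by (auto simp: add_principal_def)
    have jc: "j \<in> carrier R" "j' \<in> carrier R" using * by auto
    have "x \<otimes> y = (j \<otimes> y \<oplus> (r \<otimes> c) \<otimes> j') \<oplus> (r \<otimes> r') \<otimes> c [^] Suc k"
      unfolding *(1,4) using * jc c by (simp add: l_distr r_distr m_ac a_ac)
    moreover have "j \<otimes> y \<oplus> (r \<otimes> c) \<otimes> j' \<in> J"
      using * jc c by (simp add: J.I_r_closed J.I_l_closed)
    ultimately show "x \<otimes> y \<in> add_principal J (c [^] Suc k)" using *
      unfolding add_principal_def by (intro CollectI exI[of _ "j \<otimes> y \<oplus> (r \<otimes> c) \<otimes> j'"] exI[of _ "r \<otimes> r'"]) simp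
  qed
  then show ?case by (simp add: funpow_add)
qed

text \<open>The auxiliary ideal \<open>J\<close> makes the induction possible: a generator
  \<open>c\<close> is moved into \<open>J\<close>, and \<open>ipow_add_principal\<close> takes it
  out again because \<open>c^q\<close> is zero. With \<open>J\<close> the zero ideal the result is
  that finitely many nilpotent generators give a nilpotent ideal.\<close>

lemma nilpotent_generators_ipow:
  assumes I: "ideal I R" and C: "finite C" "C \<subseteq> carrier R" and nil: "\<And>c. c \<in> C \<Longrightarrow> c [^] (q::nat) = \<zero>"
    and J: "ideal J R" and gen: "\<And>J'. ideal J' R \<Longrightarrow> J \<subseteq> J' \<Longrightarrow> C \<subseteq> J' \<Longrightarrow> I \<subseteq> J'"
  shows "\<exists>n. ipow I n \<subseteq> J"
  using C nil J gen
proof (induction arbitrary: J rule: finite_induct)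
  case empty
  interpret I: ideal I R by fact
  have "I \<subseteq> J" using empty by blast
  moreover have "ipow I 1 \<subseteq> I" using ideal_prod_inter[OF I oneideal] by simp
  ultimately show ?case by blast
next
  case (insert c C)
  interpret J: ideal J R by fact
  have c: "c \<in> carrier R" using insert by simp
  let ?J = "add_principal J c"
  have id: "ideal ?J R" by (rule add_principal_ideal[OF insert.prems(3) c])
  have JJ: "J \<subseteq> ?J"
  proof
    fix j assume "j \<in> J"
    then show "j \<in> ?J" unfolding add_principal_def using c by (intro CollectI exI[of _ j] exI[of _ \<zero>]) simp
  qed
  have cJ: "c \<in> ?J" unfolding add_principal_def using c by (intro CollectI exI[of _ \<zero>] exI[of _ \<one>]) simp
  have "\<exists>n. ipow I n \<subseteq> ?J"
  proof (rule insert.IH)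
    fix J' assume "ideal J' R" "?J \<subseteq> J'" "C \<subseteq> J'"
    then show "I \<subseteq> J'" using insert.prems(4)[of J'] JJ cJ by blast
  qed (use insert id in auto)
  then obtain n where "ipow I n \<subseteq> ?J" by blast
  from ipow_add_principal[OF I insert.prems(3) c this, of q]
  have "ipow I (n * q) \<subseteq> add_principal J (c [^] q)" .
  also have "\<dots> \<subseteq> J" using insert.prems(2)[of c] by (auto simp: add_principal_def)
  finally show ?case by blast
qed

end

section \<open>The coordinate ring is generated by the coefficients of the universal automorphism\<close>

lemma subalgebra:
  assumes "algebra K A" "subring S A" "\<And>c. c \<in> carrier K \<Longrightarrow> c \<odot>\<^bsub>A\<^esub> \<one>\<^bsub>A\<^esub> \<in> S"
  shows "algebra K (A\<lparr>carrier := S\<rparr>)"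
proof -
  interpret A: algebra K A by fact
  note S = subringE[OF assms(2)]
  have SA: "\<And>x. x \<in> S \<Longrightarrow> x \<in> carrier A" using S(1) by auto
  have sm: "c \<odot>\<^bsub>A\<^esub> x \<in> S" if "c \<in> carrier K" "x \<in> S" for c x
    using S(6)[OF assms(3)[OF that(1)] that(2)] that SA by (simp add: A.smult_assoc2)
  have "cring (A\<lparr>carrier := S\<rparr>)"
    using A.subring_iff[OF S(1)] assms(2) A.subcring_iff[OF S(1)] A.subcringI'[OF assms(2)] by simp
  then show ?thesis
    by (intro algebraI)
       (auto simp: sm SA A.R_cring A.smult_l_distr A.smult_r_distr A.smult_assoc1 A.smult_assoc2)
qed

text \<open>Adds the representing pair \<open>(A, u)\<close>, the counit, and a finite set
  \<open>G\<close> generating \<open>R\<close> over \<open>F\<close>. Generation is recorded as the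
  induction principle \<open>R_induct\<close>; it has no clause for negatives, since
  \<open>-1\<close> lies in \<open>F\<close>.\<close>

locale ppv_gal = ppv E F R \<theta>
  for E :: "('e, 'b) ring_scheme" and F R :: "'e set" and \<theta> :: "'e \<Rightarrow> 'i::finite multiindex \<Rightarrow> 'e" +
  fixes G :: "'e set" and p :: nat and A :: "('e, 'u) module"
    and u :: "(('e \<times> 'u) \<Rightarrow>\<^sub>0 int) set \<Rightarrow> (('e \<times> 'u) \<Rightarrow>\<^sub>0 int) set" and \<epsilon> :: "'u \<Rightarrow> 'e"
  assumes finite_G: "finite G" and G_subset_R: "G \<subseteq> R"
    and R_induct [consumes 1, case_names F G add mult]: "\<And>Q r. r \<in> R \<Longrightarrow> (\<And>f. f \<in> F \<Longrightarrow> Q f) \<Longrightarrow> (\<And>g. g \<in> G \<Longrightarrow> Q g) \<Longrightarrow>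
      (\<And>x y. x \<in> R \<Longrightarrow> y \<in> R \<Longrightarrow> Q x \<Longrightarrow> Q y \<Longrightarrow> Q (x \<oplus>\<^bsub>E\<^esub> y)) \<Longrightarrow>
      (\<And>x y. x \<in> R \<Longrightarrow> y \<in> R \<Longrightarrow> Q x \<Longrightarrow> Q y \<Longrightarrow> Q (x \<otimes>\<^bsub>E\<^esub> y)) \<Longrightarrow> Q r"
    and prime_p: "Factorial_Ring.prime p" and char_E: "[p] \<cdot>\<^bsub>E\<^esub> \<one>\<^bsub>E\<^esub> = \<zero>\<^bsub>E\<^esub>"
    and perfect_K: "\<And>c. c \<in> carrier (const_ring E F \<theta>) \<Longrightarrow> \<exists>d\<in>carrier (const_ring E F \<theta>). d [^]\<^bsub>E\<^esub> p = c"
    and algebra_A: "algebra (const_ring E F \<theta>) A" and u_Gal: "u \<in> carrier (Gal E F R \<theta> A)"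
    and represents: "\<And>L :: ('e, 'u) module. algebra (const_ring E F \<theta>) L \<Longrightarrow>
      bij_betw (\<lambda>f. Gal_map E F R \<theta> A L f u) (alg_hom (const_ring E F \<theta>) A L) (carrier (Gal E F R \<theta> L))"
    and counit_hom: "\<epsilon> \<in> alg_hom (const_ring E F \<theta>) A (const_ring E F \<theta>)"
    and counit_one: "Gal_map E F R \<theta> A (const_ring E F \<theta>) \<epsilon> u = \<one>\<^bsub>Gal E F R \<theta> (const_ring E F \<theta>)\<^esub>"
begin

sublocale A: tensor_product K RR A by (rule tp[OF algebra_A])
sublocale KK: tensor_product K RR K by (rule tp[OF algebra_K_K])

lemma perfect_K_pow: "c \<in> KC \<Longrightarrow> \<exists>d\<in>KC. d [^]\<^bsub>E\<^esub> (p ^ e) = c"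
proof (induction e arbitrary: c)
  case 0
  then show ?case by (intro bexI[of _ c]) (simp_all add: in_E)
next
  case (Suc e)
  then obtain d where d: "d \<in> KC" "d [^]\<^bsub>E\<^esub> (p ^ e) = c" by blast
  then obtain d' where d': "d' \<in> KC" "d' [^]\<^bsub>E\<^esub> p = d" using perfect_K by blast
  have "d' [^]\<^bsub>E\<^esub> (p ^ Suc e) = c" using d d' E.nat_pow_pow[of d' p "p ^ e"] by (simp add: in_E)
  then show ?case using d' by blast
qed

lemma E_pow_zero: "x \<in> carrier E \<Longrightarrow> x [^]\<^bsub>E\<^esub> (n::nat) = \<zero>\<^bsub>E\<^esub> \<Longrightarrow> x = \<zero>\<^bsub>E\<^esub>"
  by (induction n) (auto simp: E.integral_iff)

lemma char_RR: "[p] \<cdot>\<^bsub>RR\<^esub> \<one>\<^bsub>RR\<^esub> = \<zero>\<^bsub>RR\<^esub>"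
  using char_E by (simp add: sub_alg_add_pow)

lemma char_K: "[p] \<cdot>\<^bsub>K\<^esub> \<one>\<^bsub>K\<^esub> = \<zero>\<^bsub>K\<^esub>"
  using char_E sub_alg_add_pow[of E KC p] K_eq by simp

lemma char_A: "[p] \<cdot>\<^bsub>A\<^esub> \<one>\<^bsub>A\<^esub> = \<zero>\<^bsub>A\<^esub>"
  by (rule ring_hom_char[OF K.ring_axioms A.B.ring_axioms A.B.scalar_ring_hom char_K])

lemma char_TA: "[p] \<cdot>\<^bsub>TT A\<^esub> \<one>\<^bsub>TT A\<^esub> = \<zero>\<^bsub>TT A\<^esub>"
  by (rule ring_hom_char[OF RR.ring_axioms A.T.ring_axioms A.t_left_ring_hom char_RR])

lemma p_pow_pos: "p ^ e > 0" using prime_gt_0_nat[OF prime_p] by simp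

text \<open>Over a perfect field the coefficients of a relation among the powers are themselves
  \<open>q\<close>-th powers. By Frobenius the relation is then the \<open>q\<close>-th power of a
  combination of the original vectors, and that combination vanishes because \<open>E\<close> has no
  nilpotents. Injectivity uses the same two facts.\<close>

lemma lin_indep_pow:
  assumes V: "finite V" "V \<subseteq> R" "lin_indep K RR V"
  shows "inj_on (\<lambda>v. v [^]\<^bsub>E\<^esub> (p ^ e)) V" and "lin_indep K RR ((\<lambda>v. v [^]\<^bsub>E\<^esub> (p ^ e)) ` V)"
proof -
  let ?q = "p ^ e" and ?P = "\<lambda>v. v [^]\<^bsub>E\<^esub> (p ^ e)"
  have VR: "\<And>v. v \<in> V \<Longrightarrow> v \<in> R" using V by auto
  have PR: "\<And>v. v \<in> R \<Longrightarrow> ?P v \<in> R" using RR.nat_pow_closed[of _ ?q] by (simp add: sub_alg_pow)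
  show inj: "inj_on ?P V"
  proof (rule inj_onI)
    fix x y assume xy: "x \<in> V" "y \<in> V" "?P x = ?P y"
    have xyE: "x \<in> carrier E" "y \<in> carrier E" using xy VR by auto
    have "?P (x \<ominus>\<^bsub>E\<^esub> y) = ?P x \<ominus>\<^bsub>E\<^esub> ?P y"
      by (rule E.frobenius_minus[OF prime_p char_E xyE])
    also have "\<dots> = \<zero>\<^bsub>E\<^esub>" using xy(3) xyE by simp
    finally have "x \<ominus>\<^bsub>E\<^esub> y = \<zero>\<^bsub>E\<^esub>" using xyE E_pow_zero[of "x \<ominus>\<^bsub>E\<^esub> y" "p ^ e"] by simp
    then show "x = y" using xyE by simp
  qed
  show "lin_indep K RR (?P ` V)"
    unfolding lin_indep_def
  proof (intro ballI impI)
    fix c w assume c: "c \<in> ?P ` V \<rightarrow> KC" and z: "(\<Oplus>\<^bsub>RR\<^esub>v\<in>?P ` V. c v \<odot>\<^bsub>RR\<^esub> v) = \<zero>\<^bsub>RR\<^esub>" and w: "w \<in> ?P ` V"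
    have "\<forall>v\<in>V. \<exists>d\<in>KC. ?P d = c (?P v)" using c perfect_K_pow by blast
    then obtain d where d: "\<And>v. v \<in> V \<Longrightarrow> d v \<in> KC" "\<And>v. v \<in> V \<Longrightarrow> ?P (d v) = c (?P v)" by metis
    have cK: "\<And>v. v \<in> V \<Longrightarrow> c (?P v) \<in> KC" using c by auto
    have dv: "\<And>v. v \<in> V \<Longrightarrow> d v \<otimes>\<^bsub>E\<^esub> v \<in> R"
      using RR.m_closed d VR by (simp add: in_E(5))
    have cv: "\<And>v. v \<in> V \<Longrightarrow> c (?P v) \<otimes>\<^bsub>E\<^esub> ?P v \<in> R"
      using RR.m_closed cK PR VR by (simp add: in_E(5))
    let ?S = "\<Oplus>\<^bsub>RR\<^esub>v\<in>V. d v \<odot>\<^bsub>RR\<^esub> v"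
    have SR: "?S \<in> R" using RR.finsum_closed[of "\<lambda>v. d v \<odot>\<^bsub>RR\<^esub> v" V] dv by simp
    have "?S [^]\<^bsub>RR\<^esub> ?q = (\<Oplus>\<^bsub>RR\<^esub>v\<in>V. (d v \<odot>\<^bsub>RR\<^esub> v) [^]\<^bsub>RR\<^esub> ?q)"
      by (rule RR.frobenius_finsum[OF prime_p char_RR V(1)]) (use dv in simp)
    also have "\<dots> = (\<Oplus>\<^bsub>RR\<^esub>v\<in>V. c (?P v) \<otimes>\<^bsub>E\<^esub> ?P v)"
      by (rule RR.finsum_cong') (use d VR cv in \<open>auto simp: sub_alg_pow E.nat_pow_distrib in_E(1,3)\<close>)
    also have "\<dots> = (\<Oplus>\<^bsub>RR\<^esub>v\<in>?P ` V. c v \<odot>\<^bsub>RR\<^esub> v)"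
      using RR.finsum_reindex[OF _ inj, of "\<lambda>v. c v \<odot>\<^bsub>RR\<^esub> v"] cv by (simp add: Pi_iff)
    also have "\<dots> = \<zero>\<^bsub>E\<^esub>" using z by simp
    finally have "?S = \<zero>\<^bsub>E\<^esub>" using SR E_pow_zero[of ?S ?q] by (simp add: sub_alg_pow in_E)
    then have "\<forall>v\<in>V. d v = \<zero>\<^bsub>E\<^esub>" using V(3) d(1) unfolding lin_indep_def by simp
    moreover obtain v where v: "v \<in> V" "w = ?P v" using w by blast
    ultimately have "c w = ?P \<zero>\<^bsub>E\<^esub>" using d(2)[of v] by simp
    then show "c w = \<zero>\<^bsub>K\<^esub>" using p_pow_pos[of e] by (simp add: E.nat_pow_zero)
  qed
qed

section \<open>Expansions of elements of \<open>R \<otimes> A\<close>\<close>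

definition expansion :: "(('e \<times> 'u) \<Rightarrow>\<^sub>0 int) set \<Rightarrow> 'e set \<Rightarrow> ('e \<Rightarrow> 'u) \<Rightarrow> bool" where
  "expansion x V b \<longleftrightarrow> finite V \<and> V \<subseteq> R \<and> lin_indep K RR V \<and> b \<in> V \<rightarrow> carrier A \<and> x = (\<Oplus>\<^bsub>TT A\<^esub>v\<in>V. pt A v (b v))"

lemma ex_expansion: "x \<in> carrier (TT A) \<Longrightarrow> \<exists>V b. expansion x V b"
proof -
  assume "x \<in> carrier (TT A)"
  then obtain V b where "finite V" "V \<subseteq> carrier RR" "lin_indep K RR V" "b \<in> V \<rightarrow> carrier A"
      "x = (\<Oplus>\<^bsub>TT A\<^esub>v\<in>V. pt A v (b v))"
    by (rule A.tensor_left_expansion[OF field_K])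
  then show ?thesis by (intro exI[of _ V] exI[of _ b]) (simp add: expansion_def)
qed

lemma expansion_pow:
  assumes x: "expansion x V b"
  shows "x [^]\<^bsub>TT A\<^esub> (p ^ e) = (\<Oplus>\<^bsub>TT A\<^esub>v\<in>V. pt A (v [^]\<^bsub>E\<^esub> (p ^ e)) (b v [^]\<^bsub>A\<^esub> (p ^ e)))"
proof -
  have V: "finite V" "\<And>v. v \<in> V \<Longrightarrow> v \<in> R" "\<And>v. v \<in> V \<Longrightarrow> b v \<in> carrier A" "x = (\<Oplus>\<^bsub>TT A\<^esub>v\<in>V. pt A v (b v))"
    using x by (auto simp: expansion_def)
  have tA: "\<And>v. v \<in> V \<Longrightarrow> A.t v (b v) \<in> carrier A.T" using V A.t_closed by simp
  have "x [^]\<^bsub>TT A\<^esub> (p ^ e) = (\<Oplus>\<^bsub>TT A\<^esub>v\<in>V. A.t v (b v) [^]\<^bsub>TT A\<^esub> (p ^ e))"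
    unfolding V(4) by (rule A.T.frobenius_finsum[OF prime_p char_TA V(1)]) (use tA in simp)
  also have "\<dots> = (\<Oplus>\<^bsub>TT A\<^esub>v\<in>V. A.t (v [^]\<^bsub>E\<^esub> (p ^ e)) (b v [^]\<^bsub>A\<^esub> (p ^ e)))"
  proof (rule A.T.finsum_cong'[OF refl])
    have eq: "A.t v (b v) [^]\<^bsub>TT A\<^esub> (p ^ e) = A.t (v [^]\<^bsub>E\<^esub> (p ^ e)) (b v [^]\<^bsub>A\<^esub> (p ^ e))" if "v \<in> V" for v
      using A.t_pow[of v "b v" "p ^ e"] that V by (simp add: sub_alg_pow)
    then show "\<And>v. v \<in> V \<Longrightarrow> A.t v (b v) [^]\<^bsub>TT A\<^esub> (p ^ e) = A.t (v [^]\<^bsub>E\<^esub> (p ^ e)) (b v [^]\<^bsub>A\<^esub> (p ^ e))" .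
    show "(\<lambda>v. A.t (v [^]\<^bsub>E\<^esub> (p ^ e)) (b v [^]\<^bsub>A\<^esub> (p ^ e))) \<in> V \<rightarrow> carrier A.T"
    proof
      fix v assume "v \<in> V"
      then show "A.t (v [^]\<^bsub>E\<^esub> (p ^ e)) (b v [^]\<^bsub>A\<^esub> (p ^ e)) \<in> carrier A.T"
        using eq[of v] A.T.nat_pow_closed[OF tA, of v "p ^ e"] by simp
    qed
  qed
  finally show ?thesis .
qed

lemma expansion_pow_zero:
  assumes x: "expansion x V b" and z: "x [^]\<^bsub>TT A\<^esub> (p ^ e) = \<zero>\<^bsub>TT A\<^esub>" and v: "v \<in> V"
  shows "b v [^]\<^bsub>A\<^esub> (p ^ e) = \<zero>\<^bsub>A\<^esub>"
proof -
  let ?P = "\<lambda>v. v [^]\<^bsub>E\<^esub> (p ^ e)"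
  have V: "finite V" "V \<subseteq> R" "lin_indep K RR V" "\<And>v. v \<in> V \<Longrightarrow> b v \<in> carrier A"
    using x by (auto simp: expansion_def)
  note inj = lin_indep_pow(1)[OF V(1-3), of e]
  have PR: "\<And>v. v \<in> R \<Longrightarrow> ?P v \<in> R" using RR.nat_pow_closed[of _ "p ^ e"] by (simp add: sub_alg_pow)
  \<comment> \<open>Independence is known for the set of powers, so the coefficients are reindexed
    along the injective map from \<open>v\<close> to its \<open>q\<close>-th power.\<close>
  let ?b = "\<lambda>w. b (inv_into V ?P w) [^]\<^bsub>A\<^esub> (p ^ e)"
  have b: "?b (?P v) = b v [^]\<^bsub>A\<^esub> (p ^ e)" if "v \<in> V" for v
    using inv_into_f_f[OF inj that] by simp
  have "\<zero>\<^bsub>TT A\<^esub> = (\<Oplus>\<^bsub>TT A\<^esub>v\<in>V. A.t (?P v) (?b (?P v)))"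
    unfolding z[symmetric] expansion_pow[OF x]
    by (rule A.T.finsum_cong'[OF refl]) (use b V PR in \<open>auto intro!: A.t_closed\<close>)
  also have "\<dots> = (\<Oplus>\<^bsub>TT A\<^esub>w\<in>?P ` V. A.t w (?b w))"
    using A.T.finsum_reindex[OF _ inj, of "\<lambda>w. A.t w (?b w)"] b V PR by (auto simp: Pi_iff subset_iff)
  finally have "?b (?P v) = \<zero>\<^bsub>A\<^esub>"
    using lin_indep_pow(2)[OF V(1-3), of e] V PR b v
    by (intro A.tensor_left_indep_zero[OF field_K, of "?P ` V"]) auto
  then show ?thesis using b[OF v] by simp
qed

text \<open>The counit belongs to the neutral element, so the base change of \<open>u\<close> along
  \<open>\<epsilon>\<close> is the identity. Hence \<open>u x\<close> and \<open>x\<close> agree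
  modulo the augmentation ideal.\<close>

lemma counit_u: "x \<in> carrier (TT A) \<Longrightarrow> id\<^sub>R K \<epsilon> (u x) = id\<^sub>R K \<epsilon> x"
proof -
  assume x: "x \<in> carrier (TT A)"
  have "id\<^sub>R K \<epsilon> x \<in> carrier (TT K)"
    using ring_hom_closed[OF idR_hom(1)[OF algebra_A algebra_K_K counit_hom] x] .
  then have "\<one>\<^bsub>Gal E F R \<theta> K\<^esub> (id\<^sub>R K \<epsilon> x) = id\<^sub>R K \<epsilon> x"
    by (simp add: Gal_def Let_def BijGroup_def)
  then show ?thesis
    using base_change(2)[OF algebra_A algebra_K_K counit_hom u_Gal x] counit_one by simp
qed

text \<open>Base change along \<open>\<epsilon>\<close> leaves the left factors untouched and hence
  independent, so every single coefficient has to go to zero.\<close>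

lemma expansion_counit:
  assumes x: "expansion x V b" and z: "id\<^sub>R K \<epsilon> x = \<zero>\<^bsub>TT K\<^esub>" and v: "v \<in> V"
  shows "\<epsilon> (b v) = \<zero>\<^bsub>E\<^esub>"
proof -
  have V: "finite V" "V \<subseteq> R" "lin_indep K RR V" "\<And>v. v \<in> V \<Longrightarrow> b v \<in> carrier A" "x = (\<Oplus>\<^bsub>TT A\<^esub>v\<in>V. pt A v (b v))"
    using x by (auto simp: expansion_def)
  note h = idR_hom[OF algebra_A algebra_K_K counit_hom]
  have eK: "\<And>a. a \<in> carrier A \<Longrightarrow> \<epsilon> a \<in> KC" using ring_hom_closed[OF alg_hom_simps(1)[OF counit_hom]] .
  have h': "id\<^sub>R K \<epsilon> \<in> hom (add_monoid (TT A)) (add_monoid (TT K))"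
    using h(1) by (simp add: ring_hom_def hom_def)
  have "\<zero>\<^bsub>TT K\<^esub> = (\<Oplus>\<^bsub>TT K\<^esub>v\<in>V. id\<^sub>R K \<epsilon> (pt A v (b v)))"
    unfolding z[symmetric] V(5)
    by (rule add_monoid_hom_finsum[OF A.T.abelian_group_axioms KK.T.abelian_group_axioms h'])
       (use V A.t_closed in auto)
  also have "\<dots> = (\<Oplus>\<^bsub>TT K\<^esub>v\<in>V. pt K v (\<epsilon> (b v)))"
    by (rule KK.T.finsum_cong'[OF refl]) (use V h(2) eK in \<open>auto intro!: KK.t_closed\<close>)
  finally have "\<epsilon> (b v) = \<zero>\<^bsub>K\<^esub>"
    using V v eK by (intro KK.tensor_left_indep_zero[OF field_K, of V "\<lambda>v. \<epsilon> (b v)"]) auto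
  then show ?thesis by simp
qed

lemma pt_A_closed: "r \<in> R \<Longrightarrow> a \<in> carrier A \<Longrightarrow> pt A r a \<in> carrier (TT A)"
  using A.t_closed by simp

lemma pt_split: "r \<in> R \<Longrightarrow> a \<in> carrier A \<Longrightarrow> pt A r a = pt A r \<one>\<^bsub>A\<^esub> \<otimes>\<^bsub>TT A\<^esub> pt A \<one>\<^bsub>E\<^esub> a"
  using A.t_mult[of r "\<one>\<^bsub>A\<^esub>" "\<one>\<^bsub>E\<^esub>" a] by simp

text \<open>Rigidity of a representing object. If \<open>u\<close> and its inverse have coefficients
  in the subalgebra \<open>A0\<close>, they restrict to \<open>R \<otimes> A0\<close>, and the
  restriction \<open>u0\<close> is classified by some \<open>f : A \<rightarrow> A0\<close>.
  Followed by the inclusion, \<open>f\<close> classifies \<open>u\<close> again, so it is the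
  identity and \<open>A0\<close> is everything. The inverse \<open>w\<close> takes part because the
  restriction of \<open>u\<close> has to be bijective in order to be a point of the functor.\<close>

lemma generated_by_coefficients:
  assumes C: "C \<subseteq> carrier A" and
    w: "w \<in> ring_hom (TT A) (TT A)" "\<And>f l. f \<in> F \<Longrightarrow> l \<in> carrier A \<Longrightarrow> w (pt A f l) = pt A f l"
      "\<And>x. x \<in> carrier (TT A) \<Longrightarrow> w (u x) = x" "\<And>x. x \<in> carrier (TT A) \<Longrightarrow> u (w x) = x"
    and exp: "\<And>\<sigma> g. \<sigma> \<in> {u, w} \<Longrightarrow> g \<in> G \<Longrightarrow> \<exists>V b. expansion (\<sigma> (pt A g \<one>\<^bsub>A\<^esub>) \<ominus>\<^bsub>TT A\<^esub> pt A g \<one>\<^bsub>A\<^esub>) V b \<and> b ` V \<subseteq> C"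
  shows "carrier A = generate_ring A ((\<lambda>c. c \<odot>\<^bsub>A\<^esub> \<one>\<^bsub>A\<^esub>) ` KC \<union> C)"
proof -
  let ?H = "(\<lambda>c. c \<odot>\<^bsub>A\<^esub> \<one>\<^bsub>A\<^esub>) ` KC \<union> C"
  let ?S = "generate_ring A ?H"
  have H: "?H \<subseteq> carrier A" using C by auto
  have S: "subring ?S A" by (rule A.B.generate_ring_is_subring[OF H])
  note Ss = subringE[OF S]
  have SA: "\<And>x. x \<in> ?S \<Longrightarrow> x \<in> carrier A" using Ss(1) by auto
  define A0 where "A0 = A\<lparr>carrier := ?S\<rparr>"
  have A0: "algebra K A0" unfolding A0_def
    by (rule subalgebra[OF algebra_A S]) (auto intro: generate_ring.incl)
  have A0s [simp]: "carrier A0 = ?S" "\<one>\<^bsub>A0\<^esub> = \<one>\<^bsub>A\<^esub>" "x \<otimes>\<^bsub>A0\<^esub> y = x \<otimes>\<^bsub>A\<^esub> y" "x \<oplus>\<^bsub>A0\<^esub> y = x \<oplus>\<^bsub>A\<^esub> y" "c \<odot>\<^bsub>A0\<^esub> x = c \<odot>\<^bsub>A\<^esub> x"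
    "\<zero>\<^bsub>A0\<^esub> = \<zero>\<^bsub>A\<^esub>" for x y c
    by (simp_all add: A0_def)
  interpret A0: tensor_product K RR A0 by (rule tp[OF A0])
  define inc where "inc = restrict (\<lambda>x. x) ?S"
  have inc: "inc \<in> alg_hom K A0 A"
  proof -
    have "inc \<in> ring_hom A0 A"
      by (rule ring_hom_memI) (use Ss(3,6,7) SA in \<open>simp_all add: inc_def\<close>)
    moreover have "inc (c \<odot>\<^bsub>A0\<^esub> a) = c \<odot>\<^bsub>A\<^esub> inc a" if "c \<in> KC" "a \<in> carrier A0" for c a
      using A0.B.smult_closed[OF that] that by (simp add: inc_def)
    ultimately show ?thesis by (simp add: alg_hom_def) (simp add: inc_def)
  qed
  let ?j = "id\<^sub>R A inc"
  note j = idR_hom[OF A0 algebra_A inc]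
  have jt: "?j (A0.t r a) = A.t r a" if "r \<in> R" "a \<in> ?S" for r a
    using j(2)[OF that(1), of a] that by (simp add: inc_def)
  note js = ring_hom_closed[OF j(1)] ring_hom_add[OF j(1)] ring_hom_mult[OF j(1)] ring_hom_one[OF j(1)]
  have jh: "?j \<in> hom (add_monoid A0.T) (add_monoid A.T)"
    using j(1) by (simp add: ring_hom_def hom_def)
  note jm = add_monoid_hom_simps[OF A0.T.abelian_group_axioms A.T.abelian_group_axioms jh]
  \<comment> \<open>Injectivity of \<open>R \<otimes> A0 \<rightarrow> R \<otimes> A\<close>: an
    expansion with independent left factors over \<open>A0\<close> is also one over
    \<open>A\<close>, and there its coefficients must vanish.\<close>
  have j0: "x = \<zero>\<^bsub>A0.T\<^esub>" if x: "x \<in> carrier A0.T" and z: "?j x = \<zero>\<^bsub>A.T\<^esub>" for x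
  proof -
    obtain V b where V: "finite V" "V \<subseteq> carrier RR" "lin_indep K RR V" "b \<in> V \<rightarrow> carrier A0" "x = (\<Oplus>\<^bsub>A0.T\<^esub>v\<in>V. A0.t v (b v))"
      by (rule A0.tensor_left_expansion[OF field_K x])
    have bS: "\<And>v. v \<in> V \<Longrightarrow> b v \<in> ?S" and VR: "\<And>v. v \<in> V \<Longrightarrow> v \<in> R" using V by auto
    have "\<zero>\<^bsub>A.T\<^esub> = (\<Oplus>\<^bsub>A.T\<^esub>v\<in>V. ?j (A0.t v (b v)))"
      unfolding z[symmetric] V(5)
      by (rule add_monoid_hom_finsum[OF A0.T.abelian_group_axioms A.T.abelian_group_axioms jh])
         (use VR bS A0.t_closed in auto)
    also have "\<dots> = (\<Oplus>\<^bsub>A.T\<^esub>v\<in>V. A.t v (b v))"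
      by (rule A.T.finsum_cong'[OF refl]) (use VR bS SA jt in \<open>auto intro!: A.t_closed\<close>)
    finally have "b v = \<zero>\<^bsub>A\<^esub>" if "v \<in> V" for v
      using V that SA bS by (intro A.tensor_left_indep_zero[OF field_K, of V b]) auto
    then show ?thesis unfolding V(5)
      by (intro A0.T.add.finprod_one_eqI) (use VR A0.t_zero_right in auto)
  qed
  have jinj: "x = y" if "x \<in> carrier A0.T" "y \<in> carrier A0.T" "?j x = ?j y" for x y
    using j0[of "x \<ominus>\<^bsub>A0.T\<^esub> y"] that js(1) by (simp add: jm(5))
  let ?J = "?j ` carrier A0.T"
  have Jt: "A.t r a \<in> ?J" if "r \<in> R" "a \<in> ?S" for r a
    using jt[OF that] A0.t_closed[of r a] that by (metis A0s(1) imageI sub_alg_simps(1))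
  have Jadd: "x \<oplus>\<^bsub>A.T\<^esub> y \<in> ?J" if xy: "x \<in> ?J" "y \<in> ?J" for x y
  proof -
    obtain x' y' where "x' \<in> carrier A0.T" "y' \<in> carrier A0.T" "x = ?j x'" "y = ?j y'" using xy by blast
    then show ?thesis by (intro image_eqI[of _ _ "x' \<oplus>\<^bsub>A0.T\<^esub> y'"]) (simp_all add: js)
  qed
  have Jmult: "x \<otimes>\<^bsub>A.T\<^esub> y \<in> ?J" if xy: "x \<in> ?J" "y \<in> ?J" for x y
  proof -
    obtain x' y' where "x' \<in> carrier A0.T" "y' \<in> carrier A0.T" "x = ?j x'" "y = ?j y'" using xy by blast
    then show ?thesis by (intro image_eqI[of _ _ "x' \<otimes>\<^bsub>A0.T\<^esub> y'"]) (simp_all add: js)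
  qed
  note us = GalD[OF algebra_A u_Gal]
  have one1: "\<one>\<^bsub>A\<^esub> \<in> ?S" by (rule Ss(3))
  \<comment> \<open>Both \<open>u\<close> and \<open>w\<close> preserve the copy \<open>?J\<close>
    of \<open>R \<otimes> A0\<close>. On a generator \<open>g\<close> they differ from the identity
    by an expansion with coefficients in \<open>C\<close>; elements of \<open>F\<close> and the
    right factors are fixed.\<close>
  have stable: "\<sigma> x \<in> ?J" if \<sigma>: "\<sigma> \<in> {u, w}" and x: "x \<in> ?J" for \<sigma> x
  proof -
    have sh: "\<sigma> \<in> ring_hom A.T A.T" using \<sigma> us(3) w(1) by auto
    have sF: "\<sigma> (A.t f a) = A.t f a" if "f \<in> F" "a \<in> carrier A" for f a using \<sigma> us(5) w(2) that by auto
    note ss = ring_hom_closed[OF sh] ring_hom_add[OF sh] ring_hom_mult[OF sh]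
    have R1: "\<sigma> (A.t r \<one>\<^bsub>A\<^esub>) \<in> ?J" if "r \<in> R" for r
      using that
    proof (induction rule: R_induct)
      case (F f)
      then show ?case using sF Jt one1 by (simp add: in_E)
    next
      case (G g)
      then have g: "g \<in> R" using G_subset_R by auto
      obtain V b where Vb: "expansion (\<sigma> (pt A g \<one>\<^bsub>A\<^esub>) \<ominus>\<^bsub>TT A\<^esub> pt A g \<one>\<^bsub>A\<^esub>) V b" "b ` V \<subseteq> C"
        using exp[OF \<sigma> G] by blast
      then have V: "finite V" "\<And>v. v \<in> V \<Longrightarrow> v \<in> R" "\<And>v. v \<in> V \<Longrightarrow> b v \<in> ?S"
        and eq: "\<sigma> (pt A g \<one>\<^bsub>A\<^esub>) \<ominus>\<^bsub>TT A\<^esub> pt A g \<one>\<^bsub>A\<^esub> = (\<Oplus>\<^bsub>TT A\<^esub>v\<in>V. pt A v (b v))"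
        by (auto simp: expansion_def intro: generate_ring.incl)
      have "finsum A.T (\<lambda>v. A.t v (b v)) V' \<in> ?J" if "finite V'" "V' \<subseteq> V" for V'
        using that
      proof (induction rule: finite_induct)
        case empty
        have "\<zero>\<^bsub>A.T\<^esub> = ?j \<zero>\<^bsub>A0.T\<^esub>" by (simp add: jm(1))
        then show ?case using A0.T.zero_closed by (simp del: jm(1))
      next
        case (insert v V')
        have "finsum A.T (\<lambda>v. A.t v (b v)) (insert v V') = A.t v (b v) \<oplus>\<^bsub>A.T\<^esub> finsum A.T (\<lambda>v. A.t v (b v)) V'"
          using insert V SA by (intro A.T.finsum_insert) (auto intro!: A.t_closed simp: subset_iff)
        then show ?case using Jadd Jt insert V by auto
      qed
      from this[OF V(1)] have d: "\<sigma> (A.t g \<one>\<^bsub>A\<^esub>) \<ominus>\<^bsub>A.T\<^esub> A.t g \<one>\<^bsub>A\<^esub> \<in> ?J" using eq by simp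
      have c: "A.t g \<one>\<^bsub>A\<^esub> \<in> carrier A.T" using g pt_A_closed by simp
      have "\<sigma> (A.t g \<one>\<^bsub>A\<^esub>) = (\<sigma> (A.t g \<one>\<^bsub>A\<^esub>) \<ominus>\<^bsub>A.T\<^esub> A.t g \<one>\<^bsub>A\<^esub>) \<oplus>\<^bsub>A.T\<^esub> A.t g \<one>\<^bsub>A\<^esub>"
        using c ss(1)[OF c] by (simp add: a_minus_def A.T.a_assoc A.T.l_neg)
      then show ?case using Jadd[OF d Jt[OF g one1]] by simp
    next
      case (add x y)
      then show ?case using Jadd A.t_add_left[of x y "\<one>\<^bsub>A\<^esub>"] pt_A_closed by (simp add: ss)
    next
      case (mult x y)
      then show ?case using Jmult[OF mult(3,4)] A.t_mult[of x "\<one>\<^bsub>A\<^esub>" y "\<one>\<^bsub>A\<^esub>", symmetric] pt_A_closed by (simp add: ss)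
    qed
    obtain x' where x': "x' \<in> carrier A0.T" "x = ?j x'" using x by blast
    have "\<sigma> (?j x') \<in> ?J" using x'(1)
    proof (induction rule: A0.tensor_induct)
      case (pure r a)
      then have ra: "r \<in> R" "a \<in> ?S" by auto
      have "\<sigma> (?j (A0.t r a)) = \<sigma> (A.t r \<one>\<^bsub>A\<^esub>) \<otimes>\<^bsub>A.T\<^esub> A.t \<one>\<^bsub>E\<^esub> a"
        using ra SA by (simp add: jt pt_split[of r a] ss pt_A_closed sF)
      then show ?case using Jmult[OF R1[OF ra(1)] Jt[OF one_R ra(2)]] by simp
    next
      case (add x y)
      then show ?case using Jadd by (simp add: js ss)
    qed
    then show ?thesis using x' by simp
  qed
  let ?ji = "inv_into (carrier A0.T) ?j"
  have ji: "?ji y \<in> carrier A0.T" "?j (?ji y) = y" if "y \<in> ?J" for y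
    using inv_into_into[OF that] f_inv_into_f[OF that] by simp_all
  define u0 where "u0 = restrict (\<lambda>x. ?ji (u (?j x))) (carrier A0.T)"
  have u0c: "u0 x \<in> carrier A0.T" and u0j: "?j (u0 x) = u (?j x)" if "x \<in> carrier A0.T" for x
    using that stable[of u "?j x"] ji by (simp_all add: u0_def)
  define w0 where "w0 = (\<lambda>x. ?ji (w (?j x)))"
  have w0c: "w0 x \<in> carrier A0.T" and w0j: "?j (w0 x) = w (?j x)" if "x \<in> carrier A0.T" for x
    using that stable[of w "?j x"] ji by (simp_all add: w0_def)
  have u0: "u0 \<in> carrier (Gal E F R \<theta> A0)"
    unfolding Gal_iff[OF A0]
  proof (intro conjI ballI allI)
    show "u0 \<in> extensional (carrier (TT A0))" by (simp add: u0_def)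
    show "bij_betw u0 (carrier (TT A0)) (carrier (TT A0))"
    proof (rule bij_betwI[where g = w0])
      show "u0 \<in> carrier A0.T \<rightarrow> carrier A0.T" "w0 \<in> carrier A0.T \<rightarrow> carrier A0.T" using u0c w0c by auto
      show "w0 (u0 x) = x" if "x \<in> carrier A0.T" for x
        by (rule jinj) (use that in \<open>simp_all add: u0c w0c u0j w0j w(3) js\<close>)
      show "u0 (w0 x) = x" if "x \<in> carrier A0.T" for x
        by (rule jinj) (use that in \<open>simp_all add: u0c w0c u0j w0j w(4) js\<close>)
    qed
    show "u0 \<in> ring_hom (TT A0) (TT A0)"
    proof (rule ring_hom_memI)
      fix x y assume xy: "x \<in> carrier A0.T" "y \<in> carrier A0.T"
      show "u0 x \<in> carrier A0.T" using u0c xy by simp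
      show "u0 (x \<otimes>\<^bsub>A0.T\<^esub> y) = u0 x \<otimes>\<^bsub>A0.T\<^esub> u0 y"
        by (rule jinj) (use xy in \<open>simp_all add: u0c u0j js ring_hom_mult[OF us(3)]\<close>)
      show "u0 (x \<oplus>\<^bsub>A0.T\<^esub> y) = u0 x \<oplus>\<^bsub>A0.T\<^esub> u0 y"
        by (rule jinj) (use xy in \<open>simp_all add: u0c u0j js ring_hom_add[OF us(3)]\<close>)
    next
      show "u0 \<one>\<^bsub>A0.T\<^esub> = \<one>\<^bsub>A0.T\<^esub>"
        by (rule jinj) (simp_all add: u0c u0j js ring_hom_one[OF us(3)])
    qed
  next
    fix r k assume r: "r \<in> R"
    have t0: "A0.t r \<one>\<^bsub>A0\<^esub> \<in> carrier A0.T" "A0.t (\<theta> r k) \<one>\<^bsub>A0\<^esub> \<in> carrier A0.T"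
      using r one1 A0.t_closed by simp_all
    note T0s = add_monoid_hom_simps[OF A0.T.abelian_group_axioms A0.T.abelian_group_axioms Theta_hom(1)[OF A0]]
    show "u0 (A0.t (\<theta> r k) \<one>\<^bsub>A0\<^esub>) = \<Theta> A0 (u0 (A0.t r \<one>\<^bsub>A0\<^esub>)) k"
    proof (rule jinj)
      show "u0 (A0.t (\<theta> r k) \<one>\<^bsub>A0\<^esub>) \<in> carrier A0.T" using u0c t0 by simp
      show "\<Theta> A0 (u0 (A0.t r \<one>\<^bsub>A0\<^esub>)) k \<in> carrier A0.T" using u0c t0 T0s(3) by simp
      have "?j (u0 (A0.t (\<theta> r k) \<one>\<^bsub>A0\<^esub>)) = u (A.t (\<theta> r k) \<one>\<^bsub>A\<^esub>)" using r t0 one1 by (simp add: u0j jt)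
      also have "\<dots> = \<Theta> A (u (A.t r \<one>\<^bsub>A\<^esub>)) k" using us(4) r by simp
      also have "u (A.t r \<one>\<^bsub>A\<^esub>) = ?j (u0 (A0.t r \<one>\<^bsub>A0\<^esub>))" using r t0 one1 by (simp add: u0j jt)
      also have "\<Theta> A \<dots> k = ?j (\<Theta> A0 (u0 (A0.t r \<one>\<^bsub>A0\<^esub>)) k)"
        using idR_Theta[OF A0 algebra_A inc] u0c t0 by simp
      finally show "?j (u0 (A0.t (\<theta> r k) \<one>\<^bsub>A0\<^esub>)) = ?j (\<Theta> A0 (u0 (A0.t r \<one>\<^bsub>A0\<^esub>)) k)" .
    qed
  next
    fix f a assume fa: "f \<in> F" "a \<in> carrier A0"
    have t0: "A0.t f a \<in> carrier A0.T" using fa A0.t_closed by (simp add: in_E)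
    show "u0 (A0.t f a) = A0.t f a"
      by (rule jinj) (use t0 fa SA in \<open>simp_all add: u0c u0j jt us(5) in_E\<close>)
  qed
  \<comment> \<open>\<open>A0\<close> is a subset of \<open>A\<close>, so its elements again have
    type \<open>'u\<close> and it is admissible as a test algebra.\<close>
  obtain f where f: "f \<in> alg_hom K A A0" "Gal_map E F R \<theta> A A0 f u = u0"
  proof -
    have "u0 \<in> (\<lambda>f. Gal_map E F R \<theta> A A0 f u) ` alg_hom K A A0"
      using represents[OF A0] u0 by (simp add: bij_betw_def)
    then show thesis using that by (elim imageE) simp
  qed
  note fr = alg_hom_simps[OF f(1)]
  have fS: "\<And>a. a \<in> carrier A \<Longrightarrow> f a \<in> ?S" using ring_hom_closed[OF fr(1)] by simp
  have f1: "f \<one>\<^bsub>A\<^esub> = \<one>\<^bsub>A\<^esub>" using ring_hom_one[OF fr(1)] by simp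
  have fA: "f \<in> alg_hom K A A"
    using fr fS SA by (auto simp: alg_hom_def ring_hom_def Pi_iff)
  have idA: "restrict (\<lambda>x. x) (carrier A) \<in> alg_hom K A A"
    by (auto simp: alg_hom_def intro!: ring_hom_memI)
  note hf = idR_hom[OF algebra_A A0 f(1)] and hfA = idR_hom[OF algebra_A algebra_A fA]
    and hid = idR_hom[OF algebra_A algebra_A idA]
  have comp: "id\<^sub>R A f x = ?j (id\<^sub>R A0 f x)" if "x \<in> carrier A.T" for x
    using A.ring_hom_eq_on_tensor[OF A.T.is_cring hfA(1) ring_hom_trans[OF hf(1) j(1)] _ _ that]
    by (simp add: hfA(2) hf(2) jt fS f1 one1)
  have ident: "id\<^sub>R A (restrict (\<lambda>x. x) (carrier A)) x = x" if "x \<in> carrier A.T" for x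
  proof -
    have "(\<lambda>x. x) \<in> ring_hom A.T A.T" by (auto intro!: ring_hom_memI)
    from A.ring_hom_eq_on_tensor[OF A.T.is_cring hid(1) this _ _ that]
    show ?thesis by (simp add: hid(2))
  qed
  have ut: "u (A.t r \<one>\<^bsub>A\<^esub>) \<in> carrier A.T" if "r \<in> R" for r
    using that pt_A_closed ring_hom_closed[OF us(3)] by simp
  \<comment> \<open>Read as a map into \<open>A\<close>, \<open>f\<close> carries \<open>u\<close>
    to the image of \<open>u0\<close>, which is \<open>u\<close> itself. The identity of
    \<open>A\<close> does the same, and classifying maps are unique.\<close>
  have "Gal_map E F R \<theta> A A f u = u"
  proof (rule base_change(3)[OF algebra_A algebra_A fA u_Gal u_Gal])
    fix r assume r: "r \<in> R"
    have t0: "A0.t r \<one>\<^bsub>A0\<^esub> \<in> carrier A0.T" using r one1 A0.t_closed by simp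
    have "id\<^sub>R A f (u (A.t r \<one>\<^bsub>A\<^esub>)) = ?j (id\<^sub>R A0 f (u (A.t r \<one>\<^bsub>A\<^esub>)))" by (rule comp[OF ut[OF r]])
    also have "id\<^sub>R A0 f (u (A.t r \<one>\<^bsub>A\<^esub>)) = u0 (id\<^sub>R A0 f (A.t r \<one>\<^bsub>A\<^esub>))"
      using base_change(2)[OF algebra_A A0 f(1) u_Gal, of "A.t r \<one>\<^bsub>A\<^esub>"] f(2) pt_A_closed r by simp
    also have "id\<^sub>R A0 f (A.t r \<one>\<^bsub>A\<^esub>) = A0.t r \<one>\<^bsub>A0\<^esub>" using hf(2)[OF r, of "\<one>\<^bsub>A\<^esub>"] f1 by simp
    also have "?j (u0 \<dots>) = u (A.t r \<one>\<^bsub>A\<^esub>)" using u0j[OF t0] r one1 by (simp add: jt)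
    finally show "u (A.t r \<one>\<^bsub>A\<^esub>) = id\<^sub>R A f (u (A.t r \<one>\<^bsub>A\<^esub>))" by simp
  qed
  moreover have "Gal_map E F R \<theta> A A (restrict (\<lambda>x. x) (carrier A)) u = u"
    by (rule base_change(3)[OF algebra_A algebra_A idA u_Gal u_Gal]) (simp add: ident ut)
  ultimately have "f = restrict (\<lambda>x. x) (carrier A)"
    using represents[OF algebra_A] fA idA by (auto simp: bij_betw_def inj_on_def)
  then have "a \<in> ?S" if "a \<in> carrier A" for a using fS[OF that] that by simp
  then show ?thesis using Ss(1) by blast
qed

end

context ppv_gal
begin

section \<open>The augmentation ideal\<close>

abbreviation "Aug \<equiv> a_kernel A K \<epsilon>"

lemma Aug_iff: "x \<in> Aug \<longleftrightarrow> x \<in> carrier A \<and> \<epsilon> x = \<zero>\<^bsub>E\<^esub>"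
  by (simp add: a_kernel_def')

lemma counit_ring_hom: "\<epsilon> \<in> ring_hom A K"
  by (rule alg_hom_simps(1)[OF counit_hom])

lemma Aug_ideal: "ideal Aug A"
proof -
  interpret h: ring_hom_ring A K \<epsilon>
    by (intro ring_hom_ringI2 A.B.ring_axioms K.ring_axioms counit_ring_hom)
  show ?thesis by (rule h.kernel_is_ideal)
qed

text \<open>The coefficients come from expansions fixed before any exponent is considered, so one
  finite set \<open>C\<close> serves all \<open>e\<close> at once. The bound on the height uses the
  last clause; nilpotence of the augmentation ideal uses that \<open>C\<close> is finite.\<close>

lemma exists_coefficients:
  "\<exists>C. finite C \<and> C \<subseteq> carrier A \<and> carrier A = generate_ring A ((\<lambda>c. c \<odot>\<^bsub>A\<^esub> \<one>\<^bsub>A\<^esub>) ` KC \<union> C) \<and>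
    (\<forall>c\<in>C. \<epsilon> c = \<zero>\<^bsub>E\<^esub>) \<and>
    (\<forall>e. (\<forall>r\<in>R. r [^]\<^bsub>E\<^esub> (p ^ e) \<in> F) \<longrightarrow> (\<forall>c\<in>C. c [^]\<^bsub>A\<^esub> (p ^ e) = \<zero>\<^bsub>A\<^esub>))"
proof -
  obtain w where w: "w \<in> ring_hom (TT A) (TT A)" "\<And>f l. f \<in> F \<Longrightarrow> l \<in> carrier A \<Longrightarrow> w (pt A f l) = pt A f l"
      "\<And>x. x \<in> carrier (TT A) \<Longrightarrow> w (u x) = x" "\<And>x. x \<in> carrier (TT A) \<Longrightarrow> u (w x) = x"
    using Gal_inverse[OF algebra_A u_Gal] by blast
  note us = GalD[OF algebra_A u_Gal]
  have sh: "\<sigma> \<in> ring_hom A.T A.T" if "\<sigma> \<in> {u, w}" for \<sigma> using that us(3) w(1) by auto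
  have sF: "\<sigma> (A.t f a) = A.t f a" if "\<sigma> \<in> {u, w}" "f \<in> F" "a \<in> carrier A" for f a \<sigma> using that us(5) w(2) by auto
  have s\<epsilon>: "id\<^sub>R K \<epsilon> (\<sigma> x) = id\<^sub>R K \<epsilon> x" if "\<sigma> \<in> {u, w}" "x \<in> carrier A.T" for \<sigma> x
    using that counit_u[of x] counit_u[of "w x"] ring_hom_closed[OF w(1)] w(4) by auto
  let ?d = "\<lambda>\<sigma> g. \<sigma> (pt A g \<one>\<^bsub>A\<^esub>) \<ominus>\<^bsub>TT A\<^esub> pt A g \<one>\<^bsub>A\<^esub>"
  have tg: "pt A g \<one>\<^bsub>A\<^esub> \<in> carrier A.T" if "g \<in> R" for g using that pt_A_closed by simp
  have dc: "?d \<sigma> g \<in> carrier A.T" if "\<sigma> \<in> {u, w}" "g \<in> R" for \<sigma> g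
    using tg[OF that(2)] ring_hom_closed[OF sh[OF that(1)] tg[OF that(2)]] by simp
  have "\<forall>z \<in> {u, w} \<times> G. \<exists>Vb. expansion (?d (fst z) (snd z)) (fst Vb) (snd Vb)"
    using dc ex_expansion G_subset_R by (auto simp: subset_iff)
  then obtain Vb where Vb: "\<And>z. z \<in> {u, w} \<times> G \<Longrightarrow> expansion (?d (fst z) (snd z)) (fst (Vb z)) (snd (Vb z))"
    by metis
  define C where "C = (\<Union>z\<in>{u, w} \<times> G. snd (Vb z) ` fst (Vb z))"
  have "finite C" unfolding C_def
    using finite_G Vb by (intro finite_UN_I) (auto simp: expansion_def)
  moreover have CA: "C \<subseteq> carrier A"
    unfolding C_def using Vb by (force simp: expansion_def)
  moreover have "carrier A = generate_ring A ((\<lambda>c. c \<odot>\<^bsub>A\<^esub> \<one>\<^bsub>A\<^esub>) ` KC \<union> C)"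
  proof (rule generated_by_coefficients[OF CA w])
    fix \<sigma> g assume "\<sigma> \<in> {u, w}" "g \<in> G"
    then have z: "(\<sigma>, g) \<in> {u, w} \<times> G" by simp
    show "\<exists>V b. expansion (?d \<sigma> g) V b \<and> b ` V \<subseteq> C"
      using Vb[OF z] z unfolding C_def
      by (intro exI[of _ "fst (Vb (\<sigma>, g))"] exI[of _ "snd (Vb (\<sigma>, g))"] conjI UN_upper) simp_all
  qed
  moreover have "\<epsilon> c = \<zero>\<^bsub>E\<^esub>" if "c \<in> C" for c
  proof -
    obtain z v where z: "z \<in> {u, w} \<times> G" "v \<in> fst (Vb z)" "c = snd (Vb z) v" using \<open>c \<in> C\<close> unfolding C_def by blast
    obtain \<sigma> g where sg: "z = (\<sigma>, g)" "\<sigma> \<in> {u, w}" "g \<in> R" using z(1) G_subset_R by auto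
    note h = idR_hom[OF algebra_A algebra_K_K counit_hom]
    have h': "id\<^sub>R K \<epsilon> \<in> hom (add_monoid (TT A)) (add_monoid (TT K))"
      using h(1) by (simp add: ring_hom_def hom_def)
    have tg': "pt A g \<one>\<^bsub>A\<^esub> \<in> carrier A.T" "\<sigma> (pt A g \<one>\<^bsub>A\<^esub>) \<in> carrier A.T"
      using tg[OF sg(3)] ring_hom_closed[OF sh[OF sg(2)]] by simp_all
    have "id\<^sub>R K \<epsilon> (?d \<sigma> g) = id\<^sub>R K \<epsilon> (\<sigma> (pt A g \<one>\<^bsub>A\<^esub>)) \<ominus>\<^bsub>TT K\<^esub> id\<^sub>R K \<epsilon> (pt A g \<one>\<^bsub>A\<^esub>)"
      by (rule add_monoid_hom_simps(5)[OF A.T.abelian_group_axioms KK.T.abelian_group_axioms h' tg'(2,1)])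
    also have "\<dots> = \<zero>\<^bsub>TT K\<^esub>" using s\<epsilon>[OF sg(2) tg'(1)] ring_hom_closed[OF h(1) tg'(1)] by simp
    finally have "id\<^sub>R K \<epsilon> (?d (fst z) (snd z)) = \<zero>\<^bsub>TT K\<^esub>" using sg by simp
    from expansion_counit[OF Vb[OF z(1)] this z(2)] show ?thesis using z by simp
  qed
  moreover have "c [^]\<^bsub>A\<^esub> (p ^ e) = \<zero>\<^bsub>A\<^esub>" if P: "\<forall>r\<in>R. r [^]\<^bsub>E\<^esub> (p ^ e) \<in> F" and "c \<in> C" for c e
  proof -
    obtain z v where z: "z \<in> {u, w} \<times> G" "v \<in> fst (Vb z)" "c = snd (Vb z) v" using \<open>c \<in> C\<close> unfolding C_def by blast
    obtain \<sigma> g where sg: "z = (\<sigma>, g)" "\<sigma> \<in> {u, w}" "g \<in> R" using z(1) G_subset_R by auto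
    have tg': "pt A g \<one>\<^bsub>A\<^esub> \<in> carrier A.T" "\<sigma> (pt A g \<one>\<^bsub>A\<^esub>) \<in> carrier A.T"
      using tg[OF sg(3)] ring_hom_closed[OF sh[OF sg(2)]] by simp_all
    have gp: "pt A g \<one>\<^bsub>A\<^esub> [^]\<^bsub>TT A\<^esub> (p ^ e) = pt A (g [^]\<^bsub>E\<^esub> (p ^ e)) \<one>\<^bsub>A\<^esub>"
      using A.t_pow[of g "\<one>\<^bsub>A\<^esub>" "p ^ e"] sg by (simp add: sub_alg_pow)
    have "?d \<sigma> g [^]\<^bsub>TT A\<^esub> (p ^ e) = \<sigma> (pt A g \<one>\<^bsub>A\<^esub>) [^]\<^bsub>TT A\<^esub> (p ^ e) \<ominus>\<^bsub>TT A\<^esub> pt A g \<one>\<^bsub>A\<^esub> [^]\<^bsub>TT A\<^esub> (p ^ e)"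
      by (rule A.T.frobenius_minus[OF prime_p char_TA tg'(2,1)])
    also have "\<sigma> (pt A g \<one>\<^bsub>A\<^esub>) [^]\<^bsub>TT A\<^esub> (p ^ e) = \<sigma> (pt A (g [^]\<^bsub>E\<^esub> (p ^ e)) \<one>\<^bsub>A\<^esub>)"
      unfolding gp[symmetric] by (rule ring_hom_nat_pow[OF A.T.ring_axioms A.T.ring_axioms sh[OF sg(2)] tg'(1), symmetric])
    also have "\<dots> = pt A (g [^]\<^bsub>E\<^esub> (p ^ e)) \<one>\<^bsub>A\<^esub>" using sF[OF sg(2)] P sg(3) by simp
    also have "\<dots> \<ominus>\<^bsub>TT A\<^esub> pt A g \<one>\<^bsub>A\<^esub> [^]\<^bsub>TT A\<^esub> (p ^ e) = \<zero>\<^bsub>TT A\<^esub>"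
      unfolding gp using P sg(3) tg[of "g [^]\<^bsub>E\<^esub> (p ^ e)"] by (simp add: in_E)
    finally have "?d (fst z) (snd z) [^]\<^bsub>TT A\<^esub> (p ^ e) = \<zero>\<^bsub>TT A\<^esub>" using sg by simp
    from expansion_pow_zero[OF Vb[OF z(1)] this z(2)] show ?thesis using z by simp
  qed
  ultimately show ?thesis by (intro exI[of _ C]) simp
qed

text \<open>Modulo an ideal that contains \<open>C\<close>, every element of \<open>A\<close> is
  congruent to the scalar given by its counit, as one sees by induction over the generation of
  \<open>A\<close>. Elements with counit zero therefore lie in the ideal: \<open>C\<close> generates
  the augmentation ideal.\<close>

lemma Aug_subset:
  assumes C: "C \<subseteq> carrier A" "carrier A = generate_ring A ((\<lambda>c. c \<odot>\<^bsub>A\<^esub> \<one>\<^bsub>A\<^esub>) ` KC \<union> C)" "\<And>c. c \<in> C \<Longrightarrow> \<epsilon> c = \<zero>\<^bsub>E\<^esub>"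
    and J: "ideal J A" "C \<subseteq> J"
  shows "Aug \<subseteq> J"
proof -
  interpret J: ideal J A by fact
  interpret h: ring_hom_ring A K \<epsilon>
    by (intro ring_hom_ringI2 A.B.ring_axioms K.ring_axioms counit_ring_hom)
  let ?s = "\<lambda>c. c \<odot>\<^bsub>A\<^esub> \<one>\<^bsub>A\<^esub>"
  interpret s: ring_hom_ring K A ?s
    by (intro ring_hom_ringI2 A.B.ring_axioms K.ring_axioms A.B.scalar_ring_hom)
  have eK: "\<And>a. a \<in> carrier A \<Longrightarrow> \<epsilon> a \<in> KC" by (rule h.hom_closed)
  have \<epsilon>s: "\<epsilon> (?s c) = c" if "c \<in> KC" for c
    using alg_hom_simps(2)[OF counit_hom that, of "\<one>\<^bsub>A\<^esub>"] that h.hom_one by (simp add: in_E)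
  have "a \<in> carrier A \<and> a \<ominus>\<^bsub>A\<^esub> ?s (\<epsilon> a) \<in> J" if "a \<in> carrier A" for a
    using that[unfolded C(2)]
  proof (induction rule: generate_ring.induct)
    case one
    have "\<one>\<^bsub>A\<^esub> \<ominus>\<^bsub>A\<^esub> ?s (\<epsilon> \<one>\<^bsub>A\<^esub>) = \<zero>\<^bsub>A\<^esub>" using s.hom_one h.hom_one by simp
    then show ?case by simp
  next
    case (incl a)
    then consider c where "c \<in> KC" "a = ?s c" | "a \<in> C" by blast
    then show ?case
    proof cases
      case 1
      then show ?thesis using \<epsilon>s s.hom_closed by (simp add: a_minus_def A.B.r_neg)
    next
      case 2
      then have "?s (\<epsilon> a) = \<zero>\<^bsub>A\<^esub>" "a \<in> carrier A" using C s.hom_zero by auto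
      then show ?thesis using 2 J(2) by (auto simp: a_minus_def)
    qed
  next
    case (a_inv a)
    then have a: "a \<in> carrier A" "a \<ominus>\<^bsub>A\<^esub> ?s (\<epsilon> a) \<in> J" by simp_all
    have "?s (\<epsilon> (\<ominus>\<^bsub>A\<^esub> a)) = \<ominus>\<^bsub>A\<^esub> ?s (\<epsilon> a)" using a(1) eK by (simp only: h.hom_a_inv s.hom_a_inv)
    then have "\<ominus>\<^bsub>A\<^esub> a \<ominus>\<^bsub>A\<^esub> ?s (\<epsilon> (\<ominus>\<^bsub>A\<^esub> a)) = \<ominus>\<^bsub>A\<^esub> (a \<ominus>\<^bsub>A\<^esub> ?s (\<epsilon> a))"
      using a(1) eK s.hom_closed by (simp add: a_minus_def A.B.minus_add)
    then show ?case using a J.a_inv_closed by simp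
  next
    case (eng_add a b)
    then have ab: "a \<in> carrier A" "b \<in> carrier A" "a \<ominus>\<^bsub>A\<^esub> ?s (\<epsilon> a) \<in> J" "b \<ominus>\<^bsub>A\<^esub> ?s (\<epsilon> b) \<in> J" by simp_all
    have "?s (\<epsilon> (a \<oplus>\<^bsub>A\<^esub> b)) = ?s (\<epsilon> a) \<oplus>\<^bsub>A\<^esub> ?s (\<epsilon> b)" using ab(1,2) eK by (simp only: h.hom_add s.hom_add)
    then have "(a \<oplus>\<^bsub>A\<^esub> b) \<ominus>\<^bsub>A\<^esub> ?s (\<epsilon> (a \<oplus>\<^bsub>A\<^esub> b)) = (a \<ominus>\<^bsub>A\<^esub> ?s (\<epsilon> a)) \<oplus>\<^bsub>A\<^esub> (b \<ominus>\<^bsub>A\<^esub> ?s (\<epsilon> b))"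
      using ab(1,2) eK s.hom_closed by (simp add: a_minus_def A.B.minus_add A.B.a_ac)
    then show ?case using ab J.a_closed by simp
  next
    case (eng_mult a b)
    then have ab: "a \<in> carrier A" "b \<in> carrier A" "a \<ominus>\<^bsub>A\<^esub> ?s (\<epsilon> a) \<in> J" "b \<ominus>\<^bsub>A\<^esub> ?s (\<epsilon> b) \<in> J" by simp_all
    have sc: "?s (\<epsilon> a) \<in> carrier A" "?s (\<epsilon> b) \<in> carrier A" using ab(1,2) eK s.hom_closed by simp_all
    have eq: "?s (\<epsilon> (a \<otimes>\<^bsub>A\<^esub> b)) = ?s (\<epsilon> a) \<otimes>\<^bsub>A\<^esub> ?s (\<epsilon> b)" using ab(1,2) eK by (simp only: h.hom_mult s.hom_mult)
    have "(a \<otimes>\<^bsub>A\<^esub> b) \<ominus>\<^bsub>A\<^esub> (?s (\<epsilon> a) \<otimes>\<^bsub>A\<^esub> ?s (\<epsilon> b)) =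
        (a \<ominus>\<^bsub>A\<^esub> ?s (\<epsilon> a)) \<otimes>\<^bsub>A\<^esub> b \<oplus>\<^bsub>A\<^esub> ?s (\<epsilon> a) \<otimes>\<^bsub>A\<^esub> (b \<ominus>\<^bsub>A\<^esub> ?s (\<epsilon> b))"
      using ab(1,2) sc
      by (simp add: a_minus_def A.B.l_distr A.B.r_distr A.B.l_minus A.B.r_minus)
         (simp add: A.B.a_assoc A.B.r_neg1)
    then show ?case using ab sc J.a_closed J.I_l_closed J.I_r_closed unfolding eq by simp
  qed
  then have *: "\<And>a. a \<in> carrier A \<Longrightarrow> a \<ominus>\<^bsub>A\<^esub> ?s (\<epsilon> a) \<in> J" by blast
  show ?thesis
  proof
    fix a assume a: "a \<in> Aug"
    then have "?s (\<epsilon> a) = \<zero>\<^bsub>A\<^esub>" "a \<in> carrier A" using s.hom_zero by (simp_all add: Aug_iff)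
    then show "a \<in> J" using *[of a] by (simp add: a_minus_def)
  qed
qed

text \<open>By Frobenius, the elements with vanishing \<open>q\<close>-th power form an ideal. It
  contains the coefficients of the universal automorphism and its inverse, hence the whole
  augmentation ideal.\<close>

lemma exponent_imp_height:
  assumes P: "\<forall>r\<in>R. r [^]\<^bsub>E\<^esub> (p ^ e) \<in> F" and x: "x \<in> Aug"
  shows "x [^]\<^bsub>A\<^esub> (p ^ e) = \<zero>\<^bsub>A\<^esub>"
proof -
  obtain C where C: "C \<subseteq> carrier A" "carrier A = generate_ring A ((\<lambda>c. c \<odot>\<^bsub>A\<^esub> \<one>\<^bsub>A\<^esub>) ` KC \<union> C)"
    "\<And>c. c \<in> C \<Longrightarrow> \<epsilon> c = \<zero>\<^bsub>E\<^esub>" "\<And>c. c \<in> C \<Longrightarrow> c [^]\<^bsub>A\<^esub> (p ^ e) = \<zero>\<^bsub>A\<^esub>"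
    using exists_coefficients P by metis
  let ?J = "{x \<in> carrier A. x [^]\<^bsub>A\<^esub> (p ^ e) = \<zero>\<^bsub>A\<^esub>}"
  have "ideal ?J A"
  proof (rule idealI)
    show "ring A" by (rule A.B.ring_axioms)
    show "subgroup ?J (add_monoid A)"
    proof (rule A.B.add.subgroupI)
      show "?J \<subseteq> carrier A" by auto
      show "?J \<noteq> {}" using p_pow_pos[of e] A.B.nat_pow_zero[of "p ^ e"] A.B.zero_closed by blast
    next
      fix a assume a: "a \<in> ?J"
      have "(\<zero>\<^bsub>A\<^esub> \<ominus>\<^bsub>A\<^esub> a) [^]\<^bsub>A\<^esub> (p ^ e) = \<zero>\<^bsub>A\<^esub> [^]\<^bsub>A\<^esub> (p ^ e) \<ominus>\<^bsub>A\<^esub> a [^]\<^bsub>A\<^esub> (p ^ e)"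
        using a by (intro A.B.frobenius_minus[OF prime_p char_A]) simp_all
      then show "\<ominus>\<^bsub>A\<^esub> a \<in> ?J" using a p_pow_pos[of e] by (simp add: a_minus_def A.B.nat_pow_zero)
    next
      fix a b assume "a \<in> ?J" "b \<in> ?J"
      then show "a \<oplus>\<^bsub>A\<^esub> b \<in> ?J" by (simp add: A.B.frobenius_add[OF prime_p char_A])
    qed
    fix a x assume "a \<in> ?J" "x \<in> carrier A"
    then show "x \<otimes>\<^bsub>A\<^esub> a \<in> ?J" "a \<otimes>\<^bsub>A\<^esub> x \<in> ?J" by (simp_all add: A.B.nat_pow_distrib)
  qed
  then have "Aug \<subseteq> ?J" using C by (intro Aug_subset[OF C(1,2)]) auto
  then show ?thesis using x by blast
qed

text \<open>A common exponent only makes the augmentation ideal nil; nilpotence follows because it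
  has finitely many generators.\<close>

lemma height_imp_infinitesimal:
  assumes "\<forall>x\<in>Aug. x [^]\<^bsub>A\<^esub> (p ^ e) = \<zero>\<^bsub>A\<^esub>"
  shows "infinitesimal A Aug"
proof -
  obtain C where C: "finite C" "C \<subseteq> carrier A" "carrier A = generate_ring A ((\<lambda>c. c \<odot>\<^bsub>A\<^esub> \<one>\<^bsub>A\<^esub>) ` KC \<union> C)"
    "\<And>c. c \<in> C \<Longrightarrow> \<epsilon> c = \<zero>\<^bsub>E\<^esub>"
    using exists_coefficients by metis
  have "\<exists>n. A.B.ipow Aug n \<subseteq> {\<zero>\<^bsub>A\<^esub>}"
  proof (rule A.B.nilpotent_generators_ipow[OF Aug_ideal C(1,2)])
    show "c [^]\<^bsub>A\<^esub> (p ^ e) = \<zero>\<^bsub>A\<^esub>" if "c \<in> C" for c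
      using that assms C by (auto simp: Aug_iff)
    show "ideal {\<zero>\<^bsub>A\<^esub>} A" by (rule A.B.zeroideal)
    show "Aug \<subseteq> J'" if "ideal J' A" "C \<subseteq> J'" for J' by (rule Aug_subset[OF C(2-4) that])
  qed
  then obtain n where n: "A.B.ipow Aug n \<subseteq> {\<zero>\<^bsub>A\<^esub>}" by blast
  have "\<zero>\<^bsub>A\<^esub> \<in> A.B.ipow Aug n"
    using additive_subgroup.zero_closed[OF ideal.axioms(1)[OF A.B.ipow_ideal[OF Aug_ideal]]] .
  then show ?thesis using n unfolding infinitesimal_def by blast
qed

lemma infinitesimal_imp_height:
  assumes "infinitesimal A Aug"
  shows "\<exists>e. \<forall>x\<in>Aug. x [^]\<^bsub>A\<^esub> (p ^ e) = \<zero>\<^bsub>A\<^esub>"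
proof -
  obtain n where n: "A.B.ipow Aug n = {\<zero>\<^bsub>A\<^esub>}" using assms by (auto simp: infinitesimal_def)
  \<comment> \<open>Any \<open>e\<close> with \<open>p^e\<close> at least \<open>n\<close> would do,
    and \<open>e = n\<close> is the crude choice.\<close>
  have "n < 2 ^ n" by (rule less_exp)
  also have "(2::nat) ^ n \<le> p ^ n" by (rule power_mono[OF prime_ge_2_nat[OF prime_p]]) simp
  finally have "n \<le> p ^ n" by simp
  then have "x [^]\<^bsub>A\<^esub> (p ^ n) = \<zero>\<^bsub>A\<^esub>" if "x \<in> Aug" for x
  proof -
    have x: "x \<in> carrier A" using that by (simp add: Aug_iff)
    have "x [^]\<^bsub>A\<^esub> n = \<zero>\<^bsub>A\<^esub>" using A.B.pow_in_ipow[OF Aug_ideal that, of n] n by simp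
    moreover have "x [^]\<^bsub>A\<^esub> (n + (p ^ n - n)) = x [^]\<^bsub>A\<^esub> n \<otimes>\<^bsub>A\<^esub> x [^]\<^bsub>A\<^esub> (p ^ n - n)"
      using x by (simp add: A.B.nat_pow_mult)
    ultimately show ?thesis using \<open>n \<le> p ^ n\<close> x by simp
  qed
  then show ?thesis by blast
qed

text \<open>The counit puts the coefficients of \<open>u (r \<otimes> 1) - r \<otimes> 1\<close>
  into the augmentation ideal. Its \<open>q\<close>-th power is therefore zero, and by Frobenius
  that power is the same difference for \<open>r^q\<close>.\<close>

lemma height_imp_fixed:
  assumes Q: "\<forall>x\<in>Aug. x [^]\<^bsub>A\<^esub> (p ^ e) = \<zero>\<^bsub>A\<^esub>" and r: "r \<in> R"
  shows "u (pt A (r [^]\<^bsub>E\<^esub> (p ^ e)) \<one>\<^bsub>A\<^esub>) = pt A (r [^]\<^bsub>E\<^esub> (p ^ e)) \<one>\<^bsub>A\<^esub>"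
proof -
  note us = GalD[OF algebra_A u_Gal]
  let ?t = "pt A r \<one>\<^bsub>A\<^esub>"
  have t: "?t \<in> carrier A.T" "u ?t \<in> carrier A.T" using r pt_A_closed ring_hom_closed[OF us(3)] by simp_all
  let ?d = "u ?t \<ominus>\<^bsub>TT A\<^esub> ?t"
  obtain V b where Vb: "expansion ?d V b" using ex_expansion[of ?d] t by blast
  then have V: "\<And>v. v \<in> V \<Longrightarrow> v \<in> R" "\<And>v. v \<in> V \<Longrightarrow> b v \<in> carrier A" by (auto simp: expansion_def)
  note h = idR_hom[OF algebra_A algebra_K_K counit_hom]
  have h': "id\<^sub>R K \<epsilon> \<in> hom (add_monoid (TT A)) (add_monoid (TT K))"
    using h(1) by (simp add: ring_hom_def hom_def)
  have "id\<^sub>R K \<epsilon> ?d = id\<^sub>R K \<epsilon> (u ?t) \<ominus>\<^bsub>TT K\<^esub> id\<^sub>R K \<epsilon> ?t"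
    by (rule add_monoid_hom_simps(5)[OF A.T.abelian_group_axioms KK.T.abelian_group_axioms h' t(2,1)])
  also have "\<dots> = \<zero>\<^bsub>TT K\<^esub>" using counit_u[OF t(1)] ring_hom_closed[OF h(1) t(1)] by simp
  finally have z: "id\<^sub>R K \<epsilon> ?d = \<zero>\<^bsub>TT K\<^esub>" .
  have b0: "b v [^]\<^bsub>A\<^esub> (p ^ e) = \<zero>\<^bsub>A\<^esub>" if "v \<in> V" for v
    using Q expansion_counit[OF Vb z that] V that by (simp add: Aug_iff)
  have tp: "?t [^]\<^bsub>TT A\<^esub> (p ^ e) = pt A (r [^]\<^bsub>E\<^esub> (p ^ e)) \<one>\<^bsub>A\<^esub>"
    using A.t_pow[of r "\<one>\<^bsub>A\<^esub>" "p ^ e"] r by (simp add: sub_alg_pow)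
  have PR: "\<And>v. v \<in> R \<Longrightarrow> v [^]\<^bsub>E\<^esub> (p ^ e) \<in> R" using RR.nat_pow_closed[of _ "p ^ e"] by (simp add: sub_alg_pow)
  have "?d [^]\<^bsub>TT A\<^esub> (p ^ e) = \<zero>\<^bsub>TT A\<^esub>"
    unfolding expansion_pow[OF Vb]
    by (rule A.T.add.finprod_one_eqI) (use b0 V PR in simp)
  moreover have "?d [^]\<^bsub>TT A\<^esub> (p ^ e) = u ?t [^]\<^bsub>TT A\<^esub> (p ^ e) \<ominus>\<^bsub>TT A\<^esub> ?t [^]\<^bsub>TT A\<^esub> (p ^ e)"
    by (rule A.T.frobenius_minus[OF prime_p char_TA t(2,1)])
  moreover have "u ?t [^]\<^bsub>TT A\<^esub> (p ^ e) = u (?t [^]\<^bsub>TT A\<^esub> (p ^ e))"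
    by (rule ring_hom_nat_pow[OF A.T.ring_axioms A.T.ring_axioms us(3) t(1), symmetric])
  ultimately have "u (?t [^]\<^bsub>TT A\<^esub> (p ^ e)) \<ominus>\<^bsub>TT A\<^esub> ?t [^]\<^bsub>TT A\<^esub> (p ^ e) = \<zero>\<^bsub>TT A\<^esub>" by simp
  moreover have "?t [^]\<^bsub>TT A\<^esub> (p ^ e) \<in> carrier A.T" using t(1) by simp
  ultimately have "u (?t [^]\<^bsub>TT A\<^esub> (p ^ e)) = ?t [^]\<^bsub>TT A\<^esub> (p ^ e)"
    using ring_hom_closed[OF us(3)] A.T.r_right_minus_eq by blast
  then show ?thesis unfolding tp .
qed

end

section \<open>Determinants\<close>

lemma (in comm_monoid) finprod_Sigma:
  assumes "finite I" "\<And>i. i \<in> I \<Longrightarrow> finite (J i)" "\<And>i j. i \<in> I \<Longrightarrow> j \<in> J i \<Longrightarrow> g i j \<in> carrier G"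
  shows "(\<Otimes>i\<in>I. \<Otimes>j\<in>J i. g i j) = (\<Otimes>z\<in>Sigma I J. g (fst z) (snd z))"
proof -
  have "(\<Otimes>z\<in>(\<Union>i\<in>I. Pair i ` J i). g (fst z) (snd z)) = (\<Otimes>i\<in>I. \<Otimes>z\<in>Pair i ` J i. g (fst z) (snd z))"
    by (rule finprod_UN_disjoint) (use assms in \<open>auto simp: pairwise_def disjnt_def\<close>)
  also have "(\<Union>i\<in>I. Pair i ` J i) = Sigma I J" by auto
  also have "(\<Otimes>i\<in>I. \<Otimes>z\<in>Pair i ` J i. g (fst z) (snd z)) = (\<Otimes>i\<in>I. \<Otimes>j\<in>J i. g i j)"
  proof (rule finprod_cong')
    fix i assume i: "i \<in> I"
    show "(\<Otimes>z\<in>Pair i ` J i. g (fst z) (snd z)) = (\<Otimes>j\<in>J i. g i j)"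
      by (subst finprod_reindex) (use assms(3)[OF i] in \<open>auto simp: inj_on_def\<close>)
  qed (use assms in auto)
  finally show ?thesis ..
qed

lemma (in comm_monoid) finprod_bij:
  assumes "bij_betw h A B" "f \<in> B \<rightarrow> carrier G"
  shows "finprod G f B = finprod G (\<lambda>x. f (h x)) A"
  using finprod_reindex[of f h A] assms by (auto simp: bij_betw_def)

lemma (in comm_monoid) finprod_swap:
  assumes "finite I" "finite J" "\<And>i j. i \<in> I \<Longrightarrow> j \<in> J \<Longrightarrow> g i j \<in> carrier G"
  shows "(\<Otimes>i\<in>I. \<Otimes>j\<in>J. g i j) = (\<Otimes>j\<in>J. \<Otimes>i\<in>I. g i j)"
proof -
  have "(\<Otimes>z\<in>I \<times> J. g (fst z) (snd z)) = (\<Otimes>z\<in>J \<times> I. g (fst (prod.swap z)) (snd (prod.swap z)))"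
    by (rule finprod_bij[of prod.swap]) (use assms in \<open>auto simp: bij_betw_def\<close>)
  then show ?thesis
    using finprod_Sigma[of I "\<lambda>_. J" g] finprod_Sigma[of J "\<lambda>_. I" "\<lambda>j i. g i j"] assms by simp
qed

lemmas (in abelian_monoid) finsum_Sigma = add.finprod_Sigma
lemmas (in abelian_monoid) finsum_bij = add.finprod_bij
lemmas (in abelian_monoid) finsum_swap = add.finprod_swap

context cring
begin

text \<open>Full distributivity: multiplying out means choosing a summand in each factor. With
  \<open>PiE\<close> the choice functions are extensional, so there are finitely many and each
  choice occurs once.\<close>

lemma finprod_finsum:
  assumes "finite U" "finite B" "\<And>r t. r \<in> U \<Longrightarrow> t \<in> B \<Longrightarrow> a r t \<in> carrier R"
  shows "(\<Otimes>r\<in>U. \<Oplus>t\<in>B. a r t) = (\<Oplus>f\<in>PiE U (\<lambda>_. B). \<Otimes>r\<in>U. a r (f r))"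
  using assms(1,3)
proof (induction rule: finite_induct)
  case empty
  then show ?case by (simp add: finsum_insert)
next
  case (insert x U)
  have ax: "\<And>t. t \<in> B \<Longrightarrow> a x t \<in> carrier R" and aU: "\<And>r t. r \<in> U \<Longrightarrow> t \<in> B \<Longrightarrow> a r t \<in> carrier R"
    using insert.prems by auto
  let ?P = "PiE U (\<lambda>_. B)" and ?h = "\<lambda>(y, g). g(x := y)"
  let ?g = "\<lambda>f. \<Otimes>r\<in>insert x U. a r (f r)"
  have finP: "finite ?P" using insert.hyps assms(2) by (intro finite_PiE) auto
  have pc: "(\<Otimes>r\<in>U. a r (f r)) \<in> carrier R" if "f \<in> ?P" for f
    using that aU by (intro finprod_closed) (auto simp: PiE_iff)
  have gx: "?g (g(x := t)) = a x t \<otimes> (\<Otimes>r\<in>U. a r (g r))" if "t \<in> B" "g \<in> ?P" for t g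
  proof -
    have "?g (g(x := t)) = a x ((g(x := t)) x) \<otimes> (\<Otimes>r\<in>U. a r ((g(x := t)) r))"
      using insert.hyps that ax aU by (intro finprod_insert) (auto simp: PiE_iff)
    also have "(\<Otimes>r\<in>U. a r ((g(x := t)) r)) = (\<Otimes>r\<in>U. a r (g r))"
      using insert.hyps that aU by (intro finprod_cong') (auto simp: PiE_iff)
    finally show ?thesis by simp
  qed
  have "(\<Otimes>r\<in>insert x U. \<Oplus>t\<in>B. a r t) = (\<Oplus>t\<in>B. a x t) \<otimes> (\<Otimes>r\<in>U. \<Oplus>t\<in>B. a r t)"
    using insert.hyps ax aU by (intro finprod_insert) (auto intro!: finsum_closed)
  also have "\<dots> = (\<Oplus>t\<in>B. a x t) \<otimes> (\<Oplus>f\<in>?P. \<Otimes>r\<in>U. a r (f r))"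
    using insert.IH[OF aU] by simp
  also have "\<dots> = (\<Oplus>t\<in>B. a x t \<otimes> (\<Oplus>f\<in>?P. \<Otimes>r\<in>U. a r (f r)))"
    using assms(2) ax pc by (intro finsum_ldistr) (auto intro!: finsum_closed)
  also have "\<dots> = (\<Oplus>t\<in>B. \<Oplus>f\<in>?P. a x t \<otimes> (\<Otimes>r\<in>U. a r (f r)))"
    using finP ax pc by (intro finsum_cong' finsum_rdistr) (auto intro!: finsum_closed)
  also have "\<dots> = (\<Oplus>z\<in>B \<times> ?P. a x (fst z) \<otimes> (\<Otimes>r\<in>U. a r (snd z r)))"
    using finsum_Sigma[of B "\<lambda>_. ?P" "\<lambda>t f. a x t \<otimes> (\<Otimes>r\<in>U. a r (f r))"] assms(2) finP ax pc by simp
  also have "\<dots> = (\<Oplus>z\<in>B \<times> ?P. ?g (?h z))"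
    using gx ax pc by (intro finsum_cong') (auto simp del: finprod_insert)
  also have "\<dots> = (\<Oplus>f\<in>?h ` (B \<times> ?P). ?g f)"
  proof (rule finsum_reindex[symmetric])
    show "?g \<in> ?h ` (B \<times> ?P) \<rightarrow> carrier R"
      using gx ax pc by (auto simp del: finprod_insert)
    show "inj_on ?h (B \<times> ?P)" using inj_combinator[OF insert.hyps(2), of "\<lambda>_. B"] .
  qed
  also have "?h ` (B \<times> ?P) = PiE (insert x U) (\<lambda>_. B)"
    by (rule PiE_insert_eq[symmetric])
  finally show ?case .
qed

text \<open>The sign as a ring element. It turns the integer multiple in \<open>mat_det\<close> into
  an ordinary factor that can be rearranged with the others.\<close>

definition sgn_elt :: "('c \<Rightarrow> 'c) \<Rightarrow> 'a" where
  "sgn_elt \<pi> = (if evenperm \<pi> then \<one> else \<ominus> \<one>)"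

lemma sgn_elt_closed [simp]: "sgn_elt \<pi> \<in> carrier R"
  by (simp add: sgn_elt_def)

lemma sign_add_pow: "x \<in> carrier R \<Longrightarrow> [(sign \<pi> :: int)] \<cdot> x = sgn_elt \<pi> \<otimes> x"
  by (simp add: sign_def sgn_elt_def add_pow_int_ge add_pow_int_lt l_minus)

lemma sgn_elt_comp: "permutation \<pi> \<Longrightarrow> permutation \<tau> \<Longrightarrow> sgn_elt (\<pi> \<circ> \<tau>) = sgn_elt \<pi> \<otimes> sgn_elt \<tau>"
  by (simp add: sgn_elt_def evenperm_comp l_minus r_minus)

lemma mat_det_sgn:
  assumes "M \<in> mat_carrier R n"
  shows "mat_det R n M = (\<Oplus>\<pi>\<in>{\<pi>. \<pi> permutes {..<n}}. sgn_elt \<pi> \<otimes> (\<Otimes>r\<in>{..<n}. M r (\<pi> r)))"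
proof -
  have "(\<Otimes>r\<in>{..<n}. M r (\<pi> r)) \<in> carrier R" if "\<pi> permutes {..<n}" for \<pi>
    using assms permutes_in_image[OF that] by (intro finprod_closed) (auto simp: mat_carrier_def)
  then show ?thesis unfolding mat_det_def
    by (intro finsum_cong') (auto simp: sign_add_pow)
qed

lemma permutes_permutation: "\<pi> permutes {..<n::nat} \<Longrightarrow> permutation \<pi>"
  by (auto simp: permutation_permutes)

text \<open>This is the determinant of a matrix with two equal rows. Composing with the
  transposition of these rows matches even with odd permutations, and matched terms cancel.
  Splitting the sum by parity, rather than deducing that it equals its own negative, covers
  characteristic two.\<close>

lemma row_sum_not_inj:
  assumes N: "N \<in> mat_carrier R n" and f: "f \<in> {..<n} \<rightarrow> {..<n}" and ni: "\<not> inj_on f {..<n}"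
  shows "(\<Oplus>\<pi>\<in>{\<pi>. \<pi> permutes {..<n}}. sgn_elt \<pi> \<otimes> (\<Otimes>r\<in>{..<n}. N (f r) (\<pi> r))) = \<zero>"
proof -
  let ?S = "{\<pi>. \<pi> permutes {..<n}}" and ?T = "\<lambda>\<pi>. sgn_elt \<pi> \<otimes> (\<Otimes>r\<in>{..<n}. N (f r) (\<pi> r))"
  obtain a b where ab: "a < n" "b < n" "a \<noteq> b" "f a = f b" using ni by (auto simp: inj_on_def)
  define \<tau> where "\<tau> = Transposition.transpose a b"
  have \<tau>: "\<tau> permutes {..<n}" unfolding \<tau>_def using ab by (intro permutes_swap_id) auto
  have \<tau>\<tau>: "\<tau> \<circ> \<tau> = id" by (simp add: \<tau>_def)
  have f\<tau>: "f (\<tau> r) = f r" for r using ab by (auto simp: \<tau>_def Transposition.transpose_def)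
  have fin: "finite ?S" by (rule finite_permutations) simp
  have Nc: "N (f r) (\<pi> r) \<in> carrier R" if "\<pi> \<in> ?S" "r < n" for \<pi> r
  proof -
    have "\<pi> r < n" "f r < n" using permutes_in_image[of \<pi> "{..<n}" r] that f by auto
    then show ?thesis using N by (simp add: mat_carrier_def)
  qed
  have pc: "(\<Otimes>r\<in>{..<n}. N (f r) (\<pi> r)) \<in> carrier R" if "\<pi> \<in> ?S" for \<pi>
    using Nc[OF that] by (intro finprod_closed) auto
  have Tc: "?T \<pi> \<in> carrier R" if "\<pi> \<in> ?S" for \<pi> using pc[OF that] by simp
  have comp: "\<pi> \<circ> \<tau> \<in> ?S" if "\<pi> \<in> ?S" for \<pi> using that permutes_compose[OF \<tau>] by auto
  have od: "\<not> evenperm \<tau>" using ab by (simp add: \<tau>_def evenperm_swap)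
  have Tneg: "?T (\<pi> \<circ> \<tau>) = \<ominus> ?T \<pi>" if s: "\<pi> \<in> ?S" for \<pi>
  proof -
    have "(\<Otimes>r\<in>{..<n}. N (f r) (\<pi> r)) = (\<Otimes>r\<in>{..<n}. N (f (\<tau> r)) (\<pi> (\<tau> r)))"
      by (rule finprod_bij[OF permutes_imp_bij[OF \<tau>]]) (use Nc[OF s] in auto)
    also have "\<dots> = (\<Otimes>r\<in>{..<n}. N (f r) ((\<pi> \<circ> \<tau>) r))" by (simp add: f\<tau>)
    finally have "(\<Otimes>r\<in>{..<n}. N (f r) ((\<pi> \<circ> \<tau>) r)) = (\<Otimes>r\<in>{..<n}. N (f r) (\<pi> r))" ..
    moreover have "sgn_elt (\<pi> \<circ> \<tau>) = \<ominus> sgn_elt \<pi>"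
      using sgn_elt_comp[of \<pi> \<tau>] permutes_permutation[OF \<tau>] s permutes_permutation od
      by (simp add: sgn_elt_def[of \<tau>] r_minus)
    ultimately show ?thesis using pc[OF s] by (simp add: l_minus)
  qed
  let ?E = "{\<pi> \<in> ?S. evenperm \<pi>}" and ?O = "{\<pi> \<in> ?S. \<not> evenperm \<pi>}"
  have ev: "evenperm (\<pi> \<circ> \<tau>) \<longleftrightarrow> \<not> evenperm \<pi>" if "\<pi> \<in> ?S" for \<pi>
    using evenperm_comp[of \<pi> \<tau>] permutes_permutation[OF \<tau>] that permutes_permutation od by simp
  have cc: "(\<pi> \<circ> \<tau>) \<circ> \<tau> = \<pi>" for \<pi> :: "nat \<Rightarrow> nat" by (simp add: comp_assoc \<tau>\<tau>)
  have bij: "bij_betw (\<lambda>\<pi>. \<pi> \<circ> \<tau>) ?E ?O"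
    by (rule bij_betwI[where g = "\<lambda>\<pi>. \<pi> \<circ> \<tau>"]) (use comp ev cc in \<open>auto simp del: comp_apply\<close>)
  have "(\<Oplus>\<pi>\<in>?S. ?T \<pi>) = (\<Oplus>\<pi>\<in>?E \<union> ?O. ?T \<pi>)" by (rule arg_cong[of _ _ "finsum R ?T"]) auto
  also have "\<dots> = (\<Oplus>\<pi>\<in>?E. ?T \<pi>) \<oplus> (\<Oplus>\<pi>\<in>?O. ?T \<pi>)"
    using fin Tc by (intro finsum_Un_disjoint) auto
  also have "(\<Oplus>\<pi>\<in>?O. ?T \<pi>) = (\<Oplus>\<pi>\<in>?E. ?T (\<pi> \<circ> \<tau>))"
    by (rule finsum_bij[OF bij]) (use Tc in auto)
  also have "\<dots> = (\<Oplus>\<pi>\<in>?E. (\<ominus> \<one>) \<otimes> ?T \<pi>)"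
    by (rule finsum_cong') (use Tneg Tc in \<open>auto simp: l_minus\<close>)
  also have "\<dots> = (\<ominus> \<one>) \<otimes> (\<Oplus>\<pi>\<in>?E. ?T \<pi>)"
    using fin Tc by (intro finsum_rdistr[symmetric]) auto
  also have "(\<Oplus>\<pi>\<in>?E. ?T \<pi>) \<oplus> \<dots> = \<zero>"
    using Tc finsum_closed[of ?T ?E] by (simp add: l_minus r_neg Pi_iff)
  finally show ?thesis .
qed

text \<open>Replacing \<open>\<pi>\<close> by \<open>\<pi> \<circ> \<rho>\<close> restores the order
  of the rows at the cost of the sign of \<open>\<rho>\<close>.\<close>

lemma row_sum_permutes:
  assumes N: "N \<in> mat_carrier R n" and \<rho>: "\<rho> permutes {..<n}"
  shows "(\<Oplus>\<pi>\<in>{\<pi>. \<pi> permutes {..<n}}. sgn_elt \<pi> \<otimes> (\<Otimes>r\<in>{..<n}. N (\<rho> r) (\<pi> r))) = sgn_elt \<rho> \<otimes> mat_det R n N"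
proof -
  let ?S = "{\<pi>. \<pi> permutes {..<n}}"
  have fin: "finite ?S" by (rule finite_permutations) simp
  have Nc: "N r s \<in> carrier R" if "r < n" "s < n" for r s using N that by (simp add: mat_carrier_def)
  have in_n: "\<pi> r < n" if "\<pi> \<in> ?S" "r < n" for \<pi> r using permutes_in_image[of \<pi> "{..<n}" r] that by auto
  have pc: "(\<Otimes>r\<in>{..<n}. N (\<kappa> r) (\<pi> r)) \<in> carrier R" if "\<pi> \<in> ?S" "\<kappa> \<in> ?S" for \<pi> \<kappa>
    using Nc in_n that by (intro finprod_closed) auto
  have idS: "id \<in> ?S" by (simp add: permutes_id)
  have pc1: "(\<Otimes>r\<in>{..<n}. N r (\<pi> r)) \<in> carrier R" if "\<pi> \<in> ?S" for \<pi> using pc[OF that idS] by simp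
  have bij: "bij_betw (\<lambda>\<pi>. \<pi> \<circ> \<rho>) ?S ?S"
  proof (rule bij_betwI[where g = "\<lambda>\<pi>. \<pi> \<circ> Hilbert_Choice.inv \<rho>"])
    show "(\<lambda>\<pi>. \<pi> \<circ> \<rho>) \<in> ?S \<rightarrow> ?S" "(\<lambda>\<pi>. \<pi> \<circ> Hilbert_Choice.inv \<rho>) \<in> ?S \<rightarrow> ?S"
      using permutes_compose[OF \<rho>] permutes_compose[OF permutes_inv[OF \<rho>]] by auto
  qed (use permutes_inv_o[OF \<rho>] in \<open>auto simp: comp_assoc\<close>)
  have "(\<Oplus>\<pi>\<in>?S. sgn_elt \<pi> \<otimes> (\<Otimes>r\<in>{..<n}. N (\<rho> r) (\<pi> r))) =
      (\<Oplus>\<pi>\<in>?S. sgn_elt (\<pi> \<circ> \<rho>) \<otimes> (\<Otimes>r\<in>{..<n}. N (\<rho> r) ((\<pi> \<circ> \<rho>) r)))"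
    by (rule finsum_bij[OF bij]) (use pc \<rho> in auto)
  also have "\<dots> = (\<Oplus>\<pi>\<in>?S. sgn_elt \<rho> \<otimes> (sgn_elt \<pi> \<otimes> (\<Otimes>r\<in>{..<n}. N r (\<pi> r))))"
  proof (rule finsum_cong')
    fix \<pi> assume s: "\<pi> \<in> ?S"
    have "(\<Otimes>r\<in>{..<n}. N r (\<pi> r)) = (\<Otimes>r\<in>{..<n}. N (\<rho> r) (\<pi> (\<rho> r)))"
      by (rule finprod_bij[OF permutes_imp_bij[OF \<rho>]]) (use Nc in_n s in auto)
    moreover have "sgn_elt (\<pi> \<circ> \<rho>) = sgn_elt \<rho> \<otimes> sgn_elt \<pi>"
      using s \<rho> permutes_permutation by (simp add: sgn_elt_comp m_comm)
    ultimately show "sgn_elt (\<pi> \<circ> \<rho>) \<otimes> (\<Otimes>r\<in>{..<n}. N (\<rho> r) ((\<pi> \<circ> \<rho>) r)) =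
      sgn_elt \<rho> \<otimes> (sgn_elt \<pi> \<otimes> (\<Otimes>r\<in>{..<n}. N r (\<pi> r)))"
      using pc1[OF s] by (simp add: m_assoc)
  qed (use pc1 in auto)
  also have "\<dots> = sgn_elt \<rho> \<otimes> (\<Oplus>\<pi>\<in>?S. sgn_elt \<pi> \<otimes> (\<Otimes>r\<in>{..<n}. N r (\<pi> r)))"
    using fin pc1 by (intro finsum_rdistr[symmetric]) auto
  finally show ?thesis using mat_det_sgn[OF N] by simp
qed

lemma mat_mul_closed:
  assumes "M \<in> mat_carrier R n" "N \<in> mat_carrier R n"
  shows "mat_mul R n M N \<in> mat_carrier R n"
  using assms by (auto simp: mat_carrier_def mat_mul_def intro!: finsum_closed)

text \<open>A PPV-ring is generated with the help of \<open>inv (det Y)\<close>. Multiplicativity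
  identifies this inverse with the determinant of the inverse matrix, so that the entries of the
  inverse matrix can replace it as generators. The proof expands the Leibniz formula over all maps
  from row indices to summation indices.\<close>

lemma mat_det_mult:
  assumes M: "M \<in> mat_carrier R n" and N: "N \<in> mat_carrier R n"
  shows "mat_det R n (mat_mul R n M N) = mat_det R n M \<otimes> mat_det R n N"
proof -
  let ?S = "{\<pi>. \<pi> permutes {..<n}}" and ?F = "PiE {..<n} (\<lambda>_. {..<n})"
  let ?m = "\<lambda>f. \<Otimes>r\<in>{..<n}. M r (f r)"
  let ?D = "\<lambda>f. \<Oplus>\<pi>\<in>?S. sgn_elt \<pi> \<otimes> (\<Otimes>r\<in>{..<n}. N (f r) (\<pi> r))"
  have finS: "finite ?S" by (rule finite_permutations) simp
  have finF: "finite ?F" by (intro finite_PiE) auto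
  have Mc: "\<And>r s. r < n \<Longrightarrow> s < n \<Longrightarrow> M r s \<in> carrier R" and Nc: "\<And>r s. r < n \<Longrightarrow> s < n \<Longrightarrow> N r s \<in> carrier R"
    using M N by (simp_all add: mat_carrier_def)
  have Sn: "\<pi> r < n" if "\<pi> \<in> ?S" "r < n" for \<pi> r using permutes_in_image[of \<pi> "{..<n}" r] that by auto
  have Fn: "f r < n" if "f \<in> ?F" "r < n" for f r using that by (auto simp: PiE_iff)
  have mc: "?m f \<in> carrier R" if "\<And>r. r < n \<Longrightarrow> f r < n" for f using Mc that by (intro finprod_closed) auto
  have nc: "(\<Otimes>r\<in>{..<n}. N (f r) (\<pi> r)) \<in> carrier R" if "\<And>r. r < n \<Longrightarrow> f r < n" "\<pi> \<in> ?S" for f \<pi>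
    using Nc Sn[OF that(2)] that(1) by (intro finprod_closed) auto
  have Dc: "?D f \<in> carrier R" if "\<And>r. r < n \<Longrightarrow> f r < n" for f
    using nc[OF that] by (intro finsum_closed) auto
  have detN: "mat_det R n N \<in> carrier R"
    unfolding mat_det_sgn[OF N] using nc[of "\<lambda>r. r"] by (intro finsum_closed) auto
  have "mat_det R n (mat_mul R n M N) = (\<Oplus>\<pi>\<in>?S. sgn_elt \<pi> \<otimes> (\<Otimes>r\<in>{..<n}. \<Oplus>t\<in>{..<n}. M r t \<otimes> N t (\<pi> r)))"
    using mat_det_sgn[OF mat_mul_closed[OF M N]] by (simp add: mat_mul_def)
  also have "\<dots> = (\<Oplus>\<pi>\<in>?S. \<Oplus>f\<in>?F. ?m f \<otimes> (sgn_elt \<pi> \<otimes> (\<Otimes>r\<in>{..<n}. N (f r) (\<pi> r))))"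
  proof (rule finsum_cong')
    fix \<pi> assume s: "\<pi> \<in> ?S"
    have "(\<Otimes>r\<in>{..<n}. \<Oplus>t\<in>{..<n}. M r t \<otimes> N t (\<pi> r)) = (\<Oplus>f\<in>?F. \<Otimes>r\<in>{..<n}. M r (f r) \<otimes> N (f r) (\<pi> r))"
      by (rule finprod_finsum) (use Mc Nc Sn[OF s] in auto)
    also have "\<dots> = (\<Oplus>f\<in>?F. ?m f \<otimes> (\<Otimes>r\<in>{..<n}. N (f r) (\<pi> r)))"
    proof (rule finsum_cong')
      fix f assume f: "f \<in> ?F"
      show "(\<Otimes>r\<in>{..<n}. M r (f r) \<otimes> N (f r) (\<pi> r)) = ?m f \<otimes> (\<Otimes>r\<in>{..<n}. N (f r) (\<pi> r))"
        by (rule finprod_multf) (use Mc Nc Sn[OF s] Fn[OF f] in auto)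
    qed (use mc nc Fn s in auto)
    finally have "sgn_elt \<pi> \<otimes> (\<Otimes>r\<in>{..<n}. \<Oplus>t\<in>{..<n}. M r t \<otimes> N t (\<pi> r)) =
        sgn_elt \<pi> \<otimes> (\<Oplus>f\<in>?F. ?m f \<otimes> (\<Otimes>r\<in>{..<n}. N (f r) (\<pi> r)))" by simp
    also have "\<dots> = (\<Oplus>f\<in>?F. sgn_elt \<pi> \<otimes> (?m f \<otimes> (\<Otimes>r\<in>{..<n}. N (f r) (\<pi> r))))"
      by (rule finsum_rdistr) (use finF mc nc Fn s in auto)
    also have "\<dots> = (\<Oplus>f\<in>?F. ?m f \<otimes> (sgn_elt \<pi> \<otimes> (\<Otimes>r\<in>{..<n}. N (f r) (\<pi> r))))"
    proof (rule finsum_cong')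
      fix f assume f: "f \<in> ?F"
      show "sgn_elt \<pi> \<otimes> (?m f \<otimes> (\<Otimes>r\<in>{..<n}. N (f r) (\<pi> r))) = ?m f \<otimes> (sgn_elt \<pi> \<otimes> (\<Otimes>r\<in>{..<n}. N (f r) (\<pi> r)))"
        by (rule m_lcomm) (use mc[OF Fn[OF f]] nc[OF Fn[OF f] s] in auto)
    qed (use mc nc Fn s in auto)
    finally show "sgn_elt \<pi> \<otimes> (\<Otimes>r\<in>{..<n}. \<Oplus>t\<in>{..<n}. M r t \<otimes> N t (\<pi> r)) =
        (\<Oplus>f\<in>?F. ?m f \<otimes> (sgn_elt \<pi> \<otimes> (\<Otimes>r\<in>{..<n}. N (f r) (\<pi> r))))" .
  qed (use mc nc Fn in \<open>auto intro!: finsum_closed\<close>)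
  also have "\<dots> = (\<Oplus>f\<in>?F. \<Oplus>\<pi>\<in>?S. ?m f \<otimes> (sgn_elt \<pi> \<otimes> (\<Otimes>r\<in>{..<n}. N (f r) (\<pi> r))))"
    by (rule finsum_swap) (use finS finF mc nc Fn in auto)
  also have "\<dots> = (\<Oplus>f\<in>?F. ?m f \<otimes> ?D f)"
  proof (rule finsum_cong')
    fix f assume f: "f \<in> ?F"
    show "(\<Oplus>\<pi>\<in>?S. ?m f \<otimes> (sgn_elt \<pi> \<otimes> (\<Otimes>r\<in>{..<n}. N (f r) (\<pi> r)))) = ?m f \<otimes> ?D f"
      by (rule finsum_rdistr[symmetric]) (use finS mc[OF Fn[OF f]] nc[OF Fn[OF f]] in auto)
  qed (use mc Dc Fn in auto)
  \<comment> \<open>Maps that are not injective contribute a determinant with equal rows, that is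
    zero. The injective ones are bijections of a finite set, hence restrictions of
    permutations.\<close>
  also have "\<dots> = (\<Oplus>f\<in>(\<lambda>\<rho>. restrict \<rho> {..<n}) ` ?S. ?m f \<otimes> ?D f)"
  proof (rule add.finprod_mono_neutral_cong_right)
    show "(\<lambda>\<rho>. restrict \<rho> {..<n}) ` ?S \<subseteq> ?F" using Sn by (auto split: if_splits)
    fix f assume f: "f \<in> ?F - (\<lambda>\<rho>. restrict \<rho> {..<n}) ` ?S"
    have "\<not> inj_on f {..<n}"
    proof
      assume inj: "inj_on f {..<n}"
      define \<rho> where "\<rho> r = (if r < n then f r else r)" for r
      have im: "f ` {..<n} = {..<n}"
        using inj f Fn by (intro card_subset_eq) (auto simp: card_image)
      have "bij_betw \<rho> {..<n} {..<n}"
        using inj im by (auto simp: bij_betw_def \<rho>_def inj_on_def image_def)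
      then have "\<rho> permutes {..<n}" by (rule bij_imp_permutes) (simp add: \<rho>_def)
      moreover have "f = restrict \<rho> {..<n}"
        using f by (intro ext) (auto simp: \<rho>_def restrict_def PiE_iff extensional_def)
      ultimately show False using f by auto
    qed
    then have "?D f = \<zero>" by (intro row_sum_not_inj[OF N]) (use f Fn in auto)
    then show "?m f \<otimes> ?D f = \<zero>" using mc[of f] f Fn by simp
  qed (use finF mc Dc Fn in auto)
  also have "\<dots> = (\<Oplus>\<rho>\<in>?S. ?m (restrict \<rho> {..<n}) \<otimes> ?D (restrict \<rho> {..<n}))"
  proof (rule finsum_reindex)
    show "(\<lambda>f. ?m f \<otimes> ?D f) \<in> (\<lambda>\<rho>. restrict \<rho> {..<n}) ` ?S \<rightarrow> carrier R"
      using mc Dc Sn by auto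
    show "inj_on (\<lambda>\<rho>. restrict \<rho> {..<n}) ?S"
    proof (rule inj_onI)
      fix \<rho> \<rho>' assume *: "\<rho> \<in> ?S" "\<rho>' \<in> ?S" "restrict \<rho> {..<n} = restrict \<rho>' {..<n}"
      show "\<rho> = \<rho>'"
      proof
        fix r show "\<rho> r = \<rho>' r"
          using fun_cong[OF *(3), of r] *(1,2) by (cases "r < n") (auto simp: permutes_def)
      qed
    qed
  qed
  also have "\<dots> = (\<Oplus>\<rho>\<in>?S. (sgn_elt \<rho> \<otimes> ?m \<rho>) \<otimes> mat_det R n N)"
  proof (rule finsum_cong')
    fix \<rho> assume r: "\<rho> \<in> ?S"
    have 1: "?m (restrict \<rho> {..<n}) = ?m \<rho>"
      by (rule finprod_cong') (use Mc Sn[OF r] in auto)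
    have "?D (restrict \<rho> {..<n}) = ?D \<rho>"
    proof (rule finsum_cong')
      fix \<pi> assume s: "\<pi> \<in> ?S"
      have "(\<Otimes>ra\<in>{..<n}. N (restrict \<rho> {..<n} ra) (\<pi> ra)) = (\<Otimes>ra\<in>{..<n}. N (\<rho> ra) (\<pi> ra))"
        by (rule finprod_cong') (use Nc Sn[OF r] Sn[OF s] in auto)
      then show "sgn_elt \<pi> \<otimes> (\<Otimes>ra\<in>{..<n}. N (restrict \<rho> {..<n} ra) (\<pi> ra)) = sgn_elt \<pi> \<otimes> (\<Otimes>ra\<in>{..<n}. N (\<rho> ra) (\<pi> ra))"
        by simp
    qed (use nc Sn[OF r] in auto)
    then have 2: "?D (restrict \<rho> {..<n}) = sgn_elt \<rho> \<otimes> mat_det R n N" using row_sum_permutes[OF N] r by simp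
    show "?m (restrict \<rho> {..<n}) \<otimes> ?D (restrict \<rho> {..<n}) = (sgn_elt \<rho> \<otimes> ?m \<rho>) \<otimes> mat_det R n N"
      unfolding 1 2 using mc[OF Sn[OF r]] detN by (simp add: m_ac)
  qed (use mc Sn detN in auto)
  also have "\<dots> = (\<Oplus>\<rho>\<in>?S. sgn_elt \<rho> \<otimes> ?m \<rho>) \<otimes> mat_det R n N"
    by (rule finsum_ldistr[symmetric]) (use finS mc Sn detN in auto)
  also have "\<dots> = mat_det R n M \<otimes> mat_det R n N" using mat_det_sgn[OF M] by simp
  finally show ?thesis .
qed

lemma mat_det_cong:
  assumes "mat_eq n M N" "N \<in> mat_carrier R n"
  shows "mat_det R n M = mat_det R n N"
proof -
  have M: "M \<in> mat_carrier R n" using assms by (auto simp: mat_eq_def mat_carrier_def)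
  have Sn: "\<pi> r < n" if "\<pi> permutes {..<n}" "r < n" for \<pi> r using permutes_in_image[of \<pi> "{..<n}" r] that by auto
  have Nc: "\<And>r s. r < n \<Longrightarrow> s < n \<Longrightarrow> N r s \<in> carrier R" using assms by (simp add: mat_carrier_def)
  have "(\<Otimes>r\<in>{..<n}. M r (\<pi> r)) = (\<Otimes>r\<in>{..<n}. N r (\<pi> r))" if "\<pi> permutes {..<n}" for \<pi>
    by (rule finprod_cong') (use assms Nc Sn[OF that] in \<open>auto simp: mat_eq_def\<close>)
  moreover have "(\<Otimes>r\<in>{..<n}. N r (\<pi> r)) \<in> carrier R" if "\<pi> permutes {..<n}" for \<pi>
    using Nc Sn[OF that] by (intro finprod_closed) auto
  ultimately show ?thesis unfolding mat_det_sgn[OF M] mat_det_sgn[OF assms(2)]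
    by (intro finsum_cong') auto
qed

lemma mat_det_one: "mat_det R n (mat_one R) = \<one>"
proof -
  let ?S = "{\<pi>. \<pi> permutes {..<n}}"
  have oc: "mat_one R \<in> mat_carrier R n" by (simp add: mat_carrier_def mat_one_def)
  have z: "(\<Otimes>r\<in>{..<n}. mat_one R r (\<pi> r)) = (if \<pi> = id then \<one> else \<zero>)" if s: "\<pi> \<in> ?S" for \<pi>
  proof (cases "\<pi> = id")
    case True
    then show ?thesis by (simp add: mat_one_def)
  next
    case False
    then obtain r where r: "\<pi> r \<noteq> r" by (auto simp: fun_eq_iff)
    then have rn: "r \<in> {..<n}" using s by (auto simp: permutes_def)
    have "(\<Otimes>r\<in>insert r ({..<n} - {r}). mat_one R r (\<pi> r)) = mat_one R r (\<pi> r) \<otimes> (\<Otimes>r\<in>{..<n} - {r}. mat_one R r (\<pi> r))"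
      by (rule finprod_insert) (auto simp: mat_one_def)
    moreover have "mat_one R r (\<pi> r) = \<zero>" using r by (auto simp: mat_one_def)
    moreover have "(\<Otimes>r\<in>{..<n} - {r}. mat_one R r (\<pi> r)) \<in> carrier R" by (rule finprod_closed) (auto simp: mat_one_def)
    ultimately show ?thesis using rn False by (simp add: insert_absorb)
  qed
  have "mat_det R n (mat_one R) = (\<Oplus>\<pi>\<in>?S. if id = \<pi> then \<one> else \<zero>)"
    unfolding mat_det_sgn[OF oc] by (rule finsum_cong') (auto simp: z sgn_elt_def evenperm_id)
  also have "\<dots> = \<one>"
    using finsum_singleton[of id ?S "\<lambda>_. \<one>"] by (simp add: permutes_id finite_permutations)
  finally show ?thesis .
qed

lemma subring_finsum: "subring S R \<Longrightarrow> (\<And>x. x \<in> U \<Longrightarrow> f x \<in> S) \<Longrightarrow> finsum R f U \<in> S"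
proof (induction U rule: infinite_finite_induct)
  case (insert x U)
  then have "finsum R f (insert x U) = f x \<oplus> finsum R f U"
    using subringE(1)[OF insert.prems(1)] by (intro finsum_insert) auto
  then show ?case using insert subringE(7)[OF insert.prems(1)] by simp
qed (simp_all add: subringE(2))

lemma subring_finprod: "subring S R \<Longrightarrow> (\<And>x. x \<in> U \<Longrightarrow> f x \<in> S) \<Longrightarrow> finprod R f U \<in> S"
proof (induction U rule: infinite_finite_induct)
  case (insert x U)
  then have "finprod R f (insert x U) = f x \<otimes> finprod R f U"
    using subringE(1)[OF insert.prems(1)] by (intro finprod_insert) auto
  then show ?case using insert subringE(6)[OF insert.prems(1)] by simp
qed (simp_all add: subringE(3))

lemma subring_mat_det:
  assumes S: "subring S R" and M: "\<And>r s. r < n \<Longrightarrow> s < n \<Longrightarrow> M r s \<in> S"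
  shows "mat_det R n M \<in> S"
proof -
  have Mc: "M \<in> mat_carrier R n" using M subringE(1)[OF S] by (auto simp: mat_carrier_def)
  have sg: "sgn_elt \<pi> \<in> S" for \<pi> :: "nat \<Rightarrow> nat"
    using subringE(3,5)[OF S] by (simp add: sgn_elt_def)
  have "sgn_elt \<pi> \<otimes> (\<Otimes>r\<in>{..<n}. M r (\<pi> r)) \<in> S" if "\<pi> permutes {..<n}" for \<pi>
  proof (rule subringE(6)[OF S sg subring_finprod[OF S]])
    fix r assume "r \<in> {..<n}"
    then show "M r (\<pi> r) \<in> S" using M permutes_in_image[OF that, of r] by auto
  qed
  then show ?thesis unfolding mat_det_sgn[OF Mc] by (intro subring_finsum[OF S]) simp
qed

end

section \<open>Power series rings\<close>

lemma mps_simps [simp]: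
  "carrier (mps R) = UNIV \<rightarrow> carrier R"
  "(f \<otimes>\<^bsub>mps R\<^esub> g) k = (\<Oplus>\<^bsub>R\<^esub>z\<in>splittings k. f (fst z) \<otimes>\<^bsub>R\<^esub> g (snd z))"
  "\<one>\<^bsub>mps R\<^esub> k = (if k = 0 then \<one>\<^bsub>R\<^esub> else \<zero>\<^bsub>R\<^esub>)"
  "\<zero>\<^bsub>mps R\<^esub> k = \<zero>\<^bsub>R\<^esub>" "(f \<oplus>\<^bsub>mps R\<^esub> g) k = f k \<oplus>\<^bsub>R\<^esub> g k"
  by (simp_all add: mps_def)

text \<open>With this the differential equation becomes an identity of matrices over a commutative
  ring, in which \<open>\<theta>\<close> acts as a ring homomorphism and invertible matrices can be
  cancelled.\<close>

lemma (in cring) mps_cring: "cring (mps R :: ('i::finite multiindex \<Rightarrow> 'a) ring)"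
proof (rule cringI)
  let ?R = "mps R :: ('i multiindex \<Rightarrow> 'a) ring"
  have c: "f k \<in> carrier R" if "f \<in> carrier ?R" for f :: "'i multiindex \<Rightarrow> 'a" and k using that by auto
  show "abelian_group ?R"
  proof (rule abelian_groupI)
    fix f assume f: "f \<in> carrier ?R"
    show "\<exists>g\<in>carrier ?R. g \<oplus>\<^bsub>?R\<^esub> f = \<zero>\<^bsub>?R\<^esub>"
      using c[OF f] by (intro bexI[of _ "\<lambda>k. \<ominus> f k"] ext) (auto simp: l_neg)
  qed (auto simp: fun_eq_iff Pi_iff a_ac)
  show "comm_monoid ?R"
  proof (rule comm_monoidI)
    fix f g h assume fgh: "f \<in> carrier ?R" "g \<in> carrier ?R" "h \<in> carrier ?R"
    show "f \<otimes>\<^bsub>?R\<^esub> g \<in> carrier ?R" using c[OF fgh(1)] c[OF fgh(2)] by (auto intro!: finsum_closed)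
    show "f \<otimes>\<^bsub>?R\<^esub> g = g \<otimes>\<^bsub>?R\<^esub> f"
    proof
      fix k :: "'i multiindex"
      have "bij_betw prod.swap (splittings k) (splittings k)"
        by (rule bij_betwI[where g = prod.swap]) (auto simp: splittings_def add.commute)
      then have "(\<Oplus>z\<in>splittings k. f (fst z) \<otimes> g (snd z)) = (\<Oplus>z\<in>splittings k. f (fst (prod.swap z)) \<otimes> g (snd (prod.swap z)))"
        by (rule finsum_bij) (use c fgh in auto)
      also have "\<dots> = (\<Oplus>z\<in>splittings k. g (fst z) \<otimes> f (snd z))"
        by (rule finsum_cong') (use c[OF fgh(1)] c[OF fgh(2)] in \<open>auto simp: m_comm\<close>)
      finally show "(f \<otimes>\<^bsub>?R\<^esub> g) k = (g \<otimes>\<^bsub>?R\<^esub> f) k" by simp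
    qed
    show "(f \<otimes>\<^bsub>?R\<^esub> g) \<otimes>\<^bsub>?R\<^esub> h = f \<otimes>\<^bsub>?R\<^esub> (g \<otimes>\<^bsub>?R\<^esub> h)"
    proof
      fix k :: "'i multiindex"
      let ?A = "Sigma (splittings k) (\<lambda>z. splittings (fst z))" and ?B = "Sigma (splittings k) (\<lambda>z. splittings (snd z))"
      let ?p = "\<lambda>w. f (fst (fst w)) \<otimes> (g (fst (snd w)) \<otimes> h (snd (snd w)))"
      \<comment> \<open>Both iterated sums run over the ways to write \<open>k\<close> as a sum of
        three multiindices; \<open>?b\<close> changes the bracketing.\<close>
      let ?b = "\<lambda>w. ((fst (snd w), snd (snd w) + snd (fst w)), (snd (snd w), snd (fst w)))"
      have bij: "bij_betw ?b ?A ?B"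
        by (rule bij_betwI[where g = "\<lambda>w. ((fst (fst w) + fst (snd w), snd (snd w)), (fst (fst w), fst (snd w)))"])
           (auto simp: splittings_def add.assoc)
      note cc = c[OF fgh(1)] c[OF fgh(2)] c[OF fgh(3)]
      have "((f \<otimes>\<^bsub>?R\<^esub> g) \<otimes>\<^bsub>?R\<^esub> h) k = (\<Oplus>z\<in>splittings k. \<Oplus>y\<in>splittings (fst z). f (fst y) \<otimes> g (snd y) \<otimes> h (snd z))"
        unfolding mps_simps
        by (rule finsum_cong') (use cc in \<open>auto intro!: finsum_ldistr finsum_closed\<close>)
      also have "\<dots> = (\<Oplus>w\<in>?A. f (fst (snd w)) \<otimes> g (snd (snd w)) \<otimes> h (snd (fst w)))"
        by (rule finsum_Sigma) (use cc in auto)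
      also have "\<dots> = (\<Oplus>w\<in>?A. ?p (?b w))"
        by (rule finsum_cong') (use cc in \<open>auto simp: m_assoc\<close>)
      also have "\<dots> = (\<Oplus>w\<in>?B. ?p w)"
        by (rule finsum_bij[OF bij, symmetric]) (use cc in auto)
      also have "\<dots> = (\<Oplus>z\<in>splittings k. \<Oplus>y\<in>splittings (snd z). f (fst z) \<otimes> (g (fst y) \<otimes> h (snd y)))"
        by (rule finsum_Sigma[symmetric]) (use cc in auto)
      also have "\<dots> = (f \<otimes>\<^bsub>?R\<^esub> (g \<otimes>\<^bsub>?R\<^esub> h)) k"
        unfolding mps_simps
        by (rule finsum_cong') (use cc in \<open>auto intro!: finsum_rdistr[symmetric] finsum_closed\<close>)
      finally show "((f \<otimes>\<^bsub>?R\<^esub> g) \<otimes>\<^bsub>?R\<^esub> h) k = (f \<otimes>\<^bsub>?R\<^esub> (g \<otimes>\<^bsub>?R\<^esub> h)) k" .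
    qed
    show "\<one>\<^bsub>?R\<^esub> \<otimes>\<^bsub>?R\<^esub> f = f"
    proof
      fix k :: "'i multiindex"
      have mem: "(0, k) \<in> splittings k" by (auto simp: splittings_def)
      have "(\<one>\<^bsub>?R\<^esub> \<otimes>\<^bsub>?R\<^esub> f) k = (\<Oplus>z\<in>splittings k. if (0, k) = z then f (snd z) else \<zero>)"
        unfolding mps_simps
      proof (rule finsum_cong')
        fix z :: "'i multiindex \<times> 'i multiindex" assume "z \<in> splittings k"
        then have "fst z = 0 \<longleftrightarrow> (0, k) = z" by (cases z) (auto simp: splittings_def)
        then show "(if fst z = 0 then \<one> else \<zero>) \<otimes> f (snd z) = (if (0, k) = z then f (snd z) else \<zero>)"
          using c[OF fgh(1)] by simp
      qed (use c[OF fgh(1)] in auto)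
      also have "\<dots> = f k" using finsum_singleton[OF mem, of "\<lambda>z. f (snd z)"] c[OF fgh(1)] by auto
      finally show "(\<one>\<^bsub>?R\<^esub> \<otimes>\<^bsub>?R\<^esub> f) k = f k" .
    qed
  qed auto
  fix f g h assume fgh: "f \<in> carrier ?R" "g \<in> carrier ?R" "h \<in> carrier ?R"
  note cc = c[OF fgh(1)] c[OF fgh(2)] c[OF fgh(3)]
  show "(f \<oplus>\<^bsub>?R\<^esub> g) \<otimes>\<^bsub>?R\<^esub> h = f \<otimes>\<^bsub>?R\<^esub> h \<oplus>\<^bsub>?R\<^esub> g \<otimes>\<^bsub>?R\<^esub> h"
  proof
    fix k :: "'i multiindex"
    have "((f \<oplus>\<^bsub>?R\<^esub> g) \<otimes>\<^bsub>?R\<^esub> h) k = (\<Oplus>z\<in>splittings k. f (fst z) \<otimes> h (snd z) \<oplus> g (fst z) \<otimes> h (snd z))"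
      unfolding mps_simps by (rule finsum_cong') (use cc in \<open>auto simp: l_distr\<close>)
    also have "\<dots> = (f \<otimes>\<^bsub>?R\<^esub> h \<oplus>\<^bsub>?R\<^esub> g \<otimes>\<^bsub>?R\<^esub> h) k"
      unfolding mps_simps by (rule finsum_addf) (use cc in auto)
    finally show "((f \<oplus>\<^bsub>?R\<^esub> g) \<otimes>\<^bsub>?R\<^esub> h) k = (f \<otimes>\<^bsub>?R\<^esub> h \<oplus>\<^bsub>?R\<^esub> g \<otimes>\<^bsub>?R\<^esub> h) k" .
  qed
qed

lemma mps_map_hom:
  assumes "cring A" "cring B" "h \<in> ring_hom A B"
  shows "(\<lambda>f k. h (f k)) \<in> ring_hom (mps A :: ('i::finite multiindex \<Rightarrow> _) ring) (mps B)"
proof -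
  interpret A: cring A by fact
  interpret B: cring B by fact
  interpret h: ring_hom_cring A B h
    by (intro ring_hom_cring.intro ring_hom_cring_axioms.intro assms)
  show ?thesis
  proof (rule ring_hom_memI)
    fix f g :: "'i multiindex \<Rightarrow> _" assume "f \<in> carrier (mps A)" "g \<in> carrier (mps A)"
    then have fg: "\<And>k. f k \<in> carrier A" "\<And>k. g k \<in> carrier A" by auto
    show "(\<lambda>k. h (f k)) \<in> carrier (mps B)" using fg by auto
    show "(\<lambda>k. h ((f \<oplus>\<^bsub>mps A\<^esub> g) k)) = (\<lambda>k. h (f k)) \<oplus>\<^bsub>mps B\<^esub> (\<lambda>k. h (g k))"
      using fg by (auto simp: fun_eq_iff)
    show "(\<lambda>k. h ((f \<otimes>\<^bsub>mps A\<^esub> g) k)) = (\<lambda>k. h (f k)) \<otimes>\<^bsub>mps B\<^esub> (\<lambda>k. h (g k))"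
    proof
      fix k :: "'i multiindex"
      have "h ((f \<otimes>\<^bsub>mps A\<^esub> g) k) = (\<Oplus>\<^bsub>B\<^esub>z\<in>splittings k. h (f (fst z) \<otimes>\<^bsub>A\<^esub> g (snd z)))"
        using fg by (simp add: h.hom_finsum comp_def Pi_iff)
      also have "\<dots> = ((\<lambda>k. h (f k)) \<otimes>\<^bsub>mps B\<^esub> (\<lambda>k. h (g k))) k"
        using fg by simp
      finally show "h ((f \<otimes>\<^bsub>mps A\<^esub> g) k) = ((\<lambda>k. h (f k)) \<otimes>\<^bsub>mps B\<^esub> (\<lambda>k. h (g k))) k" .
    qed
  qed (auto simp: fun_eq_iff)
qed

lemma (in cring) mps_mult_const:
  assumes "f \<in> carrier (mps R)" "a \<in> carrier R"
  shows "(f \<otimes>\<^bsub>mps R\<^esub> mps_const R a) k = f k \<otimes> a"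
proof -
  have c: "\<And>k. f k \<in> carrier R" using assms(1) by auto
  have mem: "(k, 0) \<in> splittings k" by (auto simp: splittings_def)
  have "(f \<otimes>\<^bsub>mps R\<^esub> mps_const R a) k = (\<Oplus>z\<in>splittings k. if (k, 0) = z then f (fst z) \<otimes> a else \<zero>)"
    unfolding mps_simps
  proof (rule finsum_cong')
    fix z :: "'c multiindex \<times> 'c multiindex" assume "z \<in> splittings k"
    then have "snd z = 0 \<longleftrightarrow> (k, 0) = z" by (cases z) (auto simp: splittings_def)
    then show "f (fst z) \<otimes> mps_const R a (snd z) = (if (k, 0) = z then f (fst z) \<otimes> a else \<zero>)"
      using c assms(2) by (simp add: mps_const_def)
  qed (use c assms(2) in auto)
  also have "\<dots> = f k \<otimes> a" using finsum_singleton[OF mem, of "\<lambda>z. f (fst z) \<otimes> a"] c assms(2) by auto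
  finally show ?thesis .
qed

lemma (in cring) mps_const_hom: "mps_const R \<in> ring_hom R (mps R)"
proof (rule ring_hom_memI)
  fix x y assume xy: "x \<in> carrier R" "y \<in> carrier R"
  show c: "mps_const R x \<in> carrier (mps R)" using xy by (auto simp: mps_const_def)
  show "mps_const R (x \<otimes> y) = mps_const R x \<otimes>\<^bsub>mps R\<^esub> mps_const R y"
  proof
    fix k
    show "mps_const R (x \<otimes> y) k = (mps_const R x \<otimes>\<^bsub>mps R\<^esub> mps_const R y) k"
      unfolding mps_mult_const[OF c xy(2)] using xy by (simp add: mps_const_def)
  qed
  show "mps_const R (x \<oplus> y) = mps_const R x \<oplus>\<^bsub>mps R\<^esub> mps_const R y"
    using xy by (auto simp: fun_eq_iff mps_const_def)
qed (auto simp: fun_eq_iff mps_const_def)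

section \<open>Matrices\<close>

lemma mat_mul_hom:
  assumes "cring A" "cring B" "h \<in> ring_hom A B" "M \<in> mat_carrier A n" "N \<in> mat_carrier A n" "r < n" "s < n"
  shows "h (mat_mul A n M N r s) = mat_mul B n (\<lambda>r s. h (M r s)) (\<lambda>r s. h (N r s)) r s"
proof -
  interpret A: cring A by fact
  interpret B: cring B by fact
  interpret h: ring_hom_cring A B h
    by (intro ring_hom_cring.intro ring_hom_cring_axioms.intro assms)
  have c: "\<And>t. t < n \<Longrightarrow> M r t \<in> carrier A" "\<And>t. t < n \<Longrightarrow> N t s \<in> carrier A"
    using assms by (auto simp: mat_carrier_def)
  have "h (mat_mul A n M N r s) = (\<Oplus>\<^bsub>B\<^esub>t\<in>{..<n}. h (M r t \<otimes>\<^bsub>A\<^esub> N t s))"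
    unfolding mat_mul_def using c by (simp add: h.hom_finsum comp_def Pi_iff)
  also have "\<dots> = mat_mul B n (\<lambda>r s. h (M r s)) (\<lambda>r s. h (N r s)) r s"
    unfolding mat_mul_def by (rule B.finsum_cong') (use c in auto)
  finally show ?thesis .
qed

context cring
begin

lemma mat_mul_assoc:
  assumes "M \<in> mat_carrier R n" "N \<in> mat_carrier R n" "P \<in> mat_carrier R n" "r < n" "s < n"
  shows "mat_mul R n (mat_mul R n M N) P r s = mat_mul R n M (mat_mul R n N P) r s"
proof -
  have c: "\<And>t. t < n \<Longrightarrow> M r t \<in> carrier R" "\<And>t v. t < n \<Longrightarrow> v < n \<Longrightarrow> N t v \<in> carrier R" "\<And>t. t < n \<Longrightarrow> P t s \<in> carrier R"
    using assms by (auto simp: mat_carrier_def)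
  have "mat_mul R n (mat_mul R n M N) P r s = (\<Oplus>v\<in>{..<n}. \<Oplus>t\<in>{..<n}. M r t \<otimes> (N t v \<otimes> P v s))"
    unfolding mat_mul_def
  proof (rule finsum_cong')
    fix v assume v: "v \<in> {..<n}"
    have "(\<Oplus>t\<in>{..<n}. M r t \<otimes> N t v) \<otimes> P v s = (\<Oplus>t\<in>{..<n}. (M r t \<otimes> N t v) \<otimes> P v s)"
      by (rule finsum_ldistr) (use c v in auto)
    also have "\<dots> = (\<Oplus>t\<in>{..<n}. M r t \<otimes> (N t v \<otimes> P v s))"
      by (rule finsum_cong') (use c v in \<open>auto simp: m_assoc\<close>)
    finally show "(\<Oplus>t\<in>{..<n}. M r t \<otimes> N t v) \<otimes> P v s = (\<Oplus>t\<in>{..<n}. M r t \<otimes> (N t v \<otimes> P v s))" .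
  qed (use c in \<open>auto intro!: finsum_closed\<close>)
  also have "\<dots> = (\<Oplus>t\<in>{..<n}. \<Oplus>v\<in>{..<n}. M r t \<otimes> (N t v \<otimes> P v s))"
    by (rule finsum_swap) (use c in auto)
  also have "\<dots> = mat_mul R n M (mat_mul R n N P) r s"
    unfolding mat_mul_def
  proof (rule finsum_cong')
    fix t assume t: "t \<in> {..<n}"
    show "(\<Oplus>v\<in>{..<n}. M r t \<otimes> (N t v \<otimes> P v s)) = M r t \<otimes> (\<Oplus>v\<in>{..<n}. N t v \<otimes> P v s)"
      by (rule finsum_rdistr[symmetric]) (use c t in auto)
  qed (use c in \<open>auto intro!: finsum_closed\<close>)
  finally show ?thesis .
qed

lemma mat_mul_cong:
  assumes "mat_eq n M M'" "mat_eq n N N'" "M' \<in> mat_carrier R n" "N' \<in> mat_carrier R n"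
  shows "mat_eq n (mat_mul R n M N) (mat_mul R n M' N')"
  unfolding mat_eq_def
proof (intro allI impI)
  fix r s assume "r < n" "s < n"
  then show "mat_mul R n M N r s = mat_mul R n M' N' r s"
    unfolding mat_mul_def by (intro finsum_cong') (use assms in \<open>auto simp: mat_eq_def mat_carrier_def\<close>)
qed

lemma mat_mul_one_left:
  assumes "M \<in> mat_carrier R n"
  shows "mat_eq n (mat_mul R n (mat_one R) M) M"
  unfolding mat_eq_def
proof (intro allI impI)
  fix r s assume rs: "r < n" "s < n"
  have c: "\<And>t. t < n \<Longrightarrow> M t s \<in> carrier R" using assms rs by (simp add: mat_carrier_def)
  have "mat_mul R n (mat_one R) M r s = (\<Oplus>t\<in>{..<n}. if r = t then M t s else \<zero>)"
    unfolding mat_mul_def by (rule finsum_cong') (use c in \<open>auto simp: mat_one_def\<close>)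
  also have "\<dots> = M r s" using finsum_singleton[of r "{..<n}" "\<lambda>t. M t s"] rs c by auto
  finally show "mat_mul R n (mat_one R) M r s = M r s" .
qed

lemma mat_mul_one_right:
  assumes "M \<in> mat_carrier R n"
  shows "mat_eq n (mat_mul R n M (mat_one R)) M"
  unfolding mat_eq_def
proof (intro allI impI)
  fix r s assume rs: "r < n" "s < n"
  have c: "\<And>t. t < n \<Longrightarrow> M r t \<in> carrier R" using assms rs by (simp add: mat_carrier_def)
  have "mat_mul R n M (mat_one R) r s = (\<Oplus>t\<in>{..<n}. if s = t then M r t else \<zero>)"
    unfolding mat_mul_def by (rule finsum_cong') (use c in \<open>auto simp: mat_one_def\<close>)
  also have "\<dots> = M r s" using finsum_singleton[of s "{..<n}" "\<lambda>t. M r t"] rs c by auto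
  finally show "mat_mul R n M (mat_one R) r s = M r s" .
qed

end

section \<open>Small subrings\<close>

text \<open>Allows the algebra of constants of \<open>R \<otimes>\<^sub>F R\<close> to be copied into the universe \<open>'u\<close>.\<close>

lemma generate_ring_embeds:
  fixes S :: "('s, 'c) ring_scheme" and H :: "'s set"
  assumes inf: "infinite (UNIV :: 'u set)" and H: "(card_of H, card_of (UNIV :: 'u set)) \<in> ordLeq"
  shows "\<exists>e :: 's \<Rightarrow> 'u. inj_on e (generate_ring S H)"
proof -
  let ?U = "UNIV :: 'u set"
  \<comment> \<open>One round of all ring operations. The generated ring is exhausted by countably
    many rounds, and each round stays no larger than \<open>'u\<close>, because an infinite cardinal
    absorbs finite sums and products.\<close>
  define step where "step X' = X' \<union> ((a_inv S ` X') \<union> ((\<lambda>z. fst z \<oplus>\<^bsub>S\<^esub> snd z) ` (X' \<times> X') \<union> (\<lambda>z. fst z \<otimes>\<^bsub>S\<^esub> snd z) ` (X' \<times> X')))" for X'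
  define layer where "layer n = (step ^^ n) (insert \<one>\<^bsub>S\<^esub> H)" for n
  have img: "(card_of (f ` B), card_of ?U) \<in> ordLeq" if "(card_of B, card_of ?U) \<in> ordLeq" for f :: "'d \<Rightarrow> 's" and B
    using ordLeq_transitive[OF card_of_image that] .
  have small: "(card_of (layer n), card_of ?U) \<in> ordLeq" for n
  proof (induction n)
    case 0
    have "(card_of {\<one>\<^bsub>S\<^esub>}, card_of ?U) \<in> ordLeq"
      by (rule ordLess_imp_ordLeq[OF finite_ordLess_infinite2]) (use inf in auto)
    then have "(card_of ({\<one>\<^bsub>S\<^esub>} \<union> H), card_of ?U) \<in> ordLeq"
      by (rule card_of_Un_ordLeq_infinite[OF inf _ H])
    then show ?case by (simp add: layer_def)
  next
    case (Suc n)
    have T: "(card_of (layer n \<times> layer n), card_of ?U) \<in> ordLeq"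
      by (rule card_of_Times_ordLeq_infinite[OF inf Suc Suc])
    have "(card_of (step (layer n)), card_of ?U) \<in> ordLeq"
      unfolding step_def
      by (intro card_of_Un_ordLeq_infinite[OF inf] img[OF T] img[OF Suc] Suc)
    then show ?case by (simp add: layer_def)
  qed
  have mono: "layer m \<subseteq> layer n" if "m \<le> n" for m n
    using that by (rule lift_Suc_mono_le[rotated]) (auto simp: layer_def step_def)
  have nat: "(card_of (UNIV :: nat set), card_of ?U) \<in> ordLeq"
    using inf infinite_iff_card_of_nat by blast
  have Un: "(card_of (\<Union>n. layer n), card_of ?U) \<in> ordLeq"
    by (rule card_of_UNION_ordLeq_infinite[OF inf nat]) (use small in blast)
  have "x \<in> (\<Union>n. layer n)" if "x \<in> generate_ring S H" for x
    using that
  proof (induction rule: generate_ring.induct)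
    case one
    show ?case by (auto simp: layer_def intro!: exI[of _ 0])
  next
    case (incl h)
    then show ?case by (auto simp: layer_def intro!: exI[of _ 0])
  next
    case (a_inv h)
    then obtain n where "h \<in> layer n" by blast
    then have "\<ominus>\<^bsub>S\<^esub> h \<in> layer (Suc n)" by (auto simp: layer_def step_def)
    then show ?case by blast
  next
    case (eng_add x y)
    then obtain m n where "x \<in> layer m" "y \<in> layer n" by blast
    then have "x \<in> layer (max m n)" "y \<in> layer (max m n)" using mono by (meson max.cobounded1 max.cobounded2 subsetD)+
    then have "x \<oplus>\<^bsub>S\<^esub> y \<in> layer (Suc (max m n))" by (force simp: layer_def step_def)
    then show ?case by blast
  next
    case (eng_mult x y)
    then obtain m n where "x \<in> layer m" "y \<in> layer n" by blast
    then have "x \<in> layer (max m n)" "y \<in> layer (max m n)" using mono by (meson max.cobounded1 max.cobounded2 subsetD)+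
    then have "x \<otimes>\<^bsub>S\<^esub> y \<in> layer (Suc (max m n))" by (force simp: layer_def step_def)
    then show ?case by blast
  qed
  then have "generate_ring S H \<subseteq> (\<Union>n. layer n)" by blast
  from ordLeq_transitive[OF card_of_mono1[OF this] Un]
  show ?thesis unfolding card_of_ordLeq[symmetric] by blast
qed

text \<open>Transport of structure: each law for \<open>L\<close> holds because it holds in
  \<open>S\<close> after applying the injective \<open>\<kappa>\<close>, with scalars acting through
  \<open>j\<close>. It recognises a record built on the type \<open>'u\<close> as an
  algebra.\<close>

lemma algebra_via_injection:
  assumes K: "cring K" and S: "cring S" and j: "j \<in> ring_hom K S" and inj: "inj_on \<kappa> (carrier L)"
    and cl: "\<And>x. x \<in> carrier L \<Longrightarrow> \<kappa> x \<in> carrier S"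
    and one: "\<one>\<^bsub>L\<^esub> \<in> carrier L" "\<kappa> \<one>\<^bsub>L\<^esub> = \<one>\<^bsub>S\<^esub>" and zero: "\<zero>\<^bsub>L\<^esub> \<in> carrier L" "\<kappa> \<zero>\<^bsub>L\<^esub> = \<zero>\<^bsub>S\<^esub>"
    and add: "\<And>x y. x \<in> carrier L \<Longrightarrow> y \<in> carrier L \<Longrightarrow> x \<oplus>\<^bsub>L\<^esub> y \<in> carrier L \<and> \<kappa> (x \<oplus>\<^bsub>L\<^esub> y) = \<kappa> x \<oplus>\<^bsub>S\<^esub> \<kappa> y"
    and mult: "\<And>x y. x \<in> carrier L \<Longrightarrow> y \<in> carrier L \<Longrightarrow> x \<otimes>\<^bsub>L\<^esub> y \<in> carrier L \<and> \<kappa> (x \<otimes>\<^bsub>L\<^esub> y) = \<kappa> x \<otimes>\<^bsub>S\<^esub> \<kappa> y"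
    and neg: "\<And>x. x \<in> carrier L \<Longrightarrow> \<exists>y\<in>carrier L. \<kappa> y = \<ominus>\<^bsub>S\<^esub> \<kappa> x"
    and smult: "\<And>c x. c \<in> carrier K \<Longrightarrow> x \<in> carrier L \<Longrightarrow> c \<odot>\<^bsub>L\<^esub> x \<in> carrier L \<and> \<kappa> (c \<odot>\<^bsub>L\<^esub> x) = j c \<otimes>\<^bsub>S\<^esub> \<kappa> x"
  shows "algebra K L"
proof -
  interpret K: cring K by fact
  interpret S: cring S by fact
  note js = ring_hom_closed[OF j] ring_hom_add[OF j] ring_hom_mult[OF j] ring_hom_one[OF j]
  have eqI: "x = y" if "x \<in> carrier L" "y \<in> carrier L" "\<kappa> x = \<kappa> y" for x y
    using inj that by (auto dest: inj_onD)
  have ag: "abelian_group L"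
  proof (rule abelian_groupI)
    fix x y z assume xyz: "x \<in> carrier L" "y \<in> carrier L" "z \<in> carrier L"
    show "x \<oplus>\<^bsub>L\<^esub> y \<in> carrier L" using add xyz by simp
    show "x \<oplus>\<^bsub>L\<^esub> y \<oplus>\<^bsub>L\<^esub> z = x \<oplus>\<^bsub>L\<^esub> (y \<oplus>\<^bsub>L\<^esub> z)" by (rule eqI) (use xyz add cl in \<open>simp_all add: S.a_assoc\<close>)
    show "x \<oplus>\<^bsub>L\<^esub> y = y \<oplus>\<^bsub>L\<^esub> x" by (rule eqI) (use xyz add cl in \<open>simp_all add: S.a_comm\<close>)
    show "\<zero>\<^bsub>L\<^esub> \<oplus>\<^bsub>L\<^esub> x = x" by (rule eqI) (use xyz add cl zero in simp_all)
    obtain y where y: "y \<in> carrier L" "\<kappa> y = \<ominus>\<^bsub>S\<^esub> \<kappa> x" using neg xyz by blast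
    have "y \<oplus>\<^bsub>L\<^esub> x = \<zero>\<^bsub>L\<^esub>" by (rule eqI) (use xyz y add cl zero in \<open>simp_all add: S.l_neg\<close>)
    then show "\<exists>y\<in>carrier L. y \<oplus>\<^bsub>L\<^esub> x = \<zero>\<^bsub>L\<^esub>" using y by blast
  qed (rule zero)
  have cm: "comm_monoid L"
  proof (rule comm_monoidI)
    fix x y z assume xyz: "x \<in> carrier L" "y \<in> carrier L" "z \<in> carrier L"
    show "x \<otimes>\<^bsub>L\<^esub> y \<in> carrier L" using mult xyz by simp
    show "x \<otimes>\<^bsub>L\<^esub> y \<otimes>\<^bsub>L\<^esub> z = x \<otimes>\<^bsub>L\<^esub> (y \<otimes>\<^bsub>L\<^esub> z)" by (rule eqI) (use xyz mult cl in \<open>simp_all add: S.m_assoc\<close>)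
    show "x \<otimes>\<^bsub>L\<^esub> y = y \<otimes>\<^bsub>L\<^esub> x" by (rule eqI) (use xyz mult cl in \<open>simp_all add: S.m_comm\<close>)
    show "\<one>\<^bsub>L\<^esub> \<otimes>\<^bsub>L\<^esub> x = x" by (rule eqI) (use xyz mult cl one in simp_all)
  qed (rule one)
  have "cring L"
  proof (rule cringI[OF ag cm])
    fix x y z assume xyz: "x \<in> carrier L" "y \<in> carrier L" "z \<in> carrier L"
    show "(x \<oplus>\<^bsub>L\<^esub> y) \<otimes>\<^bsub>L\<^esub> z = x \<otimes>\<^bsub>L\<^esub> z \<oplus>\<^bsub>L\<^esub> y \<otimes>\<^bsub>L\<^esub> z"
      by (rule eqI) (use xyz add mult cl in \<open>simp_all add: S.l_distr\<close>)
  qed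
  then show ?thesis
  proof (rule algebraI[OF K])
    fix a b x y assume ab: "a \<in> carrier K" "b \<in> carrier K" and xy: "x \<in> carrier L" "y \<in> carrier L"
    show "a \<odot>\<^bsub>L\<^esub> x \<in> carrier L" using smult ab xy by simp
    show "(a \<oplus>\<^bsub>K\<^esub> b) \<odot>\<^bsub>L\<^esub> x = a \<odot>\<^bsub>L\<^esub> x \<oplus>\<^bsub>L\<^esub> b \<odot>\<^bsub>L\<^esub> x"
      by (rule eqI) (use ab xy add smult cl js in \<open>simp_all add: S.l_distr\<close>)
    show "a \<odot>\<^bsub>L\<^esub> (x \<oplus>\<^bsub>L\<^esub> y) = a \<odot>\<^bsub>L\<^esub> x \<oplus>\<^bsub>L\<^esub> a \<odot>\<^bsub>L\<^esub> y"
      by (rule eqI) (use ab xy add smult cl js in \<open>simp_all add: S.r_distr\<close>)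
    show "(a \<otimes>\<^bsub>K\<^esub> b) \<odot>\<^bsub>L\<^esub> x = a \<odot>\<^bsub>L\<^esub> (b \<odot>\<^bsub>L\<^esub> x)"
      by (rule eqI) (use ab xy smult cl js in \<open>simp_all add: S.m_assoc\<close>)
    show "(a \<odot>\<^bsub>L\<^esub> x) \<otimes>\<^bsub>L\<^esub> y = a \<odot>\<^bsub>L\<^esub> (x \<otimes>\<^bsub>L\<^esub> y)"
      by (rule eqI) (use ab xy mult smult cl js in \<open>simp_all add: S.m_assoc\<close>)
  next
    fix x assume x: "x \<in> carrier L"
    show "\<one>\<^bsub>K\<^esub> \<odot>\<^bsub>L\<^esub> x = x"
      by (rule eqI) (use x smult[OF K.one_closed] cl js in simp_all)
  qed
qed

text \<open>Mirror image of \<open>tensor_left_expansion\<close>. In comparing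
  \<open>R \<otimes> L\<close> with a ring that contains \<open>L\<close> as constants, the
  independent vectors must be those of \<open>L\<close>.\<close>

lemma (in tensor_product) tensor_right_expansion:
  assumes "field K" and x: "x \<in> carrier T"
  obtains V b where "finite V" "V \<subseteq> carrier B" "lin_indep K B V" "b \<in> V \<rightarrow> carrier A"
    "x = (\<Oplus>\<^bsub>T\<^esub>v\<in>V. t (b v) v)"
proof -
  interpret vspace K B by (intro vspace.intro assms B.module)
  have "\<exists>V b. finite V \<and> V \<subseteq> carrier B \<and> b \<in> V \<rightarrow> carrier A \<and> x = (\<Oplus>\<^bsub>T\<^esub>v\<in>V. t (b v) v)"
    using x
  proof (induction rule: tensor_induct)
    case (pure a b)
    then show ?case by (intro exI[of _ "{b}"] exI[of _ "\<lambda>_. a"]) (auto simp: T.finsum_insert)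
  next
    case (add x y)
    then obtain V b W c where *: "finite V" "V \<subseteq> carrier B" "b \<in> V \<rightarrow> carrier A" "x = (\<Oplus>\<^bsub>T\<^esub>v\<in>V. t (b v) v)"
      "finite W" "W \<subseteq> carrier B" "c \<in> W \<rightarrow> carrier A" "y = (\<Oplus>\<^bsub>T\<^esub>v\<in>W. t (c v) v)" by blast
    let ?b = "\<lambda>v. if v \<in> V then b v else \<zero>\<^bsub>A\<^esub>" and ?c = "\<lambda>v. if v \<in> W then c v else \<zero>\<^bsub>A\<^esub>"
    have A: "\<And>v. v \<in> V \<union> W \<Longrightarrow> v \<in> carrier B" "\<And>v. ?b v \<in> carrier A" "\<And>v. ?c v \<in> carrier A"
      "\<And>v. v \<in> V \<Longrightarrow> b v \<in> carrier A" "\<And>v. v \<in> W \<Longrightarrow> c v \<in> carrier A" using * by auto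
    have "x = (\<Oplus>\<^bsub>T\<^esub>v\<in>V \<union> W. t (?b v) v)"
      unfolding *(4) by (rule T.add.finprod_mono_neutral_cong_left) (use * A in auto)
    moreover have "y = (\<Oplus>\<^bsub>T\<^esub>v\<in>V \<union> W. t (?c v) v)"
      unfolding *(8) by (rule T.add.finprod_mono_neutral_cong_left) (use * A in auto)
    ultimately have "x \<oplus>\<^bsub>T\<^esub> y = (\<Oplus>\<^bsub>T\<^esub>v\<in>V \<union> W. t (?b v) v \<oplus>\<^bsub>T\<^esub> t (?c v) v)"
      by (simp only:) (rule T.finsum_addf[symmetric]; use A in auto)
    also have "\<dots> = (\<Oplus>\<^bsub>T\<^esub>v\<in>V \<union> W. t (?b v \<oplus>\<^bsub>A\<^esub> ?c v) v)"
      by (rule T.finsum_cong') (use A in \<open>auto simp: t_add_left\<close>)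
    finally show ?case using * A
      by (intro exI[of _ "V \<union> W"] exI[of _ "\<lambda>v. ?b v \<oplus>\<^bsub>A\<^esub> ?c v"]) auto
  qed
  then obtain V b where Vb: "finite V" "V \<subseteq> carrier B" "b \<in> V \<rightarrow> carrier A" "x = (\<Oplus>\<^bsub>T\<^esub>v\<in>V. t (b v) v)" by blast
  obtain W c where "W \<subseteq> V" "lin_indep K B W" "c \<in> W \<rightarrow> carrier A"
    "(\<Oplus>\<^bsub>T\<^esub>v\<in>V. t (b v) v) = (\<Oplus>\<^bsub>T\<^esub>v\<in>W. t (c v) v)"
    using balanced_sum_indep[OF A.module T.abelian_group_axioms, of t, OF _ _ _ _ Vb(1-3)]
    by (auto simp: t_add_left t_add_right t_balanced)
  then show thesis using that[of W c] Vb finite_subset by blast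
qed

section \<open>Linear independence of constants\<close>

lemma lin_indepD:
  assumes "lin_indep K M V" "c \<in> V \<rightarrow> carrier K" "(\<Oplus>\<^bsub>M\<^esub>v\<in>V. c v \<odot>\<^bsub>M\<^esub> v) = \<zero>\<^bsub>M\<^esub>" "v \<in> V"
  shows "c v = \<zero>\<^bsub>K\<^esub>"
  using assms(1)[unfolded lin_indep_def, rule_format, OF assms(2-4)] .

lemma lin_indep_subset:
  assumes "module K M" "field K" "lin_indep K M V" "finite V" "V \<subseteq> carrier M" "W \<subseteq> V"
  shows "lin_indep K M W"
proof -
  interpret M: module K M by fact
  show ?thesis unfolding lin_indep_def
  proof (intro ballI impI)
    fix c w assume c: "c \<in> W \<rightarrow> carrier K" "(\<Oplus>\<^bsub>M\<^esub>v\<in>W. c v \<odot>\<^bsub>M\<^esub> v) = \<zero>\<^bsub>M\<^esub>" "w \<in> W"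
    let ?c = "\<lambda>v. if v \<in> W then c v else \<zero>\<^bsub>K\<^esub>"
    have cK: "?c v \<in> carrier K" if "v \<in> V" for v using c(1) by auto
    have VM: "v \<in> carrier M" if "v \<in> V" for v using that assms(5) by auto
    have "(\<Oplus>\<^bsub>M\<^esub>v\<in>V. ?c v \<odot>\<^bsub>M\<^esub> v) = (\<Oplus>\<^bsub>M\<^esub>v\<in>W. c v \<odot>\<^bsub>M\<^esub> v)"
      by (rule M.add.finprod_mono_neutral_cong_right) (use assms(4,6) VM cK in auto)
    then have "(\<Oplus>\<^bsub>M\<^esub>v\<in>V. ?c v \<odot>\<^bsub>M\<^esub> v) = \<zero>\<^bsub>M\<^esub>" using c(2) by simp
    moreover have "?c \<in> V \<rightarrow> carrier K" using cK by blast
    ultimately have "?c w = \<zero>\<^bsub>K\<^esub>" using lin_indepD[OF assms(3), of ?c w] c(3) assms(6) by blast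
    then show "c w = \<zero>\<^bsub>K\<^esub>" using c(3) by simp
  qed
qed

context ppv
begin

lemma theta_const_of_zero:
  assumes "r \<in> R" "\<And>k. k \<noteq> 0 \<Longrightarrow> \<theta> r k = \<zero>\<^bsub>E\<^esub>"
  shows "r \<in> KC"
proof -
  have "\<theta> r = mps_const E r"
    using assms theta_0 by (auto simp: fun_eq_iff[of "\<theta> r"] mps_const_def)
  then show ?thesis using constants_R[OF assms(1)] by (simp add: KC_iff)
qed

text \<open>A ring \<open>S\<close> with a map \<open>D\<close> into its power series, receiving
  \<open>R\<close> through \<open>a\<close> and an algebra \<open>L\<close> of constants through
  \<open>\<kappa>\<close>. The instances have \<open>S = R \<otimes>\<^sub>F R\<close>, and
  \<open>a\<close> is one of the two embeddings of \<open>R\<close>.\<close>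

context
  fixes S :: "('s, 'c) ring_scheme" and D :: "'s \<Rightarrow> 'i multiindex \<Rightarrow> 's" and a :: "'e \<Rightarrow> 's"
    and L :: "('e, 'l) module" and \<kappa> :: "'l \<Rightarrow> 's"
  assumes S: "cring S" and D: "D \<in> ring_hom S (mps S)" and a: "a \<in> ring_hom RR S"
    and Da: "\<And>r k. r \<in> R \<Longrightarrow> D (a r) k = a (\<theta> r k)"
    and L: "algebra K L" and \<kappa>: "\<kappa> \<in> ring_hom L S" and inj: "inj_on \<kappa> (carrier L)"
    and \<kappa>_smult: "\<And>c l. c \<in> KC \<Longrightarrow> l \<in> carrier L \<Longrightarrow> \<kappa> (c \<odot>\<^bsub>L\<^esub> l) = a c \<otimes>\<^bsub>S\<^esub> \<kappa> l"
    and \<kappa>_const: "\<And>l. l \<in> carrier L \<Longrightarrow> D (\<kappa> l) = mps_const S (\<kappa> l)"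
begin

lemma D_mult_const:
  assumes "r \<in> R" "l \<in> carrier L"
  shows "D (a r \<otimes>\<^bsub>S\<^esub> \<kappa> l) k = a (\<theta> r k) \<otimes>\<^bsub>S\<^esub> \<kappa> l"
proof -
  interpret S: cring S by (rule S)
  have c: "a r \<in> carrier S" "\<kappa> l \<in> carrier S" using ring_hom_closed[OF a] ring_hom_closed[OF \<kappa>] assms by simp_all
  have "D (a r \<otimes>\<^bsub>S\<^esub> \<kappa> l) k = (D (a r) \<otimes>\<^bsub>mps S\<^esub> mps_const S (\<kappa> l)) k"
    using ring_hom_mult[OF D c] \<kappa>_const[OF assms(2)] by simp
  also have "\<dots> = D (a r) k \<otimes>\<^bsub>S\<^esub> \<kappa> l"
    by (rule S.mps_mult_const[OF ring_hom_closed[OF D c(1)] c(2)])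
  finally show ?thesis using Da assms by simp
qed

lemma D_additive: "(\<lambda>x. D x k) \<in> hom (add_monoid S) (add_monoid S)"
proof (rule homI)
  fix x y assume xy: "x \<in> carrier (add_monoid S)" "y \<in> carrier (add_monoid S)"
  show "D x k \<in> carrier (add_monoid S)" using ring_hom_closed[OF D, of x] xy by auto
  show "D (x \<otimes>\<^bsub>add_monoid S\<^esub> y) k = D x k \<otimes>\<^bsub>add_monoid S\<^esub> D y k"
    using ring_hom_add[OF D, of x y] xy by simp
qed

text \<open>The coefficients at a chosen vector \<open>w\<close>, taken over all relations, form an
  ID-ideal of \<open>R\<close>, which by ID-simplicity is zero or everything. If it is zero, the
  relation is one among fewer vectors. If it contains one, differentiating the normalised relation
  shows that its other coefficients are constants, and this contradicts independence over
  \<open>K\<close>.\<close>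

lemma constants_lin_indep:
  assumes V: "finite V" "V \<subseteq> carrier L" "lin_indep K L V" and b: "b \<in> V \<rightarrow> R"
    and z: "(\<Oplus>\<^bsub>S\<^esub>v\<in>V. a (b v) \<otimes>\<^bsub>S\<^esub> \<kappa> v) = \<zero>\<^bsub>S\<^esub>" and v: "v \<in> V"
  shows "b v = \<zero>\<^bsub>E\<^esub>"
  using V b z v
proof (induction arbitrary: b v rule: finite_induct)
  case empty
  then show ?case by simp
next
  case (insert w V)
  interpret S: cring S by (rule S)
  interpret L: algebra K L by (rule L)
  interpret a: ring_hom_cring RR S a
    by (intro ring_hom_cring.intro ring_hom_cring_axioms.intro RR.is_cring S a)
  interpret \<kappa>: ring_hom_cring L S \<kappa>
    by (intro ring_hom_cring.intro ring_hom_cring_axioms.intro L.M_cring S \<kappa>)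
  have wL: "w \<in> carrier L" and VL: "\<And>v. v \<in> V \<Longrightarrow> v \<in> carrier L" using insert.prems by auto
  have ac: "\<And>r. r \<in> R \<Longrightarrow> a r \<in> carrier S" using a.hom_closed by simp
  have kc: "\<And>l. l \<in> carrier L \<Longrightarrow> \<kappa> l \<in> carrier S" by (rule \<kappa>.hom_closed)
  have indV: "lin_indep K L V"
    by (rule lin_indep_subset[OF L.module field_K insert.prems(2)]) (use insert in auto)
  let ?s = "\<lambda>b. \<Oplus>\<^bsub>S\<^esub>v\<in>V. a (b v) \<otimes>\<^bsub>S\<^esub> \<kappa> v"
  have tc: "a (b v) \<otimes>\<^bsub>S\<^esub> \<kappa> v \<in> carrier S" if "b \<in> V \<rightarrow> R" "v \<in> V" for b v
  proof -
    have "b v \<in> R" using that by auto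
    then show ?thesis using ac kc VL that(2) by simp
  qed
  have sc: "?s b \<in> carrier S" if "b \<in> V \<rightarrow> R" for b using tc[OF that] by (intro S.finsum_closed) auto
  have IH: "b v = \<zero>\<^bsub>E\<^esub>" if "b \<in> V \<rightarrow> R" "?s b = \<zero>\<^bsub>S\<^esub>" "v \<in> V" for b v
    by (rule insert.IH[OF _ indV that]) (use VL in auto)
  have s_add: "?s b \<oplus>\<^bsub>S\<^esub> ?s b' = ?s (\<lambda>v. b v \<oplus>\<^bsub>E\<^esub> b' v)" if bb: "b \<in> V \<rightarrow> R" "b' \<in> V \<rightarrow> R" for b b'
  proof -
    have "?s b \<oplus>\<^bsub>S\<^esub> ?s b' = (\<Oplus>\<^bsub>S\<^esub>v\<in>V. a (b v) \<otimes>\<^bsub>S\<^esub> \<kappa> v \<oplus>\<^bsub>S\<^esub> a (b' v) \<otimes>\<^bsub>S\<^esub> \<kappa> v)"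
      using tc[OF bb(1)] tc[OF bb(2)] by (intro S.finsum_addf[symmetric]) auto
    also have "\<dots> = ?s (\<lambda>v. b v \<oplus>\<^bsub>E\<^esub> b' v)"
    proof (rule S.finsum_cong')
      fix v assume v: "v \<in> V"
      then have "b v \<in> R" "b' v \<in> R" using bb by auto
      then show "a (b v) \<otimes>\<^bsub>S\<^esub> \<kappa> v \<oplus>\<^bsub>S\<^esub> a (b' v) \<otimes>\<^bsub>S\<^esub> \<kappa> v = a (b v \<oplus>\<^bsub>E\<^esub> b' v) \<otimes>\<^bsub>S\<^esub> \<kappa> v"
        using a.hom_add[of "b v" "b' v"] ac kc VL v by (simp add: S.l_distr)
    next
      show "(\<lambda>v. a (b v \<oplus>\<^bsub>E\<^esub> b' v) \<otimes>\<^bsub>S\<^esub> \<kappa> v) \<in> V \<rightarrow> carrier S"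
        using tc[of "\<lambda>v. b v \<oplus>\<^bsub>E\<^esub> b' v"] bb RR.a_closed by (auto simp: Pi_iff)
    qed simp
    finally show ?thesis .
  qed
  have s_mult: "a x \<otimes>\<^bsub>S\<^esub> ?s b = ?s (\<lambda>v. x \<otimes>\<^bsub>E\<^esub> b v)" if b: "b \<in> V \<rightarrow> R" and x: "x \<in> R" for b x
  proof -
    have "a x \<otimes>\<^bsub>S\<^esub> ?s b = (\<Oplus>\<^bsub>S\<^esub>v\<in>V. a x \<otimes>\<^bsub>S\<^esub> (a (b v) \<otimes>\<^bsub>S\<^esub> \<kappa> v))"
      using tc[OF b] ac[OF x] insert.hyps by (intro S.finsum_rdistr) auto
    also have "\<dots> = ?s (\<lambda>v. x \<otimes>\<^bsub>E\<^esub> b v)"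
    proof (rule S.finsum_cong')
      fix v assume v: "v \<in> V"
      then have "b v \<in> R" using b by auto
      then show "a x \<otimes>\<^bsub>S\<^esub> (a (b v) \<otimes>\<^bsub>S\<^esub> \<kappa> v) = a (x \<otimes>\<^bsub>E\<^esub> b v) \<otimes>\<^bsub>S\<^esub> \<kappa> v"
        using a.hom_mult[of x "b v"] ac kc VL v x by (simp add: S.m_assoc)
    next
      show "(\<lambda>v. a (x \<otimes>\<^bsub>E\<^esub> b v) \<otimes>\<^bsub>S\<^esub> \<kappa> v) \<in> V \<rightarrow> carrier S"
        using tc[of "\<lambda>v. x \<otimes>\<^bsub>E\<^esub> b v"] b x RR.m_closed by (auto simp: Pi_iff)
    qed simp
    finally show ?thesis .
  qed
  have s_D: "D (?s b) k = ?s (\<lambda>v. \<theta> (b v) k)" if b: "b \<in> V \<rightarrow> R" for b k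
  proof -
    have "D (?s b) k = (\<Oplus>\<^bsub>S\<^esub>v\<in>V. D (a (b v) \<otimes>\<^bsub>S\<^esub> \<kappa> v) k)"
      using tc[OF b] by (intro add_monoid_hom_finsum[OF S.abelian_group_axioms S.abelian_group_axioms D_additive]) auto
    also have "\<dots> = ?s (\<lambda>v. \<theta> (b v) k)"
      using b VL tc[of "\<lambda>v. \<theta> (b v) k"] by (intro S.finsum_cong') (auto simp: D_mult_const Pi_iff)
    finally show ?thesis .
  qed
  \<comment> \<open>The possible coefficients at \<open>w\<close> in relations among
    \<open>w\<close> and the vectors of \<open>V\<close>.\<close>
  define J where "J = {r \<in> R. \<exists>b \<in> V \<rightarrow> R. a r \<otimes>\<^bsub>S\<^esub> \<kappa> w \<oplus>\<^bsub>S\<^esub> ?s b = \<zero>\<^bsub>S\<^esub>}"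
  have JI: "r \<in> J" if "r \<in> R" "b \<in> V \<rightarrow> R" "a r \<otimes>\<^bsub>S\<^esub> \<kappa> w \<oplus>\<^bsub>S\<^esub> ?s b = \<zero>\<^bsub>S\<^esub>" for r b
    using that unfolding J_def by blast
  have JE: "\<exists>b. r \<in> R \<and> b \<in> V \<rightarrow> R \<and> a r \<otimes>\<^bsub>S\<^esub> \<kappa> w \<oplus>\<^bsub>S\<^esub> ?s b = \<zero>\<^bsub>S\<^esub>" if "r \<in> J" for r
    using that unfolding J_def by blast
  have Jmult: "x \<otimes>\<^bsub>E\<^esub> r \<in> J" if "r \<in> J" and x: "x \<in> R" for r x
  proof -
    obtain b where b: "r \<in> R" "b \<in> V \<rightarrow> R" "a r \<otimes>\<^bsub>S\<^esub> \<kappa> w \<oplus>\<^bsub>S\<^esub> ?s b = \<zero>\<^bsub>S\<^esub>" using JE \<open>r \<in> J\<close> by blast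
    have "a (x \<otimes>\<^bsub>E\<^esub> r) \<otimes>\<^bsub>S\<^esub> \<kappa> w \<oplus>\<^bsub>S\<^esub> ?s (\<lambda>v. x \<otimes>\<^bsub>E\<^esub> b v) = a x \<otimes>\<^bsub>S\<^esub> (a r \<otimes>\<^bsub>S\<^esub> \<kappa> w \<oplus>\<^bsub>S\<^esub> ?s b)"
      using a.hom_mult[of x r] b(1) x ac kc wL sc[OF b(2)] s_mult[OF b(2) x] by (simp add: S.r_distr S.m_assoc)
    then show ?thesis
      using b x ac RR.m_closed[of x] by (intro JI[of _ "\<lambda>v. x \<otimes>\<^bsub>E\<^esub> b v"]) (auto simp: Pi_iff)
  qed
  have "ideal J RR"
  proof (rule idealI)
    show "ring RR" ..
    show "subgroup J (add_monoid RR)"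
    proof (rule RR.add.subgroupI)
      show "J \<subseteq> carrier RR" by (auto simp: J_def)
      have "?s (\<lambda>_. \<zero>\<^bsub>E\<^esub>) = \<zero>\<^bsub>S\<^esub>"
        using a.hom_zero kc VL by (intro S.add.finprod_one_eqI) simp
      then have "\<zero>\<^bsub>E\<^esub> \<in> J" using a.hom_zero kc wL RR.zero_closed by (intro JI[of _ "\<lambda>_. \<zero>\<^bsub>E\<^esub>"]) auto
      then show "J \<noteq> {}" by blast
    next
      fix r assume r: "r \<in> J"
      then have rR: "r \<in> R" by (simp add: J_def)
      have "\<ominus>\<^bsub>RR\<^esub> r = (\<ominus>\<^bsub>RR\<^esub> \<one>\<^bsub>RR\<^esub>) \<otimes>\<^bsub>RR\<^esub> r" using rR by (subst RR.l_minus) simp_all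
      then show "\<ominus>\<^bsub>RR\<^esub> r \<in> J" using Jmult[OF r, of "\<ominus>\<^bsub>RR\<^esub> \<one>\<^bsub>RR\<^esub>"] RR.a_inv_closed[OF RR.one_closed] by simp
    next
      fix r r' assume r: "r \<in> J" "r' \<in> J"
      from JE[OF r(1)] obtain b where b1: "r \<in> R" "b \<in> V \<rightarrow> R" "a r \<otimes>\<^bsub>S\<^esub> \<kappa> w \<oplus>\<^bsub>S\<^esub> ?s b = \<zero>\<^bsub>S\<^esub>"
        by (elim exE conjE)
      from JE[OF r(2)] obtain b' where b2: "r' \<in> R" "b' \<in> V \<rightarrow> R" "a r' \<otimes>\<^bsub>S\<^esub> \<kappa> w \<oplus>\<^bsub>S\<^esub> ?s b' = \<zero>\<^bsub>S\<^esub>"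
        by (elim exE conjE)
      note b = b1 b2
      have "a (r \<oplus>\<^bsub>E\<^esub> r') \<otimes>\<^bsub>S\<^esub> \<kappa> w \<oplus>\<^bsub>S\<^esub> ?s (\<lambda>v. b v \<oplus>\<^bsub>E\<^esub> b' v)
          = (a r \<otimes>\<^bsub>S\<^esub> \<kappa> w \<oplus>\<^bsub>S\<^esub> ?s b) \<oplus>\<^bsub>S\<^esub> (a r' \<otimes>\<^bsub>S\<^esub> \<kappa> w \<oplus>\<^bsub>S\<^esub> ?s b')"
      proof -
        have "a (r \<oplus>\<^bsub>E\<^esub> r') \<otimes>\<^bsub>S\<^esub> \<kappa> w = a r \<otimes>\<^bsub>S\<^esub> \<kappa> w \<oplus>\<^bsub>S\<^esub> a r' \<otimes>\<^bsub>S\<^esub> \<kappa> w"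
          using a.hom_add[of r r'] b(1,4) ac kc wL by (simp add: S.l_distr)
        moreover have "(x \<oplus>\<^bsub>S\<^esub> y) \<oplus>\<^bsub>S\<^esub> (z \<oplus>\<^bsub>S\<^esub> z') = (x \<oplus>\<^bsub>S\<^esub> z) \<oplus>\<^bsub>S\<^esub> (y \<oplus>\<^bsub>S\<^esub> z')"
          if "x \<in> carrier S" "y \<in> carrier S" "z \<in> carrier S" "z' \<in> carrier S" for x y z z'
          using that by (simp add: S.a_ac)
        ultimately show ?thesis
          using s_add[OF b(2,5), symmetric] sc[OF b(2)] sc[OF b(5)] b(1,4) ac kc wL by simp
      qed
      then have "a (r \<oplus>\<^bsub>E\<^esub> r') \<otimes>\<^bsub>S\<^esub> \<kappa> w \<oplus>\<^bsub>S\<^esub> ?s (\<lambda>v. b v \<oplus>\<^bsub>E\<^esub> b' v) = \<zero>\<^bsub>S\<^esub>" using b by simp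
      then show "r \<oplus>\<^bsub>RR\<^esub> r' \<in> J"
        using b RR.a_closed by (intro JI[of _ "\<lambda>v. b v \<oplus>\<^bsub>E\<^esub> b' v"]) (auto simp: Pi_iff)
    qed
    fix r x assume "r \<in> J" "x \<in> carrier RR"
    then show 1: "x \<otimes>\<^bsub>RR\<^esub> r \<in> J" using Jmult by simp
    have "r \<in> R" using \<open>r \<in> J\<close> by (simp add: J_def)
    then show "r \<otimes>\<^bsub>RR\<^esub> x \<in> J" using 1 RR.m_comm[of r x] \<open>x \<in> carrier RR\<close> by simp
  qed
  \<comment> \<open>The vectors are constants, so applying \<open>D\<close> to a relation applies
    \<open>\<theta>\<close> to its coefficients and yields another relation.\<close>
  moreover have "\<theta> r k \<in> J" if "r \<in> J" for r k
  proof -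
    obtain b where b: "r \<in> R" "b \<in> V \<rightarrow> R" "a r \<otimes>\<^bsub>S\<^esub> \<kappa> w \<oplus>\<^bsub>S\<^esub> ?s b = \<zero>\<^bsub>S\<^esub>" using JE \<open>r \<in> J\<close> by blast
    note Dk = add_monoid_hom_simps[OF S.abelian_group_axioms S.abelian_group_axioms D_additive[of k]]
    have "\<zero>\<^bsub>S\<^esub> = D (a r \<otimes>\<^bsub>S\<^esub> \<kappa> w \<oplus>\<^bsub>S\<^esub> ?s b) k" using b(3) Dk(1) by simp
    also have "\<dots> = a (\<theta> r k) \<otimes>\<^bsub>S\<^esub> \<kappa> w \<oplus>\<^bsub>S\<^esub> ?s (\<lambda>v. \<theta> (b v) k)"
      using b(1) sc[OF b(2)] ac kc wL by (simp add: Dk(4) D_mult_const s_D[OF b(2)])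
    finally show ?thesis using b by (intro JI[of _ "\<lambda>v. \<theta> (b v) k"]) (auto simp: Pi_iff)
  qed
  ultimately have J: "J = {\<zero>\<^bsub>E\<^esub>} \<or> J = R" by (rule ID_simple_R)
  have bw: "b w \<in> R" "b \<in> V \<rightarrow> R" using insert.prems by auto
  have "(\<Oplus>\<^bsub>S\<^esub>v\<in>insert w V. a (b v) \<otimes>\<^bsub>S\<^esub> \<kappa> v) = a (b w) \<otimes>\<^bsub>S\<^esub> \<kappa> w \<oplus>\<^bsub>S\<^esub> ?s b"
    using insert.hyps tc[OF bw(2)] ac[OF bw(1)] kc[OF wL] by (intro S.finsum_insert) auto
  then have rel: "a (b w) \<otimes>\<^bsub>S\<^esub> \<kappa> w \<oplus>\<^bsub>S\<^esub> ?s b = \<zero>\<^bsub>S\<^esub>" using insert.prems by simp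
  then have bJ: "b w \<in> J" using bw by (intro JI[of _ b]) auto
  from J show ?case
  proof
    assume "J = {\<zero>\<^bsub>E\<^esub>}"
    then have 0: "b w = \<zero>\<^bsub>E\<^esub>" using bJ by simp
    then have "?s b = \<zero>\<^bsub>S\<^esub>" using rel a.hom_zero kc[OF wL] sc[OF bw(2)] by simp
    then have "b v = \<zero>\<^bsub>E\<^esub>" if "v \<in> V" for v using IH[OF bw(2) _ that] by simp
    then show ?thesis using 0 insert.prems(5) by (cases "v = w") simp_all
  next
    \<comment> \<open>There is a relation with coefficient one at \<open>w\<close>. In positive
      degree \<open>D\<close> annihilates that term and leaves a relation among the vectors of
      \<open>V\<close>, trivial by induction. So the remaining coefficients lie in \<open>K\<close>,
      and injectivity of \<open>\<kappa>\<close> pulls the relation back to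
      \<open>L\<close>.\<close>
    assume "J = R"
    then have "\<one>\<^bsub>E\<^esub> \<in> J" by simp
    then obtain c where c: "c \<in> V \<rightarrow> R" "a \<one>\<^bsub>E\<^esub> \<otimes>\<^bsub>S\<^esub> \<kappa> w \<oplus>\<^bsub>S\<^esub> ?s c = \<zero>\<^bsub>S\<^esub>" using JE by blast
    have a1: "a \<one>\<^bsub>E\<^esub> = \<one>\<^bsub>S\<^esub>" using a.hom_one by simp
    have w0: "\<kappa> w \<oplus>\<^bsub>S\<^esub> ?s c = \<zero>\<^bsub>S\<^esub>" using c(2) a1 kc[OF wL] by simp
    have "c v \<in> KC" if v: "v \<in> V" for v
    proof (rule theta_const_of_zero)
      show "c v \<in> R" using c(1) v by auto
      fix k :: "'i multiindex" assume k: "k \<noteq> 0"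
      note Dk = add_monoid_hom_simps[OF S.abelian_group_axioms S.abelian_group_axioms D_additive[of k]]
      have "\<zero>\<^bsub>S\<^esub> = D (\<kappa> w \<oplus>\<^bsub>S\<^esub> ?s c) k" using w0 Dk(1) by simp
      also have "\<dots> = D (\<kappa> w) k \<oplus>\<^bsub>S\<^esub> ?s (\<lambda>v. \<theta> (c v) k)"
        using sc[OF c(1)] kc[OF wL] by (simp add: Dk(4) s_D[OF c(1)])
      also have "D (\<kappa> w) k = \<zero>\<^bsub>S\<^esub>" using \<kappa>_const[OF wL] k by (simp add: mps_const_def)
      finally have "?s (\<lambda>v. \<theta> (c v) k) = \<zero>\<^bsub>S\<^esub>" using sc[of "\<lambda>v. \<theta> (c v) k"] c(1) by (simp add: Pi_iff)
      then show "\<theta> (c v) k = \<zero>\<^bsub>E\<^esub>" using IH[of "\<lambda>v. \<theta> (c v) k" v] c(1) v by (auto simp: Pi_iff)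
    qed
    then have cK: "c \<in> V \<rightarrow> KC" by auto
    have cv: "c v \<odot>\<^bsub>L\<^esub> v \<in> carrier L" if "v \<in> V" for v using cK VL that by auto
    have "\<kappa> (w \<oplus>\<^bsub>L\<^esub> (\<Oplus>\<^bsub>L\<^esub>v\<in>V. c v \<odot>\<^bsub>L\<^esub> v)) = \<kappa> w \<oplus>\<^bsub>S\<^esub> (\<Oplus>\<^bsub>S\<^esub>v\<in>V. \<kappa> (c v \<odot>\<^bsub>L\<^esub> v))"
      using cv wL by (simp add: \<kappa>.hom_add \<kappa>.hom_finsum comp_def Pi_iff L.finsum_closed)
    also have "(\<Oplus>\<^bsub>S\<^esub>v\<in>V. \<kappa> (c v \<odot>\<^bsub>L\<^esub> v)) = ?s c"
      using \<kappa>_smult cK VL tc[OF c(1)] by (intro S.finsum_cong') (auto simp: Pi_iff)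
    finally have "\<kappa> (w \<oplus>\<^bsub>L\<^esub> (\<Oplus>\<^bsub>L\<^esub>v\<in>V. c v \<odot>\<^bsub>L\<^esub> v)) = \<kappa> \<zero>\<^bsub>L\<^esub>" using w0 \<kappa>.hom_zero by simp
    moreover have "(\<Oplus>\<^bsub>L\<^esub>v\<in>V. c v \<odot>\<^bsub>L\<^esub> v) \<in> carrier L" using cv by (intro L.finsum_closed) auto
    ultimately have rel0: "w \<oplus>\<^bsub>L\<^esub> (\<Oplus>\<^bsub>L\<^esub>v\<in>V. c v \<odot>\<^bsub>L\<^esub> v) = \<zero>\<^bsub>L\<^esub>"
      using inj_onD[OF inj, of "w \<oplus>\<^bsub>L\<^esub> (\<Oplus>\<^bsub>L\<^esub>v\<in>V. c v \<odot>\<^bsub>L\<^esub> v)" "\<zero>\<^bsub>L\<^esub>"] wL L.a_closed L.zero_closed by blast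
    let ?c = "\<lambda>v. if v = w then \<one>\<^bsub>E\<^esub> else c v"
    have one: "\<one>\<^bsub>E\<^esub> \<in> KC" using K.one_closed by simp
    have "(\<Oplus>\<^bsub>L\<^esub>v\<in>insert w V. ?c v \<odot>\<^bsub>L\<^esub> v) = ?c w \<odot>\<^bsub>L\<^esub> w \<oplus>\<^bsub>L\<^esub> (\<Oplus>\<^bsub>L\<^esub>v\<in>V. ?c v \<odot>\<^bsub>L\<^esub> v)"
      using insert.hyps cv wL one by (intro L.finsum_insert) auto
    also have "(\<Oplus>\<^bsub>L\<^esub>v\<in>V. ?c v \<odot>\<^bsub>L\<^esub> v) = (\<Oplus>\<^bsub>L\<^esub>v\<in>V. c v \<odot>\<^bsub>L\<^esub> v)"
      using insert.hyps cv by (intro L.finsum_cong') auto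
    also have "?c w \<odot>\<^bsub>L\<^esub> w = w" using L.smult_one[OF wL] by simp
    finally have "(\<Oplus>\<^bsub>L\<^esub>v\<in>insert w V. ?c v \<odot>\<^bsub>L\<^esub> v) = \<zero>\<^bsub>L\<^esub>" using rel0 by simp
    moreover have "?c \<in> insert w V \<rightarrow> KC" using cK one by auto
    ultimately have "?c w = \<zero>\<^bsub>K\<^esub>" using lin_indepD[OF insert.prems(2), of ?c w] by blast
    then have "\<one>\<^bsub>E\<^esub> = \<zero>\<^bsub>E\<^esub>" by simp
    then show ?thesis using E.one_not_zero by simp
  qed
qed

text \<open>The map exists by the universal property; its injectivity is
  \<open>constants_lin_indep\<close> applied to an expansion whose right factors are independent
  over \<open>K\<close>.\<close>

lemma constants_tensor_map:
  obtains h where "h \<in> ring_hom (TT L) S"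
    "\<And>r l. r \<in> R \<Longrightarrow> l \<in> carrier L \<Longrightarrow> h (pt L r l) = a r \<otimes>\<^bsub>S\<^esub> \<kappa> l"
    "inj_on h (carrier (TT L))" "\<And>x k. x \<in> carrier (TT L) \<Longrightarrow> h (\<Theta> L x k) = D (h x) k"
proof -
  interpret S: cring S by (rule S)
  interpret L: tensor_product K RR L by (rule tp[OF L])
  note as = ring_hom_closed[OF a] ring_hom_mult[OF a]
  note ks = ring_hom_closed[OF \<kappa>]
  have bal: "a (c \<odot>\<^bsub>RR\<^esub> r) \<otimes>\<^bsub>S\<^esub> \<kappa> l = a r \<otimes>\<^bsub>S\<^esub> \<kappa> (c \<odot>\<^bsub>L\<^esub> l)" if "c \<in> KC" "r \<in> carrier RR" "l \<in> carrier L" for c r l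
    using that as(2)[of c r] as(1)[of c] as(1)[of r] ks by (simp add: \<kappa>_smult S.m_ac in_E(5))
  obtain h where h: "h \<in> ring_hom L.T S" "\<And>r l. r \<in> carrier RR \<Longrightarrow> l \<in> carrier L \<Longrightarrow> h (L.t r l) = a r \<otimes>\<^bsub>S\<^esub> \<kappa> l"
    using L.tensor_ring_universal[OF S a \<kappa> bal] by blast
  have ht: "h (L.t r l) = a r \<otimes>\<^bsub>S\<^esub> \<kappa> l" if "r \<in> R" "l \<in> carrier L" for r l using h(2) that by simp
  have hh: "h \<in> hom (add_monoid L.T) (add_monoid S)" using h(1) by (simp add: ring_hom_def hom_def)
  note hs = add_monoid_hom_simps[OF L.T.abelian_group_axioms S.abelian_group_axioms hh]
  have h0: "x = \<zero>\<^bsub>L.T\<^esub>" if x: "x \<in> carrier L.T" and z: "h x = \<zero>\<^bsub>S\<^esub>" for x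
  proof -
    obtain V b where V: "finite V" "V \<subseteq> carrier L" "lin_indep K L V" "b \<in> V \<rightarrow> carrier RR" "x = (\<Oplus>\<^bsub>L.T\<^esub>v\<in>V. L.t (b v) v)"
      by (rule L.tensor_right_expansion[OF field_K x])
    have bV: "\<And>v. v \<in> V \<Longrightarrow> b v \<in> R" "\<And>v. v \<in> V \<Longrightarrow> v \<in> carrier L" using V by auto
    have "h x = (\<Oplus>\<^bsub>S\<^esub>v\<in>V. h (L.t (b v) v))"
      unfolding V(5) by (rule add_monoid_hom_finsum[OF L.T.abelian_group_axioms S.abelian_group_axioms hh])
        (use bV L.t_closed in auto)
    also have "\<dots> = (\<Oplus>\<^bsub>S\<^esub>v\<in>V. a (b v) \<otimes>\<^bsub>S\<^esub> \<kappa> v)"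
      by (rule S.finsum_cong') (use bV ht as ks in auto)
    finally have "b v = \<zero>\<^bsub>E\<^esub>" if "v \<in> V" for v
      using constants_lin_indep[OF V(1-3), of b v] V(4) z that by simp
    then show ?thesis unfolding V(5)
      by (intro L.T.add.finprod_one_eqI) (use bV L.t_zero_left in auto)
  qed
  have inj: "inj_on h (carrier L.T)"
  proof (rule inj_onI)
    fix x y assume xy: "x \<in> carrier L.T" "y \<in> carrier L.T" "h x = h y"
    have "h (x \<ominus>\<^bsub>L.T\<^esub> y) = \<zero>\<^bsub>S\<^esub>" using xy hs by simp
    then have "x \<ominus>\<^bsub>L.T\<^esub> y = \<zero>\<^bsub>L.T\<^esub>" using xy by (intro h0) auto
    then show "x = y" using xy by simp
  qed
  have "h (\<Theta> L x k) = D (h x) k" if "x \<in> carrier L.T" for x k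
    using that
  proof (induction rule: L.tensor_induct)
    case (pure r l)
    then have "r \<in> R" by simp
    then show ?case using pure by (simp add: Theta_hom(2)[OF \<open>algebra K L\<close>] ht D_mult_const)
  next
    case (add x y)
    note T = add_monoid_hom_simps[OF L.T.abelian_group_axioms L.T.abelian_group_axioms Theta_hom(1)[OF \<open>algebra K L\<close>, of k]]
    note Dk = add_monoid_hom_simps[OF S.abelian_group_axioms S.abelian_group_axioms D_additive[of k]]
    show ?case using add by (simp add: T hs Dk)
  qed
  then show thesis using that[OF h(1) ht inj] by simp
qed

end

end

section \<open>The torsor\<close>

lemma mat_eq_refl: "mat_eq n M M" and mat_eq_sym: "mat_eq n M N \<Longrightarrow> mat_eq n N M"
  and mat_eq_trans [trans]: "mat_eq n M N \<Longrightarrow> mat_eq n N P \<Longrightarrow> mat_eq n M P"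
  by (simp_all add: mat_eq_def)

lemma (in cring) mat_mul_assoc_eq:
  assumes "M \<in> mat_carrier R n" "N \<in> mat_carrier R n" "P \<in> mat_carrier R n"
  shows "mat_eq n (mat_mul R n (mat_mul R n M N) P) (mat_mul R n M (mat_mul R n N P))"
  unfolding mat_eq_def using mat_mul_assoc[OF assms] by blast

lemma mat_carrier_hom:
  assumes "h \<in> ring_hom A B" "M \<in> mat_carrier A n"
  shows "(\<lambda>r s. h (M r s)) \<in> mat_carrier B n"
  using assms ring_hom_closed[OF assms(1)] by (simp add: mat_carrier_def)

lemma mat_mul_hom_eq:
  assumes "cring A" "cring B" "h \<in> ring_hom A B" "M \<in> mat_carrier A n" "N \<in> mat_carrier A n"
  shows "mat_eq n (\<lambda>r s. h (mat_mul A n M N r s)) (mat_mul B n (\<lambda>r s. h (M r s)) (\<lambda>r s. h (N r s)))"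
  unfolding mat_eq_def using mat_mul_hom[OF assms] by blast

lemma mat_eq_hom: "mat_eq n M N \<Longrightarrow> mat_eq n (\<lambda>r s. h (M r s)) (\<lambda>r s. h (N r s))"
  by (simp add: mat_eq_def)

lemma mat_one_hom:
  assumes "ring A" "ring B" "h \<in> ring_hom A B"
  shows "(\<lambda>r s. h (mat_one A r s)) = mat_one B"
  using ring_hom_one[OF assms(3)] ring_hom_zero[OF assms(3,1,2)] by (auto simp: mat_one_def fun_eq_iff)

lemma (in cring) mat_one_carrier: "mat_one R \<in> mat_carrier R n"
  by (simp add: mat_carrier_def mat_one_def)

lemma (in cring) mat_left_cancel:
  assumes c: "N \<in> mat_carrier R n" "M \<in> mat_carrier R n" "U \<in> mat_carrier R n" "V \<in> mat_carrier R n"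
    and NM: "mat_eq n (mat_mul R n N M) (mat_one R)"
    and eq: "mat_eq n (mat_mul R n M U) (mat_mul R n M V)"
  shows "mat_eq n U V"
proof -
  have *: "mat_eq n Z (mat_mul R n N (mat_mul R n M Z))" if Z: "Z \<in> mat_carrier R n" for Z
  proof -
    have "mat_eq n Z (mat_mul R n (mat_one R) Z)" by (rule mat_eq_sym[OF mat_mul_one_left[OF Z]])
    also have "mat_eq n (mat_mul R n (mat_one R) Z) (mat_mul R n (mat_mul R n N M) Z)"
      by (rule mat_mul_cong[OF mat_eq_sym[OF NM] mat_eq_refl mat_mul_closed[OF c(1,2)] Z])
    also have "mat_eq n (mat_mul R n (mat_mul R n N M) Z) (mat_mul R n N (mat_mul R n M Z))"
      by (rule mat_mul_assoc_eq[OF c(1,2) Z])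
    finally show ?thesis .
  qed
  have "mat_eq n (mat_mul R n N (mat_mul R n M U)) (mat_mul R n N (mat_mul R n M V))"
    by (rule mat_mul_cong[OF mat_eq_refl eq c(1) mat_mul_closed[OF c(2,4)]])
  then show ?thesis using *[OF c(3)] mat_eq_sym[OF *[OF c(4)]] mat_eq_trans by blast
qed

text \<open>Adds the solution matrix \<open>Y\<close> with inverse \<open>W\<close>, whose entries
  are taken as the generators \<open>G\<close>, and the matrix \<open>B\<close> of the differential
  equation. The map \<open>\<iota>\<close> serves to bound the cardinality of \<open>K\<close> by
  that of \<open>'u\<close>.\<close>

locale ppv_torsor = ppv_gal E F R \<theta> G p A u \<epsilon>
  for E :: "('e, 'b) ring_scheme" and F R :: "'e set" and \<theta> :: "'e \<Rightarrow> 'i::finite multiindex \<Rightarrow> 'e"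
    and G :: "'e set" and p :: nat and A :: "('e, 'u) module"
    and u :: "(('e \<times> 'u) \<Rightarrow>\<^sub>0 int) set \<Rightarrow> (('e \<times> 'u) \<Rightarrow>\<^sub>0 int) set" and \<epsilon> :: "'u \<Rightarrow> 'e" +
  fixes n :: nat and Y W :: "nat \<Rightarrow> nat \<Rightarrow> 'e" and B :: "nat \<Rightarrow> nat \<Rightarrow> 'i multiindex \<Rightarrow> 'e" and \<iota> :: "'e \<Rightarrow> 'u"
  assumes Y: "Y \<in> mat_carrier (sub_alg E R) n" and W: "W \<in> mat_carrier (sub_alg E R) n"
    and YW: "mat_eq n (mat_mul (sub_alg E R) n Y W) (mat_one (sub_alg E R))"
    and WY: "mat_eq n (mat_mul (sub_alg E R) n W Y) (mat_one (sub_alg E R))"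
    and B: "\<And>r s k. r < n \<Longrightarrow> s < n \<Longrightarrow> B r s k \<in> F"
    and DE: "mat_eq n (\<lambda>r s. \<theta> (Y r s)) (mat_mul (mps (sub_alg E R)) n B (\<lambda>r s. mps_const (sub_alg E R) (Y r s)))"
    and G_eq: "G = {Y r s | r s. r < n \<and> s < n} \<union> {W r s | r s. r < n \<and> s < n}"
    and infinite_u: "infinite (UNIV :: 'u set)" and inj_\<iota>: "inj_on \<iota> (carrier (const_ring E F \<theta>))"
begin

text \<open>Two fundamental solutions of one equation differ by a constant matrix. Since
  \<open>bY = aY Z\<close>, one has \<open>D(aY) D(Z) = D(bY) = B1 bY = B1 aY Z = D(aY) Z\<close>,
  where undifferentiated matrices are read as constant series, and \<open>D(aY)\<close> can be
  cancelled because \<open>D(aW)\<close> is inverse to it. Keeping \<open>a\<close> and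
  \<open>b\<close> arbitrary allows the two embeddings to be exchanged.\<close>

lemma constant_matrix:
  fixes S :: "('s, 'c) ring_scheme"
  assumes S: "cring S" and D: "D \<in> ring_hom S (mps S)" and a: "a \<in> ring_hom RR S" and b: "b \<in> ring_hom RR S"
    and ab: "\<And>f. f \<in> F \<Longrightarrow> a f = b f"
    and Da: "\<And>r k. r \<in> R \<Longrightarrow> D (a r) k = a (\<theta> r k)" and Db: "\<And>r k. r \<in> R \<Longrightarrow> D (b r) k = b (\<theta> r k)"
    and rs: "r < n" "s < n"
  defines "Z \<equiv> mat_mul S n (\<lambda>r s. a (W r s)) (\<lambda>r s. b (Y r s))"
  shows "D (Z r s) = mps_const S (Z r s)"
proof -
  interpret S: cring S by fact
  interpret P: cring "mps S :: ('i multiindex \<Rightarrow> 's) ring" by (rule S.mps_cring)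
  interpret PR: cring "mps RR :: ('i multiindex \<Rightarrow> 'e) ring" by (rule RR.mps_cring)
  let ?P = "mps S :: ('i multiindex \<Rightarrow> 's) ring"
  let ?c = "mps_const S :: 's \<Rightarrow> 'i multiindex \<Rightarrow> 's"
  have ch: "?c \<in> ring_hom S ?P" by (rule S.mps_const_hom)
  define aY where "aY = (\<lambda>r s. a (Y r s))"
  define aW where "aW = (\<lambda>r s. a (W r s))"
  define bY where "bY = (\<lambda>r s. b (Y r s))"
  define B1 where "B1 = (\<lambda>r s k. a (B r s k))"
  have c: "aY \<in> mat_carrier S n" "aW \<in> mat_carrier S n" "bY \<in> mat_carrier S n"
    unfolding aY_def aW_def bY_def using mat_carrier_hom[OF a Y] mat_carrier_hom[OF a W] mat_carrier_hom[OF b Y] by simp_all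
  have Z_eq: "Z = mat_mul S n aW bY" by (simp add: Z_def aW_def bY_def)
  have Zc: "Z \<in> mat_carrier S n" unfolding Z_eq by (rule S.mat_mul_closed[OF c(2,3)])
  note hc = mat_carrier_hom[OF ch] mat_carrier_hom[OF D]
  have B1c: "B1 \<in> mat_carrier ?P n"
    using B ring_hom_closed[OF a] by (auto simp: mat_carrier_def B1_def in_E)
  have aYaW: "mat_eq n (mat_mul S n aY aW) (mat_one S)"
    using mat_eq_trans[OF mat_eq_sym[OF mat_mul_hom_eq[OF RR.is_cring S a Y W]] mat_eq_hom[OF YW, of a]]
    by (simp add: aY_def aW_def mat_one_hom[OF RR.ring_axioms S.ring_axioms a])
  have aWaY: "mat_eq n (mat_mul S n aW aY) (mat_one S)"
    using mat_eq_trans[OF mat_eq_sym[OF mat_mul_hom_eq[OF RR.is_cring S a W Y]] mat_eq_hom[OF WY, of a]]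
    by (simp add: aY_def aW_def mat_one_hom[OF RR.ring_axioms S.ring_axioms a])
  have aYZ: "mat_eq n (mat_mul S n aY Z) bY"
  proof -
    have "mat_eq n (mat_mul S n aY Z) (mat_mul S n (mat_mul S n aY aW) bY)"
      unfolding Z_eq by (rule mat_eq_sym[OF S.mat_mul_assoc_eq[OF c]])
    also have "mat_eq n (mat_mul S n (mat_mul S n aY aW) bY) (mat_mul S n (mat_one S) bY)"
      by (rule S.mat_mul_cong[OF aYaW mat_eq_refl S.mat_one_carrier c(3)])
    also have "mat_eq n (mat_mul S n (mat_one S) bY) bY" by (rule S.mat_mul_one_left[OF c(3)])
    finally show ?thesis .
  qed
  \<comment> \<open>The equation transported along \<open>x\<close>. As \<open>a\<close> and
    \<open>b\<close> agree on \<open>F\<close>, both images of \<open>Y\<close> solve the equation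
    with the same matrix \<open>B1\<close>.\<close>
  have DE': "mat_eq n (\<lambda>r s. D (x (Y r s))) (mat_mul ?P n B1 (\<lambda>r s. ?c (x (Y r s))))"
    if x: "x \<in> ring_hom RR S" and Dx: "\<And>r k. r \<in> R \<Longrightarrow> D (x r) k = x (\<theta> r k)" and xF: "\<And>f. f \<in> F \<Longrightarrow> x f = a f" for x
  proof -
    let ?m = "\<lambda>f (k :: 'i multiindex). x (f k)"
    have m: "?m \<in> ring_hom (mps RR) ?P" by (rule mps_map_hom[OF RR.is_cring S x])
    have Bc: "B \<in> mat_carrier (mps RR) n" using B by (auto simp: mat_carrier_def in_E)
    have Yc: "(\<lambda>r s. mps_const RR (Y r s)) \<in> mat_carrier (mps RR) n"
      by (rule mat_carrier_hom[OF RR.mps_const_hom Y])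
    have x0: "x \<zero>\<^bsub>E\<^esub> = \<zero>\<^bsub>S\<^esub>" using ring_hom_zero[OF x RR.ring_axioms S.ring_axioms] by simp
    have "mat_eq n (\<lambda>r s. D (x (Y r s))) (\<lambda>r s. ?m (\<theta> (Y r s)))"
      using Y Dx by (auto simp: mat_eq_def mat_carrier_def fun_eq_iff)
    also have "mat_eq n (\<lambda>r s. ?m (\<theta> (Y r s))) (\<lambda>r s. ?m (mat_mul (mps RR) n B (\<lambda>r s. mps_const RR (Y r s)) r s))"
      by (rule mat_eq_hom[OF DE])
    also have "mat_eq n (\<lambda>r s. ?m (mat_mul (mps RR) n B (\<lambda>r s. mps_const RR (Y r s)) r s))
        (mat_mul ?P n (\<lambda>r s. ?m (B r s)) (\<lambda>r s. ?m (mps_const RR (Y r s))))"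
      by (rule mat_mul_hom_eq[OF PR.is_cring P.is_cring m Bc Yc])
    also have "mat_eq n (mat_mul ?P n (\<lambda>r s. ?m (B r s)) (\<lambda>r s. ?m (mps_const RR (Y r s)))) (mat_mul ?P n B1 (\<lambda>r s. ?c (x (Y r s))))"
    proof (rule P.mat_mul_cong[OF _ _ B1c])
      show "mat_eq n (\<lambda>r s. ?m (B r s)) B1" using B xF by (simp add: mat_eq_def B1_def)
      show "mat_eq n (\<lambda>r s. ?m (mps_const RR (Y r s))) (\<lambda>r s. ?c (x (Y r s)))"
        using x0 by (auto simp: mat_eq_def mps_const_def fun_eq_iff)
      show "(\<lambda>r s. ?c (x (Y r s))) \<in> mat_carrier ?P n" by (rule hc(1)[OF mat_carrier_hom[OF x Y]])
    qed
    finally show ?thesis .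
  qed
  let ?D = "\<lambda>M r s. D (M r s)" and ?C = "\<lambda>M r s. ?c (M r s)"
  have DaY': "mat_eq n (?D aY) (mat_mul ?P n B1 (?C aY))" using DE'[OF a Da refl] by (simp add: aY_def)
  have DbY': "mat_eq n (?D bY) (mat_mul ?P n B1 (?C bY))" using DE'[OF b Db ab[symmetric]] by (simp add: bY_def)
  have "mat_eq n (mat_mul ?P n (?D aY) (?D Z)) (mat_mul ?P n (?D aY) (?C Z))"
  proof -
    have "mat_eq n (mat_mul ?P n (?D aY) (?D Z)) (?D (mat_mul S n aY Z))"
      by (rule mat_eq_sym[OF mat_mul_hom_eq[OF S P.is_cring D c(1) Zc]])
    also have "mat_eq n (?D (mat_mul S n aY Z)) (?D bY)" by (rule mat_eq_hom[OF aYZ])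
    also have "mat_eq n (?D bY) (mat_mul ?P n B1 (?C bY))" by (rule DbY')
    also have "mat_eq n (mat_mul ?P n B1 (?C bY)) (mat_mul ?P n B1 (mat_mul ?P n (?C aY) (?C Z)))"
    proof (rule P.mat_mul_cong[OF mat_eq_refl _ B1c P.mat_mul_closed[OF hc(1)[OF c(1)] hc(1)[OF Zc]]])
      show "mat_eq n (?C bY) (mat_mul ?P n (?C aY) (?C Z))"
        using mat_eq_trans[OF mat_eq_hom[OF mat_eq_sym[OF aYZ], of ?c] mat_mul_hom_eq[OF S P.is_cring ch c(1) Zc]] .
    qed
    also have "mat_eq n (mat_mul ?P n B1 (mat_mul ?P n (?C aY) (?C Z))) (mat_mul ?P n (mat_mul ?P n B1 (?C aY)) (?C Z))"
      by (rule mat_eq_sym[OF P.mat_mul_assoc_eq[OF B1c hc(1)[OF c(1)] hc(1)[OF Zc]]])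
    also have "mat_eq n (mat_mul ?P n (mat_mul ?P n B1 (?C aY)) (?C Z)) (mat_mul ?P n (?D aY) (?C Z))"
      by (rule P.mat_mul_cong[OF mat_eq_sym[OF DaY'] mat_eq_refl hc(2)[OF c(1)] hc(1)[OF Zc]])
    finally show ?thesis .
  qed
  moreover have "mat_eq n (mat_mul ?P n (?D aW) (?D aY)) (mat_one ?P)"
    using mat_eq_trans[OF mat_eq_sym[OF mat_mul_hom_eq[OF S P.is_cring D c(2,1)]] mat_eq_hom[OF aWaY, of D]]
    by (simp add: mat_one_hom[OF S.ring_axioms P.ring_axioms D])
  ultimately have "mat_eq n (?D Z) (?C Z)"
    by (intro P.mat_left_cancel[OF hc(2)[OF c(2)] hc(2)[OF c(1)] hc(2)[OF Zc] hc(1)[OF Zc]])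
  then show ?thesis using rs by (simp add: mat_eq_def)
qed

text \<open>Write \<open>Z\<close> and \<open>Z'\<close> for the two matrices in the hypotheses.
  From \<open>b Y = (a Y) Z\<close> and \<open>b W = Z' (a W)\<close>, a subring containing the
  image of \<open>a\<close> and all entries of \<open>Z\<close> and \<open>Z'\<close> contains the
  images under \<open>b\<close> of the generators.\<close>

lemma torsor_surj:
  fixes S :: "('s, 'c) ring_scheme"
  assumes S: "cring S" and a: "a \<in> ring_hom RR S" and b: "b \<in> ring_hom RR S" and ab: "\<And>f. f \<in> F \<Longrightarrow> a f = b f"
    and J: "subring J S" "\<And>r. r \<in> R \<Longrightarrow> a r \<in> J"
    and Z: "\<And>r s. r < n \<Longrightarrow> s < n \<Longrightarrow> mat_mul S n (\<lambda>r s. a (W r s)) (\<lambda>r s. b (Y r s)) r s \<in> J"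
    and Z': "\<And>r s. r < n \<Longrightarrow> s < n \<Longrightarrow> mat_mul S n (\<lambda>r s. b (W r s)) (\<lambda>r s. a (Y r s)) r s \<in> J"
    and r: "r \<in> R"
  shows "b r \<in> J"
  using r
proof (induction rule: R_induct)
  interpret S: cring S by fact
  let ?aY = "\<lambda>r s. a (Y r s)" and ?aW = "\<lambda>r s. a (W r s)" and ?bY = "\<lambda>r s. b (Y r s)" and ?bW = "\<lambda>r s. b (W r s)"
  have c: "?aY \<in> mat_carrier S n" "?aW \<in> mat_carrier S n" "?bY \<in> mat_carrier S n" "?bW \<in> mat_carrier S n"
    using mat_carrier_hom[OF a Y] mat_carrier_hom[OF a W] mat_carrier_hom[OF b Y] mat_carrier_hom[OF b W] by simp_all
  have aYaW: "mat_eq n (mat_mul S n ?aY ?aW) (mat_one S)"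
    using mat_eq_trans[OF mat_eq_sym[OF mat_mul_hom_eq[OF RR.is_cring S a Y W]] mat_eq_hom[OF YW, of a]]
    by (simp add: mat_one_hom[OF RR.ring_axioms S.ring_axioms a])
  have RY: "\<And>r s. r < n \<Longrightarrow> s < n \<Longrightarrow> Y r s \<in> R" and RW: "\<And>r s. r < n \<Longrightarrow> s < n \<Longrightarrow> W r s \<in> R"
    using Y W by (simp_all add: mat_carrier_def)
  {
    case (G g)
    then consider r s where "r < n" "s < n" "g = Y r s" | r s where "r < n" "s < n" "g = W r s"
      unfolding G_eq by blast
    then show ?case
    proof cases
      case 1
      have "mat_eq n (mat_mul S n ?aY (mat_mul S n ?aW ?bY)) (mat_mul S n (mat_mul S n ?aY ?aW) ?bY)"
        by (rule mat_eq_sym[OF S.mat_mul_assoc_eq[OF c(1,2,3)]])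
      also have "mat_eq n (mat_mul S n (mat_mul S n ?aY ?aW) ?bY) (mat_mul S n (mat_one S) ?bY)"
        by (rule S.mat_mul_cong[OF aYaW mat_eq_refl S.mat_one_carrier c(3)])
      also have "mat_eq n (mat_mul S n (mat_one S) ?bY) ?bY" by (rule S.mat_mul_one_left[OF c(3)])
      finally have "b (Y r s) = mat_mul S n ?aY (mat_mul S n ?aW ?bY) r s"
        using 1 by (simp add: mat_eq_def)
      also have "\<dots> = (\<Oplus>\<^bsub>S\<^esub>t\<in>{..<n}. a (Y r t) \<otimes>\<^bsub>S\<^esub> mat_mul S n ?aW ?bY t s)"
        by (subst mat_mul_def) (rule refl)
      also have "\<dots> \<in> J"
        using 1 by (intro S.subring_finsum[OF J(1)] subringE(6)[OF J(1)] J(2) RY Z) auto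
      finally show ?thesis using 1 by simp
    next
      case 2
      have "mat_eq n (mat_mul S n (mat_mul S n ?bW ?aY) ?aW) (mat_mul S n ?bW (mat_mul S n ?aY ?aW))"
        by (rule S.mat_mul_assoc_eq[OF c(4,1,2)])
      also have "mat_eq n (mat_mul S n ?bW (mat_mul S n ?aY ?aW)) (mat_mul S n ?bW (mat_one S))"
        by (rule S.mat_mul_cong[OF mat_eq_refl aYaW c(4) S.mat_one_carrier])
      also have "mat_eq n (mat_mul S n ?bW (mat_one S)) ?bW" by (rule S.mat_mul_one_right[OF c(4)])
      finally have "b (W r s) = mat_mul S n (mat_mul S n ?bW ?aY) ?aW r s"
        using 2 by (simp add: mat_eq_def)
      also have "\<dots> = (\<Oplus>\<^bsub>S\<^esub>t\<in>{..<n}. mat_mul S n ?bW ?aY r t \<otimes>\<^bsub>S\<^esub> a (W t s))"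
        by (subst mat_mul_def) (rule refl)
      also have "\<dots> \<in> J"
        using 2 by (intro S.subring_finsum[OF J(1)] subringE(6)[OF J(1)] J(2) RW Z') auto
      finally show ?thesis using 2 by simp
    qed
  next
    case (F f)
    then show ?case using J(2)[of f] ab[of f] by (simp add: in_E)
  next
    case (add x y)
    then show ?case using ring_hom_add[OF b, of x y] subringE(7)[OF J(1)] by simp
  next
    case (mult x y)
    then show ?case using ring_hom_mult[OF b, of x y] subringE(6)[OF J(1)] by simp
  }
qed

text \<open>Outside \<open>F\<close>, the elements \<open>1\<close> and \<open>s\<close> would be
  independent over \<open>F\<close>. The hypothesis reads
  \<open>1 \<otimes> s + s \<otimes> (-1) = 0\<close>, a relation with independent left factors, so
  the right factor \<open>s\<close> of \<open>1\<close> would have to be zero, which lies in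
  \<open>F\<close>.\<close>

lemma tensor_F_eq_imp_in_F:
  assumes s: "s \<in> R" and eq: "tensor_product.t FF RR RR \<one>\<^bsub>E\<^esub> s = tensor_product.t FF RR RR s \<one>\<^bsub>E\<^esub>"
  shows "s \<in> F"
proof (rule ccontr)
  assume sF: "s \<notin> F"
  interpret SS: tensor_product FF RR RR by (intro tensor_product.intro algebra_F_R)
  have s1: "\<one>\<^bsub>E\<^esub> \<noteq> s" using sF by auto
  have fF: "field FF"
  proof -
    show ?thesis
    proof (rule FF.cring_fieldI)
      show "Units FF = carrier FF - {\<zero>\<^bsub>FF\<^esub>}"
      proof
        show "Units FF \<subseteq> carrier FF - {\<zero>\<^bsub>FF\<^esub>}"
          using E.one_not_zero by (auto simp: Units_def)
        show "carrier FF - {\<zero>\<^bsub>FF\<^esub>} \<subseteq> Units FF"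
        proof
          fix x assume x: "x \<in> carrier FF - {\<zero>\<^bsub>FF\<^esub>}"
          then have "inv\<^bsub>E\<^esub> x \<in> F" "inv\<^bsub>E\<^esub> x \<otimes>\<^bsub>E\<^esub> x = \<one>\<^bsub>E\<^esub>" "x \<otimes>\<^bsub>E\<^esub> inv\<^bsub>E\<^esub> x = \<one>\<^bsub>E\<^esub>"
            using E.subfield_m_inv[OF subfield_F, of x] by auto
          then show "x \<in> Units FF" using x by (auto simp: Units_def)
        qed
      qed
    qed
  qed
  let ?V = "{\<one>\<^bsub>E\<^esub>, s}"
  have ind: "lin_indep FF RR ?V"
    unfolding lin_indep_def
  proof (intro ballI impI)
    fix c v assume c: "c \<in> ?V \<rightarrow> carrier FF" and z: "(\<Oplus>\<^bsub>RR\<^esub>v\<in>?V. c v \<odot>\<^bsub>RR\<^esub> v) = \<zero>\<^bsub>RR\<^esub>" and v: "v \<in> ?V"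
    let ?c1 = "c \<one>\<^bsub>E\<^esub>" and ?c2 = "c s"
    have cF: "?c1 \<in> F" "?c2 \<in> F" using c by auto
    have mR: "?c1 \<in> R" "?c2 \<otimes>\<^bsub>E\<^esub> s \<in> R" using cF s RR.m_closed[of ?c2 s] by (auto simp: in_E)
    have "(\<Oplus>\<^bsub>RR\<^esub>v\<in>?V. c v \<odot>\<^bsub>RR\<^esub> v) = c \<one>\<^bsub>E\<^esub> \<odot>\<^bsub>RR\<^esub> \<one>\<^bsub>E\<^esub> \<oplus>\<^bsub>RR\<^esub> (\<Oplus>\<^bsub>RR\<^esub>v\<in>{s}. c v \<odot>\<^bsub>RR\<^esub> v)"
      by (rule RR.finsum_insert) (use s1 mR cF in \<open>auto simp: in_E\<close>)
    also have "(\<Oplus>\<^bsub>RR\<^esub>v\<in>{s}. c v \<odot>\<^bsub>RR\<^esub> v) = ?c2 \<otimes>\<^bsub>E\<^esub> s \<oplus>\<^bsub>RR\<^esub> (\<Oplus>\<^bsub>RR\<^esub>v\<in>{}. c v \<odot>\<^bsub>RR\<^esub> v)"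
      using RR.finsum_insert[of "{}" s "\<lambda>v. c v \<odot>\<^bsub>RR\<^esub> v"] mR by simp
    also have "\<dots> = ?c2 \<otimes>\<^bsub>E\<^esub> s" using mR RR.r_zero[of "?c2 \<otimes>\<^bsub>E\<^esub> s"] by simp
    finally have rel: "?c1 \<oplus>\<^bsub>E\<^esub> ?c2 \<otimes>\<^bsub>E\<^esub> s = \<zero>\<^bsub>E\<^esub>" using z cF by (simp add: in_E)
    have c2: "?c2 = \<zero>\<^bsub>E\<^esub>"
    proof (rule ccontr)
      assume "?c2 \<noteq> \<zero>\<^bsub>E\<^esub>"
      then have i: "inv\<^bsub>E\<^esub> ?c2 \<in> F" "inv\<^bsub>E\<^esub> ?c2 \<otimes>\<^bsub>E\<^esub> ?c2 = \<one>\<^bsub>E\<^esub>"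
        using E.subfield_m_inv[OF subfield_F, of ?c2] cF by auto
      have e: "?c2 \<otimes>\<^bsub>E\<^esub> s = \<ominus>\<^bsub>E\<^esub> ?c1"
        using rel cF s by (intro E.sum_zero_eq_neg) (auto simp: in_E E.a_comm)
      have "s = inv\<^bsub>E\<^esub> ?c2 \<otimes>\<^bsub>E\<^esub> (?c2 \<otimes>\<^bsub>E\<^esub> s)"
        using i cF s by (simp add: E.m_assoc[symmetric] in_E)
      also have "\<dots> = inv\<^bsub>E\<^esub> ?c2 \<otimes>\<^bsub>E\<^esub> (\<ominus>\<^bsub>E\<^esub> ?c1)" using e by simp
      also have "\<dots> \<in> F" using subringE(5,6)[OF subring_F] i(1) cF(1) by blast
      finally show False using sF by simp
    qed
    then have "?c1 = \<zero>\<^bsub>E\<^esub>" using rel cF s by (simp add: in_E)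
    then show "c v = \<zero>\<^bsub>FF\<^esub>" using c2 v by auto
  qed
  let ?b = "\<lambda>v. if v = s then \<ominus>\<^bsub>RR\<^esub> \<one>\<^bsub>RR\<^esub> else s"
  have mo: "\<ominus>\<^bsub>RR\<^esub> \<one>\<^bsub>RR\<^esub> \<in> R" using RR.a_inv_closed[OF RR.one_closed] by simp
  have tc: "SS.t \<one>\<^bsub>E\<^esub> s \<in> carrier SS.T" "SS.t s \<one>\<^bsub>E\<^esub> \<in> carrier SS.T" "SS.t s (\<ominus>\<^bsub>RR\<^esub> \<one>\<^bsub>RR\<^esub>) \<in> carrier SS.T"
    using s mo SS.t_closed by simp_all
  have "SS.t s (\<ominus>\<^bsub>RR\<^esub> \<one>\<^bsub>RR\<^esub>) \<oplus>\<^bsub>SS.T\<^esub> SS.t s \<one>\<^bsub>E\<^esub> = SS.t s (\<ominus>\<^bsub>RR\<^esub> \<one>\<^bsub>RR\<^esub> \<oplus>\<^bsub>RR\<^esub> \<one>\<^bsub>RR\<^esub>)"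
    using SS.t_add_right[of s "\<ominus>\<^bsub>RR\<^esub> \<one>\<^bsub>RR\<^esub>" "\<one>\<^bsub>RR\<^esub>"] s mo by simp
  also have "\<ominus>\<^bsub>RR\<^esub> \<one>\<^bsub>RR\<^esub> \<oplus>\<^bsub>RR\<^esub> \<one>\<^bsub>RR\<^esub> = \<zero>\<^bsub>RR\<^esub>" by (rule RR.l_neg) simp
  also have "SS.t s \<zero>\<^bsub>RR\<^esub> = \<zero>\<^bsub>SS.T\<^esub>" using s by (intro SS.t_zero_right) simp
  finally have neg: "SS.t s (\<ominus>\<^bsub>RR\<^esub> \<one>\<^bsub>RR\<^esub>) \<oplus>\<^bsub>SS.T\<^esub> SS.t s \<one>\<^bsub>E\<^esub> = \<zero>\<^bsub>SS.T\<^esub>" .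
  have "(\<Oplus>\<^bsub>SS.T\<^esub>v\<in>?V. SS.t v (?b v)) = SS.t \<one>\<^bsub>E\<^esub> (?b \<one>\<^bsub>E\<^esub>) \<oplus>\<^bsub>SS.T\<^esub> (\<Oplus>\<^bsub>SS.T\<^esub>v\<in>{s}. SS.t v (?b v))"
    by (rule SS.T.finsum_insert) (use s1 tc in auto)
  also have "(\<Oplus>\<^bsub>SS.T\<^esub>v\<in>{s}. SS.t v (?b v)) = SS.t s (\<ominus>\<^bsub>RR\<^esub> \<one>\<^bsub>RR\<^esub>)"
    using SS.T.finsum_insert[of "{}" s "\<lambda>v. SS.t v (?b v)"] tc by simp
  also have "SS.t \<one>\<^bsub>E\<^esub> (?b \<one>\<^bsub>E\<^esub>) = SS.t s \<one>\<^bsub>E\<^esub>" using s1 eq by simp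
  also have "SS.t s \<one>\<^bsub>E\<^esub> \<oplus>\<^bsub>SS.T\<^esub> SS.t s (\<ominus>\<^bsub>RR\<^esub> \<one>\<^bsub>RR\<^esub>) = \<zero>\<^bsub>SS.T\<^esub>"
    using neg tc SS.T.a_comm by simp
  finally have z: "(\<Oplus>\<^bsub>SS.T\<^esub>v\<in>?V. SS.t v (?b v)) = \<zero>\<^bsub>SS.T\<^esub>" .
  have "?b \<one>\<^bsub>E\<^esub> = \<zero>\<^bsub>RR\<^esub>"
    by (rule SS.tensor_left_indep_zero[OF fF _ _ ind _ z]) (use s mo in auto)
  then have "s = \<zero>\<^bsub>E\<^esub>" using s1 by simp
  then show False using sF subringE(2)[OF subring_F] by simp
qed

end

context ppv_torsor
begin

text \<open>The automorphism that tests \<open>s\<close> lives over the algebra \<open>L\<close> of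
  constants of \<open>R \<otimes>\<^sub>F R\<close> generated by the comparison matrices. Each of
  the two embeddings of \<open>R\<close> extends to an isomorphism
  \<open>R \<otimes>\<^sub>K L \<rightarrow> R \<otimes>\<^sub>F R\<close> compatible with the
  derivations; the second followed by the inverse of the first is the automorphism sought.\<close>

lemma fixed_imp_in_F:
  assumes s: "s \<in> R" and fixed: "\<And>(L :: ('e, 'u) module) \<sigma>. algebra K L \<Longrightarrow> \<sigma> \<in> carrier (Gal E F R \<theta> L) \<Longrightarrow>
    \<sigma> (pt L s \<one>\<^bsub>L\<^esub>) = pt L s \<one>\<^bsub>L\<^esub>"
  shows "s \<in> F"
proof -
  interpret SS: tensor_product FF RR RR by (intro tensor_product.intro algebra_F_R)
  let ?S = "tensor FF RR RR"
  define j1 where "j1 = (\<lambda>r. SS.t r \<one>\<^bsub>RR\<^esub>)"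
  define j2 where "j2 = (\<lambda>r. SS.t \<one>\<^bsub>RR\<^esub> r)"
  have j1: "j1 \<in> ring_hom RR ?S" unfolding j1_def by (rule SS.t_left_ring_hom)
  have j2: "j2 \<in> ring_hom RR ?S" unfolding j2_def by (rule SS.t_right_ring_hom)
  have jF: "j1 f = j2 f" if "f \<in> F" for f
    using SS.t_balanced[of f "\<one>\<^bsub>RR\<^esub>" "\<one>\<^bsub>RR\<^esub>"] that by (simp add: j1_def j2_def in_E)
  have tj: "SS.t r r' = j1 r \<otimes>\<^bsub>?S\<^esub> j2 r'" if "r \<in> R" "r' \<in> R" for r r'
    using SS.t_mult[of r "\<one>\<^bsub>RR\<^esub>" "\<one>\<^bsub>RR\<^esub>" r'] that by (simp add: j1_def j2_def)
  interpret P: cring "mps ?S :: ('i multiindex \<Rightarrow> _) ring" by (rule SS.T.mps_cring)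
  let ?P = "mps ?S :: ('i multiindex \<Rightarrow> _) ring"
  \<comment> \<open>The derivation on \<open>R \<otimes>\<^sub>F R\<close> comes from the universal
    property: the product of the series \<open>f1 r\<close> and \<open>f2 r'\<close> is the Leibniz
    rule for \<open>r \<otimes> r'\<close>. Balancedness over \<open>F\<close> holds because
    \<open>\<theta>\<close> preserves \<open>F\<close>.\<close>
  define f1 where "f1 = (\<lambda>r (k :: 'i multiindex). j1 (\<theta> r k))"
  define f2 where "f2 = (\<lambda>r (k :: 'i multiindex). j2 (\<theta> r k))"
  have f1: "f1 \<in> ring_hom RR ?P"
    using ring_hom_trans[OF theta_hom mps_map_hom[OF RR.is_cring SS.T.is_cring j1]] by (simp add: f1_def comp_def)
  have f2: "f2 \<in> ring_hom RR ?P"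
    using ring_hom_trans[OF theta_hom mps_map_hom[OF RR.is_cring SS.T.is_cring j2]] by (simp add: f2_def comp_def)
  have f12: "f1 c = f2 c" if "c \<in> F" for c using jF theta_F that by (simp add: f1_def f2_def)
  have bal: "f1 (c \<odot>\<^bsub>RR\<^esub> r) \<otimes>\<^bsub>?P\<^esub> f2 r' = f1 r \<otimes>\<^bsub>?P\<^esub> f2 (c \<odot>\<^bsub>RR\<^esub> r')"
    if "c \<in> carrier FF" "r \<in> carrier RR" "r' \<in> carrier RR" for c r r'
  proof -
    have cR: "c \<in> carrier RR" and cF: "c \<in> F" using that by (simp_all add: in_E)
    have "f1 (c \<odot>\<^bsub>RR\<^esub> r) = f1 r \<otimes>\<^bsub>?P\<^esub> f2 c"
      using ring_hom_mult[OF f1 cR that(2)] f12[OF cF] P.m_comm[OF ring_hom_closed[OF f2 cR] ring_hom_closed[OF f1 that(2)]]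
      by (simp del: mps_simps)
    moreover have "f2 (c \<odot>\<^bsub>RR\<^esub> r') = f2 c \<otimes>\<^bsub>?P\<^esub> f2 r'"
      using ring_hom_mult[OF f2 cR that(3)] by simp
    ultimately show ?thesis
      using P.m_assoc[OF ring_hom_closed[OF f1 that(2)] ring_hom_closed[OF f2 cR] ring_hom_closed[OF f2 that(3)]] by simp
  qed
  obtain D where D: "D \<in> ring_hom ?S ?P" and Dt: "\<And>r r'. r \<in> carrier RR \<Longrightarrow> r' \<in> carrier RR \<Longrightarrow> D (SS.t r r') = f1 r \<otimes>\<^bsub>?P\<^esub> f2 r'"
    using SS.tensor_ring_universal[OF P.is_cring f1 f2 bal] by blast
  have D1: "D (j1 r) k = j1 (\<theta> r k)" if "r \<in> R" for r k
  proof -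
    have "D (j1 r) = f1 r \<otimes>\<^bsub>?P\<^esub> \<one>\<^bsub>?P\<^esub>"
      using Dt[of r "\<one>\<^bsub>RR\<^esub>"] that ring_hom_one[OF f2] by (simp add: j1_def)
    also have "\<dots> = f1 r" by (rule P.r_one[OF ring_hom_closed[OF f1]]) (use that in simp)
    finally show ?thesis by (simp add: f1_def)
  qed
  have D2: "D (j2 r) k = j2 (\<theta> r k)" if "r \<in> R" for r k
  proof -
    have "D (j2 r) = \<one>\<^bsub>?P\<^esub> \<otimes>\<^bsub>?P\<^esub> f2 r"
      using Dt[of "\<one>\<^bsub>RR\<^esub>" r] that ring_hom_one[OF f1] by (simp add: j2_def)
    also have "\<dots> = f2 r" by (rule P.l_one[OF ring_hom_closed[OF f2]]) (use that in simp)
    finally show ?thesis by (simp add: f2_def)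
  qed
  \<comment> \<open>The matrix comparing the two copies of \<open>Y\<close>, and the one comparing
    them in the opposite order. Both are needed, the first to reach the entries of \<open>Y\<close>
    in the other factor, the second those of \<open>W\<close>; both are constant by
    \<open>constant_matrix\<close>.\<close>
  define Z1 where "Z1 = mat_mul ?S n (\<lambda>r s. j1 (W r s)) (\<lambda>r s. j2 (Y r s))"
  define Z2 where "Z2 = mat_mul ?S n (\<lambda>r s. j2 (W r s)) (\<lambda>r s. j1 (Y r s))"
  have Z1c: "Z1 \<in> mat_carrier ?S n" and Z2c: "Z2 \<in> mat_carrier ?S n"
    unfolding Z1_def Z2_def
    by (rule SS.T.mat_mul_closed[OF mat_carrier_hom[OF j1 W] mat_carrier_hom[OF j2 Y]],
        rule SS.T.mat_mul_closed[OF mat_carrier_hom[OF j2 W] mat_carrier_hom[OF j1 Y]])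
  have Z1D: "D (Z1 r s) = mps_const ?S (Z1 r s)" if "r < n" "s < n" for r s
    unfolding Z1_def by (rule constant_matrix[OF SS.T.is_cring D j1 j2 jF D1 D2 that])
  have Z2D: "D (Z2 r s) = mps_const ?S (Z2 r s)" if "r < n" "s < n" for r s
    unfolding Z2_def by (rule constant_matrix[OF SS.T.is_cring D j2 j1 jF[symmetric] D2 D1 that])
  define Zs where "Zs = (\<lambda>z. Z1 (fst z) (snd z)) ` ({..<n} \<times> {..<n}) \<union> (\<lambda>z. Z2 (fst z) (snd z)) ` ({..<n} \<times> {..<n})"
  define H where "H = j1 ` KC \<union> Zs"
  have HS: "H \<subseteq> carrier ?S"
    using Z1c Z2c ring_hom_closed[OF j1] by (auto simp: H_def Zs_def mat_carrier_def in_E)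
  define C where "C = generate_ring ?S H"
  have C: "subring C ?S" unfolding C_def by (rule SS.T.generate_ring_is_subring[OF HS])
  note Cs = subringE[OF C]
  have CS: "\<And>x. x \<in> C \<Longrightarrow> x \<in> carrier ?S" using Cs(1) by auto
  have HC: "H \<subseteq> C" by (auto simp: C_def intro: generate_ring.incl)
  have ch: "mps_const ?S \<in> ring_hom ?S ?P" by (rule SS.T.mps_const_hom)
  interpret Dh: ring_hom_ring ?S ?P D by (intro ring_hom_ringI2 SS.T.ring_axioms P.ring_axioms D)
  interpret ch: ring_hom_ring ?S ?P "mps_const ?S" by (intro ring_hom_ringI2 SS.T.ring_axioms P.ring_axioms ch)
  have CD: "D c = mps_const ?S c" if "c \<in> C" for c
  proof -
    have "c \<in> carrier ?S \<and> D c = mps_const ?S c" using that[unfolded C_def]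
    proof (induction rule: generate_ring.induct)
      case one
      then show ?case using Dh.hom_one ch.hom_one by simp
    next
      case (incl h)
      have "D (j1 c) = mps_const ?S (j1 c)" if "c \<in> KC" for c
      proof
        fix k
        have j0: "j1 \<zero>\<^bsub>E\<^esub> = \<zero>\<^bsub>?S\<^esub>" using ring_hom_zero[OF j1 RR.ring_axioms SS.T.ring_axioms] by simp
        have "\<theta> c = mps_const E c" using that by (simp add: KC_iff)
        then show "D (j1 c) k = mps_const ?S (j1 c) k"
          using D1[of c k] that j0 by (simp add: mps_const_def in_E)
      qed
      then show ?case using incl HS Z1D Z2D by (auto simp: H_def Zs_def)
    next
      case (a_inv h)
      then show ?case using Dh.hom_a_inv ch.hom_a_inv by simp
    next
      case (eng_add x y)
      then show ?case using Dh.hom_add[of x y] ch.hom_add[of x y] by simp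
    next
      case (eng_mult x y)
      then show ?case using Dh.hom_mult[of x y] ch.hom_mult[of x y] by simp
    qed
    then show ?thesis by simp
  qed
  \<comment> \<open>The scalars are bounded through \<open>\<iota>\<close>, and the two matrices
    contribute finitely many elements.\<close>
  have "(card_of H, card_of (UNIV :: 'u set)) \<in> ordLeq"
    unfolding H_def
  proof (rule card_of_Un_ordLeq_infinite[OF infinite_u])
    have "(card_of KC, card_of (UNIV :: 'u set)) \<in> ordLeq"
      using inj_\<iota> card_of_ordLeq[of KC "UNIV :: 'u set"] by blast
    then show "(card_of (j1 ` KC), card_of (UNIV :: 'u set)) \<in> ordLeq"
      by (rule ordLeq_transitive[OF card_of_image])
    have "finite Zs" by (simp add: Zs_def)
    then show "(card_of Zs, card_of (UNIV :: 'u set)) \<in> ordLeq"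
      by (rule ordLess_imp_ordLeq[OF finite_ordLess_infinite2[OF _ infinite_u]])
  qed
  then obtain e :: "_ \<Rightarrow> 'u" where e: "inj_on e C"
    using generate_ring_embeds[OF infinite_u, of H ?S] unfolding C_def by blast
  define \<kappa> where "\<kappa> = inv_into C e"
  have \<kappa>e: "\<And>c. c \<in> C \<Longrightarrow> \<kappa> (e c) = c" using e by (simp add: \<kappa>_def)
  \<comment> \<open>A copy of \<open>C\<close> on elements of \<open>'u\<close>, as required of a
    test algebra; \<open>\<kappa>\<close> is the isomorphism back to \<open>C\<close>.\<close>
  define L :: "('e, 'u) module" where "L = \<lparr>carrier = e ` C, monoid.mult = (\<lambda>x y. e (\<kappa> x \<otimes>\<^bsub>?S\<^esub> \<kappa> y)), monoid.one = e \<one>\<^bsub>?S\<^esub>,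
    ring.zero = e \<zero>\<^bsub>?S\<^esub>, ring.add = (\<lambda>x y. e (\<kappa> x \<oplus>\<^bsub>?S\<^esub> \<kappa> y)), smult = (\<lambda>c x. e (j1 c \<otimes>\<^bsub>?S\<^esub> \<kappa> x))\<rparr>"
  have Ls: "carrier L = e ` C" "\<And>x y. x \<otimes>\<^bsub>L\<^esub> y = e (\<kappa> x \<otimes>\<^bsub>?S\<^esub> \<kappa> y)" "\<one>\<^bsub>L\<^esub> = e \<one>\<^bsub>?S\<^esub>" "\<zero>\<^bsub>L\<^esub> = e \<zero>\<^bsub>?S\<^esub>"
    "\<And>x y. x \<oplus>\<^bsub>L\<^esub> y = e (\<kappa> x \<oplus>\<^bsub>?S\<^esub> \<kappa> y)" "\<And>c x. c \<odot>\<^bsub>L\<^esub> x = e (j1 c \<otimes>\<^bsub>?S\<^esub> \<kappa> x)"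
    by (simp_all add: L_def)
  have \<kappa>C: "\<kappa> x \<in> C" if "x \<in> carrier L" for x using that \<kappa>e by (auto simp: Ls)
  have j1C: "j1 c \<in> C" if "c \<in> KC" for c using HC that by (auto simp: H_def)
  have \<kappa>inj: "inj_on \<kappa> (carrier L)" using \<kappa>e by (auto simp: inj_on_def Ls)
  have \<kappa>r: "\<kappa> \<in> ring_hom L ?S"
    by (rule ring_hom_memI) (use \<kappa>C CS Cs in \<open>simp_all add: Ls(2-5) \<kappa>e\<close>)
  have \<kappa>s1: "\<kappa> (c \<odot>\<^bsub>L\<^esub> l) = j1 c \<otimes>\<^bsub>?S\<^esub> \<kappa> l" if "c \<in> KC" "l \<in> carrier L" for c l
    using Cs(6)[OF j1C[OF that(1)] \<kappa>C[OF that(2)]] by (simp add: Ls(6) \<kappa>e)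
  have \<kappa>s2: "\<kappa> (c \<odot>\<^bsub>L\<^esub> l) = j2 c \<otimes>\<^bsub>?S\<^esub> \<kappa> l" if "c \<in> KC" "l \<in> carrier L" for c l
    using \<kappa>s1[OF that] jF[of c] that by (simp add: in_E)
  have jK: "j1 \<in> ring_hom K ?S"
    by (rule ring_hom_memI) (use ring_hom_closed[OF j1] ring_hom_mult[OF j1] ring_hom_add[OF j1] ring_hom_one[OF j1] in \<open>auto simp: in_E\<close>)
  have L: "algebra K L"
  proof (rule algebra_via_injection[OF K.is_cring SS.T.is_cring jK \<kappa>inj])
    show "\<kappa> x \<in> carrier ?S" if "x \<in> carrier L" for x using \<kappa>C[OF that] CS by simp
    show "\<one>\<^bsub>L\<^esub> \<in> carrier L" "\<kappa> \<one>\<^bsub>L\<^esub> = \<one>\<^bsub>?S\<^esub>" "\<zero>\<^bsub>L\<^esub> \<in> carrier L" "\<kappa> \<zero>\<^bsub>L\<^esub> = \<zero>\<^bsub>?S\<^esub>"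
      using Cs(2,3) \<kappa>e by (simp_all add: Ls)
    show "x \<oplus>\<^bsub>L\<^esub> y \<in> carrier L \<and> \<kappa> (x \<oplus>\<^bsub>L\<^esub> y) = \<kappa> x \<oplus>\<^bsub>?S\<^esub> \<kappa> y" if "x \<in> carrier L" "y \<in> carrier L" for x y
      using Cs(7)[OF \<kappa>C[OF that(1)] \<kappa>C[OF that(2)]] by (simp add: Ls(1,5) \<kappa>e)
    show "x \<otimes>\<^bsub>L\<^esub> y \<in> carrier L \<and> \<kappa> (x \<otimes>\<^bsub>L\<^esub> y) = \<kappa> x \<otimes>\<^bsub>?S\<^esub> \<kappa> y" if "x \<in> carrier L" "y \<in> carrier L" for x y
      using Cs(6)[OF \<kappa>C[OF that(1)] \<kappa>C[OF that(2)]] by (simp add: Ls(1,2) \<kappa>e)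
    show "\<exists>y\<in>carrier L. \<kappa> y = \<ominus>\<^bsub>?S\<^esub> \<kappa> x" if "x \<in> carrier L" for x
      using Cs(5)[OF \<kappa>C[OF that]] by (intro bexI[of _ "e (\<ominus>\<^bsub>?S\<^esub> \<kappa> x)"]) (simp_all add: Ls(1) \<kappa>e)
    show "c \<odot>\<^bsub>L\<^esub> x \<in> carrier L \<and> \<kappa> (c \<odot>\<^bsub>L\<^esub> x) = j1 c \<otimes>\<^bsub>?S\<^esub> \<kappa> x" if "c \<in> carrier K" "x \<in> carrier L" for c x
      using Cs(6)[OF j1C[OF that(1)] \<kappa>C[OF that(2)]] by (simp add: Ls(1,6) \<kappa>e)
  qed
  have \<kappa>D: "D (\<kappa> l) = mps_const ?S (\<kappa> l)" if "l \<in> carrier L" for l by (rule CD[OF \<kappa>C[OF that]])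
  interpret L: tensor_product K RR L by (rule tp[OF L])
  obtain h1 where h1: "h1 \<in> ring_hom (TT L) ?S" "\<And>r l. r \<in> R \<Longrightarrow> l \<in> carrier L \<Longrightarrow> h1 (pt L r l) = j1 r \<otimes>\<^bsub>?S\<^esub> \<kappa> l"
    "inj_on h1 (carrier (TT L))" "\<And>x k. x \<in> carrier (TT L) \<Longrightarrow> h1 (\<Theta> L x k) = D (h1 x) k"
    using constants_tensor_map[OF SS.T.is_cring D j1 D1 L \<kappa>r \<kappa>inj \<kappa>s1 \<kappa>D] by blast
  obtain h2 where h2: "h2 \<in> ring_hom (TT L) ?S" "\<And>r l. r \<in> R \<Longrightarrow> l \<in> carrier L \<Longrightarrow> h2 (pt L r l) = j2 r \<otimes>\<^bsub>?S\<^esub> \<kappa> l"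
    "inj_on h2 (carrier (TT L))" "\<And>x k. x \<in> carrier (TT L) \<Longrightarrow> h2 (\<Theta> L x k) = D (h2 x) k"
    using constants_tensor_map[OF SS.T.is_cring D j2 D2 L \<kappa>r \<kappa>inj \<kappa>s2 \<kappa>D] by blast
  have \<kappa>1: "\<kappa> \<one>\<^bsub>L\<^esub> = \<one>\<^bsub>?S\<^esub>" by (rule ring_hom_one[OF \<kappa>r])
  \<comment> \<open>Proved once for both embeddings: the image contains one copy of \<open>R\<close>
    and the constants \<open>C\<close>, hence by \<open>torsor_surj\<close> the other copy, and the
    two copies generate.\<close>
  have surj: "h ` carrier (TT L) = carrier ?S"
    if h: "h \<in> ring_hom (TT L) ?S" and ht: "\<And>r l. r \<in> R \<Longrightarrow> l \<in> carrier L \<Longrightarrow> h (pt L r l) = a r \<otimes>\<^bsub>?S\<^esub> \<kappa> l"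
      and ab: "(a = j1 \<and> b = j2) \<or> (a = j2 \<and> b = j1)" for h a b
  proof -
    let ?J = "h ` carrier (TT L)"
    interpret h: ring_hom_ring "TT L" ?S h by (intro ring_hom_ringI2 L.T.ring_axioms SS.T.ring_axioms h)
    have J: "subring ?J ?S" by (rule h.img_is_subring[OF L.T.carrier_is_subring])
    have a: "a \<in> ring_hom RR ?S" and b: "b \<in> ring_hom RR ?S" using ab j1 j2 by auto
    have aF: "a f = b f" if "f \<in> F" for f using ab jF[OF that] by auto
    have aJ: "a r \<in> ?J" if r: "r \<in> R" for r
    proof (rule image_eqI)
      show "a r = h (pt L r \<one>\<^bsub>L\<^esub>)" using ht[OF r, of "\<one>\<^bsub>L\<^esub>"] \<kappa>1 ring_hom_closed[OF a, of r] r by simp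
      show "pt L r \<one>\<^bsub>L\<^esub> \<in> carrier (TT L)" using L.t_closed[of r "\<one>\<^bsub>L\<^esub>"] r by simp
    qed
    have CJ: "c \<in> ?J" if c: "c \<in> C" for c
    proof (rule image_eqI)
      have a1: "a \<one>\<^bsub>E\<^esub> = \<one>\<^bsub>?S\<^esub>" using ring_hom_one[OF a] by simp
      show "c = h (pt L \<one>\<^bsub>E\<^esub> (e c))" using ht[of "\<one>\<^bsub>E\<^esub>" "e c"] a1 CS[OF c] c by (simp add: Ls(1) \<kappa>e)
      show "pt L \<one>\<^bsub>E\<^esub> (e c) \<in> carrier (TT L)" using L.t_closed[of "\<one>\<^bsub>E\<^esub>" "e c"] c by (simp add: Ls(1))
    qed
    have Z12: "Z1 r s \<in> ?J" "Z2 r s \<in> ?J" if "r < n" "s < n" for r s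
    proof -
      have "Z1 r s \<in> (\<lambda>z. Z1 (fst z) (snd z)) ` ({..<n} \<times> {..<n})" "Z2 r s \<in> (\<lambda>z. Z2 (fst z) (snd z)) ` ({..<n} \<times> {..<n})"
        using that by (auto intro!: image_eqI[of _ _ "(r, s)"])
      then have "Z1 r s \<in> H" "Z2 r s \<in> H" unfolding H_def Zs_def by blast+
      then show "Z1 r s \<in> ?J" "Z2 r s \<in> ?J" using HC CJ by auto
    qed
    have bJ: "b r \<in> ?J" if "r \<in> R" for r
      by (rule torsor_surj[OF SS.T.is_cring a b aF J aJ _ _ that])
         (use ab Z12 in \<open>auto simp: Z1_def Z2_def\<close>)
    have "x \<in> ?J" if "x \<in> carrier ?S" for x
      using that
    proof (induction rule: SS.tensor_induct)
      case (pure r r')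
      then have rr: "r \<in> R" "r' \<in> R" by simp_all
      have "j1 r \<in> ?J" "j2 r' \<in> ?J" using ab aJ bJ rr by auto
      then show ?case using tj[OF rr] subringE(6)[OF J] by simp
    next
      case (add x y)
      then show ?case using subringE(7)[OF J] by blast
    qed
    then show ?thesis using subringE(1)[OF J] by blast
  qed
  have bij1: "bij_betw h1 (carrier (TT L)) (carrier ?S)" and bij2: "bij_betw h2 (carrier (TT L)) (carrier ?S)"
    using surj[OF h1(1,2) disjI1[OF conjI[OF refl refl]]] surj[OF h2(1,2) disjI2[OF conjI[OF refl refl]]] h1(3) h2(3) by (simp_all add: bij_betw_def)
  let ?g = "inv_into (carrier (TT L)) h1"
  have g: "?g \<in> ring_hom ?S (TT L)" by (rule ring_hom_inv_into[OF L.T.ring_axioms h1(1) bij1])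
  have gb: "bij_betw ?g (carrier ?S) (carrier (TT L))" by (rule bij_betw_inv_into[OF bij1])
  have hg: "h1 (?g y) = y" if "y \<in> carrier ?S" for y using bij_betw_inv_into_right[OF bij1 that] .
  \<comment> \<open>\<open>\<sigma>\<close> expresses the second embedding of \<open>R\<close> in
    the coordinates given by the first. If it fixes \<open>s \<otimes> 1\<close>, then
    \<open>j1 s = j2 s\<close>.\<close>
  define \<sigma> where "\<sigma> = restrict (?g \<circ> h2) (carrier (TT L))"
  have \<sigma>h: "h1 (\<sigma> x) = h2 x" if "x \<in> carrier (TT L)" for x
    using hg[OF ring_hom_closed[OF h2(1) that]] that by (simp add: \<sigma>_def)
  have \<sigma>r: "\<sigma> \<in> ring_hom (TT L) (TT L)"
    unfolding \<sigma>_def by (rule L.T.ring_hom_restrict[OF ring_hom_trans[OF h2(1) g]]) simp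
  have \<sigma>c: "\<sigma> x \<in> carrier (TT L)" if "x \<in> carrier (TT L)" for x by (rule ring_hom_closed[OF \<sigma>r that])
  have tL: "pt L r l \<in> carrier (TT L)" if "r \<in> R" "l \<in> carrier L" for r l using L.t_closed[of r l] that by simp
  note Ts = add_monoid_hom_simps[OF L.T.abelian_group_axioms L.T.abelian_group_axioms Theta_hom(1)[OF L]]
  have \<sigma>: "\<sigma> \<in> carrier (Gal E F R \<theta> L)"
    unfolding Gal_iff[OF L]
  proof (intro conjI ballI allI)
    show "\<sigma> \<in> extensional (carrier (TT L))" by (simp add: \<sigma>_def)
    show "bij_betw \<sigma> (carrier (TT L)) (carrier (TT L))"
      using bij_betw_trans[OF bij2 gb] by (simp add: \<sigma>_def cong: bij_betw_cong)
    show "\<sigma> \<in> ring_hom (TT L) (TT L)" by (rule \<sigma>r)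
  next
    fix r k assume r: "r \<in> R"
    have t1: "pt L r \<one>\<^bsub>L\<^esub> \<in> carrier (TT L)" and t2: "pt L (\<theta> r k) \<one>\<^bsub>L\<^esub> \<in> carrier (TT L)" using tL r by simp_all
    show "\<sigma> (pt L (\<theta> r k) \<one>\<^bsub>L\<^esub>) = \<Theta> L (\<sigma> (pt L r \<one>\<^bsub>L\<^esub>)) k"
    proof (rule inj_onD[OF h1(3)])
      show "\<sigma> (pt L (\<theta> r k) \<one>\<^bsub>L\<^esub>) \<in> carrier (TT L)" by (rule \<sigma>c[OF t2])
      show "\<Theta> L (\<sigma> (pt L r \<one>\<^bsub>L\<^esub>)) k \<in> carrier (TT L)" by (rule Ts(3)[OF \<sigma>c[OF t1]])
      have "h1 (\<sigma> (pt L (\<theta> r k) \<one>\<^bsub>L\<^esub>)) = h2 (\<Theta> L (pt L r \<one>\<^bsub>L\<^esub>) k)"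
        using \<sigma>h[OF t2] Theta_hom(2)[OF L r, of "\<one>\<^bsub>L\<^esub>" k] by simp
      also have "\<dots> = D (h2 (pt L r \<one>\<^bsub>L\<^esub>)) k" by (rule h2(4)[OF t1])
      also have "h2 (pt L r \<one>\<^bsub>L\<^esub>) = h1 (\<sigma> (pt L r \<one>\<^bsub>L\<^esub>))" using \<sigma>h[OF t1] by simp
      also have "D \<dots> k = h1 (\<Theta> L (\<sigma> (pt L r \<one>\<^bsub>L\<^esub>)) k)" by (rule h1(4)[OF \<sigma>c[OF t1], symmetric])
      finally show "h1 (\<sigma> (pt L (\<theta> r k) \<one>\<^bsub>L\<^esub>)) = h1 (\<Theta> L (\<sigma> (pt L r \<one>\<^bsub>L\<^esub>)) k)" .
    qed
  next
    fix f l assume fl: "f \<in> F" "l \<in> carrier L"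
    have fR: "f \<in> R" using fl by (simp add: in_E)
    have "h1 (\<sigma> (pt L f l)) = h1 (pt L f l)"
      using \<sigma>h[OF tL[OF fR fl(2)]] h1(2)[OF fR fl(2)] h2(2)[OF fR fl(2)] jF[OF fl(1)] by simp
    then show "\<sigma> (pt L f l) = pt L f l"
      by (rule inj_onD[OF h1(3)]) (use tL[OF fR fl(2)] \<sigma>c in auto)
  qed
  have "h2 (pt L s \<one>\<^bsub>L\<^esub>) = h1 (pt L s \<one>\<^bsub>L\<^esub>)"
    using \<sigma>h[OF tL[OF s L.B.one_closed]] fixed[OF L \<sigma>] by simp
  then have "j2 s = j1 s"
    using h1(2)[OF s, of "\<one>\<^bsub>L\<^esub>"] h2(2)[OF s, of "\<one>\<^bsub>L\<^esub>"] \<kappa>1 ring_hom_closed[OF j1, of s] ring_hom_closed[OF j2, of s] s by simp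
  then show ?thesis
    by (intro tensor_F_eq_imp_in_F[OF s]) (simp add: j1_def j2_def)
qed

text \<open>By representability every automorphism over a test algebra is a base change of
  \<open>u\<close>, so the invariance of \<open>r^q \<otimes> 1\<close> under \<open>u\<close>
  passes to all of them.\<close>

lemma height_imp_exponent:
  assumes Q: "\<forall>x\<in>Aug. x [^]\<^bsub>A\<^esub> (p ^ e) = \<zero>\<^bsub>A\<^esub>" and r: "r \<in> R"
  shows "r [^]\<^bsub>E\<^esub> (p ^ e) \<in> F"
proof (rule fixed_imp_in_F)
  let ?s = "r [^]\<^bsub>E\<^esub> (p ^ e)"
  show sR: "?s \<in> R" using RR.nat_pow_closed[of r "p ^ e"] r by (simp add: sub_alg_pow)
  fix L :: "('e, 'u) module" and \<sigma> assume L: "algebra K L" and \<sigma>: "\<sigma> \<in> carrier (Gal E F R \<theta> L)"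
  have "\<sigma> \<in> (\<lambda>f. Gal_map E F R \<theta> A L f u) ` alg_hom K A L"
    using represents[OF L] \<sigma> by (simp add: bij_betw_def)
  then obtain f where f: "f \<in> alg_hom K A L" "\<sigma> = Gal_map E F R \<theta> A L f u" by (elim imageE)
  have t: "pt A ?s \<one>\<^bsub>A\<^esub> \<in> carrier (TT A)" by (rule pt_A_closed[OF sR]) simp
  have "id\<^sub>R L f (pt A ?s \<one>\<^bsub>A\<^esub>) = pt L ?s \<one>\<^bsub>L\<^esub>"
    using idR_hom(2)[OF algebra_A L f(1) sR, of "\<one>\<^bsub>A\<^esub>"] ring_hom_one[OF alg_hom_simps(1)[OF f(1)]] by simp
  then show "\<sigma> (pt L ?s \<one>\<^bsub>L\<^esub>) = pt L ?s \<one>\<^bsub>L\<^esub>"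
    using base_change(2)[OF algebra_A L f(1) u_Gal t] height_imp_fixed[OF Q r] f(2) by simp
qed

end

section \<open>Exponent and height\<close>

text \<open>The definitions speak of the record \<open>E\<lparr>carrier := S\<rparr>\<close>, the
  tensor products of the module record \<open>sub_alg E S\<close>. The operations are the same; this
  and the following lemmas translate between the two.\<close>

lemma finsum_sub_alg: "finsum (E\<lparr>carrier := S\<rparr>) = finsum (sub_alg E S)"
  by (simp add: finsum_def finprod_def sub_alg_def fun_eq_iff)

lemma mps_sub_alg: "mps (E\<lparr>carrier := S\<rparr>) = mps (sub_alg E S)"
proof -
  have "\<one>\<^bsub>E\<lparr>carrier := S\<rparr>\<^esub> = \<one>\<^bsub>sub_alg E S\<^esub>" "\<zero>\<^bsub>E\<lparr>carrier := S\<rparr>\<^esub> = \<zero>\<^bsub>sub_alg E S\<^esub>"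
    "carrier (E\<lparr>carrier := S\<rparr>) = carrier (sub_alg E S)" "monoid.mult (E\<lparr>carrier := S\<rparr>) = monoid.mult (sub_alg E S)"
    "ring.add (E\<lparr>carrier := S\<rparr>) = ring.add (sub_alg E S)"
    by (simp_all add: sub_alg_def)
  then show ?thesis by (simp only: mps_def finsum_sub_alg)
qed

lemma mps_const_carrier: "mps_const (E\<lparr>carrier := S\<rparr>) = mps_const E" "mps_const (sub_alg E S) = mps_const E"
  by (simp_all add: mps_const_def fun_eq_iff)

lemma mat_sub_alg:
  "mat_mul (E\<lparr>carrier := S\<rparr>) = mat_mul (sub_alg E S)" "mat_one (E\<lparr>carrier := S\<rparr>) = mat_one (sub_alg E S)"
  "mat_carrier (E\<lparr>carrier := S\<rparr>) = mat_carrier (sub_alg E S)"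
  by (simp_all add: mat_mul_def mat_one_def mat_carrier_def finsum_sub_alg fun_eq_iff)

lemma carrier_update_add_pow: "[(n::nat)] \<cdot>\<^bsub>E\<lparr>carrier := S\<rparr>\<^esub> x = [n] \<cdot>\<^bsub>E\<^esub> x"
  by (induction n) (simp_all add: add_pow_def nat_pow_def)

lemma ideal_sub_alg:
  assumes "ideal I (sub_alg E S)" "ring (E\<lparr>carrier := S\<rparr>)"
  shows "ideal I (E\<lparr>carrier := S\<rparr>)"
proof -
  interpret I: ideal I "sub_alg E S" by fact
  have "subgroup I (add_monoid (sub_alg E S))" by (rule I.a_subgroup)
  then have "subgroup I (add_monoid (E\<lparr>carrier := S\<rparr>))"
    by (simp add: subgroup_def m_inv_def)
  then show ?thesis
    using I.I_l_closed I.I_r_closed assms(2) by (intro idealI) simp_all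
qed

context ppv_torsor
begin

lemma pow_F: "f \<in> F \<Longrightarrow> f [^]\<^bsub>E\<^esub> (k::nat) \<in> F"
  using FF.nat_pow_closed[of f k] by (simp add: sub_alg_pow)

text \<open>The \<open>q\<close>-th power of a fraction is the fraction of the \<open>q\<close>-th
  powers, and \<open>F\<close> is closed under division. So the exponent can be tested on
  \<open>R\<close>, where finitely many generators are available.\<close>

lemma exponent_on_R_imp_E:
  assumes P: "\<forall>r\<in>R. r [^]\<^bsub>E\<^esub> (p ^ e) \<in> F" and x: "x = a \<otimes>\<^bsub>E\<^esub> inv\<^bsub>E\<^esub> b" "a \<in> R" "b \<in> R" "b \<noteq> \<zero>\<^bsub>E\<^esub>"
  shows "x [^]\<^bsub>E\<^esub> (p ^ e) \<in> F"
proof -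
  let ?q = "p ^ e"
  have ab: "a \<in> carrier E" "b \<in> carrier E" "b \<in> Units E" using x E.field_Units by auto
  have ib: "inv\<^bsub>E\<^esub> b \<in> carrier E" "inv\<^bsub>E\<^esub> b \<otimes>\<^bsub>E\<^esub> b = \<one>\<^bsub>E\<^esub>" using ab by simp_all
  let ?c = "b [^]\<^bsub>E\<^esub> ?q" and ?d = "inv\<^bsub>E\<^esub> b [^]\<^bsub>E\<^esub> ?q"
  have c: "?c \<in> F" using P x by simp
  have c0: "?c \<noteq> \<zero>\<^bsub>E\<^esub>" using E_pow_zero[OF ab(2)] x by auto
  have dc: "?d \<otimes>\<^bsub>E\<^esub> ?c = \<one>\<^bsub>E\<^esub>"
    using E.nat_pow_distrib[OF ib(1) ab(2), of ?q] ib by simp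
  have i: "inv\<^bsub>E\<^esub> ?c \<in> F" "?c \<otimes>\<^bsub>E\<^esub> inv\<^bsub>E\<^esub> ?c = \<one>\<^bsub>E\<^esub>"
    using E.subfield_m_inv[OF subfield_F, of ?c] c c0 by auto
  have "?d = ?d \<otimes>\<^bsub>E\<^esub> (?c \<otimes>\<^bsub>E\<^esub> inv\<^bsub>E\<^esub> ?c)" using ib i by simp
  also have "\<dots> = (?d \<otimes>\<^bsub>E\<^esub> ?c) \<otimes>\<^bsub>E\<^esub> inv\<^bsub>E\<^esub> ?c"
    by (rule E.m_assoc[symmetric]) (use ib ab i in \<open>auto simp: in_E(2)\<close>)
  also have "\<dots> = inv\<^bsub>E\<^esub> ?c" unfolding dc using i by (simp add: in_E(2))
  finally have "?d \<in> F" using i by simp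
  moreover have "x [^]\<^bsub>E\<^esub> ?q = a [^]\<^bsub>E\<^esub> ?q \<otimes>\<^bsub>E\<^esub> ?d" unfolding x(1) by (rule E.nat_pow_distrib[OF ab(1) ib(1)])
  ultimately show ?thesis using P x(2) subringE(6)[OF subring_F] by simp
qed

text \<open>Pure inseparability bounds the exponent of one element at a time. A common bound for the
  finitely many generators carries over to \<open>R\<close>, because raising to the power
  \<open>q\<close> respects sums and products and maps \<open>F\<close> into itself.\<close>

lemma purely_inseparable_imp_exponent:
  assumes "\<And>x. x \<in> G \<Longrightarrow> \<exists>e. x [^]\<^bsub>E\<^esub> (p ^ e) \<in> F"
  shows "\<exists>e. \<forall>r\<in>R. r [^]\<^bsub>E\<^esub> (p ^ e) \<in> F"
proof -
  obtain ex where ex: "\<And>x. x \<in> G \<Longrightarrow> x [^]\<^bsub>E\<^esub> (p ^ ex x) \<in> F" using assms by metis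
  \<comment> \<open>The sum is a crude common upper bound, valid also when \<open>G\<close> is
    empty.\<close>
  define m where "m = (\<Sum>x\<in>G. ex x)"
  have m: "x [^]\<^bsub>E\<^esub> (p ^ m) \<in> F" if "x \<in> G" for x
  proof -
    have le: "ex x \<le> m" unfolding m_def using finite_G that by (intro member_le_sum) auto
    have xE: "x \<in> carrier E" using that G_subset_R by auto
    have "p ^ m = p ^ ex x * p ^ (m - ex x)" using le by (simp flip: power_add)
    then have "x [^]\<^bsub>E\<^esub> (p ^ m) = (x [^]\<^bsub>E\<^esub> (p ^ ex x)) [^]\<^bsub>E\<^esub> (p ^ (m - ex x))"
      using xE by (simp add: E.nat_pow_pow)
    then show ?thesis using pow_F ex[OF that] by simp
  qed
  have "r [^]\<^bsub>E\<^esub> (p ^ m) \<in> F" if "r \<in> R" for r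
    using that
  proof (induction rule: R_induct)
    case (F f) then show ?case by (rule pow_F)
  next
    case (G g) then show ?case by (rule m)
  next
    case (add x y)
    then show ?case using subringE(7)[OF subring_F] by (simp add: E.frobenius_add[OF prime_p char_E] in_E(1))
  next
    case (mult x y)
    then show ?case using subringE(6)[OF subring_F] by (simp add: E.nat_pow_distrib in_E(1))
  qed
  then show ?thesis by blast
qed

end

text \<open>Besides unpacking the definitions, the task is to trade the generators \<open>Y\<close>
  and \<open>inv (det Y)\<close> for the entries of \<open>Y\<close> and of its inverse. The latter
  suit the matrix computations, where both \<open>Y\<close> and \<open>W\<close> are
  transported.\<close>

lemma PPV_extension_imp_torsor:
  fixes E :: "'e ring" and F R :: "'e set"
    and \<theta> :: "'e \<Rightarrow> 'i::finite multiindex \<Rightarrow> 'e" and A :: "('e, 'u) module"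
    and u :: "(('e \<times> 'u) \<Rightarrow>\<^sub>0 int) set \<Rightarrow> (('e \<times> 'u) \<Rightarrow>\<^sub>0 int) set"
    and \<epsilon> :: "'u \<Rightarrow> 'e" and \<iota> :: "'e \<Rightarrow> 'u"
  assumes IDF: "ID_field (E\<lparr>carrier := F\<rparr>) \<theta>"
    and p: "p > 0" "ring_char (E\<lparr>carrier := F\<rparr>) = p"
    and perf: "perfect_field p (const_ring E F \<theta>)"
    and PPV: "PPV_extension E F R \<theta>"
    and rep: "represents_Gal E F R \<theta> A u"
    and cou: "is_counit E F R \<theta> A u \<epsilon>"
    and inf: "infinite (UNIV :: 'u set)" and inj: "inj_on \<iota> (carrier (const_ring E F \<theta>))"
  shows "\<exists>G n Y W B. ppv_torsor E F R \<theta> G p A u \<epsilon> n Y W B \<iota>"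
proof -
  let ?R = "E\<lparr>carrier := R\<rparr>" and ?F = "E\<lparr>carrier := F\<rparr>"
  obtain n B where "ID_field E \<theta>" and sR: "subring R E" and IDE: "IDE ?F \<theta> n B" and PR: "PPV_ring ?R F \<theta> n B"
    using PPV by (auto simp: PPV_extension_def)
  interpret E: field E using \<open>ID_field E \<theta>\<close> by (simp add: ID_field_def)
  have IDR: "ID_ring ?R \<theta>" and sF: "subfield F ?R" and simple: "ID_simple ?R \<theta>"
    and const: "ID_constants ?R \<theta> = ID_constants (?R\<lparr>carrier := F\<rparr>) \<theta>"
    using PR by (simp_all add: PPV_ring_def)
  obtain Y where Y: "Y \<in> general_linear ?R n"
    and DE: "mat_eq n (\<lambda>r s. \<theta> (Y r s)) (mat_mul (mps ?R) n B (\<lambda>r s. mps_const ?R (Y r s)))"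
    and gen: "carrier ?R = generate_ring ?R (F \<union> {Y r s | r s. r < n \<and> s < n} \<union> {inv\<^bsub>?R\<^esub> (mat_det ?R n Y)})"
    using PR by (auto simp: PPV_ring_def)
  interpret R: cring ?R using IDR by (simp add: ID_ring_def)
  have FR: "F \<subseteq> R" using subfieldE(3)[OF sF] by simp
  have RE: "R \<subseteq> carrier E" by (rule subringE(1)[OF sR])
  have fF: "field ?F" using IDF by (simp add: ID_field_def)
  have subF: "subfield F E" by (rule E.subfield_iff(1)[OF fF]) (use FR RE in auto)
  obtain W where Yc: "Y \<in> mat_carrier ?R n" and Wc: "W \<in> mat_carrier ?R n"
    and YW: "mat_eq n (mat_mul ?R n Y W) (mat_one ?R)" and WY: "mat_eq n (mat_mul ?R n W Y) (mat_one ?R)"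
    using Y by (auto simp: general_linear_def)
  define G where "G = {Y r s | r s. r < n \<and> s < n} \<union> {W r s | r s. r < n \<and> s < n}"
  have G_alt: "G = (\<lambda>z. Y (fst z) (snd z)) ` ({..<n} \<times> {..<n}) \<union> (\<lambda>z. W (fst z) (snd z)) ` ({..<n} \<times> {..<n})"
    by (force simp: G_def)
  have YR: "\<And>r s. r < n \<Longrightarrow> s < n \<Longrightarrow> Y r s \<in> R" and WR: "\<And>r s. r < n \<Longrightarrow> s < n \<Longrightarrow> W r s \<in> R"
    using Yc Wc by (simp_all add: mat_carrier_def)
  have \<theta>R: "\<theta> \<in> ring_hom (sub_alg E R) (mps (sub_alg E R))"
  proof -
    have "\<theta> \<in> ring_hom ?R (mps ?R)" using IDR by (simp only: ID_ring_def iterative_derivation_def)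
    then have "\<theta> \<in> ring_hom ?R (mps (sub_alg E R))" unfolding mps_sub_alg .
    then show ?thesis by (simp add: ring_hom_def)
  qed
  have \<theta>0: "\<theta> r 0 = r" if "r \<in> R" for r
    using IDR that by (simp add: ID_ring_def iterative_derivation_def)
  have \<theta>F: "\<theta> f k \<in> F" if "f \<in> F" for f k
    using IDF that by (auto simp: ID_field_def iterative_derivation_def ring_hom_def)
  \<comment> \<open>Makes the last generator a polynomial in the entries of
    \<open>W\<close>.\<close>
  have det: "inv\<^bsub>?R\<^esub> (mat_det ?R n Y) = mat_det ?R n W"
  proof (rule R.comm_inv_char)
    show d: "mat_det ?R n Y \<in> carrier ?R" "mat_det ?R n W \<in> carrier ?R"
      using R.subring_mat_det[OF R.carrier_is_subring, of n Y] R.subring_mat_det[OF R.carrier_is_subring, of n W] YR WR by simp_all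
    have "mat_det ?R n Y \<otimes>\<^bsub>?R\<^esub> mat_det ?R n W = mat_det ?R n (mat_mul ?R n Y W)"
      by (rule R.mat_det_mult[OF Yc Wc, symmetric])
    also have "\<dots> = mat_det ?R n (mat_one ?R)" by (rule R.mat_det_cong[OF YW R.mat_one_carrier])
    also have "\<dots> = \<one>\<^bsub>?R\<^esub>" by (rule R.mat_det_one)
    finally show "mat_det ?R n Y \<otimes>\<^bsub>?R\<^esub> mat_det ?R n W = \<one>\<^bsub>?R\<^esub>" .
  qed
  have ind: "Q r" if r: "r \<in> R" and QF: "\<And>f. f \<in> F \<Longrightarrow> Q f" and QG: "\<And>g. g \<in> G \<Longrightarrow> Q g"
    and Qadd: "\<And>x y. x \<in> R \<Longrightarrow> y \<in> R \<Longrightarrow> Q x \<Longrightarrow> Q y \<Longrightarrow> Q (x \<oplus>\<^bsub>E\<^esub> y)"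
    and Qmult: "\<And>x y. x \<in> R \<Longrightarrow> y \<in> R \<Longrightarrow> Q x \<Longrightarrow> Q y \<Longrightarrow> Q (x \<otimes>\<^bsub>E\<^esub> y)" for Q r
  proof -
    let ?S = "{x \<in> R. Q x}"
    note subF' = subringE[OF subfieldE(1)[OF subF]]
    \<comment> \<open>The generated ring is also closed under negation. The induction principle
      needs no clause for it, since negation is multiplication by \<open>-1\<close>, and
      \<open>-1\<close> lies in \<open>F\<close>.\<close>
    have m1: "\<ominus>\<^bsub>?R\<^esub> \<one>\<^bsub>?R\<^esub> \<in> F"
    proof -
      have "\<ominus>\<^bsub>?R\<^esub> \<one>\<^bsub>?R\<^esub> = \<ominus>\<^bsub>E\<^esub> \<one>\<^bsub>E\<^esub>"
        using R.l_neg[OF R.one_closed] R.a_inv_closed[OF R.one_closed] RE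
        by (intro E.minus_equality[symmetric]) auto
      then show ?thesis using subF'(3,5) by simp
    qed
    have S: "subring ?S ?R"
    proof (rule R.subringI)
      show "?S \<subseteq> carrier ?R" by auto
      show "\<one>\<^bsub>?R\<^esub> \<in> ?S" using QF subF'(3) FR by auto
      show "\<And>h1 h2. h1 \<in> ?S \<Longrightarrow> h2 \<in> ?S \<Longrightarrow> h1 \<otimes>\<^bsub>?R\<^esub> h2 \<in> ?S" using Qmult R.m_closed by simp
      show "\<And>h1 h2. h1 \<in> ?S \<Longrightarrow> h2 \<in> ?S \<Longrightarrow> h1 \<oplus>\<^bsub>?R\<^esub> h2 \<in> ?S" using Qadd R.a_closed by simp
      fix h assume h: "h \<in> ?S"
      have "\<ominus>\<^bsub>?R\<^esub> h = (\<ominus>\<^bsub>?R\<^esub> \<one>\<^bsub>?R\<^esub>) \<otimes>\<^bsub>?R\<^esub> h" 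
        using R.l_minus[OF R.one_closed, of h] R.l_one[of h] h by simp
      then show "\<ominus>\<^bsub>?R\<^esub> h \<in> ?S"
        using Qmult[of "\<ominus>\<^bsub>?R\<^esub> \<one>\<^bsub>?R\<^esub>" h] m1 QF FR h R.a_inv_closed[of h] by auto
    qed
    have QY: "Q (Y r s)" and QW: "Q (W r s)" if "r < n" "s < n" for r s
      by (rule QG; use that in \<open>unfold G_def, blast\<close>)+
    have "F \<union> {Y r s | r s. r < n \<and> s < n} \<union> {inv\<^bsub>?R\<^esub> (mat_det ?R n Y)} \<subseteq> ?S"
    proof -
      have "mat_det ?R n W \<in> ?S"
        by (rule R.subring_mat_det[OF S]) (simp add: WR QW)
      then show ?thesis using QF FR QY YR unfolding det by blast
    qed
    moreover have "?S \<subseteq> carrier ?R" by auto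
    ultimately have "generate_ring ?R (F \<union> {Y r s | r s. r < n \<and> s < n} \<union> {inv\<^bsub>?R\<^esub> (mat_det ?R n Y)}) \<subseteq> ?S"
      using S by (intro R.generate_ring_min_subring1) auto
    then have "carrier ?R \<subseteq> ?S" using gen by simp
    then show ?thesis using r by auto
  qed
  have K: "field (const_ring E F \<theta>)" using perf by (simp add: perfect_field_def)
  have cR: "r \<in> F" if "r \<in> R" "\<theta> r = mps_const E r" for r
  proof -
    have "r \<in> ID_constants ?R \<theta>" using that by (simp add: ID_constants_def mps_const_carrier)
    then show ?thesis unfolding const by (simp add: ID_constants_def)
  qed
  have sim: "I = {\<zero>\<^bsub>E\<^esub>} \<or> I = R" if "ideal I (sub_alg E R)" "\<And>r k. r \<in> I \<Longrightarrow> \<theta> r k \<in> I" for I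
    using simple ideal_sub_alg[OF that(1) R.ring_axioms] that(2) by (auto simp: ID_simple_def ID_ideal_def)
  have ppv: "ppv E F R \<theta>"
    by (rule ppv.intro, rule E.field_axioms, rule ppv_axioms.intro)
       (fact sR subF FR \<theta>R \<theta>F \<theta>0 K cR sim)+
  note pf = ring_char_field[OF fF p(2,1)]
  have perK: "\<exists>d\<in>carrier (const_ring E F \<theta>). d [^]\<^bsub>E\<^esub> p = c" if "c \<in> carrier (const_ring E F \<theta>)" for c
  proof -
    have "c \<in> (\<lambda>x. x [^]\<^bsub>const_ring E F \<theta>\<^esub> p) ` carrier (const_ring E F \<theta>)"
      using perf that by (simp add: perfect_field_def)
    then obtain d where "d \<in> carrier (const_ring E F \<theta>)" "c = d [^]\<^bsub>const_ring E F \<theta>\<^esub> p" by blast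
    then show ?thesis by (intro bexI[of _ d]) (simp_all add: const_ring_def sub_alg_pow)
  qed
  have gal: "ppv_gal E F R \<theta> G p A u \<epsilon>"
  proof (intro ppv_gal.intro ppv ppv_gal_axioms.intro)
    show "finite G" unfolding G_alt by simp
    show "G \<subseteq> R" using YR WR by (auto simp: G_def)
    show "Factorial_Ring.prime p" by (rule pf)
    show "[p] \<cdot>\<^bsub>E\<^esub> \<one>\<^bsub>E\<^esub> = \<zero>\<^bsub>E\<^esub>" using pf(2) by (simp add: carrier_update_add_pow)
    show "algebra (const_ring E F \<theta>) A" "u \<in> carrier (Gal E F R \<theta> A)"
      using rep by (simp_all add: represents_Gal_def)
    show "bij_betw (\<lambda>f. Gal_map E F R \<theta> A L f u) (alg_hom (const_ring E F \<theta>) A L) (carrier (Gal E F R \<theta> L))"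
      if "algebra (const_ring E F \<theta>) L" for L :: "('e, 'u) module"
      using rep that by (simp add: represents_Gal_def)
    show "\<epsilon> \<in> alg_hom (const_ring E F \<theta>) A (const_ring E F \<theta>)"
      "Gal_map E F R \<theta> A (const_ring E F \<theta>) \<epsilon> u = \<one>\<^bsub>Gal E F R \<theta> (const_ring E F \<theta>)\<^esub>"
      using cou by (simp_all add: is_counit_def)
  qed (fact ind perK)+
  have "ppv_torsor E F R \<theta> G p A u \<epsilon> n Y W B \<iota>"
  proof (intro ppv_torsor.intro gal ppv_torsor_axioms.intro)
    show "Y \<in> mat_carrier (sub_alg E R) n" "W \<in> mat_carrier (sub_alg E R) n"
      "mat_eq n (mat_mul (sub_alg E R) n Y W) (mat_one (sub_alg E R))"
      "mat_eq n (mat_mul (sub_alg E R) n W Y) (mat_one (sub_alg E R))"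
      using Yc Wc YW WY by (simp_all add: mat_sub_alg)
    show "B r s k \<in> F" if "r < n" "s < n" for r s k
      using IDE that by (auto simp: IDE_def general_linear_def mat_carrier_def)
    show "mat_eq n (\<lambda>r s. \<theta> (Y r s)) (mat_mul (mps (sub_alg E R)) n B (\<lambda>r s. mps_const (sub_alg E R) (Y r s)))"
      using DE by (simp add: mps_sub_alg mps_const_carrier)
  qed (fact G_def inf inj)+
  then show ?thesis by blast
qed

theorem corollary3p6:
  fixes E :: "'e ring" and F R :: "'e set"
    and \<theta> :: "'e \<Rightarrow> 'i::finite multiindex \<Rightarrow> 'e"
    and p :: nat
    and A :: "('e, 'u) module"
    and u :: "(('e \<times> 'u) \<Rightarrow>\<^sub>0 int) set \<Rightarrow> (('e \<times> 'u) \<Rightarrow>\<^sub>0 int) set"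
    and \<epsilon> :: "'u \<Rightarrow> 'e" and \<iota> :: "'e \<Rightarrow> 'u"
  assumes "ID_field (E\<lparr>carrier := F\<rparr>) \<theta>"
    and "p > 0" and "ring_char (E\<lparr>carrier := F\<rparr>) = p"
    and "nondegenerate (E\<lparr>carrier := F\<rparr>) \<theta>"
    and "perfect_field p (const_ring E F \<theta>)"
    and "PPV_extension E F R \<theta>"
    and "represents_Gal E F R \<theta> A u"
    and "is_counit E F R \<theta> A u \<epsilon>"
    \<comment> \<open>the universe \<open>'u\<close> contains a copy of every finitely generated algebra over the constants\<close>
    and "infinite (UNIV :: 'u set)" and "inj_on \<iota> (carrier (const_ring E F \<theta>))"
  shows "(purely_inseparable p E F \<longleftrightarrow> infinitesimal A (a_kernel A (const_ring E F \<theta>) \<epsilon>)) \<and>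
         (purely_inseparable p E F \<longrightarrow>
           (\<exists>e. has_exponent p E F e \<and> has_height p A (a_kernel A (const_ring E F \<theta>) \<epsilon>) e))"
proof -
  obtain G n Y W B where "ppv_torsor E F R \<theta> G p A u \<epsilon> n Y W B \<iota>"
    using PPV_extension_imp_torsor[OF assms(1-3,5-10)] by blast
  then interpret ppv_torsor E F R \<theta> G p A u \<epsilon> n Y W B \<iota> .
  \<comment> \<open>Once \<open>P e\<close> and \<open>Q e\<close> are equivalent for each
    \<open>e\<close>, the least \<open>e\<close> with \<open>P e\<close> is simultaneously the
    exponent and the height, and existence of some \<open>e\<close> gives the equivalence of the two
    properties.\<close>
  define P where "P e \<longleftrightarrow> (\<forall>x\<in>carrier E. x [^]\<^bsub>E\<^esub> (p ^ e) \<in> F)" for e :: nat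
  define Q where "Q e \<longleftrightarrow> (\<forall>x\<in>a_kernel A K \<epsilon>. x [^]\<^bsub>A\<^esub> (p ^ e) = \<zero>\<^bsub>A\<^esub>)" for e :: nat
  have frac: "\<exists>a\<in>R. \<exists>b\<in>R - {\<zero>\<^bsub>E\<^esub>}. x = a \<otimes>\<^bsub>E\<^esub> inv\<^bsub>E\<^esub> b" if "x \<in> carrier E" for x
    using assms(6) that by (simp add: PPV_extension_def)
  have P_R: "P e \<longleftrightarrow> (\<forall>r\<in>R. r [^]\<^bsub>E\<^esub> (p ^ e) \<in> F)" for e
  proof
    assume "P e" then show "\<forall>r\<in>R. r [^]\<^bsub>E\<^esub> (p ^ e) \<in> F" by (simp add: P_def in_E(1))
  next
    assume R: "\<forall>r\<in>R. r [^]\<^bsub>E\<^esub> (p ^ e) \<in> F"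
    show "P e" unfolding P_def
    proof
      fix x assume "x \<in> carrier E"
      then obtain a b where "a \<in> R" "b \<in> R" "b \<noteq> \<zero>\<^bsub>E\<^esub>" "x = a \<otimes>\<^bsub>E\<^esub> inv\<^bsub>E\<^esub> b" using frac by blast
      then show "x [^]\<^bsub>E\<^esub> (p ^ e) \<in> F" using exponent_on_R_imp_E[OF R] by blast
    qed
  qed
  have PQ: "P e \<longleftrightarrow> Q e" for e
    using exponent_imp_height[of e] height_imp_exponent[of e] unfolding P_R Q_def by blast
  have insep: "purely_inseparable p E F \<longleftrightarrow> (\<exists>e. P e)"
  proof
    assume "purely_inseparable p E F"
    then have "\<exists>e. x [^]\<^bsub>E\<^esub> (p ^ e) \<in> F" if "x \<in> G" for x
      using that G_subset_R by (auto simp: purely_inseparable_def)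
    then show "\<exists>e. P e" unfolding P_R by (rule purely_inseparable_imp_exponent)
  qed (auto simp: purely_inseparable_def P_def)
  have infin: "infinitesimal A (a_kernel A K \<epsilon>) \<longleftrightarrow> (\<exists>e. Q e)"
    using height_imp_infinitesimal infinitesimal_imp_height unfolding Q_def by blast
  have "\<exists>e. has_exponent p E F e \<and> has_height p A (a_kernel A K \<epsilon>) e" if "\<exists>e. P e"
  proof (intro exI conjI)
    let ?e = "LEAST e. P e"
    have e: "P ?e" "\<And>e'. P e' \<Longrightarrow> ?e \<le> e'" using LeastI_ex[OF that] Least_le[of P] by blast+
    then show "has_exponent p E F ?e" unfolding has_exponent_def P_def by blast
    show "has_height p A (a_kernel A K \<epsilon>) ?e" using e unfolding PQ has_height_def Q_def by blast
  qed
  then show ?thesis using insep infin PQ by simp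
qed

end
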